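(* Let $\mathcal B$ be a category, $F:\mathcal B^{\mathrm{op}}\to\mathbf{Cat}$ a pseudofunctor with small fibers $F(b)$, let $\widehat F$ be its fiberwise presheaf completion, and $y_F:F\Rightarrow\widehat F$ the pseudonatural transformation given by the Yoneda embeddings. For every pseudofunctor $G:\mathcal B^{\mathrm{op}}\to\mathbf{Cocont}$, restriction along $y_F$ induces an equivalence between cocontinuous pseudonatural transformations $\widehat F\Rightarrow G$ and arbitrary pseudonatural transformations $F\Rightarrow UG$, including the corresponding modification categories; that is, an equivalence between the category of pseudonatural transformations $\widehat F\Rightarrow G$ with cocontinuous components (and modifications) and the category of pseudonatural transformations $F\Rightarrow UG$ (and modifications).
   Context: $\mathbf{Cocont}$ is the 2-category of cocomplete categories, cocontinuous functors and natural transformations, and $U$ is the forgetful 2-functor from $\mathbf{Cocont}$ to the 2-category of (possibly large) categories. One either assumes $F$ has small fibers or works in a fixed universe enlargement. The fiberwise presheaf completion is defined by $\widehat F(b):=\operatorname{PSh}(F(b))=[F(b)^{\mathrm{op}},\mathbf{Set}]$; for $u:b'\to b$ in $\mathcal B$, the functor $F(u):F(b)\to F(b')$ induces $$\widehat F(u):=F(u)_!:=\operatorname{Lan}_{F(u)^{\mathrm{op}}}:\operatorname{PSh}(F(b))\to\operatorname{PSh}(F(b')).$$ The canonical comparison isomorphisms for iterated left Kan extensions make $\widehat F$ a pseudofunctor $\mathcal B^{\mathrm{op}}\to\mathbf{Cocont}$. The components of $y_F$ are the Yoneda embeddings $y_{F(b)}:F(b)\to\operatorname{PSh}(F(b))$,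 with pseudonaturality isomorphisms $F(u)_!\,y_{F(b)}(e)\cong y_{F(b')}(F(u)e)$ given by co-Yoneda. *)

theory Defs
  imports "HOL-Library.FuncSet" "HOL-Library.Equipollence"
begin

section \<open>The universe of small sets\<close>

text \<open>
  The type \<open>'u\<close> plays the role of a universe: a subset of \<open>'u\<close> is small if its cardinality
  is strictly below that of \<open>'u\<close>.  The only closure property imposed is regularity, i.e. closure
  under small unions.  A Grothendieck universe \<open>V\<^sub>\<kappa>\<close> (\<open>\<kappa>\<close> inaccessible) is an instance:
  it has cardinality \<open>\<kappa>\<close>, and its elements are exactly its own subsets of cardinality
  less than \<open>\<kappa>\<close>.  Being a strong limit is not required, so the predicate is also satisfied
  by types that exist in plain HOL.
\<close>

definition small_set :: "'u set \<Rightarrow> bool" where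
  "small_set A \<longleftrightarrow> A \<prec> (UNIV :: 'u set)"

definition universe :: "'u itself \<Rightarrow> bool" where
  "universe _ \<longleftrightarrow> infinite (UNIV :: 'u set) \<and>
     (\<forall>(I :: 'u set) (A :: 'u \<Rightarrow> 'u set).
        small_set I \<longrightarrow> (\<forall>i\<in>I. small_set (A i)) \<longrightarrow> small_set (\<Union>i\<in>I. A i))"


section \<open>Categories, functors, natural transformations\<close>

record ('o, 'm) cat =
  Obj :: "'o set"
  Arr :: "'m set"
  Dom :: "'m \<Rightarrow> 'o"
  Cod :: "'m \<Rightarrow> 'o"
  Idt :: "'o \<Rightarrow> 'm"
  Cmp :: "'m \<Rightarrow> 'm \<Rightarrow> 'm" (infixl "\<odot>\<index>" 70)

definition hom :: "('o, 'm) cat \<Rightarrow> 'o \<Rightarrow> 'o \<Rightarrow> 'm set" where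
  "hom C x y = {f \<in> Arr C. Dom C f = x \<and> Cod C f = y}"

definition is_category :: "('o, 'm) cat \<Rightarrow> bool" where
  "is_category C \<longleftrightarrow>
     (\<forall>f\<in>Arr C. Dom C f \<in> Obj C \<and> Cod C f \<in> Obj C) \<and>
     (\<forall>x\<in>Obj C. Idt C x \<in> hom C x x) \<and>
     (\<forall>f\<in>Arr C. \<forall>g\<in>Arr C. Dom C g = Cod C f \<longrightarrow> g \<odot>\<^bsub>C\<^esub> f \<in> hom C (Dom C f) (Cod C g)) \<and>
     (\<forall>f\<in>Arr C. Idt C (Cod C f) \<odot>\<^bsub>C\<^esub> f = f \<and> f \<odot>\<^bsub>C\<^esub> Idt C (Dom C f) = f) \<and>
     (\<forall>f\<in>Arr C. \<forall>g\<in>Arr C. \<forall>h\<in>Arr C. Dom C g = Cod C f \<longrightarrow> Dom C h = Cod C g \<longrightarrow>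
        h \<odot>\<^bsub>C\<^esub> (g \<odot>\<^bsub>C\<^esub> f) = (h \<odot>\<^bsub>C\<^esub> g) \<odot>\<^bsub>C\<^esub> f)"

definition small_category :: "('u, 'u) cat \<Rightarrow> bool" where
  "small_category C \<longleftrightarrow> is_category C \<and> small_set (Obj C) \<and> small_set (Arr C)"

definition is_iso :: "('o, 'm) cat \<Rightarrow> 'm \<Rightarrow> bool" where
  "is_iso C f \<longleftrightarrow> f \<in> Arr C \<and>
     (\<exists>g \<in> hom C (Cod C f) (Dom C f).
        g \<odot>\<^bsub>C\<^esub> f = Idt C (Dom C f) \<and> f \<odot>\<^bsub>C\<^esub> g = Idt C (Cod C f))"

definition opp :: "('o, 'm) cat \<Rightarrow> ('o, 'm) cat" where
  "opp C = \<lparr>Obj = Obj C, Arr = Arr C, Dom = Cod C, Cod = Dom C, Idt = Idt C,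
            Cmp = (\<lambda>g f. f \<odot>\<^bsub>C\<^esub> g)\<rparr>"

definition full_subcat :: "('o, 'm) cat \<Rightarrow> 'o set \<Rightarrow> ('o, 'm) cat" where
  "full_subcat C X = \<lparr>Obj = Obj C \<inter> X, Arr = {f \<in> Arr C. Dom C f \<in> X \<and> Cod C f \<in> X},
     Dom = Dom C, Cod = Cod C, Idt = Idt C, Cmp = Cmp C\<rparr>"

text \<open>
  Functors, transformations and modifications are extensional (\<open>undefined\<close> off their domain), so
  that HOL equality of the representing functions is equality of the mathematical objects.
\<close>

record ('o1, 'm1, 'o2, 'm2) ftor =
  fobj :: "'o1 \<Rightarrow> 'o2"
  farr :: "'m1 \<Rightarrow> 'm2"

definition is_functor ::
  "('o1, 'm1) cat \<Rightarrow> ('o2, 'm2) cat \<Rightarrow> ('o1, 'm1, 'o2, 'm2) ftor \<Rightarrow> bool" where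
  "is_functor C D F \<longleftrightarrow>
     fobj F \<in> Obj C \<rightarrow>\<^sub>E Obj D \<and> farr F \<in> extensional (Arr C) \<and>
     (\<forall>f\<in>Arr C. farr F f \<in> hom D (fobj F (Dom C f)) (fobj F (Cod C f))) \<and>
     (\<forall>x\<in>Obj C. farr F (Idt C x) = Idt D (fobj F x)) \<and>
     (\<forall>f\<in>Arr C. \<forall>g\<in>Arr C. Dom C g = Cod C f \<longrightarrow>
        farr F (g \<odot>\<^bsub>C\<^esub> f) = farr F g \<odot>\<^bsub>D\<^esub> farr F f)"

definition id_ftor :: "('o, 'm) cat \<Rightarrow> ('o, 'm, 'o, 'm) ftor" where
  "id_ftor C = \<lparr>fobj = (\<lambda>x\<in>Obj C. x), farr = (\<lambda>f\<in>Arr C. f)\<rparr>"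

definition comp_ftor ::
  "('o1, 'm1) cat \<Rightarrow> ('o2, 'm2, 'o3, 'm3) ftor \<Rightarrow> ('o1, 'm1, 'o2, 'm2) ftor
     \<Rightarrow> ('o1, 'm1, 'o3, 'm3) ftor" where
  "comp_ftor C G F = \<lparr>fobj = (\<lambda>x\<in>Obj C. fobj G (fobj F x)),
                      farr = (\<lambda>f\<in>Arr C. farr G (farr F f))\<rparr>"

definition is_nat ::
  "('o1, 'm1) cat \<Rightarrow> ('o2, 'm2) cat \<Rightarrow> ('o1, 'm1, 'o2, 'm2) ftor \<Rightarrow> ('o1, 'm1, 'o2, 'm2) ftor
     \<Rightarrow> ('o1 \<Rightarrow> 'm2) \<Rightarrow> bool" where
  "is_nat C D F G \<tau> \<longleftrightarrow>
     is_functor C D F \<and> is_functor C D G \<and> \<tau> \<in> extensional (Obj C) \<and>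
     (\<forall>x\<in>Obj C. \<tau> x \<in> hom D (fobj F x) (fobj G x)) \<and>
     (\<forall>f\<in>Arr C. \<tau> (Cod C f) \<odot>\<^bsub>D\<^esub> farr F f = farr G f \<odot>\<^bsub>D\<^esub> \<tau> (Dom C f))"

definition is_natiso ::
  "('o1, 'm1) cat \<Rightarrow> ('o2, 'm2) cat \<Rightarrow> ('o1, 'm1, 'o2, 'm2) ftor \<Rightarrow> ('o1, 'm1, 'o2, 'm2) ftor
     \<Rightarrow> ('o1 \<Rightarrow> 'm2) \<Rightarrow> bool" where
  "is_natiso C D F G \<tau> \<longleftrightarrow> is_nat C D F G \<tau> \<and> (\<forall>x\<in>Obj C. is_iso D (\<tau> x))"

definition is_equivalence ::
  "('o1, 'm1) cat \<Rightarrow> ('o2, 'm2) cat \<Rightarrow> ('o1, 'm1, 'o2, 'm2) ftor \<Rightarrow> bool" where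
  "is_equivalence C D F \<longleftrightarrow> is_category C \<and> is_category D \<and> is_functor C D F \<and>
     (\<exists>G \<eta> \<epsilon>. is_functor D C G \<and>
        is_natiso C C (id_ftor C) (comp_ftor C G F) \<eta> \<and>
        is_natiso D D (comp_ftor D F G) (id_ftor D) \<epsilon>)"

text \<open>The functor category; an arrow carries its source and target functor.\<close>

type_synonym ('o1, 'm1, 'o2, 'm2) nat_arr =
  "('o1, 'm1, 'o2, 'm2) ftor \<times> ('o1, 'm1, 'o2, 'm2) ftor \<times> ('o1 \<Rightarrow> 'm2)"

definition fun_cat ::
  "('o1, 'm1) cat \<Rightarrow> ('o2, 'm2) cat
     \<Rightarrow> (('o1, 'm1, 'o2, 'm2) ftor, ('o1, 'm1, 'o2, 'm2) nat_arr) cat" where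
  "fun_cat C D = \<lparr>
     Obj = {F. is_functor C D F},
     Arr = {(F, G, \<tau>). is_nat C D F G \<tau>},
     Dom = (\<lambda>(F, G, \<tau>). F),
     Cod = (\<lambda>(F, G, \<tau>). G),
     Idt = (\<lambda>F. (F, F, \<lambda>x\<in>Obj C. Idt D (fobj F x))),
     Cmp = (\<lambda>(G', H, \<sigma>) (F, G, \<tau>). (F, H, \<lambda>x\<in>Obj C. \<sigma> x \<odot>\<^bsub>D\<^esub> \<tau> x))\<rparr>"


section \<open>Cocomplete categories and cocontinuous functors\<close>

definition is_cocone ::
  "('j, 'n) cat \<Rightarrow> ('o, 'm) cat \<Rightarrow> ('j, 'n, 'o, 'm) ftor \<Rightarrow> 'o \<Rightarrow> ('j \<Rightarrow> 'm) \<Rightarrow> bool" where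
  "is_cocone J D K x \<iota> \<longleftrightarrow> x \<in> Obj D \<and>
     (\<forall>j\<in>Obj J. \<iota> j \<in> hom D (fobj K j) x) \<and>
     (\<forall>a\<in>Arr J. \<iota> (Cod J a) \<odot>\<^bsub>D\<^esub> farr K a = \<iota> (Dom J a))"

definition is_colimit ::
  "('j, 'n) cat \<Rightarrow> ('o, 'm) cat \<Rightarrow> ('j, 'n, 'o, 'm) ftor \<Rightarrow> 'o \<Rightarrow> ('j \<Rightarrow> 'm) \<Rightarrow> bool" where
  "is_colimit J D K x \<iota> \<longleftrightarrow> is_cocone J D K x \<iota> \<and>
     (\<forall>y \<kappa>. is_cocone J D K y \<kappa> \<longrightarrow>
        (\<exists>!h. h \<in> hom D x y \<and> (\<forall>j\<in>Obj J. h \<odot>\<^bsub>D\<^esub> \<iota> j = \<kappa> j)))"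

definition cocomplete :: "'u itself \<Rightarrow> ('o, 'm) cat \<Rightarrow> bool" where
  "cocomplete _ D \<longleftrightarrow>
     (\<forall>(J :: ('u, 'u) cat) K. small_category J \<longrightarrow> is_functor J D K \<longrightarrow>
        (\<exists>x \<iota>. is_colimit J D K x \<iota>))"

definition cocontinuous ::
  "'u itself \<Rightarrow> ('o1, 'm1) cat \<Rightarrow> ('o2, 'm2) cat \<Rightarrow> ('o1, 'm1, 'o2, 'm2) ftor \<Rightarrow> bool" where
  "cocontinuous _ C D F \<longleftrightarrow> is_functor C D F \<and>
     (\<forall>(J :: ('u, 'u) cat) K x \<iota>. small_category J \<longrightarrow> is_functor J C K \<longrightarrow>
        is_colimit J C K x \<iota> \<longrightarrow>
        is_colimit J D (comp_ftor J F K) (fobj F x) (\<lambda>j. farr F (\<iota> j)))"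


section \<open>Presheaves and the Yoneda embedding\<close>

type_synonym 'u set_arr = "'u set \<times> 'u set \<times> ('u \<Rightarrow> 'u)"

definition set_cat :: "('u set, 'u set_arr) cat" where
  "set_cat = \<lparr>
     Obj = {A. small_set A},
     Arr = {(A, B, f). small_set A \<and> small_set B \<and> f \<in> A \<rightarrow>\<^sub>E B},
     Dom = (\<lambda>(A, B, f). A),
     Cod = (\<lambda>(A, B, f). B),
     Idt = (\<lambda>A. (A, A, \<lambda>x\<in>A. x)),
     Cmp = (\<lambda>(B', C, g) (A, B, f). (A, C, compose A g f))\<rparr>"

type_synonym 'u presheaf = "('u, 'u, 'u set, 'u set_arr) ftor"
type_synonym 'u presheaf_arr = "('u, 'u, 'u set, 'u set_arr) nat_arr"

definition PSh :: "('u, 'u) cat \<Rightarrow> ('u presheaf, 'u presheaf_arr) cat" where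
  "PSh C = fun_cat (opp C) set_cat"

definition hom_psh :: "('u, 'u) cat \<Rightarrow> 'u \<Rightarrow> 'u presheaf" where
  "hom_psh C e = \<lparr>
     fobj = (\<lambda>x\<in>Obj C. hom C x e),
     farr = (\<lambda>f\<in>Arr C. (hom C (Cod C f) e, hom C (Dom C f) e, \<lambda>g\<in>hom C (Cod C f) e. g \<odot>\<^bsub>C\<^esub> f))\<rparr>"

definition yoneda :: "('u, 'u) cat \<Rightarrow> ('u, 'u, 'u presheaf, 'u presheaf_arr) ftor" where
  "yoneda C = \<lparr>
     fobj = (\<lambda>e\<in>Obj C. hom_psh C e),
     farr = (\<lambda>h\<in>Arr C. (hom_psh C (Dom C h), hom_psh C (Cod C h),
        \<lambda>x\<in>Obj C. (hom C x (Dom C h), hom C x (Cod C h), \<lambda>g\<in>hom C x (Dom C h). h \<odot>\<^bsub>C\<^esub> g)))\<rparr>"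


section \<open>Left Kan extensions\<close>

text \<open>
  \<open>is_lan C C' D K P L \<eta>\<close>: the functor \<open>L : C' \<rightarrow> D\<close> with unit \<open>\<eta> : P \<Rightarrow> L \<circ> K\<close> is a left Kan
  extension of \<open>P : C \<rightarrow> D\<close> along \<open>K : C \<rightarrow> C'\<close>.
\<close>

definition is_lan ::
  "('o1, 'm1) cat \<Rightarrow> ('o2, 'm2) cat \<Rightarrow> ('o3, 'm3) cat \<Rightarrow> ('o1, 'm1, 'o2, 'm2) ftor
     \<Rightarrow> ('o1, 'm1, 'o3, 'm3) ftor \<Rightarrow> ('o2, 'm2, 'o3, 'm3) ftor \<Rightarrow> ('o1 \<Rightarrow> 'm3) \<Rightarrow> bool" where
  "is_lan C C' D K P L \<eta> \<longleftrightarrow>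
     is_functor C' D L \<and> is_nat C D P (comp_ftor C L K) \<eta> \<and>
     (\<forall>Q \<theta>. is_functor C' D Q \<longrightarrow> is_nat C D P (comp_ftor C Q K) \<theta> \<longrightarrow>
        (\<exists>!\<sigma>. is_nat C' D L Q \<sigma> \<and> (\<forall>x\<in>Obj C. \<sigma> (fobj K x) \<odot>\<^bsub>D\<^esub> \<eta> x = \<theta> x)))"

text \<open>A choice of left Kan extension, its unit, and the factorization of \<open>\<theta> : P \<Rightarrow> Q \<circ> K\<close> through it.\<close>

definition lan_choice ::
  "('o1, 'm1) cat \<Rightarrow> ('o2, 'm2) cat \<Rightarrow> ('o3, 'm3) cat \<Rightarrow> ('o1, 'm1, 'o2, 'm2) ftor
     \<Rightarrow> ('o1, 'm1, 'o3, 'm3) ftor \<Rightarrow> ('o2, 'm2, 'o3, 'm3) ftor \<times> ('o1 \<Rightarrow> 'm3)" where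
  "lan_choice C C' D K P = (SOME z. is_lan C C' D K P (fst z) (snd z))"

definition lan ::
  "('o1, 'm1) cat \<Rightarrow> ('o2, 'm2) cat \<Rightarrow> ('o3, 'm3) cat \<Rightarrow> ('o1, 'm1, 'o2, 'm2) ftor
     \<Rightarrow> ('o1, 'm1, 'o3, 'm3) ftor \<Rightarrow> ('o2, 'm2, 'o3, 'm3) ftor" where
  "lan C C' D K P = fst (lan_choice C C' D K P)"

definition lan_unit ::
  "('o1, 'm1) cat \<Rightarrow> ('o2, 'm2) cat \<Rightarrow> ('o3, 'm3) cat \<Rightarrow> ('o1, 'm1, 'o2, 'm2) ftor
     \<Rightarrow> ('o1, 'm1, 'o3, 'm3) ftor \<Rightarrow> 'o1 \<Rightarrow> 'm3" where
  "lan_unit C C' D K P = snd (lan_choice C C' D K P)"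

definition lan_desc ::
  "('o1, 'm1) cat \<Rightarrow> ('o2, 'm2) cat \<Rightarrow> ('o3, 'm3) cat \<Rightarrow> ('o1, 'm1, 'o2, 'm2) ftor
     \<Rightarrow> ('o1, 'm1, 'o3, 'm3) ftor \<Rightarrow> ('o2, 'm2, 'o3, 'm3) ftor \<Rightarrow> ('o1 \<Rightarrow> 'm3) \<Rightarrow> 'o2 \<Rightarrow> 'm3" where
  "lan_desc C C' D K P Q \<theta> =
     (THE \<sigma>. is_nat C' D (lan C C' D K P) Q \<sigma> \<and>
        (\<forall>x\<in>Obj C. \<sigma> (fobj K x) \<odot>\<^bsub>D\<^esub> lan_unit C C' D K P x = \<theta> x))"

definition lan_ftor ::
  "('o1, 'm1) cat \<Rightarrow> ('o2, 'm2) cat \<Rightarrow> ('o3, 'm3) cat \<Rightarrow> ('o1, 'm1, 'o2, 'm2) ftor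
     \<Rightarrow> (('o1, 'm1, 'o3, 'm3) ftor, ('o1, 'm1, 'o3, 'm3) nat_arr,
         ('o2, 'm2, 'o3, 'm3) ftor, ('o2, 'm2, 'o3, 'm3) nat_arr) ftor" where
  "lan_ftor C C' D K = \<lparr>
     fobj = (\<lambda>P\<in>Obj (fun_cat C D). lan C C' D K P),
     farr = (\<lambda>t\<in>Arr (fun_cat C D). case t of (P, Q, \<tau>) \<Rightarrow>
       (lan C C' D K P, lan C C' D K Q,
        lan_desc C C' D K P (lan C C' D K Q) (\<lambda>x\<in>Obj C. lan_unit C C' D K Q x \<odot>\<^bsub>D\<^esub> \<tau> x)))\<rparr>"


section \<open>Pseudofunctors, pseudonatural transformations, modifications\<close>

text \<open>
  A pseudofunctor \<open>P : B\<^sup>o\<^sup>p \<rightarrow> CAT\<close> has structure isomorphisms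
  \<open>PM P u v : P v \<circ> P u \<Rightarrow> P (u \<odot> v)\<close> for composable \<open>v : b'' \<rightarrow> b'\<close>, \<open>u : b' \<rightarrow> b\<close> in \<open>B\<close>, and
  \<open>PI P b : id \<Rightarrow> P (id\<^sub>b)\<close>.  All fibres have their objects and arrows in one type each, which is no
  restriction, since one may pass to a disjoint union.
\<close>

record ('b, 'v, 'o, 'm) psf =
  PC :: "'b \<Rightarrow> ('o, 'm) cat"
  PF :: "'v \<Rightarrow> ('o, 'm, 'o, 'm) ftor"
  PM :: "'v \<Rightarrow> 'v \<Rightarrow> 'o \<Rightarrow> 'm"
  PI :: "'b \<Rightarrow> 'o \<Rightarrow> 'm"

definition pseudofunctor :: "('b, 'v) cat \<Rightarrow> ('b, 'v, 'o, 'm) psf \<Rightarrow> bool" where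
  "pseudofunctor B P \<longleftrightarrow>
     (\<forall>b\<in>Obj B. is_category (PC P b)) \<and>
     (\<forall>u\<in>Arr B. is_functor (PC P (Cod B u)) (PC P (Dom B u)) (PF P u)) \<and>
     (\<forall>u\<in>Arr B. \<forall>v\<in>Arr B. Dom B u = Cod B v \<longrightarrow>
        is_natiso (PC P (Cod B u)) (PC P (Dom B v))
          (comp_ftor (PC P (Cod B u)) (PF P v) (PF P u)) (PF P (u \<odot>\<^bsub>B\<^esub> v)) (PM P u v)) \<and>
     (\<forall>b\<in>Obj B. is_natiso (PC P b) (PC P b) (id_ftor (PC P b)) (PF P (Idt B b)) (PI P b)) \<and>
     (\<forall>u\<in>Arr B. \<forall>v\<in>Arr B. \<forall>w\<in>Arr B. Dom B u = Cod B v \<longrightarrow> Dom B v = Cod B w \<longrightarrow>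
        (\<forall>x\<in>Obj (PC P (Cod B u)).
           PM P (u \<odot>\<^bsub>B\<^esub> v) w x \<odot>\<^bsub>PC P (Dom B w)\<^esub> farr (PF P w) (PM P u v x) =
           PM P u (v \<odot>\<^bsub>B\<^esub> w) x \<odot>\<^bsub>PC P (Dom B w)\<^esub> PM P v w (fobj (PF P u) x))) \<and>
     (\<forall>u\<in>Arr B. \<forall>x\<in>Obj (PC P (Cod B u)).
        PM P u (Idt B (Dom B u)) x \<odot>\<^bsub>PC P (Dom B u)\<^esub> PI P (Dom B u) (fobj (PF P u) x) =
          Idt (PC P (Dom B u)) (fobj (PF P u) x) \<and>
        PM P (Idt B (Cod B u)) u x \<odot>\<^bsub>PC P (Dom B u)\<^esub> farr (PF P u) (PI P (Cod B u) x) =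
          Idt (PC P (Dom B u)) (fobj (PF P u) x))"

text \<open>
  Since \<open>Cocont\<close> is locally full in \<open>CAT\<close>, a pseudofunctor into \<open>Cocont\<close> is a pseudofunctor into
  \<open>CAT\<close> with a property, and the forgetful 2-functor \<open>U\<close> leaves the data unchanged.
\<close>

definition pseudofunctor_cocont ::
  "'u itself \<Rightarrow> ('b, 'v) cat \<Rightarrow> ('b, 'v, 'o, 'm) psf \<Rightarrow> bool" where
  "pseudofunctor_cocont U B P \<longleftrightarrow> pseudofunctor B P \<and>
     (\<forall>b\<in>Obj B. cocomplete U (PC P b)) \<and>
     (\<forall>u\<in>Arr B. cocontinuous U (PC P (Cod B u)) (PC P (Dom B u)) (PF P u))"

text \<open>
  The 2-cell of a pseudonatural transformation \<open>\<alpha> : P \<Rightarrow> Q\<close> at \<open>u : b' \<rightarrow> b\<close> is an isomorphism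
  \<open>Q u \<circ> \<alpha>\<^sub>b \<Rightarrow> \<alpha>\<^sub>b\<^sub>' \<circ> P u\<close>.
\<close>

record ('b, 'v, 'o1, 'm1, 'o2, 'm2) pnt =
  NC :: "'b \<Rightarrow> ('o1, 'm1, 'o2, 'm2) ftor"
  N2 :: "'v \<Rightarrow> 'o1 \<Rightarrow> 'm2"

definition pseudonat ::
  "('b, 'v) cat \<Rightarrow> ('b, 'v, 'o1, 'm1) psf \<Rightarrow> ('b, 'v, 'o2, 'm2) psf
     \<Rightarrow> ('b, 'v, 'o1, 'm1, 'o2, 'm2) pnt \<Rightarrow> bool" where
  "pseudonat B P Q \<alpha> \<longleftrightarrow>
     NC \<alpha> \<in> extensional (Obj B) \<and> N2 \<alpha> \<in> extensional (Arr B) \<and>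
     (\<forall>b\<in>Obj B. is_functor (PC P b) (PC Q b) (NC \<alpha> b)) \<and>
     (\<forall>u\<in>Arr B. is_natiso (PC P (Cod B u)) (PC Q (Dom B u))
        (comp_ftor (PC P (Cod B u)) (PF Q u) (NC \<alpha> (Cod B u)))
        (comp_ftor (PC P (Cod B u)) (NC \<alpha> (Dom B u)) (PF P u)) (N2 \<alpha> u)) \<and>
     (\<forall>u\<in>Arr B. \<forall>v\<in>Arr B. Dom B u = Cod B v \<longrightarrow>
        (\<forall>x\<in>Obj (PC P (Cod B u)).
           N2 \<alpha> (u \<odot>\<^bsub>B\<^esub> v) x \<odot>\<^bsub>PC Q (Dom B v)\<^esub> PM Q u v (fobj (NC \<alpha> (Cod B u)) x) =
           farr (NC \<alpha> (Dom B v)) (PM P u v x) \<odot>\<^bsub>PC Q (Dom B v)\<^esub>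
             (N2 \<alpha> v (fobj (PF P u) x) \<odot>\<^bsub>PC Q (Dom B v)\<^esub> farr (PF Q v) (N2 \<alpha> u x)))) \<and>
     (\<forall>b\<in>Obj B. \<forall>x\<in>Obj (PC P b).
        N2 \<alpha> (Idt B b) x \<odot>\<^bsub>PC Q b\<^esub> PI Q b (fobj (NC \<alpha> b) x) = farr (NC \<alpha> b) (PI P b x))"

definition modification ::
  "('b, 'v) cat \<Rightarrow> ('b, 'v, 'o1, 'm1) psf \<Rightarrow> ('b, 'v, 'o2, 'm2) psf
     \<Rightarrow> ('b, 'v, 'o1, 'm1, 'o2, 'm2) pnt \<Rightarrow> ('b, 'v, 'o1, 'm1, 'o2, 'm2) pnt
     \<Rightarrow> ('b \<Rightarrow> 'o1 \<Rightarrow> 'm2) \<Rightarrow> bool" where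
  "modification B P Q \<alpha> \<beta> \<Gamma> \<longleftrightarrow>
     pseudonat B P Q \<alpha> \<and> pseudonat B P Q \<beta> \<and> \<Gamma> \<in> extensional (Obj B) \<and>
     (\<forall>b\<in>Obj B. is_nat (PC P b) (PC Q b) (NC \<alpha> b) (NC \<beta> b) (\<Gamma> b)) \<and>
     (\<forall>u\<in>Arr B. \<forall>x\<in>Obj (PC P (Cod B u)).
        N2 \<beta> u x \<odot>\<^bsub>PC Q (Dom B u)\<^esub> farr (PF Q u) (\<Gamma> (Cod B u) x) =
        \<Gamma> (Dom B u) (fobj (PF P u) x) \<odot>\<^bsub>PC Q (Dom B u)\<^esub> N2 \<alpha> u x)"

type_synonym ('b, 'v, 'o1, 'm1, 'o2, 'm2) mod_arr =
  "('b, 'v, 'o1, 'm1, 'o2, 'm2) pnt \<times> ('b, 'v, 'o1, 'm1, 'o2, 'm2) pnt \<times> ('b \<Rightarrow> 'o1 \<Rightarrow> 'm2)"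

definition PsNat ::
  "('b, 'v) cat \<Rightarrow> ('b, 'v, 'o1, 'm1) psf \<Rightarrow> ('b, 'v, 'o2, 'm2) psf
     \<Rightarrow> (('b, 'v, 'o1, 'm1, 'o2, 'm2) pnt, ('b, 'v, 'o1, 'm1, 'o2, 'm2) mod_arr) cat" where
  "PsNat B P Q = \<lparr>
     Obj = {\<alpha>. pseudonat B P Q \<alpha>},
     Arr = {(\<alpha>, \<beta>, \<Gamma>). modification B P Q \<alpha> \<beta> \<Gamma>},
     Dom = (\<lambda>(\<alpha>, \<beta>, \<Gamma>). \<alpha>),
     Cod = (\<lambda>(\<alpha>, \<beta>, \<Gamma>). \<beta>),
     Idt = (\<lambda>\<alpha>. (\<alpha>, \<alpha>, \<lambda>b\<in>Obj B. \<lambda>x\<in>Obj (PC P b). Idt (PC Q b) (fobj (NC \<alpha> b) x))),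
     Cmp = (\<lambda>(\<beta>', \<gamma>, \<Delta>) (\<alpha>, \<beta>, \<Gamma>).
       (\<alpha>, \<gamma>, \<lambda>b\<in>Obj B. \<lambda>x\<in>Obj (PC P b). \<Delta> b x \<odot>\<^bsub>PC Q b\<^esub> \<Gamma> b x))\<rparr>"

definition PsNat_cocont ::
  "'u itself \<Rightarrow> ('b, 'v) cat \<Rightarrow> ('b, 'v, 'o1, 'm1) psf \<Rightarrow> ('b, 'v, 'o2, 'm2) psf
     \<Rightarrow> (('b, 'v, 'o1, 'm1, 'o2, 'm2) pnt, ('b, 'v, 'o1, 'm1, 'o2, 'm2) mod_arr) cat" where
  "PsNat_cocont U B P Q =
     full_subcat (PsNat B P Q) {\<alpha>. \<forall>b\<in>Obj B. cocontinuous U (PC P b) (PC Q b) (NC \<alpha> b)}"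

definition comp_pnt ::
  "('b, 'v) cat \<Rightarrow> ('b, 'v, 'o1, 'm1) psf \<Rightarrow> ('b, 'v, 'o2, 'm2) psf \<Rightarrow> ('b, 'v, 'o3, 'm3) psf
     \<Rightarrow> ('b, 'v, 'o2, 'm2, 'o3, 'm3) pnt \<Rightarrow> ('b, 'v, 'o1, 'm1, 'o2, 'm2) pnt
     \<Rightarrow> ('b, 'v, 'o1, 'm1, 'o3, 'm3) pnt" where
  "comp_pnt B P Q R \<beta> \<alpha> = \<lparr>
     NC = (\<lambda>b\<in>Obj B. comp_ftor (PC P b) (NC \<beta> b) (NC \<alpha> b)),
     N2 = (\<lambda>u\<in>Arr B. \<lambda>x\<in>Obj (PC P (Cod B u)).
       farr (NC \<beta> (Dom B u)) (N2 \<alpha> u x) \<odot>\<^bsub>PC R (Dom B u)\<^esub> N2 \<beta> u (fobj (NC \<alpha> (Cod B u)) x))\<rparr>"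

text \<open>
  Restriction along \<open>y : P \<Rightarrow> Q\<close>: precomposition on transformations and whiskering on modifications,
  on the cocontinuous transformations \<open>Q \<Rightarrow> R\<close>.
\<close>

definition restrict_along ::
  "'u itself \<Rightarrow> ('b, 'v) cat \<Rightarrow> ('b, 'v, 'o1, 'm1) psf \<Rightarrow> ('b, 'v, 'o2, 'm2) psf
     \<Rightarrow> ('b, 'v, 'o3, 'm3) psf \<Rightarrow> ('b, 'v, 'o1, 'm1, 'o2, 'm2) pnt
     \<Rightarrow> (('b, 'v, 'o2, 'm2, 'o3, 'm3) pnt, ('b, 'v, 'o2, 'm2, 'o3, 'm3) mod_arr,
         ('b, 'v, 'o1, 'm1, 'o3, 'm3) pnt, ('b, 'v, 'o1, 'm1, 'o3, 'm3) mod_arr) ftor" where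
  "restrict_along U B P Q R y = \<lparr>
     fobj = (\<lambda>\<alpha>\<in>Obj (PsNat_cocont U B Q R). comp_pnt B P Q R \<alpha> y),
     farr = (\<lambda>t\<in>Arr (PsNat_cocont U B Q R). case t of (\<alpha>, \<beta>, \<Gamma>) \<Rightarrow>
       (comp_pnt B P Q R \<alpha> y, comp_pnt B P Q R \<beta> y,
        \<lambda>b\<in>Obj B. \<lambda>x\<in>Obj (PC P b). \<Gamma> b (fobj (NC y b) x)))\<rparr>"


section \<open>The fibrewise presheaf completion\<close>

text \<open>
  \<open>psh_ext B F u P\<close> is \<open>F(u)\<^sub>! P\<close>, the left Kan extension of \<open>P\<close> along \<open>F(u)\<^sup>o\<^sup>p\<close>.  The functor
  \<open>F(u)\<^sup>o\<^sup>p\<close> is given by the same data as \<open>F(u)\<close>.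
\<close>

definition psh_ext ::
  "('b, 'v) cat \<Rightarrow> ('b, 'v, 'u, 'u) psf \<Rightarrow> 'v \<Rightarrow> 'u presheaf \<Rightarrow> 'u presheaf" where
  "psh_ext B F u P = lan (opp (PC F (Cod B u))) (opp (PC F (Dom B u))) set_cat (PF F u) P"

definition psh_unit ::
  "('b, 'v) cat \<Rightarrow> ('b, 'v, 'u, 'u) psf \<Rightarrow> 'v \<Rightarrow> 'u presheaf \<Rightarrow> 'u \<Rightarrow> 'u set_arr" where
  "psh_unit B F u P = lan_unit (opp (PC F (Cod B u))) (opp (PC F (Dom B u))) set_cat (PF F u) P"

definition psh_desc ::
  "('b, 'v) cat \<Rightarrow> ('b, 'v, 'u, 'u) psf \<Rightarrow> 'v \<Rightarrow> 'u presheaf \<Rightarrow> 'u presheaf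
     \<Rightarrow> ('u \<Rightarrow> 'u set_arr) \<Rightarrow> 'u \<Rightarrow> 'u set_arr" where
  "psh_desc B F u P Q \<theta> =
     lan_desc (opp (PC F (Cod B u))) (opp (PC F (Dom B u))) set_cat (PF F u) P Q \<theta>"

text \<open>
  The comparison \<open>F(v)\<^sub>! (F(u)\<^sub>! P) \<rightarrow> F(u \<odot> v)\<^sub>! P\<close> corresponds, under the universal properties of
  the two Kan extensions in its source, to the natural family
  \<open>P x \<rightarrow> (F(u \<odot> v)\<^sub>! P) (F(u \<odot> v) x) \<rightarrow> (F(u \<odot> v)\<^sub>! P) (F v (F u x))\<close>
  whose second map is restriction along the structure isomorphism of \<open>F\<close>.  The unit comparison is
  \<open>P x \<rightarrow> (F(id)\<^sub>! P) (F(id) x) \<rightarrow> (F(id)\<^sub>! P) x\<close>.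
\<close>

definition psh_completion ::
  "('b, 'v) cat \<Rightarrow> ('b, 'v, 'u, 'u) psf \<Rightarrow> ('b, 'v, 'u presheaf, 'u presheaf_arr) psf" where
  "psh_completion B F = \<lparr>
     PC = (\<lambda>b. PSh (PC F b)),
     PF = (\<lambda>u. lan_ftor (opp (PC F (Cod B u))) (opp (PC F (Dom B u))) set_cat (PF F u)),
     PM = (\<lambda>u v. \<lambda>P\<in>Obj (PSh (PC F (Cod B u))).
       (psh_ext B F v (psh_ext B F u P), psh_ext B F (u \<odot>\<^bsub>B\<^esub> v) P,
        psh_desc B F v (psh_ext B F u P) (psh_ext B F (u \<odot>\<^bsub>B\<^esub> v) P)
          (psh_desc B F u P
             (comp_ftor (opp (PC F (Dom B u))) (psh_ext B F (u \<odot>\<^bsub>B\<^esub> v) P) (PF F v))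
             (\<lambda>x\<in>Obj (PC F (Cod B u)).
                farr (psh_ext B F (u \<odot>\<^bsub>B\<^esub> v) P) (PM F u v x) \<odot>\<^bsub>set_cat\<^esub>
                  psh_unit B F (u \<odot>\<^bsub>B\<^esub> v) P x)))),
     PI = (\<lambda>b. \<lambda>P\<in>Obj (PSh (PC F b)).
       (P, psh_ext B F (Idt B b) P,
        \<lambda>x\<in>Obj (PC F b). farr (psh_ext B F (Idt B b) P) (PI F b x) \<odot>\<^bsub>set_cat\<^esub>
                            psh_unit B F (Idt B b) P x))\<rparr>"

text \<open>
  The 2-cell \<open>F(u)\<^sub>! (hom(-, e)) \<rightarrow> hom(-, F u e)\<close> is the map induced by the action
  \<open>hom(x, e) \<rightarrow> hom(F u x, F u e)\<close> of \<open>F u\<close> on arrows; this is the co-Yoneda isomorphism.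
\<close>

definition yoneda_pnt ::
  "('b, 'v) cat \<Rightarrow> ('b, 'v, 'u, 'u) psf
     \<Rightarrow> ('b, 'v, 'u, 'u, 'u presheaf, 'u presheaf_arr) pnt" where
  "yoneda_pnt B F = \<lparr>
     NC = (\<lambda>b\<in>Obj B. yoneda (PC F b)),
     N2 = (\<lambda>u\<in>Arr B. \<lambda>e\<in>Obj (PC F (Cod B u)).
       (psh_ext B F u (hom_psh (PC F (Cod B u)) e), hom_psh (PC F (Dom B u)) (fobj (PF F u) e),
        psh_desc B F u (hom_psh (PC F (Cod B u)) e) (hom_psh (PC F (Dom B u)) (fobj (PF F u) e))
          (\<lambda>x\<in>Obj (PC F (Cod B u)).
             (hom (PC F (Cod B u)) x e, hom (PC F (Dom B u)) (fobj (PF F u) x) (fobj (PF F u) e),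
              \<lambda>g\<in>hom (PC F (Cod B u)) x e. farr (PF F u) g))))\<rparr>"

end

theory Submission
  imports Defs
begin

text \<open>
  The proof rests on two facts about a single small category \<open>C\<close>.  A functor on \<open>PSh C\<close> that is
  cocontinuous is determined by its restriction along the Yoneda embedding, in the strong sense
  that every transformation from this restriction to the restriction of an arbitrary functor
  extends uniquely (\<open>nat_eq_on_representables\<close>, \<open>nat_extension\<close>): each presheaf is the colimit of
  representables over its category of elements, and the functor preserves this colimit.  And every
  functor from \<open>C\<close> to a cocomplete category extends to a cocontinuous functor on \<open>PSh C\<close>
  (\<open>cocontinuous_extension\<close>), by colimits weighted by presheaves.

  The fibres of \<open>G\<close> are cocomplete but may have large hom-sets, so the usual right adjoint
  \<open>d \<mapsto> D(f-, d)\<close> takes values in large presheaves and cannot prove that the extension is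
  cocontinuous.  It is replaced by the lemma \<open>colimit_PSh_large\<close>: a small colimit of presheaves
  remains universal with respect to large presheaves, because the values of a small cocone form a
  small subpresheaf.

  On the side of the completion, all maps out of a left Kan extension are described by their values
  on the generating elements that are the values of the unit.  In these terms Kan extension is a
  cocontinuous functor, its comparison cells are natural, and the Yoneda embeddings together with
  the co-Yoneda isomorphisms form a pseudonatural transformation (\<open>yoneda_pnt_pseudonat\<close>).

  The theorem follows by applying the two facts in every fibre.  The condition for a modification
  and the coherence conditions for a pseudonatural transformation are equations between
  transformations whose source is cocontinuous, being a composite of cocontinuous functors.
  They may therefore be tested at representables, where they become, up to the invertible
  co-Yoneda maps, the corresponding conditions for transformations defined on \<open>F\<close>.  Thus
  restriction is fully faithful (\<open>restrict_fully_faithful\<close>) and essentially surjective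
  (\<open>restrict_essentially_surjective\<close>).
\<close>

section \<open>Categories, functors and transformations\<close>

lemma homD:
  assumes "f \<in> hom C x y"
  shows "f \<in> Arr C" "Dom C f = x" "Cod C f = y"
  using assms by (auto simp: hom_def)

lemma homI: "f \<in> Arr C \<Longrightarrow> Dom C f = x \<Longrightarrow> Cod C f = y \<Longrightarrow> f \<in> hom C x y"
  by (auto simp: hom_def)

lemma hom_objs:
  assumes "is_category C" "f \<in> hom C x y"
  shows "x \<in> Obj C" "y \<in> Obj C"
  using assms unfolding is_category_def hom_def by auto

lemma Idt_hom: "is_category C \<Longrightarrow> x \<in> Obj C \<Longrightarrow> Idt C x \<in> hom C x x"
  unfolding is_category_def by auto

lemma cmp_hom:
  assumes "is_category C" "f \<in> hom C x y" "g \<in> hom C y z"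
  shows "g \<odot>\<^bsub>C\<^esub> f \<in> hom C x z"
  using assms unfolding is_category_def hom_def by auto

lemma cmp_idl: "is_category C \<Longrightarrow> f \<in> hom C x y \<Longrightarrow> Idt C y \<odot>\<^bsub>C\<^esub> f = f"
  unfolding is_category_def hom_def by auto

lemma cmp_idr: "is_category C \<Longrightarrow> f \<in> hom C x y \<Longrightarrow> f \<odot>\<^bsub>C\<^esub> Idt C x = f"
  unfolding is_category_def hom_def by auto

lemma cmp_assoc:
  assumes "is_category C" "f \<in> hom C x y" "g \<in> hom C y z" "h \<in> hom C z w"
  shows "h \<odot>\<^bsub>C\<^esub> (g \<odot>\<^bsub>C\<^esub> f) = (h \<odot>\<^bsub>C\<^esub> g) \<odot>\<^bsub>C\<^esub> f"
  using assms unfolding is_category_def hom_def by auto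

lemma ftor_obj: "is_functor C D F \<Longrightarrow> x \<in> Obj C \<Longrightarrow> fobj F x \<in> Obj D"
  unfolding is_functor_def by auto

lemma ftor_hom:
  assumes "is_functor C D F" "f \<in> hom C x y"
  shows "farr F f \<in> hom D (fobj F x) (fobj F y)"
  using assms unfolding is_functor_def hom_def by auto

lemma ftor_id: "is_functor C D F \<Longrightarrow> x \<in> Obj C \<Longrightarrow> farr F (Idt C x) = Idt D (fobj F x)"
  unfolding is_functor_def by auto

lemma ftor_cmp:
  assumes "is_functor C D F" "f \<in> hom C x y" "g \<in> hom C y z"
  shows "farr F (g \<odot>\<^bsub>C\<^esub> f) = farr F g \<odot>\<^bsub>D\<^esub> farr F f"
  using assms unfolding is_functor_def hom_def by auto

lemma ftor_eqI:
  assumes "is_functor C D F" "is_functor C D G"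
    and "\<And>x. x \<in> Obj C \<Longrightarrow> fobj F x = fobj G x"
    and "\<And>f. f \<in> Arr C \<Longrightarrow> farr F f = farr G f"
  shows "F = G"
proof -
  have "fobj F = fobj G"
    using assms(1-3) unfolding is_functor_def PiE_def by (auto intro: extensionalityI)
  moreover have "farr F = farr G"
    using assms(1,2,4) unfolding is_functor_def by (auto intro: extensionalityI)
  ultimately show ?thesis by simp
qed

lemma nat_functors:
  assumes "is_nat C D F G \<tau>"
  shows "is_functor C D F" "is_functor C D G"
  using assms unfolding is_nat_def by auto

lemma nat_hom: "is_nat C D F G \<tau> \<Longrightarrow> x \<in> Obj C \<Longrightarrow> \<tau> x \<in> hom D (fobj F x) (fobj G x)"
  unfolding is_nat_def by auto

lemma nat_comm:
  assumes "is_nat C D F G \<tau>" "f \<in> hom C x y"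
  shows "\<tau> y \<odot>\<^bsub>D\<^esub> farr F f = farr G f \<odot>\<^bsub>D\<^esub> \<tau> x"
  using assms unfolding is_nat_def hom_def by auto

lemma nat_eqI:
  assumes "is_nat C D F G \<sigma>" "is_nat C D F' G' \<tau>" "\<And>x. x \<in> Obj C \<Longrightarrow> \<sigma> x = \<tau> x"
  shows "\<sigma> = \<tau>"
  using assms unfolding is_nat_def by (auto intro: extensionalityI)

lemma is_natI:
  assumes "is_category C" "is_functor C D F" "is_functor C D G" "\<tau> \<in> extensional (Obj C)"
    and "\<And>x. x \<in> Obj C \<Longrightarrow> \<tau> x \<in> hom D (fobj F x) (fobj G x)"
    and "\<And>f x y. x \<in> Obj C \<Longrightarrow> y \<in> Obj C \<Longrightarrow> f \<in> hom C x y \<Longrightarrow>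
           \<tau> y \<odot>\<^bsub>D\<^esub> farr F f = farr G f \<odot>\<^bsub>D\<^esub> \<tau> x"
  shows "is_nat C D F G \<tau>"
  using assms unfolding is_nat_def by (auto simp: is_category_def hom_def)

lemma is_functorI:
  assumes "is_category C"
    and "fobj F \<in> extensional (Obj C)" "farr F \<in> extensional (Arr C)"
    and "\<And>x. x \<in> Obj C \<Longrightarrow> fobj F x \<in> Obj D"
    and "\<And>f x y. f \<in> hom C x y \<Longrightarrow> farr F f \<in> hom D (fobj F x) (fobj F y)"
    and "\<And>x. x \<in> Obj C \<Longrightarrow> farr F (Idt C x) = Idt D (fobj F x)"
    and "\<And>f g x y z. f \<in> hom C x y \<Longrightarrow> g \<in> hom C y z \<Longrightarrow>
           farr F (g \<odot>\<^bsub>C\<^esub> f) = farr F g \<odot>\<^bsub>D\<^esub> farr F f"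
  shows "is_functor C D F"
  using assms unfolding is_functor_def PiE_def by (auto simp: hom_def)

lemma fobj_id [simp]: "x \<in> Obj C \<Longrightarrow> fobj (id_ftor C) x = x"
  and farr_id [simp]: "f \<in> Arr C \<Longrightarrow> farr (id_ftor C) f = f"
  by (auto simp: id_ftor_def)

lemma fobj_comp [simp]: "x \<in> Obj C \<Longrightarrow> fobj (comp_ftor C G F) x = fobj G (fobj F x)"
  and farr_comp [simp]: "f \<in> Arr C \<Longrightarrow> farr (comp_ftor C G F) f = farr G (farr F f)"
  by (auto simp: comp_ftor_def)

lemma farr_comp_hom [simp]: "f \<in> hom C x y \<Longrightarrow> farr (comp_ftor C G F) f = farr G (farr F f)"
  by (auto simp: hom_def)

lemma id_ftor_functor: "is_category C \<Longrightarrow> is_functor C C (id_ftor C)"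
  by (rule is_functorI)
     (auto simp: homD id_ftor_def hom_objs dest: Idt_hom cmp_hom homD)

lemma comp_ftor_functor:
  assumes "is_category C" "is_functor C D F" "is_functor D E G"
  shows "is_functor C E (comp_ftor C G F)"
proof (rule is_functorI[OF assms(1)])
  show "fobj (comp_ftor C G F) \<in> extensional (Obj C)" "farr (comp_ftor C G F) \<in> extensional (Arr C)"
    by (auto simp: comp_ftor_def)
next
  fix x assume x: "x \<in> Obj C"
  have "Idt C x \<in> Arr C" using Idt_hom[OF assms(1) x] by (simp add: homD)
  then show "farr (comp_ftor C G F) (Idt C x) = Idt E (fobj (comp_ftor C G F) x)"
    using x assms by (simp add: ftor_id ftor_obj)
  show "fobj (comp_ftor C G F) x \<in> Obj E" using x assms by (simp add: ftor_obj)
next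
  fix f x y assume f: "f \<in> hom C x y"
  then show "farr (comp_ftor C G F) f \<in> hom E (fobj (comp_ftor C G F) x) (fobj (comp_ftor C G F) y)"
    using ftor_hom[OF assms(3) ftor_hom[OF assms(2) f]] hom_objs[OF assms(1) f] by simp
  fix g z assume g: "g \<in> hom C y z"
  show "farr (comp_ftor C G F) (g \<odot>\<^bsub>C\<^esub> f) = farr (comp_ftor C G F) g \<odot>\<^bsub>E\<^esub> farr (comp_ftor C G F) f"
    using f g cmp_hom[OF assms(1) f g] ftor_cmp[OF assms(2) f g]
      ftor_cmp[OF assms(3) ftor_hom[OF assms(2) f] ftor_hom[OF assms(2) g]] by simp
qed

lemma comp_ftor_assoc:
  assumes "is_functor C D F"
  shows "comp_ftor C (comp_ftor D H G) F = comp_ftor C H (comp_ftor C G F)"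
  using assms unfolding comp_ftor_def is_functor_def hom_def
  by (auto simp: fun_eq_iff restrict_def)

lemma nat_id: 
  assumes "is_category C" "is_category D" "is_functor C D F"
  shows "is_nat C D F F (\<lambda>x\<in>Obj C. Idt D (fobj F x))"
proof (rule is_natI[OF assms(1,3,3)])
  fix f x y assume "x \<in> Obj C" "y \<in> Obj C" "f \<in> hom C x y"
  then show "(\<lambda>x\<in>Obj C. Idt D (fobj F x)) y \<odot>\<^bsub>D\<^esub> farr F f = farr F f \<odot>\<^bsub>D\<^esub> (\<lambda>x\<in>Obj C. Idt D (fobj F x)) x"
    using assms by (simp add: cmp_idl[OF assms(2) ftor_hom[OF assms(3)]]
        cmp_idr[OF assms(2) ftor_hom[OF assms(3)]])
qed (use assms in \<open>auto simp: Idt_hom ftor_obj\<close>)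

lemma nat_vcomp:
  assumes C: "is_category C" and D: "is_category D"
    and s: "is_nat C D F G \<sigma>" and t: "is_nat C D G H \<tau>"
  shows "is_nat C D F H (\<lambda>x\<in>Obj C. \<tau> x \<odot>\<^bsub>D\<^esub> \<sigma> x)"
proof (rule is_natI[OF C nat_functors(1)[OF s] nat_functors(2)[OF t]])
  fix x assume "x \<in> Obj C"
  then show "(\<lambda>x\<in>Obj C. \<tau> x \<odot>\<^bsub>D\<^esub> \<sigma> x) x \<in> hom D (fobj F x) (fobj H x)"
    using cmp_hom[OF D nat_hom[OF s] nat_hom[OF t]] by simp
next
  fix f x y assume x: "x \<in> Obj C" and y: "y \<in> Obj C" and f: "f \<in> hom C x y"
  note Ff = ftor_hom[OF nat_functors(1)[OF s] f] and Gf = ftor_hom[OF nat_functors(2)[OF s] f]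
    and Hf = ftor_hom[OF nat_functors(2)[OF t] f]
  have "(\<tau> y \<odot>\<^bsub>D\<^esub> \<sigma> y) \<odot>\<^bsub>D\<^esub> farr F f = \<tau> y \<odot>\<^bsub>D\<^esub> (farr G f \<odot>\<^bsub>D\<^esub> \<sigma> x)"
    using cmp_assoc[OF D Ff nat_hom[OF s y] nat_hom[OF t y]] nat_comm[OF s f] by simp
  also have "\<dots> = (farr H f \<odot>\<^bsub>D\<^esub> \<tau> x) \<odot>\<^bsub>D\<^esub> \<sigma> x"
    using cmp_assoc[OF D nat_hom[OF s x] Gf nat_hom[OF t y]] nat_comm[OF t f] by simp
  also have "\<dots> = farr H f \<odot>\<^bsub>D\<^esub> (\<tau> x \<odot>\<^bsub>D\<^esub> \<sigma> x)"
    using cmp_assoc[OF D nat_hom[OF s x] nat_hom[OF t x] Hf] by simp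
  finally show "(\<lambda>x\<in>Obj C. \<tau> x \<odot>\<^bsub>D\<^esub> \<sigma> x) y \<odot>\<^bsub>D\<^esub> farr F f = farr H f \<odot>\<^bsub>D\<^esub> (\<lambda>x\<in>Obj C. \<tau> x \<odot>\<^bsub>D\<^esub> \<sigma> x) x"
    using x y by simp
qed simp

lemma nat_whisker_left:
  assumes C: "is_category C" and s: "is_nat C D F G \<sigma>" and H: "is_functor D E H"
  shows "is_nat C E (comp_ftor C H F) (comp_ftor C H G) (\<lambda>x\<in>Obj C. farr H (\<sigma> x))"
proof (rule is_natI[OF C comp_ftor_functor[OF C nat_functors(1)[OF s] H]
      comp_ftor_functor[OF C nat_functors(2)[OF s] H]])
  fix x assume "x \<in> Obj C"
  then show "(\<lambda>x\<in>Obj C. farr H (\<sigma> x)) x \<in> hom E (fobj (comp_ftor C H F) x) (fobj (comp_ftor C H G) x)"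
    using ftor_hom[OF H nat_hom[OF s]] by simp
next
  fix f x y assume x: "x \<in> Obj C" and y: "y \<in> Obj C" and f: "f \<in> hom C x y"
  show "(\<lambda>x\<in>Obj C. farr H (\<sigma> x)) y \<odot>\<^bsub>E\<^esub> farr (comp_ftor C H F) f =
        farr (comp_ftor C H G) f \<odot>\<^bsub>E\<^esub> (\<lambda>x\<in>Obj C. farr H (\<sigma> x)) x"
    using x y f nat_comm[OF s f]
      ftor_cmp[OF H ftor_hom[OF nat_functors(1)[OF s] f] nat_hom[OF s y]]
      ftor_cmp[OF H nat_hom[OF s x] ftor_hom[OF nat_functors(2)[OF s] f]]
    by simp
qed simp

lemma nat_whisker_right:
  assumes C: "is_category C" and K: "is_functor C D K" and s: "is_nat D E F G \<sigma>"
  shows "is_nat C E (comp_ftor C F K) (comp_ftor C G K) (\<lambda>x\<in>Obj C. \<sigma> (fobj K x))"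
proof (rule is_natI[OF C comp_ftor_functor[OF C K nat_functors(1)[OF s]]
      comp_ftor_functor[OF C K nat_functors(2)[OF s]]])
  fix x assume "x \<in> Obj C"
  then show "(\<lambda>x\<in>Obj C. \<sigma> (fobj K x)) x \<in> hom E (fobj (comp_ftor C F K) x) (fobj (comp_ftor C G K) x)"
    using nat_hom[OF s ftor_obj[OF K]] by simp
next
  fix f x y assume x: "x \<in> Obj C" and y: "y \<in> Obj C" and f: "f \<in> hom C x y"
  then show "(\<lambda>x\<in>Obj C. \<sigma> (fobj K x)) y \<odot>\<^bsub>E\<^esub> farr (comp_ftor C F K) f =
        farr (comp_ftor C G K) f \<odot>\<^bsub>E\<^esub> (\<lambda>x\<in>Obj C. \<sigma> (fobj K x)) x"
    using nat_comm[OF s ftor_hom[OF K f]] by simp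
qed simp

section \<open>Isomorphisms\<close>

text \<open>
  Inverses are unique, so the choice is immaterial; it only serves to have a name for the inverse.
\<close>

definition cinv :: "('o, 'm) cat \<Rightarrow> 'm \<Rightarrow> 'm" where
  "cinv C f = (SOME g. g \<in> hom C (Cod C f) (Dom C f) \<and>
     g \<odot>\<^bsub>C\<^esub> f = Idt C (Dom C f) \<and> f \<odot>\<^bsub>C\<^esub> g = Idt C (Cod C f))"

lemma cinv:
  assumes "is_iso C f" "f \<in> hom C x y"
  shows "cinv C f \<in> hom C y x" "cinv C f \<odot>\<^bsub>C\<^esub> f = Idt C x" "f \<odot>\<^bsub>C\<^esub> cinv C f = Idt C y"
proof -
  have "\<exists>g. g \<in> hom C (Cod C f) (Dom C f) \<and> g \<odot>\<^bsub>C\<^esub> f = Idt C (Dom C f) \<and> f \<odot>\<^bsub>C\<^esub> g = Idt C (Cod C f)"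
    using assms(1) unfolding is_iso_def by auto
  from someI_ex[OF this] show "cinv C f \<in> hom C y x" "cinv C f \<odot>\<^bsub>C\<^esub> f = Idt C x" "f \<odot>\<^bsub>C\<^esub> cinv C f = Idt C y"
    unfolding cinv_def using homD[OF assms(2)] by auto
qed

lemma isoI:
  assumes "f \<in> hom C x y" "g \<in> hom C y x" "g \<odot>\<^bsub>C\<^esub> f = Idt C x" "f \<odot>\<^bsub>C\<^esub> g = Idt C y"
  shows "is_iso C f"
  using assms homD[OF assms(1)] unfolding is_iso_def by auto

lemma iso_cinv:
  assumes "is_iso C f" "f \<in> hom C x y"
  shows "is_iso C (cinv C f)"
  using cinv[OF assms] assms(2) isoI by metis

lemma iso_cancel_left:
  assumes C: "is_category C" and f: "is_iso C f" "f \<in> hom C y z"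
    and g: "g \<in> hom C x y" and h: "h \<in> hom C x y" and eq: "f \<odot>\<^bsub>C\<^esub> g = f \<odot>\<^bsub>C\<^esub> h"
  shows "g = h"
proof -
  have "cinv C f \<odot>\<^bsub>C\<^esub> (f \<odot>\<^bsub>C\<^esub> k) = k" if "k \<in> hom C x y" for k
    using cmp_assoc[OF C that f(2) cinv(1)[OF f]] cinv(2)[OF f] cmp_idl[OF C that] by simp
  then show ?thesis using g h eq by metis
qed

lemma iso_cancel_right:
  assumes C: "is_category C" and f: "is_iso C f" "f \<in> hom C x y"
    and g: "g \<in> hom C y z" and h: "h \<in> hom C y z" and eq: "g \<odot>\<^bsub>C\<^esub> f = h \<odot>\<^bsub>C\<^esub> f"
  shows "g = h"
proof -
  have "(k \<odot>\<^bsub>C\<^esub> f) \<odot>\<^bsub>C\<^esub> cinv C f = k" if "k \<in> hom C y z" for k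
    using cmp_assoc[OF C cinv(1)[OF f] f(2) that] cinv(3)[OF f] cmp_idr[OF C that] by simp
  then show ?thesis using g h eq by metis
qed

lemma cmp_cinv_cancel:
  assumes C: "is_category C" and f: "is_iso C f" "f \<in> hom C y z" and g: "g \<in> hom C x z"
  shows "f \<odot>\<^bsub>C\<^esub> (cinv C f \<odot>\<^bsub>C\<^esub> g) = g"
  using cmp_assoc[OF C g cinv(1)[OF f] f(2)] cinv(3)[OF f] cmp_idl[OF C g] by simp

lemma cinv_cmp_cancel:
  assumes C: "is_category C" and f: "is_iso C f" "f \<in> hom C y z" and g: "g \<in> hom C x y"
  shows "cinv C f \<odot>\<^bsub>C\<^esub> (f \<odot>\<^bsub>C\<^esub> g) = g"
  using cmp_assoc[OF C g f(2) cinv(1)[OF f]] cinv(2)[OF f] cmp_idl[OF C g] by simp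

lemma iso_cmp:
  assumes C: "is_category C" and f: "is_iso C f" "f \<in> hom C x y" and g: "is_iso C g" "g \<in> hom C y z"
  shows "is_iso C (g \<odot>\<^bsub>C\<^esub> f)"
proof (rule isoI)
  note F = cinv[OF f] and G = cinv[OF g]
  show gf: "g \<odot>\<^bsub>C\<^esub> f \<in> hom C x z" by (rule cmp_hom[OF C f(2) g(2)])
  show fg: "cinv C f \<odot>\<^bsub>C\<^esub> cinv C g \<in> hom C z x" by (rule cmp_hom[OF C G(1) F(1)])
  show "(cinv C f \<odot>\<^bsub>C\<^esub> cinv C g) \<odot>\<^bsub>C\<^esub> (g \<odot>\<^bsub>C\<^esub> f) = Idt C x"
    using cmp_assoc[OF C gf G(1) F(1)] cinv_cmp_cancel[OF C g f(2)] F(2) by simp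
  show "(g \<odot>\<^bsub>C\<^esub> f) \<odot>\<^bsub>C\<^esub> (cinv C f \<odot>\<^bsub>C\<^esub> cinv C g) = Idt C z"
    using cmp_assoc[OF C fg f(2) g(2)] cmp_cinv_cancel[OF C f G(1)] G(3) by simp
qed

lemma ftor_iso:
  assumes "is_category C" "is_functor C D F" "is_iso C f" "f \<in> hom C x y"
  shows "is_iso D (farr F f)"
proof (rule isoI[OF ftor_hom[OF assms(2,4)] ftor_hom[OF assms(2) cinv(1)[OF assms(3,4)]]])
  show "farr F (cinv C f) \<odot>\<^bsub>D\<^esub> farr F f = Idt D (fobj F x)"
    using ftor_cmp[OF assms(2,4) cinv(1)[OF assms(3,4)]] cinv(2)[OF assms(3,4)]
      ftor_id[OF assms(2) hom_objs(1)[OF assms(1,4)]] by simp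
  show "farr F f \<odot>\<^bsub>D\<^esub> farr F (cinv C f) = Idt D (fobj F y)"
    using ftor_cmp[OF assms(2) cinv(1)[OF assms(3,4)] assms(4)] cinv(3)[OF assms(3,4)]
      ftor_id[OF assms(2) hom_objs(2)[OF assms(1,4)]] by simp
qed

lemma natiso_nat: "is_natiso C D F G \<tau> \<Longrightarrow> is_nat C D F G \<tau>"
  and natiso_iso: "is_natiso C D F G \<tau> \<Longrightarrow> x \<in> Obj C \<Longrightarrow> is_iso D (\<tau> x)"
  by (auto simp: is_natiso_def)

text \<open>
  Inverting the two opposite isomorphic sides of a commuting square: with the components of a
  transformation as these sides, this is the naturality of the inverse.
\<close>

lemma square_cinv:
  assumes C: "is_category C" and s: "is_iso C s" "s \<in> hom C a b" and t: "is_iso C t" "t \<in> hom C a' b'"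
    and f: "f \<in> hom C a a'" and g: "g \<in> hom C b b'" and eq: "t \<odot>\<^bsub>C\<^esub> f = g \<odot>\<^bsub>C\<^esub> s"
  shows "cinv C t \<odot>\<^bsub>C\<^esub> g = f \<odot>\<^bsub>C\<^esub> cinv C s"
proof (rule iso_cancel_right[OF C s])
  note S = cinv[OF s] and T = cinv[OF t]
  show "cinv C t \<odot>\<^bsub>C\<^esub> g \<in> hom C b a'" by (rule cmp_hom[OF C g T(1)])
  show "f \<odot>\<^bsub>C\<^esub> cinv C s \<in> hom C b a'" by (rule cmp_hom[OF C S(1) f])
  show "cinv C t \<odot>\<^bsub>C\<^esub> g \<odot>\<^bsub>C\<^esub> s = f \<odot>\<^bsub>C\<^esub> cinv C s \<odot>\<^bsub>C\<^esub> s"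
    using cmp_assoc[OF C s(2) g T(1)] eq cinv_cmp_cancel[OF C t f]
      cmp_assoc[OF C s(2) S(1) f] S(2) cmp_idr[OF C f] by simp
qed

lemma nat_cinv:
  assumes C: "is_category C" and D: "is_category D" and s: "is_natiso C D F G \<sigma>"
  shows "is_nat C D G F (\<lambda>x\<in>Obj C. cinv D (\<sigma> x))"
proof (rule is_natI[OF C nat_functors(2,1)[OF natiso_nat[OF s]]])
  fix x assume x: "x \<in> Obj C"
  then show "(\<lambda>x\<in>Obj C. cinv D (\<sigma> x)) x \<in> hom D (fobj G x) (fobj F x)"
    using cinv(1)[OF natiso_iso[OF s] nat_hom[OF natiso_nat[OF s]]] by simp
next
  fix f x y assume x: "x \<in> Obj C" and y: "y \<in> Obj C" and f: "f \<in> hom C x y"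
  show "(\<lambda>x\<in>Obj C. cinv D (\<sigma> x)) y \<odot>\<^bsub>D\<^esub> farr G f = farr F f \<odot>\<^bsub>D\<^esub> (\<lambda>x\<in>Obj C. cinv D (\<sigma> x)) x"
    using square_cinv[OF D natiso_iso[OF s x] nat_hom[OF natiso_nat[OF s] x]
        natiso_iso[OF s y] nat_hom[OF natiso_nat[OF s] y]
        ftor_hom[OF nat_functors(1)[OF natiso_nat[OF s]] f]
        ftor_hom[OF nat_functors(2)[OF natiso_nat[OF s]] f] nat_comm[OF natiso_nat[OF s] f]] x y
    by simp
qed simp

section \<open>Fully faithful and essentially surjective functors\<close>

text \<open>
  An inverse is built on objects by choosing, for every \<open>d\<close>, an object \<open>Go d\<close> with an isomorphism
  \<open>\<epsilon> d\<close> from its image to \<open>d\<close>.  An arrow \<open>g\<close> of \<open>D\<close> is conjugated by these isomorphisms to \<open>k g\<close>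
  and then lifted along the fully faithful functor.  Every equation about lifts (functoriality,
  naturality of the unit) is checked after applying \<open>F\<close>, which is faithful, and the unit is
  invertible because a fully faithful functor reflects isomorphisms.
\<close>

lemma equivalenceI:
  assumes C: "is_category C" and D: "is_category D" and F: "is_functor C D F"
    and ff: "\<And>x y g. x \<in> Obj C \<Longrightarrow> y \<in> Obj C \<Longrightarrow> g \<in> hom D (fobj F x) (fobj F y) \<Longrightarrow>
               \<exists>!f. f \<in> hom C x y \<and> farr F f = g"
    and eso: "\<And>d. d \<in> Obj D \<Longrightarrow> \<exists>x e. x \<in> Obj C \<and> e \<in> hom D (fobj F x) d \<and> is_iso D e"
  shows "is_equivalence C D F"
proof -
  obtain Go \<epsilon> where Go: "\<And>d. d \<in> Obj D \<Longrightarrow> Go d \<in> Obj C"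
    and e: "\<And>d. d \<in> Obj D \<Longrightarrow> \<epsilon> d \<in> hom D (fobj F (Go d)) d"
    and ei: "\<And>d. d \<in> Obj D \<Longrightarrow> is_iso D (\<epsilon> d)"
    using eso by metis
  have faith: "f = f'" if "f \<in> hom C x y" "f' \<in> hom C x y" "farr F f = farr F f'" for f f' x y
    using ff[OF hom_objs(1)[OF C that(1)] hom_objs(2)[OF C that(1)] ftor_hom[OF F that(1)]] that by metis
  have refl_iso: "is_iso C f" if f: "f \<in> hom C x y" and i: "is_iso D (farr F f)" for f x y
  proof -
    note o = hom_objs[OF C f]
    note Ff = ftor_hom[OF F f]
    note I = cinv[OF i Ff]
    obtain g where g: "g \<in> hom C y x" "farr F g = cinv D (farr F f)"
      using ff[OF o(2,1) I(1)] by metis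
    show ?thesis
    proof (rule isoI[OF f g(1)])
      show "g \<odot>\<^bsub>C\<^esub> f = Idt C x"
        by (rule faith[OF cmp_hom[OF C f g(1)] Idt_hom[OF C o(1)]])
           (simp add: ftor_cmp[OF F f g(1)] g(2) I(2) ftor_id[OF F o(1)])
      show "f \<odot>\<^bsub>C\<^esub> g = Idt C y"
        by (rule faith[OF cmp_hom[OF C g(1) f] Idt_hom[OF C o(2)]])
           (simp add: ftor_cmp[OF F g(1) f] g(2) I(3) ftor_id[OF F o(2)])
    qed
  qed
  define k where "k g = cinv D (\<epsilon> (Cod D g)) \<odot>\<^bsub>D\<^esub> (g \<odot>\<^bsub>D\<^esub> \<epsilon> (Dom D g))" for g
  have k: "k g \<in> hom D (fobj F (Go x)) (fobj F (Go y))" if g: "g \<in> hom D x y" for g x y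
    unfolding k_def homD(2,3)[OF g]
    by (rule cmp_hom[OF D cmp_hom[OF D e g] cinv(1)[OF ei e]]) (use hom_objs[OF D g] in auto)
  define Ga where "Ga g = (THE f. f \<in> hom C (Go (Dom D g)) (Go (Cod D g)) \<and> farr F f = k g)" for g
  have Ga: "Ga g \<in> hom C (Go x) (Go y)" "farr F (Ga g) = k g" if g: "g \<in> hom D x y" for g x y
    using theI'[OF ff[OF Go[OF hom_objs(1)[OF D g]] Go[OF hom_objs(2)[OF D g]] k[OF g]]] homD(2,3)[OF g]
    unfolding Ga_def by auto
  have ek: "\<epsilon> y \<odot>\<^bsub>D\<^esub> k g = g \<odot>\<^bsub>D\<^esub> \<epsilon> x" if g: "g \<in> hom D x y" for g x y
    unfolding k_def homD(2,3)[OF g]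
    by (rule cmp_cinv_cancel[OF D ei e cmp_hom[OF D e g]]) (use hom_objs[OF D g] in auto)
  define G where "G = \<lparr>fobj = (\<lambda>d\<in>Obj D. Go d), farr = (\<lambda>g\<in>Arr D. Ga g)\<rparr>"
  have Gf [simp]: "farr G g = Ga g" if "g \<in> hom D x y" for g x y
    using homD(1)[OF that] by (simp add: G_def)
  have Gob [simp]: "fobj G d = Go d" if "d \<in> Obj D" for d using that by (simp add: G_def)
  have G: "is_functor D C G"
  proof (rule is_functorI[OF D])
    fix d assume d: "d \<in> Obj D"
    note i = Idt_hom[OF D d]
    have "\<epsilon> d \<odot>\<^bsub>D\<^esub> k (Idt D d) = \<epsilon> d \<odot>\<^bsub>D\<^esub> Idt D (fobj F (Go d))"
      using ek[OF i] cmp_idl[OF D e[OF d]] cmp_idr[OF D e[OF d]] by simp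
    then have "k (Idt D d) = Idt D (fobj F (Go d))"
      by (rule iso_cancel_left[OF D ei[OF d] e[OF d] k[OF i] Idt_hom[OF D ftor_obj[OF F Go[OF d]]]])
    then show "farr G (Idt D d) = Idt C (fobj G d)"
      using faith[OF Ga(1)[OF i] Idt_hom[OF C Go[OF d]]] Ga(2)[OF i] i d ftor_id[OF F Go[OF d]] by simp
    show "fobj G d \<in> Obj C" using d Go by simp
  next
    fix f x y assume f: "f \<in> hom D x y"
    note o = hom_objs[OF D f]
    show "farr G f \<in> hom C (fobj G x) (fobj G y)" using Ga(1)[OF f] f o by simp
    fix g z assume g: "g \<in> hom D y z"
    note z = hom_objs(2)[OF D g] and gf = cmp_hom[OF D f g] and kg = k[OF g] and kf = k[OF f]
    have "\<epsilon> z \<odot>\<^bsub>D\<^esub> (k g \<odot>\<^bsub>D\<^esub> k f) = g \<odot>\<^bsub>D\<^esub> \<epsilon> y \<odot>\<^bsub>D\<^esub> k f"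
      using cmp_assoc[OF D kf kg e[OF z]] ek[OF g] by simp
    also have "\<dots> = g \<odot>\<^bsub>D\<^esub> f \<odot>\<^bsub>D\<^esub> \<epsilon> x"
      using cmp_assoc[OF D kf e[OF o(2)] g] ek[OF f] cmp_assoc[OF D e[OF o(1)] f g] by simp
    finally have "k (g \<odot>\<^bsub>D\<^esub> f) = k g \<odot>\<^bsub>D\<^esub> k f"
      using iso_cancel_left[OF D ei[OF z] e[OF z] k[OF gf] cmp_hom[OF D kf kg]] ek[OF gf] by simp
    then show "farr G (g \<odot>\<^bsub>D\<^esub> f) = farr G g \<odot>\<^bsub>C\<^esub> farr G f"
      using faith[OF Ga(1)[OF gf] cmp_hom[OF C Ga(1)[OF f] Ga(1)[OF g]]] Ga(2)[OF gf] Ga(2)[OF f]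
          Ga(2)[OF g]
        ftor_cmp[OF F Ga(1)[OF f] Ga(1)[OF g]] f g gf by simp
  qed (auto simp: G_def)
  note GF = comp_ftor_functor[OF C F G] and FG = comp_ftor_functor[OF D G F]
  have eps: "is_natiso D D (comp_ftor D F G) (id_ftor D) (\<lambda>d\<in>Obj D. \<epsilon> d)"
    unfolding is_natiso_def
  proof (intro conjI is_natI[OF D FG id_ftor_functor[OF D]])
    fix f x y assume x: "x \<in> Obj D" and y: "y \<in> Obj D" and f: "f \<in> hom D x y"
    then show "(\<lambda>d\<in>Obj D. \<epsilon> d) y \<odot>\<^bsub>D\<^esub> farr (comp_ftor D F G) f = farr (id_ftor D) f \<odot>\<^bsub>D\<^esub> (\<lambda>d\<in>Obj D. \<epsilon> d) x"
      using ek[OF f] Ga(2)[OF f] homD(1)[OF f] by simp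
  qed (use e ei in auto)
  note Fo = ftor_obj[OF F]
  define h where "h x = cinv D (\<epsilon> (fobj F x))" for x
  have h: "h x \<in> hom D (fobj F x) (fobj F (Go (fobj F x)))" if "x \<in> Obj C" for x
    unfolding h_def by (rule cinv(1)[OF ei e]) (use Fo[OF that] in auto)
  define \<eta> where "\<eta> x = (THE f. f \<in> hom C x (Go (fobj F x)) \<and> farr F f = h x)" for x
  have eta: "\<eta> x \<in> hom C x (Go (fobj F x))" "farr F (\<eta> x) = h x" if x: "x \<in> Obj C" for x
    using theI'[OF ff[OF x Go[OF Fo[OF x]] h[OF x]]] unfolding \<eta>_def by auto
  have "is_natiso C C (id_ftor C) (comp_ftor C G F) (\<lambda>x\<in>Obj C. \<eta> x)"
    unfolding is_natiso_def
  proof (intro conjI is_natI[OF C id_ftor_functor[OF C] GF])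
    fix f x y assume x: "x \<in> Obj C" and y: "y \<in> Obj C" and f: "f \<in> hom C x y"
    note Ff = ftor_hom[OF F f]
    note GFf = Ga[OF Ff]
    have "farr F (\<eta> y \<odot>\<^bsub>C\<^esub> f) = h y \<odot>\<^bsub>D\<^esub> farr F f"
      using ftor_cmp[OF F f eta(1)[OF y]] eta(2)[OF y] by simp
    also have "\<dots> = k (farr F f) \<odot>\<^bsub>D\<^esub> h x"
      unfolding h_def
      by (rule square_cinv[OF D ei e ei e k[OF Ff] Ff ek[OF Ff]]) (use Fo x y in auto)
    also have "\<dots> = farr F (Ga (farr F f) \<odot>\<^bsub>C\<^esub> \<eta> x)"
      using ftor_cmp[OF F eta(1)[OF x] GFf(1)] eta(2)[OF x] GFf(2) by simp
    finally have "\<eta> y \<odot>\<^bsub>C\<^esub> f = Ga (farr F f) \<odot>\<^bsub>C\<^esub> \<eta> x"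
      by (rule faith[OF cmp_hom[OF C f eta(1)[OF y]] cmp_hom[OF C eta(1)[OF x] GFf(1)]])
    then show "(\<lambda>x\<in>Obj C. \<eta> x) y \<odot>\<^bsub>C\<^esub> farr (id_ftor C) f = farr (comp_ftor C G F) f \<odot>\<^bsub>C\<^esub> (\<lambda>x\<in>Obj C. \<eta> x) x"
      using x y f homD(1)[OF f] Gf[OF Ff] by simp
  next
    show "\<forall>x\<in>Obj C. is_iso C ((\<lambda>x\<in>Obj C. \<eta> x) x)"
    proof
      fix x assume x: "x \<in> Obj C"
      have "is_iso D (h x)" unfolding h_def by (rule iso_cinv[OF ei e]) (use Fo[OF x] in auto)
      then show "is_iso C ((\<lambda>x\<in>Obj C. \<eta> x) x)" using refl_iso[OF eta(1)[OF x]] eta(2)[OF x] x by simp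
    qed
  qed (use eta Fo in auto)
  then show ?thesis unfolding is_equivalence_def using C D F G eps by blast
qed

section \<open>Categories of pseudonatural transformations\<close>

lemma paste_squares:
  assumes D: "is_category D"
    and f: "f \<in> hom D a b" and g: "g \<in> hom D b c" and f': "f' \<in> hom D a' b'" and g': "g' \<in> hom D b' c'"
    and n1: "n1 \<in> hom D a a'" and n2: "n2 \<in> hom D b b'" and n3: "n3 \<in> hom D c c'"
    and sq1: "n2 \<odot>\<^bsub>D\<^esub> f = f' \<odot>\<^bsub>D\<^esub> n1" and sq2: "n3 \<odot>\<^bsub>D\<^esub> g = g' \<odot>\<^bsub>D\<^esub> n2"
  shows "n3 \<odot>\<^bsub>D\<^esub> (g \<odot>\<^bsub>D\<^esub> f) = (g' \<odot>\<^bsub>D\<^esub> f') \<odot>\<^bsub>D\<^esub> n1"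
proof -
  have "n3 \<odot>\<^bsub>D\<^esub> (g \<odot>\<^bsub>D\<^esub> f) = g' \<odot>\<^bsub>D\<^esub> (n2 \<odot>\<^bsub>D\<^esub> f)"
    using cmp_assoc[OF D f g n3] sq2 cmp_assoc[OF D f n2 g'] by simp
  then show ?thesis using sq1 cmp_assoc[OF D n1 f' g'] by simp
qed

lemma full_subcat_category:
  assumes "is_category C"
  shows "is_category (full_subcat C X)"
proof -
  have h: "hom (full_subcat C X) x y = (if x \<in> X \<and> y \<in> X then hom C x y else {})" for x y
    by (auto simp: hom_def full_subcat_def)
  show ?thesis
    using assms unfolding is_category_def h by (auto simp: full_subcat_def)
qed

lemma hom_full_subcat: "hom (full_subcat C X) x y = (if x \<in> X \<and> y \<in> X then hom C x y else {})"
  by (auto simp: hom_def full_subcat_def)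

text \<open>
  The fibres and the reindexing functors, which is all that the composition of modifications
  refers to.
\<close>

definition fibre_data :: "('b, 'v) cat \<Rightarrow> ('b, 'v, 'o, 'm) psf \<Rightarrow> bool" where
  "fibre_data B P \<longleftrightarrow> (\<forall>b\<in>Obj B. is_category (PC P b)) \<and>
     (\<forall>u\<in>Arr B. is_functor (PC P (Cod B u)) (PC P (Dom B u)) (PF P u))"

lemma fibre_cat: "fibre_data B P \<Longrightarrow> b \<in> Obj B \<Longrightarrow> is_category (PC P b)"
  and fibre_ftor: "fibre_data B P \<Longrightarrow> u \<in> Arr B \<Longrightarrow> is_functor (PC P (Cod B u)) (PC P (Dom B u)) (PF P u)"
  by (auto simp: fibre_data_def)

lemma pseudofunctor_fibre_data: "pseudofunctor B P \<Longrightarrow> fibre_data B P"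
  by (auto simp: fibre_data_def pseudofunctor_def)

lemma Dom_obj: "is_category C \<Longrightarrow> u \<in> Arr C \<Longrightarrow> Dom C u \<in> Obj C"
  and Cod_obj: "is_category C \<Longrightarrow> u \<in> Arr C \<Longrightarrow> Cod C u \<in> Obj C"
  by (auto simp: is_category_def)

lemma pnt_ftor: "pseudonat B P Q \<alpha> \<Longrightarrow> b \<in> Obj B \<Longrightarrow> is_functor (PC P b) (PC Q b) (NC \<alpha> b)"
  by (auto simp: pseudonat_def)

lemma pnt_natiso: "pseudonat B P Q \<alpha> \<Longrightarrow> u \<in> Arr B \<Longrightarrow>
     is_natiso (PC P (Cod B u)) (PC Q (Dom B u))
        (comp_ftor (PC P (Cod B u)) (PF Q u) (NC \<alpha> (Cod B u)))
        (comp_ftor (PC P (Cod B u)) (NC \<alpha> (Dom B u)) (PF P u)) (N2 \<alpha> u)"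
  by (auto simp: pseudonat_def)

lemma pnt_hom:
  assumes "pseudonat B P Q \<alpha>" "u \<in> Arr B" "x \<in> Obj (PC P (Cod B u))"
  shows "N2 \<alpha> u x \<in> hom (PC Q (Dom B u)) (fobj (PF Q u) (fobj (NC \<alpha> (Cod B u)) x))
                                       (fobj (NC \<alpha> (Dom B u)) (fobj (PF P u) x))"
  using nat_hom[OF natiso_nat[OF pnt_natiso[OF assms(1,2)]] assms(3)] assms(3) by simp

lemma pnt_iso:
  assumes "pseudonat B P Q \<alpha>" "u \<in> Arr B" "x \<in> Obj (PC P (Cod B u))"
  shows "is_iso (PC Q (Dom B u)) (N2 \<alpha> u x)"
  using natiso_iso[OF pnt_natiso[OF assms(1,2)] assms(3)] .

lemma pnt_comm:
  assumes "pseudonat B P Q \<alpha>" "u \<in> Arr B" "f \<in> hom (PC P (Cod B u)) x y"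
  shows "N2 \<alpha> u y \<odot>\<^bsub>PC Q (Dom B u)\<^esub> farr (PF Q u) (farr (NC \<alpha> (Cod B u)) f) =
         farr (NC \<alpha> (Dom B u)) (farr (PF P u) f) \<odot>\<^bsub>PC Q (Dom B u)\<^esub> N2 \<alpha> u x"
  using nat_comm[OF natiso_nat[OF pnt_natiso[OF assms(1,2)]] assms(3)] assms(3) by simp

lemma pnt_comp:
  assumes "pseudonat B P Q \<alpha>" "u \<in> Arr B" "v \<in> Arr B" "Dom B u = Cod B v" "x \<in> Obj (PC P (Cod B u))"
  shows "N2 \<alpha> (u \<odot>\<^bsub>B\<^esub> v) x \<odot>\<^bsub>PC Q (Dom B v)\<^esub> PM Q u v (fobj (NC \<alpha> (Cod B u)) x) =
           farr (NC \<alpha> (Dom B v)) (PM P u v x) \<odot>\<^bsub>PC Q (Dom B v)\<^esub>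
             (N2 \<alpha> v (fobj (PF P u) x) \<odot>\<^bsub>PC Q (Dom B v)\<^esub> farr (PF Q v) (N2 \<alpha> u x))"
  using assms unfolding pseudonat_def by blast

lemma pnt_unit:
  assumes "pseudonat B P Q \<alpha>" "b \<in> Obj B" "x \<in> Obj (PC P b)"
  shows "N2 \<alpha> (Idt B b) x \<odot>\<^bsub>PC Q b\<^esub> PI Q b (fobj (NC \<alpha> b) x) = farr (NC \<alpha> b) (PI P b x)"
  using assms unfolding pseudonat_def by blast

lemma mod_pnt:
  assumes "modification B P Q \<alpha> \<beta> \<Gamma>"
  shows "pseudonat B P Q \<alpha>" "pseudonat B P Q \<beta>"
  using assms by (auto simp: modification_def)

lemma mod_nat: "modification B P Q \<alpha> \<beta> \<Gamma> \<Longrightarrow> b \<in> Obj B \<Longrightarrow>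
    is_nat (PC P b) (PC Q b) (NC \<alpha> b) (NC \<beta> b) (\<Gamma> b)"
  by (auto simp: modification_def)

lemma mod_hom: "modification B P Q \<alpha> \<beta> \<Gamma> \<Longrightarrow> b \<in> Obj B \<Longrightarrow> x \<in> Obj (PC P b) \<Longrightarrow>
    \<Gamma> b x \<in> hom (PC Q b) (fobj (NC \<alpha> b) x) (fobj (NC \<beta> b) x)"
  by (rule nat_hom[OF mod_nat])

lemma mod_comm:
  assumes "modification B P Q \<alpha> \<beta> \<Gamma>" "u \<in> Arr B" "x \<in> Obj (PC P (Cod B u))"
  shows "N2 \<beta> u x \<odot>\<^bsub>PC Q (Dom B u)\<^esub> farr (PF Q u) (\<Gamma> (Cod B u) x) =
        \<Gamma> (Dom B u) (fobj (PF P u) x) \<odot>\<^bsub>PC Q (Dom B u)\<^esub> N2 \<alpha> u x"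
  using assms by (auto simp: modification_def)

lemma mod_eqI:
  assumes "modification B P Q \<alpha> \<beta> \<Gamma>" "modification B P Q \<alpha>' \<beta>' \<Delta>"
    and "\<And>b x. b \<in> Obj B \<Longrightarrow> x \<in> Obj (PC P b) \<Longrightarrow> \<Gamma> b x = \<Delta> b x"
  shows "\<Gamma> = \<Delta>"
proof (rule extensionalityI[of _ "Obj B"])
  fix b assume b: "b \<in> Obj B"
  show "\<Gamma> b = \<Delta> b" by (rule nat_eqI[OF mod_nat[OF assms(1) b] mod_nat[OF assms(2) b] assms(3)[OF b]])
qed (use assms(1,2) in \<open>auto simp: modification_def\<close>)

lemma hom_PsNat: "hom (PsNat B P Q) \<alpha> \<beta> = {(\<alpha>, \<beta>, \<Gamma>) |\<Gamma>. modification B P Q \<alpha> \<beta> \<Gamma>}"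
  by (auto simp: hom_def PsNat_def)

lemma PsNat_sel [simp]:
  "Obj (PsNat B P Q) = {\<alpha>. pseudonat B P Q \<alpha>}"
  "Arr (PsNat B P Q) = {(\<alpha>, \<beta>, \<Gamma>). modification B P Q \<alpha> \<beta> \<Gamma>}"
  "Dom (PsNat B P Q) (\<alpha>, \<beta>, \<Gamma>) = \<alpha>" "Cod (PsNat B P Q) (\<alpha>, \<beta>, \<Gamma>) = \<beta>"
  "Idt (PsNat B P Q) \<alpha> = (\<alpha>, \<alpha>, \<lambda>b\<in>Obj B. \<lambda>x\<in>Obj (PC P b). Idt (PC Q b) (fobj (NC \<alpha> b) x))"
  "(\<beta>', \<gamma>, \<Delta>) \<odot>\<^bsub>PsNat B P Q\<^esub> (\<alpha>, \<beta>, \<Gamma>) =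
     (\<alpha>, \<gamma>, \<lambda>b\<in>Obj B. \<lambda>x\<in>Obj (PC P b). \<Delta> b x \<odot>\<^bsub>PC Q b\<^esub> \<Gamma> b x)"
  by (auto simp: PsNat_def)

lemma mod_id:
  assumes B: "is_category B" and P: "fibre_data B P" and Q: "fibre_data B Q" and a: "pseudonat B P Q \<alpha>"
  shows "modification B P Q \<alpha> \<alpha> (\<lambda>b\<in>Obj B. \<lambda>x\<in>Obj (PC P b). Idt (PC Q b) (fobj (NC \<alpha> b) x))"
  unfolding modification_def
proof (intro conjI ballI)
  fix b assume b: "b \<in> Obj B"
  show "is_nat (PC P b) (PC Q b) (NC \<alpha> b) (NC \<alpha> b)
          ((\<lambda>b\<in>Obj B. \<lambda>x\<in>Obj (PC P b). Idt (PC Q b) (fobj (NC \<alpha> b) x)) b)"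
    using nat_id[OF fibre_cat[OF P b] fibre_cat[OF Q b] pnt_ftor[OF a b]] b by simp
next
  fix u x assume u: "u \<in> Arr B" and x: "x \<in> Obj (PC P (Cod B u))"
  note d = Dom_obj[OF B u] and c = Cod_obj[OF B u]
  note h = pnt_hom[OF a u x]
  show "N2 \<alpha> u x \<odot>\<^bsub>PC Q (Dom B u)\<^esub>
         farr (PF Q u) ((\<lambda>b\<in>Obj B. \<lambda>x\<in>Obj (PC P b). Idt (PC Q b) (fobj (NC \<alpha> b) x)) (Cod B u) x) =
        (\<lambda>b\<in>Obj B. \<lambda>x\<in>Obj (PC P b). Idt (PC Q b) (fobj (NC \<alpha> b) x)) (Dom B u) (fobj (PF P u) x) \<odot>\<^bsub>PC Q
            (Dom B u)\<^esub>
        N2 \<alpha> u x"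
    using d c x ftor_id[OF fibre_ftor[OF Q u] ftor_obj[OF pnt_ftor[OF a c] x]]
      ftor_obj[OF fibre_ftor[OF P u] x] cmp_idl[OF fibre_cat[OF Q d] h] cmp_idr[OF fibre_cat[OF Q d] h]
    by simp
qed (use a in auto)

lemma mod_cmp:
  assumes B: "is_category B" and P: "fibre_data B P" and Q: "fibre_data B Q"
    and G: "modification B P Q \<alpha> \<beta> \<Gamma>" and D: "modification B P Q \<beta> \<gamma> \<Delta>"
  shows "modification B P Q \<alpha> \<gamma> (\<lambda>b\<in>Obj B. \<lambda>x\<in>Obj (PC P b). \<Delta> b x \<odot>\<^bsub>PC Q b\<^esub> \<Gamma> b x)"
  unfolding modification_def
proof (intro conjI ballI)
  fix b assume b: "b \<in> Obj B"
  show "is_nat (PC P b) (PC Q b) (NC \<alpha> b) (NC \<gamma> b)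
          ((\<lambda>b\<in>Obj B. \<lambda>x\<in>Obj (PC P b). \<Delta> b x \<odot>\<^bsub>PC Q b\<^esub> \<Gamma> b x) b)"
    using nat_vcomp[OF fibre_cat[OF P b] fibre_cat[OF Q b] mod_nat[OF G b] mod_nat[OF D b]] b by simp
next
  fix u x assume u: "u \<in> Arr B" and x: "x \<in> Obj (PC P (Cod B u))"
  note d = Dom_obj[OF B u] and c = Cod_obj[OF B u]
  note Fx = ftor_obj[OF fibre_ftor[OF P u] x]
  note Qu = fibre_ftor[OF Q u]
  note G1 = mod_hom[OF G c x] and D1 = mod_hom[OF D c x]
  show "N2 \<gamma> u x \<odot>\<^bsub>PC Q (Dom B u)\<^esub>
         farr (PF Q u) ((\<lambda>b\<in>Obj B. \<lambda>x\<in>Obj (PC P b). \<Delta> b x \<odot>\<^bsub>PC Q b\<^esub> \<Gamma> b x) (Cod B u) x) =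
        (\<lambda>b\<in>Obj B. \<lambda>x\<in>Obj (PC P b). \<Delta> b x \<odot>\<^bsub>PC Q b\<^esub> \<Gamma> b x) (Dom B u) (fobj (PF P u) x) \<odot>\<^bsub>PC Q (Dom B u)\<^esub>
        N2 \<alpha> u x"
    using d c x Fx ftor_cmp[OF Qu G1 D1]
      paste_squares[OF fibre_cat[OF Q d] ftor_hom[OF Qu G1] ftor_hom[OF Qu D1] mod_hom[OF G d Fx]
          mod_hom[OF D d Fx]
        pnt_hom[OF mod_pnt(1)[OF G] u x] pnt_hom[OF mod_pnt(2)[OF G] u x] pnt_hom[OF mod_pnt(2)[OF D] u x]
        mod_comm[OF G u x] mod_comm[OF D u x]]
    by simp
qed (use G D in \<open>auto simp: mod_pnt\<close>)

lemma PsNat_category: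
  assumes B: "is_category B" and P: "fibre_data B P" and Q: "fibre_data B Q"
  shows "is_category (PsNat B P Q)"
  unfolding is_category_def
proof (intro conjI ballI impI)
  fix f assume "f \<in> Arr (PsNat B P Q)"
  then obtain \<alpha> \<beta> \<Gamma> where f: "f = (\<alpha>, \<beta>, \<Gamma>)" and G: "modification B P Q \<alpha> \<beta> \<Gamma>" by auto
  note pn = mod_pnt[OF G]
  show "Dom (PsNat B P Q) f \<in> Obj (PsNat B P Q)" "Cod (PsNat B P Q) f \<in> Obj (PsNat B P Q)"
    using pn f by auto
  show "Idt (PsNat B P Q) (Cod (PsNat B P Q) f) \<odot>\<^bsub>PsNat B P Q\<^esub> f = f"
    unfolding f PsNat_sel prod.inject
  proof (intro conjI refl mod_eqI[OF mod_cmp[OF B P Q G mod_id[OF B P Q pn(2)]] G])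
  qed (simp add: cmp_idl[OF fibre_cat[OF Q] mod_hom[OF G]])
  show "f \<odot>\<^bsub>PsNat B P Q\<^esub> Idt (PsNat B P Q) (Dom (PsNat B P Q) f) = f"
    unfolding f PsNat_sel prod.inject
  proof (intro conjI refl mod_eqI[OF mod_cmp[OF B P Q mod_id[OF B P Q pn(1)] G] G])
  qed (simp add: cmp_idr[OF fibre_cat[OF Q] mod_hom[OF G]])
  fix g assume "g \<in> Arr (PsNat B P Q)" and "Dom (PsNat B P Q) g = Cod (PsNat B P Q) f"
  then obtain \<gamma> \<Delta> where g: "g = (\<beta>, \<gamma>, \<Delta>)" and D: "modification B P Q \<beta> \<gamma> \<Delta>" using f by auto
  note DG = mod_cmp[OF B P Q G D]
  show "g \<odot>\<^bsub>PsNat B P Q\<^esub> f \<in> hom (PsNat B P Q) (Dom (PsNat B P Q) f) (Cod (PsNat B P Q) g)"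
    unfolding f g PsNat_sel hom_PsNat using DG by auto
  fix h assume "h \<in> Arr (PsNat B P Q)" and "Dom (PsNat B P Q) h = Cod (PsNat B P Q) g"
  then obtain \<delta> \<Theta> where h: "h = (\<gamma>, \<delta>, \<Theta>)" and T: "modification B P Q \<gamma> \<delta> \<Theta>" using g by auto
  show "h \<odot>\<^bsub>PsNat B P Q\<^esub> (g \<odot>\<^bsub>PsNat B P Q\<^esub> f) = h \<odot>\<^bsub>PsNat B P Q\<^esub> g \<odot>\<^bsub>PsNat B P Q\<^esub> f"
    unfolding f g h PsNat_sel prod.inject
    by (intro conjI refl mod_eqI[OF mod_cmp[OF B P Q DG T] mod_cmp[OF B P Q G mod_cmp[OF B P Q D T]]])
      (simp add: cmp_assoc[OF fibre_cat[OF Q] mod_hom[OF G] mod_hom[OF D] mod_hom[OF T]])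
next
  fix \<alpha> assume "\<alpha> \<in> Obj (PsNat B P Q)"
  then have a: "pseudonat B P Q \<alpha>" by simp
  show "Idt (PsNat B P Q) \<alpha> \<in> hom (PsNat B P Q) \<alpha> \<alpha>"
    unfolding hom_PsNat using mod_id[OF B P Q a] by simp
qed

text \<open>
  The inverses of the components form a modification: the reindexing functors preserve inverses,
  so the defining square can be inverted.
\<close>

lemma mod_iso:
  assumes B: "is_category B" and P: "fibre_data B P" and Q: "fibre_data B Q"
    and G: "modification B P Q \<alpha> \<beta> \<Gamma>"
    and iso: "\<And>b x. b \<in> Obj B \<Longrightarrow> x \<in> Obj (PC P b) \<Longrightarrow> is_iso (PC Q b) (\<Gamma> b x)"
  shows "is_iso (PsNat B P Q) (\<alpha>, \<beta>, \<Gamma>)"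
proof -
  define I where "I = (\<lambda>b\<in>Obj B. \<lambda>x\<in>Obj (PC P b). cinv (PC Q b) (\<Gamma> b x))"
  have I: "modification B P Q \<beta> \<alpha> I"
    unfolding modification_def
  proof (intro conjI ballI)
    fix b assume b: "b \<in> Obj B"
    show "is_nat (PC P b) (PC Q b) (NC \<beta> b) (NC \<alpha> b) (I b)"
      using nat_cinv[OF fibre_cat[OF P b] fibre_cat[OF Q b], of "NC \<alpha> b" "NC \<beta> b" "\<Gamma> b"] mod_nat[OF G b] iso
          b
      by (auto simp: I_def is_natiso_def)
  next
    fix u x assume u: "u \<in> Arr B" and x: "x \<in> Obj (PC P (Cod B u))"
    note d = Dom_obj[OF B u] and c = Cod_obj[OF B u]
    note Fx = ftor_obj[OF fibre_ftor[OF P u] x]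
    note Qu = fibre_ftor[OF Q u] and Qd = fibre_cat[OF Q d] and Qc = fibre_cat[OF Q c]
    note g = mod_hom[OF G c x] and ig = iso[OF c x]
    note Fg = ftor_hom[OF Qu g] and iFg = ftor_iso[OF Qc Qu ig g]
    have ci: "farr (PF Q u) (cinv (PC Q (Cod B u)) (\<Gamma> (Cod B u) x)) =
        cinv (PC Q (Dom B u)) (farr (PF Q u) (\<Gamma> (Cod B u) x))"
      by (rule iso_cancel_left[OF Qd iFg Fg])
        (use cinv[OF ig g] cinv[OF iFg Fg] ftor_cmp[OF Qu cinv(1)[OF ig g] g]
          ftor_id[OF Qu hom_objs(2)[OF Qc g]] in \<open>auto intro: ftor_hom[OF Qu]\<close>)
    show "N2 \<alpha> u x \<odot>\<^bsub>PC Q (Dom B u)\<^esub> farr (PF Q u) (I (Cod B u) x) =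
          I (Dom B u) (fobj (PF P u) x) \<odot>\<^bsub>PC Q (Dom B u)\<^esub> N2 \<beta> u x"
      using square_cinv[OF Qd iFg Fg iso[OF d Fx] mod_hom[OF G d Fx] pnt_hom[OF mod_pnt(1)[OF G] u x]
          pnt_hom[OF mod_pnt(2)[OF G] u x] mod_comm[OF G u x, symmetric]] d c x Fx ci
      by (simp add: I_def)
  qed (use mod_pnt[OF G] in \<open>auto simp: I_def\<close>)
  note pn = mod_pnt[OF G]
  show ?thesis
  proof (rule isoI)
    show "(\<alpha>, \<beta>, \<Gamma>) \<in> hom (PsNat B P Q) \<alpha> \<beta>" "(\<beta>, \<alpha>, I) \<in> hom (PsNat B P Q) \<beta> \<alpha>"
      using G I by (auto simp: hom_PsNat)
    show "(\<beta>, \<alpha>, I) \<odot>\<^bsub>PsNat B P Q\<^esub> (\<alpha>, \<beta>, \<Gamma>) = Idt (PsNat B P Q) \<alpha>"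
      unfolding PsNat_sel prod.inject
      by (intro conjI refl mod_eqI[OF mod_cmp[OF B P Q G I] mod_id[OF B P Q pn(1)]])
         (simp add: I_def cinv[OF iso mod_hom[OF G]])
    show "(\<alpha>, \<beta>, \<Gamma>) \<odot>\<^bsub>PsNat B P Q\<^esub> (\<beta>, \<alpha>, I) = Idt (PsNat B P Q) \<beta>"
      unfolding PsNat_sel prod.inject
      by (intro conjI refl mod_eqI[OF mod_cmp[OF B P Q I G] mod_id[OF B P Q pn(2)]])
         (simp add: I_def cinv[OF iso mod_hom[OF G]])
  qed
qed

section \<open>Small sets\<close>

lemma small_image:
  fixes f :: "'u \<Rightarrow> 'u"
  shows "small_set A \<Longrightarrow> small_set (f ` A)"
  unfolding small_set_def by (rule lesspoll_trans1[OF image_lepoll])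

lemma small_subset: "small_set A \<Longrightarrow> S \<subseteq> A \<Longrightarrow> small_set S"
  unfolding small_set_def by (rule lesspoll_trans1[OF subset_imp_lepoll])

lemma small_UN:
  fixes I :: "'u set" and A :: "'u \<Rightarrow> 'u set"
  assumes "universe TYPE('u)" "small_set I" "\<And>i. i \<in> I \<Longrightarrow> small_set (A i)"
  shows "small_set (\<Union>i\<in>I. A i)"
  using assms unfolding universe_def by blast

definition enc :: "'u \<times> 'u \<Rightarrow> 'u" where
  "enc = (SOME e. inj e)"

lemma inj_enc:
  assumes "universe TYPE('u)"
  shows "inj (enc :: 'u \<times> 'u \<Rightarrow> 'u)"
proof -
  have "infinite (UNIV :: 'u set)" using assms by (simp add: universe_def)
  from card_of_Times_same_infinite[OF this] have "\<exists>e :: 'u \<times> 'u \<Rightarrow> 'u. inj e"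
    unfolding card_of_ordIso[symmetric] by (auto simp: bij_betw_def)
  then show ?thesis unfolding enc_def by (rule someI_ex)
qed

definition dec1 :: "'u \<Rightarrow> 'u" where "dec1 t = fst (inv enc t)"
definition dec2 :: "'u \<Rightarrow> 'u" where "dec2 t = snd (inv enc t)"

lemma dec_enc:
  fixes a b :: 'u
  assumes "universe TYPE('u)"
  shows "dec1 (enc (a, b)) = a" "dec2 (enc (a, b)) = b"
  using inj_enc[OF assms] by (auto simp: dec1_def dec2_def)

text \<open>
  Regularity speaks of unions only; coding pairs by single elements makes a disjoint union a union.
\<close>

lemma small_Sigma:
  fixes I :: "'u set"
  assumes U: "universe TYPE('u)" and I: "small_set I" and A: "\<And>i. i \<in> I \<Longrightarrow> small_set (A i)"
  shows "small_set {enc (i, a) |i a. i \<in> I \<and> a \<in> A i}"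
proof -
  have "{enc (i, a) |i a. i \<in> I \<and> a \<in> A i} = (\<Union>i\<in>I. (\<lambda>a. enc (i, a)) ` A i)" by auto
  then show ?thesis using small_UN[OF U I small_image[OF A]] by auto
qed

section \<open>Presheaves, elementwise\<close>

lemma opp_sel [simp]:
  "Obj (opp C) = Obj C" "Arr (opp C) = Arr C" "Dom (opp C) = Cod C" "Cod (opp C) = Dom C"
  "Idt (opp C) = Idt C" "g \<odot>\<^bsub>opp C\<^esub> f = f \<odot>\<^bsub>C\<^esub> g"
  by (auto simp: opp_def)

lemma hom_opp [simp]: "hom (opp C) x y = hom C y x"
  by (auto simp: hom_def)

lemma opp_category: "is_category C \<Longrightarrow> is_category (opp C)"
  unfolding is_category_def hom_opp by (auto simp: hom_def)

lemma functor_opp: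
  assumes "is_functor C D F"
  shows "is_functor (opp C) (opp D) F"
  using assms unfolding is_functor_def hom_opp by (auto simp: hom_def)

lemma set_cat_sel [simp]:
  "Obj set_cat = {A. small_set A}"
  "Dom set_cat (A, B, f) = A" "Cod set_cat (A, B, f) = B"
  "Idt set_cat A = (A, A, \<lambda>x\<in>A. x)"
  "(B', D, g) \<odot>\<^bsub>set_cat\<^esub> (A, B, f) = (A, D, compose A g f)"
  by (auto simp: set_cat_def)

lemma hom_set_cat: "hom set_cat A B = {(A, B, f) |f. small_set A \<and> small_set B \<and> f \<in> A \<rightarrow>\<^sub>E B}"
  by (auto simp: hom_def set_cat_def)

lemma Arr_set_cat: "Arr set_cat = {(A, B, f). small_set A \<and> small_set B \<and> f \<in> A \<rightarrow>\<^sub>E B}"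
  by (auto simp: set_cat_def)

lemma set_cat_category: "is_category set_cat"
proof -
  have mem: "(A', B', f) \<in> hom set_cat A B \<longleftrightarrow>
      A' = A \<and> B' = B \<and> small_set A \<and> small_set B \<and> f \<in> A \<rightarrow>\<^sub>E B" for A B A' B' f
    by (auto simp: hom_set_cat)
  show ?thesis
    unfolding is_category_def Arr_set_cat
    by (auto simp: mem compose_def PiE_iff) (auto simp: fun_eq_iff restrict_def extensional_def)
qed

lemma fun_cat_sel [simp]:
  "Obj (fun_cat C D) = {F. is_functor C D F}"
  "Arr (fun_cat C D) = {(F, G, \<tau>). is_nat C D F G \<tau>}"
  "Dom (fun_cat C D) (F, G, \<tau>) = F" "Cod (fun_cat C D) (F, G, \<tau>) = G"
  "Idt (fun_cat C D) F = (F, F, \<lambda>x\<in>Obj C. Idt D (fobj F x))"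
  "(G', H, \<sigma>) \<odot>\<^bsub>fun_cat C D\<^esub> (F, G, \<tau>) = (F, H, \<lambda>x\<in>Obj C. \<sigma> x \<odot>\<^bsub>D\<^esub> \<tau> x)"
  by (auto simp: fun_cat_def)

lemma hom_fun_cat: "hom (fun_cat C D) F G = {(F, G, \<tau>) |\<tau>. is_nat C D F G \<tau>}"
  by (auto simp: hom_def fun_cat_def)

lemma fun_cat_category:
  assumes C: "is_category C" and D: "is_category D"
  shows "is_category (fun_cat C D)"
  unfolding is_category_def
proof (intro conjI ballI impI)
  fix f assume "f \<in> Arr (fun_cat C D)"
  then obtain F G \<sigma> where f: "f = (F, G, \<sigma>)" and s: "is_nat C D F G \<sigma>" by auto
  note fs = nat_functors[OF s]
  show "Dom (fun_cat C D) f \<in> Obj (fun_cat C D)" "Cod (fun_cat C D) f \<in> Obj (fun_cat C D)"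
    using fs f by auto
  show "Idt (fun_cat C D) (Cod (fun_cat C D) f) \<odot>\<^bsub>fun_cat C D\<^esub> f = f"
    unfolding f fun_cat_sel prod.inject
    by (intro conjI refl nat_eqI[OF nat_vcomp[OF C D s nat_id[OF C D fs(2)]] s])
      (simp add: cmp_idl[OF D nat_hom[OF s]])
  show "f \<odot>\<^bsub>fun_cat C D\<^esub> Idt (fun_cat C D) (Dom (fun_cat C D) f) = f"
    unfolding f fun_cat_sel prod.inject
    by (intro conjI refl nat_eqI[OF nat_vcomp[OF C D nat_id[OF C D fs(1)] s] s])
      (simp add: cmp_idr[OF D nat_hom[OF s]])
  fix g assume "g \<in> Arr (fun_cat C D)" and "Dom (fun_cat C D) g = Cod (fun_cat C D) f"
  then obtain H \<tau> where g: "g = (G, H, \<tau>)" and t: "is_nat C D G H \<tau>" using f by auto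
  show "g \<odot>\<^bsub>fun_cat C D\<^esub> f \<in> hom (fun_cat C D) (Dom (fun_cat C D) f) (Cod (fun_cat C D) g)"
    unfolding f g fun_cat_sel hom_fun_cat using nat_vcomp[OF C D s t] by auto
  fix h assume "h \<in> Arr (fun_cat C D)" and "Dom (fun_cat C D) h = Cod (fun_cat C D) g"
  then obtain K \<rho> where h: "h = (H, K, \<rho>)" and r: "is_nat C D H K \<rho>" using g by auto
  show "h \<odot>\<^bsub>fun_cat C D\<^esub> (g \<odot>\<^bsub>fun_cat C D\<^esub> f) = h \<odot>\<^bsub>fun_cat C D\<^esub> g \<odot>\<^bsub>fun_cat C D\<^esub> f"
    unfolding f g h fun_cat_sel prod.inject
    by (intro conjI refl nat_eqI[OF nat_vcomp[OF C D nat_vcomp[OF C D s t] r]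
          nat_vcomp[OF C D s nat_vcomp[OF C D t r]]])
      (simp add: cmp_assoc[OF D nat_hom[OF s] nat_hom[OF t] nat_hom[OF r]])
next
  fix F assume "F \<in> Obj (fun_cat C D)"
  then show "Idt (fun_cat C D) F \<in> hom (fun_cat C D) F F"
    unfolding hom_fun_cat using nat_id[OF C D] by auto
qed

lemma PSh_category: "is_category C \<Longrightarrow> is_category (PSh C)"
  unfolding PSh_def by (rule fun_cat_category[OF opp_category set_cat_category])

lemma Obj_PSh: "P \<in> Obj (PSh C) \<longleftrightarrow> is_functor (opp C) set_cat P"
  by (simp add: PSh_def)

lemma hom_PSh: "hom (PSh C) P Q = {(P, Q, \<tau>) |\<tau>. is_nat (opp C) set_cat P Q \<tau>}"
  by (simp add: PSh_def hom_fun_cat)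

text \<open>
  \<open>act P a p\<close> is the restriction of the element \<open>p\<close> of \<open>P\<close> along the arrow \<open>a\<close>, and
  \<open>nap m x p\<close> is the value at stage \<open>x\<close> of the presheaf map \<open>m\<close> on \<open>p\<close>.  Both forget the domains and
  codomains that arrows carry along, so that equations between presheaf maps become equations
  between elements.
\<close>

lemma hom_PSh_triple: "m \<in> hom (PSh A) P Q \<Longrightarrow> m = (P, Q, snd (snd m))"
  by (auto simp: hom_PSh)

definition act :: "'u presheaf \<Rightarrow> 'u \<Rightarrow> 'u \<Rightarrow> 'u" where
  "act P a p = snd (snd (farr P a)) p"

definition nap :: "'u presheaf_arr \<Rightarrow> 'u \<Rightarrow> 'u \<Rightarrow> 'u" where
  "nap m x p = snd (snd (snd (snd m) x)) p"

lemma psh_small: "P \<in> Obj (PSh C) \<Longrightarrow> x \<in> Obj C \<Longrightarrow> small_set (fobj P x)"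
  using ftor_obj[of "opp C" set_cat P x] by (auto simp: Obj_PSh)

lemma psh_farr:
  assumes "P \<in> Obj (PSh C)" "a \<in> hom C x y"
  shows "farr P a = (fobj P y, fobj P x, \<lambda>p\<in>fobj P y. act P a p)"
  using ftor_hom[of "opp C" set_cat P a y x] assms
  by (auto simp: Obj_PSh hom_set_cat act_def restrict_PiE fun_eq_iff PiE_iff extensional_def)

lemma psh_act:
  assumes "P \<in> Obj (PSh C)" "a \<in> hom C x y" "p \<in> fobj P y"
  shows "act P a p \<in> fobj P x"
  using ftor_hom[of "opp C" set_cat P a y x] assms by (auto simp: Obj_PSh hom_set_cat act_def)

lemma psh_id:
  assumes "P \<in> Obj (PSh C)" "x \<in> Obj C" "p \<in> fobj P x"
  shows "act P (Idt C x) p = p"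
  using ftor_id[of "opp C" set_cat P x] assms by (simp add: Obj_PSh act_def)

lemma psh_cmp:
  assumes "P \<in> Obj (PSh C)" "a \<in> hom C x y" "b \<in> hom C y z" "p \<in> fobj P z"
  shows "act P (b \<odot>\<^bsub>C\<^esub> a) p = act P a (act P b p)"
proof -
  have "farr P (b \<odot>\<^bsub>C\<^esub> a) = farr P a \<odot>\<^bsub>set_cat\<^esub> farr P b"
    using ftor_cmp[of "opp C" set_cat P b z y a x] assms by (simp add: Obj_PSh)
  then show ?thesis
    using psh_farr[OF assms(1,2)] psh_farr[OF assms(1,3)] psh_act[OF assms(1,3,4)] assms(4)
    by (simp add: act_def[of P "b \<odot>\<^bsub>C\<^esub> a"] compose_def)
qed

text \<open>
  The presheaf with given stages and given restriction operation; \<open>mknt\<close> below does the same for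
  maps.  Extensionality and the domains and codomains of arrows are supplied here once and for all.
\<close>

definition mkpsh :: "('u, 'u) cat \<Rightarrow> ('u \<Rightarrow> 'u set) \<Rightarrow> ('u \<Rightarrow> 'u \<Rightarrow> 'u) \<Rightarrow> 'u presheaf" where
  "mkpsh C S A = \<lparr>fobj = (\<lambda>x\<in>Obj C. S x),
     farr = (\<lambda>a\<in>Arr C. (S (Cod C a), S (Dom C a), \<lambda>p\<in>S (Cod C a). A a p))\<rparr>"

lemma fobj_mkpsh [simp]: "x \<in> Obj C \<Longrightarrow> fobj (mkpsh C S A) x = S x"
  by (simp add: mkpsh_def)

lemma act_mkpsh [simp]: "a \<in> hom C x y \<Longrightarrow> p \<in> S y \<Longrightarrow> act (mkpsh C S A) a p = A a p"
  by (simp add: mkpsh_def act_def hom_def)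

lemma mkpsh_psh:
  assumes C: "is_category C" and S: "\<And>x. x \<in> Obj C \<Longrightarrow> small_set (S x)"
    and A: "\<And>a x y p. a \<in> hom C x y \<Longrightarrow> p \<in> S y \<Longrightarrow> A a p \<in> S x"
    and I: "\<And>x p. x \<in> Obj C \<Longrightarrow> p \<in> S x \<Longrightarrow> A (Idt C x) p = p"
    and M: "\<And>a b x y z p. a \<in> hom C x y \<Longrightarrow> b \<in> hom C y z \<Longrightarrow> p \<in> S z \<Longrightarrow> A (b \<odot>\<^bsub>C\<^esub> a) p = A a (A b p)"
  shows "mkpsh C S A \<in> Obj (PSh C)"
  unfolding Obj_PSh
proof (rule is_functorI[OF opp_category[OF C]])
  fix a x y assume "a \<in> hom (opp C) x y"
  then have a: "a \<in> hom C y x" by simp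
  note o = hom_objs[OF C a]
  show "farr (mkpsh C S A) a \<in> hom set_cat (fobj (mkpsh C S A) x) (fobj (mkpsh C S A) y)"
    using a o S A[OF a] by (auto simp: mkpsh_def hom_set_cat homD)
  fix b z assume "b \<in> hom (opp C) y z"
  then have b: "b \<in> hom C z y" by simp
  show "farr (mkpsh C S A) (b \<odot>\<^bsub>opp C\<^esub> a) = farr (mkpsh C S A) b \<odot>\<^bsub>set_cat\<^esub> farr (mkpsh C S A) a"
    using M[OF b a] A[OF a] a b cmp_hom[OF C b a] 
    by (auto simp: mkpsh_def homD compose_def fun_eq_iff restrict_def)
next
  fix x assume "x \<in> Obj (opp C)"
  then have x: "x \<in> Obj C" by simp
  show "farr (mkpsh C S A) (Idt (opp C) x) = Idt set_cat (fobj (mkpsh C S A) x)"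
    using x I[OF x] Idt_hom[OF C x] by (auto simp: mkpsh_def homD)
qed (use S in \<open>auto simp: mkpsh_def\<close>)

lemma hom_PSh_obj:
  assumes "is_category C" "m \<in> hom (PSh C) P Q"
  shows "P \<in> Obj (PSh C)" "Q \<in> Obj (PSh C)"
  using hom_objs[OF PSh_category[OF assms(1)] assms(2)] .

lemma nap_in:
  assumes "m \<in> hom (PSh C) P Q" "x \<in> Obj C" "p \<in> fobj P x"
  shows "nap m x p \<in> fobj Q x"
proof -
  obtain \<tau> where m: "m = (P, Q, \<tau>)" and t: "is_nat (opp C) set_cat P Q \<tau>"
    using assms(1) by (auto simp: hom_PSh)
  show ?thesis using nat_hom[OF t, of x] assms(2,3) by (auto simp: nap_def m hom_set_cat)
qed

lemma nap_comm:
  assumes C: "is_category C" and m: "m \<in> hom (PSh C) P Q" and a: "a \<in> hom C x y" and p: "p \<in> fobj P y"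
  shows "nap m x (act P a p) = act Q a (nap m y p)"
proof -
  obtain \<tau> where m': "m = (P, Q, \<tau>)" and t: "is_nat (opp C) set_cat P Q \<tau>"
    using m by (auto simp: hom_PSh)
  note o = hom_objs[OF C a] and PQ = hom_PSh_obj[OF C m]
  have *: "\<tau> z = (fobj P z, fobj Q z, snd (snd (\<tau> z)))" if "z \<in> Obj C" for z
    using nat_hom[OF t, of z] that by (auto simp: hom_set_cat)
  have "\<tau> x \<odot>\<^bsub>set_cat\<^esub> farr P a = farr Q a \<odot>\<^bsub>set_cat\<^esub> \<tau> y"
    using nat_comm[OF t, of a y x] a by simp
  then have "(fobj P y, fobj Q x, compose (fobj P y) (snd (snd (\<tau> x))) (\<lambda>p\<in>fobj P y. act P a p)) =
        (fobj P y, fobj Q x, compose (fobj P y) (\<lambda>p\<in>fobj Q y. act Q a p) (snd (snd (\<tau> y))))"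
    using psh_farr[OF PQ(1) a] psh_farr[OF PQ(2) a] *[OF o(1)] *[OF o(2)] by (metis set_cat_sel(5))
  then have "compose (fobj P y) (snd (snd (\<tau> x))) (\<lambda>p\<in>fobj P y. act P a p) p =
        compose (fobj P y) (\<lambda>p\<in>fobj Q y. act Q a p) (snd (snd (\<tau> y))) p" by simp
  then show ?thesis using p nap_in[OF m o(2) p] by (simp add: compose_def nap_def m')
qed

lemma nap_eqI:
  assumes m: "m \<in> hom (PSh C) P Q" and n: "n \<in> hom (PSh C) P Q"
    and eq: "\<And>x p. x \<in> Obj C \<Longrightarrow> p \<in> fobj P x \<Longrightarrow> nap m x p = nap n x p"
  shows "m = n"
proof -
  obtain \<sigma> \<tau> where m': "m = (P, Q, \<sigma>)" and s: "is_nat (opp C) set_cat P Q \<sigma>"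
    and n': "n = (P, Q, \<tau>)" and t: "is_nat (opp C) set_cat P Q \<tau>"
    using m n by (auto simp: hom_PSh)
  have "\<sigma> = \<tau>"
  proof (rule nat_eqI[OF s t])
    fix x assume "x \<in> Obj (opp C)"
    then have x: "x \<in> Obj C" by simp
    obtain f g where "\<sigma> x = (fobj P x, fobj Q x, f)" "f \<in> fobj P x \<rightarrow>\<^sub>E fobj Q x"
      "\<tau> x = (fobj P x, fobj Q x, g)" "g \<in> fobj P x \<rightarrow>\<^sub>E fobj Q x"
      using nat_hom[OF s, of x] nat_hom[OF t, of x] x by (auto simp: hom_set_cat)
    then show "\<sigma> x = \<tau> x" using eq[OF x] by (auto simp: nap_def m' n' intro: PiE_ext)
  qed
  then show ?thesis using m' n' by simp
qed

definition mknt :: "('u, 'u) cat \<Rightarrow> 'u presheaf \<Rightarrow> 'u presheaf \<Rightarrow> ('u \<Rightarrow> 'u \<Rightarrow> 'u) \<Rightarrow> 'u presheaf_arr" where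
  "mknt C P Q t = (P, Q, \<lambda>x\<in>Obj C. (fobj P x, fobj Q x, \<lambda>p\<in>fobj P x. t x p))"

lemma nap_mknt [simp]: "x \<in> Obj C \<Longrightarrow> p \<in> fobj P x \<Longrightarrow> nap (mknt C P Q t) x p = t x p"
  by (simp add: mknt_def nap_def)

lemma mknt_hom:
  assumes C: "is_category C" and P: "P \<in> Obj (PSh C)" and Q: "Q \<in> Obj (PSh C)"
    and t: "\<And>x p. x \<in> Obj C \<Longrightarrow> p \<in> fobj P x \<Longrightarrow> t x p \<in> fobj Q x"
    and n: "\<And>a x y p. a \<in> hom C x y \<Longrightarrow> p \<in> fobj P y \<Longrightarrow> t x (act P a p) = act Q a (t y p)"
  shows "mknt C P Q t \<in> hom (PSh C) P Q"
proof -
  have "is_nat (opp C) set_cat P Q (\<lambda>x\<in>Obj C. (fobj P x, fobj Q x, \<lambda>p\<in>fobj P x. t x p))"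
  proof (rule is_natI[OF opp_category[OF C]])
    fix a x y assume "x \<in> Obj (opp C)" "y \<in> Obj (opp C)" "a \<in> hom (opp C) x y"
    then have x: "x \<in> Obj C" and y: "y \<in> Obj C" and a: "a \<in> hom C y x" by auto
    have "compose (fobj P x) (\<lambda>p\<in>fobj P y. t y p) (\<lambda>p\<in>fobj P x. act P a p) =
      compose (fobj P x) (\<lambda>p\<in>fobj Q x. act Q a p) (\<lambda>p\<in>fobj P x. t x p)"
      unfolding compose_def by (rule restrict_ext) (use n[OF a] t[OF x] psh_act[OF P a] in auto)
    then show "(\<lambda>x\<in>Obj C. (fobj P x, fobj Q x, \<lambda>p\<in>fobj P x. t x p)) y \<odot>\<^bsub>set_cat\<^esub> farr P a =
          farr Q a \<odot>\<^bsub>set_cat\<^esub> (\<lambda>x\<in>Obj C. (fobj P x, fobj Q x, \<lambda>p\<in>fobj P x. t x p)) x"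
      using x y psh_farr[OF P a] psh_farr[OF Q a] by simp
  qed (use P Q t psh_small[OF P] psh_small[OF Q] in \<open>auto simp: Obj_PSh hom_set_cat\<close>)
  then show ?thesis by (simp add: hom_PSh mknt_def)
qed

lemma nap_cmp:
  assumes m: "m \<in> hom (PSh C) P Q" and n: "n \<in> hom (PSh C) Q R" and x: "x \<in> Obj C" and p: "p \<in> fobj P x"
  shows "nap (n \<odot>\<^bsub>PSh C\<^esub> m) x p = nap n x (nap m x p)"
proof -
  obtain \<sigma> \<tau> where m': "m = (P, Q, \<sigma>)" and s: "is_nat (opp C) set_cat P Q \<sigma>"
    and n': "n = (Q, R, \<tau>)" and t: "is_nat (opp C) set_cat Q R \<tau>"
    using m n by (auto simp: hom_PSh)
  obtain f g where "\<sigma> x = (fobj P x, fobj Q x, f)" "\<tau> x = (fobj Q x, fobj R x, g)"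
    using nat_hom[OF s, of x] nat_hom[OF t, of x] x by (auto simp: hom_set_cat)
  then show ?thesis using x p by (simp add: m' n' PSh_def nap_def compose_def)
qed

lemma nap_Idt: "x \<in> Obj C \<Longrightarrow> p \<in> fobj P x \<Longrightarrow> nap (Idt (PSh C) P) x p = p"
  by (simp add: PSh_def nap_def)

section \<open>The Yoneda lemma\<close>

lemma hom_psh_eq: "hom_psh C e = mkpsh C (\<lambda>x. hom C x e) (\<lambda>a g. g \<odot>\<^bsub>C\<^esub> a)"
  by (simp add: hom_psh_def mkpsh_def)

lemma fobj_hom_psh [simp]: "x \<in> Obj C \<Longrightarrow> fobj (hom_psh C e) x = hom C x e"
  by (simp add: hom_psh_eq)

lemma act_hom_psh [simp]: "a \<in> hom C x y \<Longrightarrow> g \<in> hom C y e \<Longrightarrow> act (hom_psh C e) a g = g \<odot>\<^bsub>C\<^esub> a"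
  by (simp add: hom_psh_eq)

lemma hom_psh_psh:
  assumes "small_category C"
  shows "hom_psh C e \<in> Obj (PSh C)"
proof -
  have C: "is_category C" and s: "small_set (Arr C)" using assms by (auto simp: small_category_def)
  show ?thesis
    unfolding hom_psh_eq
    by (rule mkpsh_psh[OF C])
      (auto simp: cmp_idr[OF C] cmp_assoc[OF C] homD intro: small_subset[OF s] cmp_hom[OF C])
qed

lemma fobj_yoneda [simp]: "e \<in> Obj C \<Longrightarrow> fobj (yoneda C) e = hom_psh C e"
  by (simp add: yoneda_def)

lemma farr_yoneda:
  assumes "is_category C" "h \<in> hom C e e'"
  shows "farr (yoneda C) h = mknt C (hom_psh C e) (hom_psh C e') (\<lambda>x g. h \<odot>\<^bsub>C\<^esub> g)"
  using homD[OF assms(2)] by (simp add: yoneda_def mknt_def cong: restrict_cong)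

lemma nap_yoneda [simp]:
  assumes "is_category C" "h \<in> hom C e e'" "g \<in> hom C x e"
  shows "nap (farr (yoneda C) h) x g = h \<odot>\<^bsub>C\<^esub> g"
  using farr_yoneda[OF assms(1,2)] hom_objs[OF assms(1,3)] assms(3) by simp

lemma yoneda_functor:
  assumes "small_category C"
  shows "is_functor C (PSh C) (yoneda C)"
proof -
  have C: "is_category C" using assms by (auto simp: small_category_def)
  note P = hom_psh_psh[OF assms] and PC = PSh_category[OF C]
  have h: "farr (yoneda C) f \<in> hom (PSh C) (hom_psh C x) (hom_psh C y)" if f: "f \<in> hom C x y" for f x y
    unfolding farr_yoneda[OF C f]
  proof (rule mknt_hom[OF C P P])
    fix a z w g assume a: "a \<in> hom C z w" and "g \<in> fobj (hom_psh C x) w"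
    then have g: "g \<in> hom C w x" using hom_objs[OF C a] by simp
    show "f \<odot>\<^bsub>C\<^esub> act (hom_psh C x) a g = act (hom_psh C y) a (f \<odot>\<^bsub>C\<^esub> g)"
      using cmp_assoc[OF C a g f] a g cmp_hom[OF C g f] by simp
  qed (use f in \<open>auto intro: cmp_hom[OF C]\<close>)
  show ?thesis
  proof (rule is_functorI[OF C])
    fix f x y assume f: "f \<in> hom C x y"
    show "farr (yoneda C) f \<in> hom (PSh C) (fobj (yoneda C) x) (fobj (yoneda C) y)"
      using h[OF f] hom_objs[OF C f] by simp
    fix g z assume g: "g \<in> hom C y z"
    note gf = cmp_hom[OF C f g]
    show "farr (yoneda C) (g \<odot>\<^bsub>C\<^esub> f) = farr (yoneda C) g \<odot>\<^bsub>PSh C\<^esub> farr (yoneda C) f"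
    proof (rule nap_eqI[OF h[OF gf] cmp_hom[OF PC h[OF f] h[OF g]]])
      fix w k assume w: "w \<in> Obj C" and k': "k \<in> fobj (hom_psh C x) w"
      then have k: "k \<in> hom C w x" by simp
      show "nap (farr (yoneda C) (g \<odot>\<^bsub>C\<^esub> f)) w k = nap (farr (yoneda C) g \<odot>\<^bsub>PSh C\<^esub> farr (yoneda C) f) w k"
        using nap_cmp[OF h[OF f] h[OF g] w k'] nap_yoneda[OF C gf k] nap_yoneda[OF C f k]
          nap_yoneda[OF C g cmp_hom[OF C k f]] cmp_assoc[OF C k f g] by simp
    qed
  next
    fix x assume x: "x \<in> Obj C"
    note i = Idt_hom[OF C x]
    have "farr (yoneda C) (Idt C x) = Idt (PSh C) (hom_psh C x)"
      by (rule nap_eqI[OF h[OF i] Idt_hom[OF PC P]])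
         (auto simp: nap_Idt nap_yoneda[OF C i] cmp_idl[OF C])
    then show "farr (yoneda C) (Idt C x) = Idt (PSh C) (fobj (yoneda C) x)" using x by simp
  qed (use P in \<open>auto simp: yoneda_def\<close>)
qed

text \<open>
  The map from a representable that corresponds to an element under the Yoneda lemma.
\<close>

definition yelt :: "('u, 'u) cat \<Rightarrow> 'u presheaf \<Rightarrow> 'u \<Rightarrow> 'u \<Rightarrow> 'u presheaf_arr" where
  "yelt C P x p = mknt C (hom_psh C x) P (\<lambda>z g. act P g p)"

lemma nap_yelt [simp]:
  "is_category C \<Longrightarrow> g \<in> hom C z x \<Longrightarrow> nap (yelt C P x p) z g = act P g p"
  unfolding yelt_def by (rule nap_mknt) (auto simp: hom_objs)

lemma yelt_hom:
  assumes sC: "small_category C" and P: "P \<in> Obj (PSh C)" and x: "x \<in> Obj C" and p: "p \<in> fobj P x"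
  shows "yelt C P x p \<in> hom (PSh C) (hom_psh C x) P"
proof -
  have C: "is_category C" using sC by (auto simp: small_category_def)
  show ?thesis
    unfolding yelt_def
    by (rule mknt_hom[OF C hom_psh_psh[OF sC] P])
      (auto simp: hom_objs[OF C] psh_cmp[OF P _ _ p] intro: psh_act[OF P _ p])
qed

text \<open>
  Every arrow \<open>g\<close> into \<open>x\<close> is the restriction along \<open>g\<close> of the identity of \<open>x\<close>.
\<close>

lemma hom_psh_eqI:
  assumes sC: "small_category C" and x: "x \<in> Obj C"
    and m: "m \<in> hom (PSh C) (hom_psh C x) P" and n: "n \<in> hom (PSh C) (hom_psh C x) P"
    and eq: "nap m x (Idt C x) = nap n x (Idt C x)"
  shows "m = n"
proof (rule nap_eqI[OF m n])
  have C: "is_category C" using sC by (auto simp: small_category_def)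
  note i = Idt_hom[OF C x]
  fix z g assume z: "z \<in> Obj C" and "g \<in> fobj (hom_psh C x) z"
  then have g: "g \<in> hom C z x" by simp
  have g': "act (hom_psh C x) g (Idt C x) = g" using g i cmp_idl[OF C g] by simp
  show "nap m z g = nap n z g"
    using nap_comm[OF C m g, of "Idt C x"] nap_comm[OF C n g, of "Idt C x"] g' eq i x by simp
qed

section \<open>Colimits weighted by a presheaf\<close>

text \<open>
  A \<open>P\<close>-weighted cocone under \<open>f\<close> with vertex \<open>d\<close> is a natural family of maps
  \<open>P x \<rightarrow> D(f x, d)\<close>.  It is the same as a cocone on the composite of \<open>f\<close> with the projection from the
  category of elements of \<open>P\<close>, but it avoids coded pairs.
\<close>

definition weighted_cocone ::
  "('u, 'u) cat \<Rightarrow> ('o, 'm) cat \<Rightarrow> ('u, 'u, 'o, 'm) ftor \<Rightarrow> 'u presheaf \<Rightarrow> 'o \<Rightarrow> ('u \<Rightarrow> 'u \<Rightarrow> 'm) \<Rightarrow> bool" where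
  "weighted_cocone C D f P d k \<longleftrightarrow> d \<in> Obj D \<and>
     (\<forall>x\<in>Obj C. \<forall>p\<in>fobj P x. k x p \<in> hom D (fobj f x) d) \<and>
     (\<forall>x y. \<forall>a\<in>hom C x y. \<forall>p\<in>fobj P y. k y p \<odot>\<^bsub>D\<^esub> farr f a = k x (act P a p))"

definition weighted_colimit ::
  "('u, 'u) cat \<Rightarrow> ('o, 'm) cat \<Rightarrow> ('u, 'u, 'o, 'm) ftor \<Rightarrow> 'u presheaf \<Rightarrow> 'o \<Rightarrow> ('u \<Rightarrow> 'u \<Rightarrow> 'm) \<Rightarrow> bool" where
  "weighted_colimit C D f P d k \<longleftrightarrow> weighted_cocone C D f P d k \<and>
     (\<forall>e l. weighted_cocone C D f P e l \<longrightarrow>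
        (\<exists>!h. h \<in> hom D d e \<and> (\<forall>x\<in>Obj C. \<forall>p\<in>fobj P x. h \<odot>\<^bsub>D\<^esub> k x p = l x p)))"

lemma weighted_cocone_hom:
  "weighted_cocone C D f P d k \<Longrightarrow> x \<in> Obj C \<Longrightarrow> p \<in> fobj P x \<Longrightarrow> k x p \<in> hom D (fobj f x) d"
  by (auto simp: weighted_cocone_def)

lemma weighted_cocone_comm:
  "weighted_cocone C D f P d k \<Longrightarrow> a \<in> hom C x y \<Longrightarrow> p \<in> fobj P y \<Longrightarrow> k y p \<odot>\<^bsub>D\<^esub> farr f a = k x (act P a p)"
  by (auto simp: weighted_cocone_def)

lemma weighted_colimit_cocone: "weighted_colimit C D f P d k \<Longrightarrow> weighted_cocone C D f P d k"
  by (auto simp: weighted_colimit_def)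

lemma weighted_colimit_ex:
  assumes "weighted_colimit C D f P d k" "weighted_cocone C D f P e l"
  obtains h where "h \<in> hom D d e" "\<And>x p. x \<in> Obj C \<Longrightarrow> p \<in> fobj P x \<Longrightarrow> h \<odot>\<^bsub>D\<^esub> k x p = l x p"
  using assms unfolding weighted_colimit_def by metis

lemma weighted_cocone_post:
  assumes D: "is_category D" and f: "is_functor C D f" and C: "is_category C" and P: "P \<in> Obj (PSh C)"
    and k: "weighted_cocone C D f P d k" and g: "g \<in> hom D d e"
  shows "weighted_cocone C D f P e (\<lambda>x p. g \<odot>\<^bsub>D\<^esub> k x p)"
  unfolding weighted_cocone_def
proof (intro conjI ballI allI)
  fix x y a p assume a: "a \<in> hom C x y" and p: "p \<in> fobj P y"
  show "g \<odot>\<^bsub>D\<^esub> k y p \<odot>\<^bsub>D\<^esub> farr f a = g \<odot>\<^bsub>D\<^esub> k x (act P a p)"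
    using cmp_assoc[OF D ftor_hom[OF f a] weighted_cocone_hom[OF k hom_objs(2)[OF C a] p] g]
      weighted_cocone_comm[OF k a p] by simp
qed (use hom_objs[OF D g] cmp_hom[OF D weighted_cocone_hom[OF k] g] in auto)

lemma weighted_colimit_eqI:
  assumes D: "is_category D" and f: "is_functor C D f" and C: "is_category C" and P: "P \<in> Obj (PSh C)"
    and k: "weighted_colimit C D f P d k" and g: "g \<in> hom D d e" and h: "h \<in> hom D d e"
    and eq: "\<And>x p. x \<in> Obj C \<Longrightarrow> p \<in> fobj P x \<Longrightarrow> g \<odot>\<^bsub>D\<^esub> k x p = h \<odot>\<^bsub>D\<^esub> k x p"
  shows "g = h"
proof -
  have "\<exists>!j. j \<in> hom D d e \<and> (\<forall>x\<in>Obj C. \<forall>p\<in>fobj P x. j \<odot>\<^bsub>D\<^esub> k x p = g \<odot>\<^bsub>D\<^esub> k x p)"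
    using k weighted_cocone_post[OF D f C P weighted_colimit_cocone[OF k] g]
    unfolding weighted_colimit_def by blast
  then show ?thesis using g h eq by metis
qed

subsection \<open>The category of elements\<close>

text \<open>
  An object is a pair of \<open>x\<close> and an element of \<open>P x\<close>; an arrow is a pair of \<open>a\<close> and an element \<open>p\<close>
  over the codomain of \<open>a\<close>, and its domain carries the restriction of \<open>p\<close>.  Pairs are coded because
  cocompleteness is a statement about diagrams whose index category lives on the universe type.
\<close>

definition elements :: "('u, 'u) cat \<Rightarrow> 'u presheaf \<Rightarrow> ('u, 'u) cat" where
  "elements C P = \<lparr>
     Obj = {enc (x, p) |x p. x \<in> Obj C \<and> p \<in> fobj P x},
     Arr = {enc (a, p) |a p. a \<in> Arr C \<and> p \<in> fobj P (Cod C a)},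
     Dom = (\<lambda>t. enc (Dom C (dec1 t), act P (dec1 t) (dec2 t))),
     Cod = (\<lambda>t. enc (Cod C (dec1 t), dec2 t)),
     Idt = (\<lambda>t. enc (Idt C (dec1 t), dec2 t)),
     Cmp = (\<lambda>s t. enc (dec1 s \<odot>\<^bsub>C\<^esub> dec1 t, dec2 s))\<rparr>"

definition elements_proj :: "('u, 'u) cat \<Rightarrow> 'u presheaf \<Rightarrow> ('u, 'u, 'u, 'u) ftor" where
  "elements_proj C P = \<lparr>fobj = (\<lambda>t\<in>Obj (elements C P). dec1 t), farr = (\<lambda>t\<in>Arr (elements C P). dec1 t)\<rparr>"

context
  fixes C :: "('u, 'u) cat" and P :: "'u presheaf"
  assumes U: "universe TYPE('u)" and sC: "small_category C" and P: "P \<in> Obj (PSh C)"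
begin

lemma enc_eq_iff: "enc (a, b) = enc (a', b') \<longleftrightarrow> a = a' \<and> b = (b' :: 'u)"
  using inj_enc[OF U] by (auto dest: injD)

lemma elements_small: "small_category (elements C P)"
proof -
  have C: "is_category C" and sO: "small_set (Obj C)" and sA: "small_set (Arr C)"
    using sC by (auto simp: small_category_def)
  note dec = dec_enc[OF U]
  have "small_set {enc (x, p) |x p. x \<in> Obj C \<and> p \<in> fobj P x}"
    by (rule small_Sigma[OF U sO psh_small[OF P]])
  moreover have "small_set {enc (a, p) |a p. a \<in> Arr C \<and> p \<in> fobj P (Cod C a)}"
    by (rule small_Sigma[OF U sA psh_small[OF P Cod_obj[OF C]]])
  moreover have "is_category (elements C P)"
  proof -
    have hE: "enc (a, p) \<in> hom (elements C P) (enc (x, q)) (enc (y, r)) \<longleftrightarrow>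
        a \<in> hom C x y \<and> p \<in> fobj P y \<and> q = act P a p \<and> r = p" for a p x q y r
      by (auto simp: hom_def elements_def enc_eq_iff dec)
    have aE: "a \<in> hom C (Dom C a) (Cod C a)" if "a \<in> Arr C" for a using that by (simp add: hom_def)
    show ?thesis
      unfolding is_category_def
    proof (intro conjI ballI impI)
      fix s assume "s \<in> Arr (elements C P)"
      then obtain a p where s: "s = enc (a, p)" and aA: "a \<in> Arr C" and p: "p \<in> fobj P (Cod C a)"
        by (auto simp: elements_def)
      note a = aE[OF aA]
      have ds: "Dom (elements C P) s = enc (Dom C a, act P a p)"
          and cs: "Cod (elements C P) s = enc (Cod C a, p)"
        by (auto simp: s elements_def dec)
      show "Dom (elements C P) s \<in> Obj (elements C P)" "Cod (elements C P) s \<in> Obj (elements C P)"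
        unfolding ds cs using hom_objs[OF C a] psh_act[OF P a p] p by (auto simp: elements_def)
      show "Idt (elements C P) (Cod (elements C P) s) \<odot>\<^bsub>elements C P\<^esub> s = s"
        "s \<odot>\<^bsub>elements C P\<^esub> Idt (elements C P) (Dom (elements C P) s) = s"
        unfolding ds cs using cmp_idl[OF C a] cmp_idr[OF C a] by (auto simp: s elements_def dec)
      fix t assume "t \<in> Arr (elements C P)" and ts: "Dom (elements C P) t = Cod (elements C P) s"
      then obtain b q where t: "t = enc (b, q)" and bA: "b \<in> Arr C" and q: "q \<in> fobj P (Cod C b)"
        by (auto simp: elements_def)
      note b' = aE[OF bA]
      have bq: "Dom C b = Cod C a" "act P b q = p" using ts unfolding cs
          by (auto simp: t elements_def dec enc_eq_iff)
      have b: "b \<in> hom C (Cod C a) (Cod C b)" using b' bq by simp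
      have ct: "Cod (elements C P) t = enc (Cod C b, q)" by (auto simp: t elements_def dec)
      have st: "t \<odot>\<^bsub>elements C P\<^esub> s = enc (b \<odot>\<^bsub>C\<^esub> a, q)" by (auto simp: s t elements_def dec)
      show "t \<odot>\<^bsub>elements C P\<^esub> s \<in> hom (elements C P) (Dom (elements C P) s) (Cod (elements C P) t)"
        unfolding ds ct st hE using cmp_hom[OF C a b] q psh_cmp[OF P a b q] bq by simp
      fix r assume "r \<in> Arr (elements C P)" and rt: "Dom (elements C P) r = Cod (elements C P) t"
      then obtain c w where r: "r = enc (c, w)" and cA: "c \<in> Arr C"
        by (auto simp: elements_def)
      have "Dom C c = Cod C b" using rt unfolding ct by (auto simp: r elements_def dec enc_eq_iff)
      then have c: "c \<in> hom C (Cod C b) (Cod C c)" using aE[OF cA] by simp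
      show "r \<odot>\<^bsub>elements C P\<^esub> (t \<odot>\<^bsub>elements C P\<^esub> s) = r \<odot>\<^bsub>elements C P\<^esub> t \<odot>\<^bsub>elements C P\<^esub> s"
        using cmp_assoc[OF C a b c] by (simp add: r s t elements_def dec)
    next
      fix s assume "s \<in> Obj (elements C P)"
      then obtain x p where s: "s = enc (x, p)" and x: "x \<in> Obj C" and p: "p \<in> fobj P x"
        by (auto simp: elements_def)
      have "Idt (elements C P) s = enc (Idt C x, p)" by (auto simp: s elements_def dec)
      then show "Idt (elements C P) s \<in> hom (elements C P) s s"
        using hE Idt_hom[OF C x] psh_id[OF P x p] p s by simp
    qed
  qed
  ultimately show ?thesis by (simp add: small_category_def elements_def)
qed

lemma elements_proj_functor: "is_functor (elements C P) C (elements_proj C P)"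
proof -
  have C: "is_category C" using sC by (auto simp: small_category_def)
  have E: "is_category (elements C P)" using elements_small by (simp add: small_category_def)
  note dec = dec_enc[OF U]
  show ?thesis
  proof (rule is_functorI[OF E])
    fix t assume t: "t \<in> Obj (elements C P)"
    then show "farr (elements_proj C P) (Idt (elements C P) t) = Idt C (fobj (elements_proj C P) t)"
      using homD(1)[OF Idt_hom[OF E t]]
      by (auto simp: elements_proj_def restrict_def) (auto simp: elements_def dec)
    show "fobj (elements_proj C P) t \<in> Obj C"
      using t by (auto simp: elements_proj_def elements_def dec)
  next
    fix s a b assume s: "s \<in> hom (elements C P) a b"
    show "farr (elements_proj C P) s \<in> hom C (fobj (elements_proj C P) a) (fobj (elements_proj C P) b)"
      using homD[OF s] hom_objs[OF E s]
      by (auto simp: elements_proj_def) (auto simp: elements_def dec hom_def)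
    fix t c assume t: "t \<in> hom (elements C P) b c"
    show "farr (elements_proj C P) (t \<odot>\<^bsub>elements C P\<^esub> s) =
        farr (elements_proj C P) t \<odot>\<^bsub>C\<^esub> farr (elements_proj C P) s"
      using homD(1)[OF s] homD(1)[OF t] homD(1)[OF cmp_hom[OF E s t]]
      by (auto simp: elements_proj_def) (auto simp: elements_def dec)
  qed (auto simp: elements_proj_def)
qed

lemma cocone_elements:
  "is_cocone (elements C P) D (comp_ftor (elements C P) f (elements_proj C P)) d \<iota> \<longleftrightarrow>
   weighted_cocone C D f P d (\<lambda>x p. \<iota> (enc (x, p)))"
  (is "?L \<longleftrightarrow> ?R")
proof -
  note dec = dec_enc[OF U]
  have C: "is_category C" using sC by (auto simp: small_category_def)
  have O: "t \<in> Obj (elements C P) \<longleftrightarrow> (\<exists>x p. t = enc (x, p) \<and> x \<in> Obj C \<and> p \<in> fobj P x)" for t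
    by (auto simp: elements_def)
  have A: "t \<in> Arr (elements C P) \<longleftrightarrow> (\<exists>a p. t = enc (a, p) \<and> a \<in> Arr C \<and> p \<in> fobj P (Cod C a))" for t
    by (auto simp: elements_def)
  have fo: "fobj (elements_proj C P) (enc (x, p)) = x" if "x \<in> Obj C" "p \<in> fobj P x" for x p
    using that O by (auto simp: elements_proj_def dec)
  have fa: "farr (elements_proj C P) (enc (a, p)) = a" if "a \<in> Arr C" "p \<in> fobj P (Cod C a)" for a p
    using that A by (auto simp: elements_proj_def dec)
  have "(\<forall>t\<in>Obj (elements C P). \<iota> t \<in> hom D (fobj (comp_ftor (elements C P) f (elements_proj C P)) t) d) \<longleftrightarrow>
        (\<forall>x\<in>Obj C. \<forall>p\<in>fobj P x. \<iota> (enc (x, p)) \<in> hom D (fobj f x) d)"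
  proof -
    have *: "\<iota> (enc (x, p)) \<in> hom D (fobj (comp_ftor (elements C P) f (elements_proj C P)) (enc (x, p))) d \<longleftrightarrow>
        \<iota> (enc (x, p)) \<in> hom D (fobj f x) d" if "x \<in> Obj C" "p \<in> fobj P x" for x p
    proof -
      have "enc (x, p) \<in> Obj (elements C P)" using O that by blast
      then show ?thesis using fo[OF that] by simp
    qed
    show ?thesis using O * by metis
  qed
  moreover have "(\<forall>a\<in>Arr (elements C P). \<iota> (Cod (elements C P) a) \<odot>\<^bsub>D\<^esub>
            farr (comp_ftor (elements C P) f (elements_proj C P)) a = \<iota> (Dom (elements C P) a)) \<longleftrightarrow>
        (\<forall>a\<in>Arr C. \<forall>p\<in>fobj P (Cod C a). \<iota> (enc (Cod C a, p)) \<odot>\<^bsub>D\<^esub> farr f a = \<iota> (enc (Dom C a, act P a p)))"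
    (is "?l \<longleftrightarrow> ?r")
  proof -
    have *: "\<iota> (Cod (elements C P) (enc (a, p))) \<odot>\<^bsub>D\<^esub>
            farr (comp_ftor (elements C P) f (elements_proj C P)) (enc (a, p))
                = \<iota> (Dom (elements C P) (enc (a, p)))
         \<longleftrightarrow> \<iota> (enc (Cod C a, p)) \<odot>\<^bsub>D\<^esub> farr f a = \<iota> (enc (Dom C a, act P a p))"
      if "a \<in> Arr C" "p \<in> fobj P (Cod C a)" for a p
    proof -
      have "enc (a, p) \<in> Arr (elements C P)" using A that by blast
      then have "farr (comp_ftor (elements C P) f (elements_proj C P)) (enc (a, p)) = farr f a"
        using fa[OF that] by simp
      then show ?thesis by (simp add: elements_def dec)
    qed
    show ?thesis using A * by metis
  qed
  moreover have "\<dots> \<longleftrightarrow> (\<forall>x y. \<forall>a\<in>hom C x y. \<forall>p\<in>fobj P y.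
      \<iota> (enc (y, p)) \<odot>\<^bsub>D\<^esub> farr f a = \<iota> (enc (x, act P a p)))"
    by (auto simp: hom_def)
  ultimately show ?thesis unfolding is_cocone_def weighted_cocone_def by blast
qed

text \<open>
  Every family indexed by coded pairs is a family in two variables and conversely, so the two
  universal properties quantify over the same cocones.
\<close>

lemma colimit_elements:
  fixes D :: "('o, 'm) cat"
  shows "is_colimit (elements C P) D (comp_ftor (elements C P) f (elements_proj C P)) d \<iota> \<longleftrightarrow>
   weighted_colimit C D f P d (\<lambda>x p. \<iota> (enc (x, p)))"
proof -
  note dec = dec_enc[OF U]
  have O: "(\<forall>t\<in>Obj (elements C P). \<phi> t) \<longleftrightarrow> (\<forall>x\<in>Obj C. \<forall>p\<in>fobj P x. \<phi> (enc (x, p)))" for \<phi>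
    by (auto simp: elements_def)
  have surj: "(\<forall>\<kappa> :: 'u \<Rightarrow> 'm. \<Phi> (\<lambda>x p. \<kappa> (enc (x, p)))) \<longleftrightarrow> (\<forall>k :: 'u \<Rightarrow> 'u \<Rightarrow> 'm. \<Phi> k)" for \<Phi>
  proof safe
    fix k :: "'u \<Rightarrow> 'u \<Rightarrow> 'm" assume a: "\<forall>\<kappa>. \<Phi> (\<lambda>x p. \<kappa> (enc (x, p)))"
    show "\<Phi> k" using a[rule_format, of "\<lambda>t. k (dec1 t) (dec2 t)"] by (simp add: dec)
  qed auto
  show ?thesis unfolding is_colimit_def weighted_colimit_def cocone_elements O
    by (subst surj[symmetric]) simp
qed

lemma cocomplete_weighted_colimit:
  assumes "cocomplete TYPE('u) D" "is_functor C D f"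
  shows "\<exists>d k. weighted_colimit C D f P d k"
proof -
  have "is_functor (elements C P) D (comp_ftor (elements C P) f (elements_proj C P))"
    using comp_ftor_functor[OF _ elements_proj_functor assms(2)] elements_small
    by (simp add: small_category_def)
  then show ?thesis using assms(1) elements_small colimit_elements unfolding cocomplete_def by metis
qed

end

subsection \<open>Density of the representables\<close>

lemma nat_yelt:
  assumes sC: "small_category C" and m: "m \<in> hom (PSh C) P Q" and x: "x \<in> Obj C" and p: "p \<in> fobj P x"
  shows "m \<odot>\<^bsub>PSh C\<^esub> yelt C P x p = yelt C Q x (nap m x p)"
proof -
  have C: "is_category C" using sC by (auto simp: small_category_def)
  note PQ = hom_PSh_obj[OF C m]
  note h = yelt_hom[OF sC PQ(1) x p] and h' = yelt_hom[OF sC PQ(2) x nap_in[OF m x p]]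
  show ?thesis
    by (rule nap_eqI[OF cmp_hom[OF PSh_category[OF C] h m] h'])
      (auto simp: nap_cmp[OF h m] C nap_comm[OF C m _ p])
qed

lemma yelt_Idt:
  assumes sC: "small_category C" and x: "x \<in> Obj C"
  shows "yelt C (hom_psh C x) x (Idt C x) = Idt (PSh C) (hom_psh C x)"
proof -
  have C: "is_category C" using sC by (auto simp: small_category_def)
  note P = hom_psh_psh[OF sC]
  show ?thesis
    by (rule nap_eqI[OF yelt_hom[OF sC P x] Idt_hom[OF PSh_category[OF C] P]])
      (auto simp: nap_Idt C x Idt_hom[OF C x] act_hom_psh[OF _ Idt_hom[OF C x]] cmp_idl[OF C])
qed

lemma yelt_yoneda:
  assumes sC: "small_category C" and P: "P \<in> Obj (PSh C)" and a: "a \<in> hom C x y" and p: "p \<in> fobj P y"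
  shows "yelt C P y p \<odot>\<^bsub>PSh C\<^esub> farr (yoneda C) a = yelt C P x (act P a p)"
proof -
  have C: "is_category C" using sC by (auto simp: small_category_def)
  note o = hom_objs[OF C a]
  have ya: "farr (yoneda C) a \<in> hom (PSh C) (hom_psh C x) (hom_psh C y)"
    using ftor_hom[OF yoneda_functor[OF sC] a] o by simp
  note h = yelt_hom[OF sC P o(2) p]
  show ?thesis
    by (rule nap_eqI[OF cmp_hom[OF PSh_category[OF C] ya h] yelt_hom[OF sC P o(1) psh_act[OF P a p]]])
      (auto simp: nap_cmp[OF ya h] C nap_yoneda[OF C a] cmp_hom[OF C _ a] psh_cmp[OF P _ a p])
qed

text \<open>
  Density: a presheaf is the colimit of representables weighted by itself.  By the Yoneda lemma
  a cocone \<open>l\<close> assigns to every element \<open>p\<close> of \<open>P x\<close> an element of \<open>Q x\<close>, namely the value of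
  \<open>l x p\<close> at the identity, and this assignment is the induced map.
\<close>

lemma weighted_colimit_yoneda:
  assumes sC: "small_category C" and P: "P \<in> Obj (PSh C)"
  shows "weighted_colimit C (PSh C) (yoneda C) P P (yelt C P)"
  unfolding weighted_colimit_def
proof (intro conjI allI impI)
  have C: "is_category C" using sC by (auto simp: small_category_def)
  show "weighted_cocone C (PSh C) (yoneda C) P P (yelt C P)"
    unfolding weighted_cocone_def using P yelt_hom[OF sC P] yelt_yoneda[OF sC P] by auto
  fix Q l assume l: "weighted_cocone C (PSh C) (yoneda C) P Q l"
  then have Q: "Q \<in> Obj (PSh C)" by (simp add: weighted_cocone_def)
  have lh: "l x p \<in> hom (PSh C) (hom_psh C x) Q" if "x \<in> Obj C" "p \<in> fobj P x" for x p
    using weighted_cocone_hom[OF l that] that by simp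
  define m where "m = mknt C P Q (\<lambda>x p. nap (l x p) x (Idt C x))"
  have m: "m \<in> hom (PSh C) P Q"
    unfolding m_def
  proof (rule mknt_hom[OF C P Q])
    fix x p assume "x \<in> Obj C" "p \<in> fobj P x"
    then show "nap (l x p) x (Idt C x) \<in> fobj Q x" using nap_in[OF lh] Idt_hom[OF C] by simp
  next
    fix a x y p assume a: "a \<in> hom C x y" and p: "p \<in> fobj P y"
    note o = hom_objs[OF C a]
    have ya: "farr (yoneda C) a \<in> hom (PSh C) (hom_psh C x) (hom_psh C y)"
      using ftor_hom[OF yoneda_functor[OF sC] a] o by simp
    have "nap (l x (act P a p)) x (Idt C x) = nap (l y p) x a"
      using weighted_cocone_comm[OF l a p] nap_cmp[OF ya lh[OF o(2) p] o(1), of "Idt C x"]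
        Idt_hom[OF C o(1)] nap_yoneda[OF C a Idt_hom[OF C o(1)]] cmp_idr[OF C a] o by simp
    also have "\<dots> = act Q a (nap (l y p) y (Idt C y))"
      using nap_comm[OF C lh[OF o(2) p] a, of "Idt C y"] Idt_hom[OF C o(2)] o cmp_idl[OF C a] a by simp
    finally show "nap (l x (act P a p)) x (Idt C x) = act Q a (nap (l y p) y (Idt C y))" .
  qed
  have ml: "m \<odot>\<^bsub>PSh C\<^esub> yelt C P x p = l x p" if x: "x \<in> Obj C" and p: "p \<in> fobj P x" for x p
  proof (rule hom_psh_eqI[OF sC x _ lh[OF x p]])
    note i = Idt_hom[OF C x]
    show "m \<odot>\<^bsub>PSh C\<^esub> yelt C P x p \<in> hom (PSh C) (hom_psh C x) Q"
      by (rule cmp_hom[OF PSh_category[OF C] yelt_hom[OF sC P x p] m])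
    show "nap (m \<odot>\<^bsub>PSh C\<^esub> yelt C P x p) x (Idt C x) = nap (l x p) x (Idt C x)"
      using nap_cmp[OF yelt_hom[OF sC P x p] m x, of "Idt C x"] i x p nap_yelt[OF C i] psh_id[OF P x p]
      by (simp add: m_def)
  qed
  show "\<exists>!h. h \<in> hom (PSh C) P Q \<and> (\<forall>x\<in>Obj C. \<forall>p\<in>fobj P x. h \<odot>\<^bsub>PSh C\<^esub> yelt C P x p = l x p)"
  proof (rule ex1I[of _ m])
    fix h assume h: "h \<in> hom (PSh C) P Q \<and> (\<forall>x\<in>Obj C. \<forall>p\<in>fobj P x. h \<odot>\<^bsub>PSh C\<^esub> yelt C P x p = l x p)"
    show "h = m"
    proof (rule nap_eqI[of _ C P Q])
      fix x p assume x: "x \<in> Obj C" and p: "p \<in> fobj P x"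
      note i = Idt_hom[OF C x] and y = yelt_hom[OF sC P x p]
      have "nap (h \<odot>\<^bsub>PSh C\<^esub> yelt C P x p) x (Idt C x) = nap (m \<odot>\<^bsub>PSh C\<^esub> yelt C P x p) x (Idt C x)"
        using h ml x p by simp
      then show "nap h x p = nap m x p"
        using nap_cmp[OF y _ x, of h Q "Idt C x"] nap_cmp[OF y m x, of "Idt C x"] h i x
          nap_yelt[OF C i] psh_id[OF P x p] by simp
    qed (use h m in auto)
  qed (use m ml in auto)
qed

text \<open>
  A cocontinuous functor preserves the presentation of a presheaf by representables.  This is the
  only consequence of cocontinuity from which transformations are extended below.
\<close>

lemma cocontinuous_weighted_colimit:
  fixes C :: "('u, 'u) cat"
  assumes U: "universe TYPE('u)" and sC: "small_category C" and P: "P \<in> Obj (PSh C)"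
    and H: "cocontinuous TYPE('u) (PSh C) D H"
  shows "weighted_colimit C D (comp_ftor C H (yoneda C)) P (fobj H P) (\<lambda>x p. farr H (yelt C P x p))"
proof -
  have C: "is_category C" using sC by (auto simp: small_category_def)
  let ?J = "elements C P" and ?K = "comp_ftor (elements C P) (yoneda C) (elements_proj C P)"
  let ?i = "\<lambda>t. yelt C P (dec1 t) (dec2 t)"
  note J = elements_small[OF U sC P]
  then have Jc: "is_category ?J" by (simp add: small_category_def)
  note pr = elements_proj_functor[OF U sC P]
  have K: "is_functor ?J (PSh C) ?K" by (rule comp_ftor_functor[OF Jc pr yoneda_functor[OF sC]])
  have "is_colimit ?J (PSh C) ?K P ?i"
    unfolding colimit_elements[OF U sC P] dec_enc[OF U] using weighted_colimit_yoneda[OF sC P] .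
  then have "is_colimit ?J D (comp_ftor ?J H ?K) (fobj H P) (\<lambda>t. farr H (?i t))"
    using H J K unfolding cocontinuous_def by blast
  then show ?thesis
    unfolding comp_ftor_assoc[OF pr, symmetric] colimit_elements[OF U sC P] dec_enc[OF U] .
qed

section \<open>Extending transformations from the representables\<close>

context
  fixes C :: "('u, 'u) cat" and D :: "('o, 'm) cat"
  assumes U: "universe TYPE('u)" and sC: "small_category C" and D: "is_category D"
begin

lemma nat_yelt_square:
  assumes s: "is_nat (PSh C) D H K \<sigma>" and P: "P \<in> Obj (PSh C)" and x: "x \<in> Obj C" and p: "p \<in> fobj P x"
  shows "\<sigma> P \<odot>\<^bsub>D\<^esub> farr H (yelt C P x p) = farr K (yelt C P x p) \<odot>\<^bsub>D\<^esub> \<sigma> (hom_psh C x)"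
  by (rule nat_comm[OF s yelt_hom[OF sC P x p]])

text \<open>
  The legs \<open>H (y x) \<rightarrow> H P\<close> are jointly epimorphic, and naturality determines a transformation on
  them from its components at representables.
\<close>

lemma nat_eq_on_representables:
  assumes H: "cocontinuous TYPE('u) (PSh C) D H"
    and s: "is_nat (PSh C) D H K \<sigma>" and t: "is_nat (PSh C) D H K \<tau>"
    and eq: "\<And>x. x \<in> Obj C \<Longrightarrow> \<sigma> (hom_psh C x) = \<tau> (hom_psh C x)"
  shows "\<sigma> = \<tau>"
proof (rule nat_eqI[OF s t])
  fix P assume P: "P \<in> Obj (PSh C)"
  have C: "is_category C" using sC by (auto simp: small_category_def)
  show "\<sigma> P = \<tau> P"
    by (rule weighted_colimit_eqI[OF D comp_ftor_functor[OF C yoneda_functor[OF sC] nat_functors(1)[OF s]] C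
        P
          cocontinuous_weighted_colimit[OF U sC P H] nat_hom[OF s P] nat_hom[OF t P]])
      (simp add: nat_yelt_square[OF s P] nat_yelt_square[OF t P] eq)
qed

text \<open>
  At \<open>P\<close> the extension is the map out of the colimit \<open>H P\<close> induced by the cocone with legs
  \<open>K (yelt C P x p) \<odot> \<tau> x\<close>.  It restricts to \<open>\<tau>\<close> because the leg at the identity of a
  representable is itself an identity.
\<close>

lemma nat_extension:
  assumes H: "cocontinuous TYPE('u) (PSh C) D H" and K: "is_functor (PSh C) D K"
    and t: "is_nat C D (comp_ftor C H (yoneda C)) (comp_ftor C K (yoneda C)) \<tau>"
  obtains \<sigma> where "is_nat (PSh C) D H K \<sigma>" "\<And>x. x \<in> Obj C \<Longrightarrow> \<sigma> (hom_psh C x) = \<tau> x"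
proof -
  have C: "is_category C" using sC by (auto simp: small_category_def)
  have Hf: "is_functor (PSh C) D H" using H by (simp add: cocontinuous_def)
  note y = yoneda_functor[OF sC] and PC = PSh_category[OF C]
  note Hy = comp_ftor_functor[OF C y Hf]
  note W = cocontinuous_weighted_colimit[OF U sC _ H]
  have th: "\<tau> x \<in> hom D (fobj H (hom_psh C x)) (fobj K (hom_psh C x))" if "x \<in> Obj C" for x
    using nat_hom[OF t that] that by simp
  have l: "weighted_cocone C D (comp_ftor C H (yoneda C)) P (fobj K P) (\<lambda>x p. farr K (yelt C P x p) \<odot>\<^bsub>D\<^esub> \<tau> x)"
    if P: "P \<in> Obj (PSh C)" for P
    unfolding weighted_cocone_def
  proof (intro conjI ballI allI)
    fix x p assume x: "x \<in> Obj C" and p: "p \<in> fobj P x"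
    show "farr K (yelt C P x p) \<odot>\<^bsub>D\<^esub> \<tau> x \<in> hom D (fobj (comp_ftor C H (yoneda C)) x) (fobj K P)"
      using cmp_hom[OF D th[OF x] ftor_hom[OF K yelt_hom[OF sC P x p]]] x by simp
  next
    fix a x z p assume a: "a \<in> hom C x z" and p: "p \<in> fobj P z"
    note o = hom_objs[OF C a]
    note e = yelt_hom[OF sC P o(2) p]
    have ya: "farr (yoneda C) a \<in> hom (PSh C) (hom_psh C x) (hom_psh C z)"
      using ftor_hom[OF y a] o by simp
    have "farr K (yelt C P z p) \<odot>\<^bsub>D\<^esub> \<tau> z \<odot>\<^bsub>D\<^esub> farr H (farr (yoneda C) a) =
      farr K (yelt C P z p) \<odot>\<^bsub>D\<^esub> (farr K (farr (yoneda C) a) \<odot>\<^bsub>D\<^esub> \<tau> x)"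
      using cmp_assoc[OF D ftor_hom[OF Hf ya] th[OF o(2)] ftor_hom[OF K e]] nat_comm[OF t a] a by simp
    also have "\<dots> = farr K (yelt C P z p \<odot>\<^bsub>PSh C\<^esub> farr (yoneda C) a) \<odot>\<^bsub>D\<^esub> \<tau> x"
      using cmp_assoc[OF D th[OF o(1)] ftor_hom[OF K ya] ftor_hom[OF K e]] ftor_cmp[OF K ya e] by simp
    finally show "farr K (yelt C P z p) \<odot>\<^bsub>D\<^esub> \<tau> z \<odot>\<^bsub>D\<^esub> farr (comp_ftor C H (yoneda C)) a =
       farr K (yelt C P x (act P a p)) \<odot>\<^bsub>D\<^esub> \<tau> x"
      using yelt_yoneda[OF sC P a p] a by simp
  qed (use ftor_obj[OF K P] in auto)
  have "\<exists>s. s \<in> hom D (fobj H P) (fobj K P) \<and>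
      (\<forall>x\<in>Obj C. \<forall>p\<in>fobj P x. s \<odot>\<^bsub>D\<^esub> farr H (yelt C P x p) = farr K (yelt C P x p) \<odot>\<^bsub>D\<^esub> \<tau> x)"
    if P: "P \<in> Obj (PSh C)" for P
    using weighted_colimit_ex[OF W[OF P] l[OF P]] by metis
  then obtain s where s: "\<And>P. P \<in> Obj (PSh C) \<Longrightarrow> s P \<in> hom D (fobj H P) (fobj K P)"
    and sq: "\<And>P x p. P \<in> Obj (PSh C) \<Longrightarrow> x \<in> Obj C \<Longrightarrow> p \<in> fobj P x \<Longrightarrow>
        s P \<odot>\<^bsub>D\<^esub> farr H (yelt C P x p) = farr K (yelt C P x p) \<odot>\<^bsub>D\<^esub> \<tau> x"
    by metis
  have "is_nat (PSh C) D H K (\<lambda>P\<in>Obj (PSh C). s P)"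
  proof (rule is_natI[OF PC Hf K])
    fix m P Q assume P: "P \<in> Obj (PSh C)" and Q: "Q \<in> Obj (PSh C)" and m: "m \<in> hom (PSh C) P Q"
    note Hm = ftor_hom[OF Hf m] and Km = ftor_hom[OF K m]
    have "s Q \<odot>\<^bsub>D\<^esub> farr H m = farr K m \<odot>\<^bsub>D\<^esub> s P"
    proof (rule weighted_colimit_eqI[OF D Hy C P W[OF P] cmp_hom[OF D Hm s[OF Q]] cmp_hom[OF D s[OF P] Km]])
      fix x p assume x: "x \<in> Obj C" and p: "p \<in> fobj P x"
      note e = yelt_hom[OF sC P x p]
      have "s Q \<odot>\<^bsub>D\<^esub> farr H m \<odot>\<^bsub>D\<^esub> farr H (yelt C P x p) = s Q \<odot>\<^bsub>D\<^esub> farr H (yelt C Q x (nap m x p))"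
        using cmp_assoc[OF D ftor_hom[OF Hf e] Hm s[OF Q]] ftor_cmp[OF Hf e m] nat_yelt[OF sC m x p] by simp
      also have "\<dots> = farr K (m \<odot>\<^bsub>PSh C\<^esub> yelt C P x p) \<odot>\<^bsub>D\<^esub> \<tau> x"
        using sq[OF Q x nap_in[OF m x p]] nat_yelt[OF sC m x p] by simp
      also have "\<dots> = farr K m \<odot>\<^bsub>D\<^esub> (s P \<odot>\<^bsub>D\<^esub> farr H (yelt C P x p))"
        using cmp_assoc[OF D th[OF x] ftor_hom[OF K e] Km] ftor_cmp[OF K e m] sq[OF P x p] by simp
      also have "\<dots> = farr K m \<odot>\<^bsub>D\<^esub> s P \<odot>\<^bsub>D\<^esub> farr H (yelt C P x p)"
        using cmp_assoc[OF D ftor_hom[OF Hf e] s[OF P] Km] by simp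
      finally show "s Q \<odot>\<^bsub>D\<^esub> farr H m \<odot>\<^bsub>D\<^esub> farr H (yelt C P x p) =
        farr K m \<odot>\<^bsub>D\<^esub> s P \<odot>\<^bsub>D\<^esub> farr H (yelt C P x p)" .
    qed
    then show "(\<lambda>P\<in>Obj (PSh C). s P) Q \<odot>\<^bsub>D\<^esub> farr H m = farr K m \<odot>\<^bsub>D\<^esub> (\<lambda>P\<in>Obj (PSh C). s P) P"
      using P Q by simp
  qed (use s in auto)
  moreover have "(\<lambda>P\<in>Obj (PSh C). s P) (hom_psh C x) = \<tau> x" if x: "x \<in> Obj C" for x
  proof -
    note P = hom_psh_psh[OF sC, of x]
    show ?thesis
      using sq[OF P x, of "Idt C x"] Idt_hom[OF C x] x yelt_Idt[OF sC x] ftor_id[OF Hf P] ftor_id[OF K P]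
        cmp_idr[OF D s[OF P]] cmp_idl[OF D th[OF x]] P by simp
  qed
  ultimately show ?thesis by (rule that)
qed

text \<open>
  The inverses at the representables extend as well, and the two composites agree with the
  identities on representables.
\<close>

lemma natiso_extension:
  assumes H: "cocontinuous TYPE('u) (PSh C) D H" and K: "cocontinuous TYPE('u) (PSh C) D K"
    and s: "is_nat (PSh C) D H K \<sigma>"
    and iso: "\<And>x. x \<in> Obj C \<Longrightarrow> is_iso D (\<sigma> (hom_psh C x))"
  shows "is_natiso (PSh C) D H K \<sigma>"
proof -
  have C: "is_category C" using sC by (auto simp: small_category_def)
  note y = yoneda_functor[OF sC] and PC = PSh_category[OF C]
  note Hf = nat_functors(1)[OF s] and Kf = nat_functors(2)[OF s]
  note rep = hom_psh_psh[OF sC]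
  define \<rho> where "\<rho> = (\<lambda>x\<in>Obj C. \<sigma> (fobj (yoneda C) x))"
  have "is_natiso C D (comp_ftor C H (yoneda C)) (comp_ftor C K (yoneda C)) \<rho>"
    using nat_whisker_right[OF C y s] iso by (simp add: is_natiso_def \<rho>_def)
  from nat_cinv[OF C D this] obtain \<tau> where t: "is_nat (PSh C) D K H \<tau>"
    and tr: "\<And>x. x \<in> Obj C \<Longrightarrow> \<tau> (hom_psh C x) = (\<lambda>x\<in>Obj C. cinv D (\<rho> x)) x"
    using nat_extension[OF K Hf] by metis
  have tx: "\<tau> (hom_psh C x) = cinv D (\<sigma> (hom_psh C x))" if "x \<in> Obj C" for x
    using tr[OF that] that by (simp add: \<rho>_def)
  have "(\<lambda>P\<in>Obj (PSh C). \<tau> P \<odot>\<^bsub>D\<^esub> \<sigma> P) = (\<lambda>P\<in>Obj (PSh C). Idt D (fobj H P))"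
    by (rule nat_eq_on_representables[OF H nat_vcomp[OF PC D s t] nat_id[OF PC D Hf]])
      (simp add: tx rep cinv(2)[OF iso nat_hom[OF s]])
  moreover have "(\<lambda>P\<in>Obj (PSh C). \<sigma> P \<odot>\<^bsub>D\<^esub> \<tau> P) = (\<lambda>P\<in>Obj (PSh C). Idt D (fobj K P))"
    by (rule nat_eq_on_representables[OF K nat_vcomp[OF PC D t s] nat_id[OF PC D Kf]])
      (simp add: tx rep cinv(3)[OF iso nat_hom[OF s]])
  ultimately have "\<tau> P \<odot>\<^bsub>D\<^esub> \<sigma> P = Idt D (fobj H P)" "\<sigma> P \<odot>\<^bsub>D\<^esub> \<tau> P = Idt D (fobj K P)"
    if "P \<in> Obj (PSh C)" for P
    using that by (auto dest!: fun_cong[of _ _ P])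
  then show ?thesis
    unfolding is_natiso_def using s isoI[OF nat_hom[OF s] nat_hom[OF t]] by blast
qed

end

section \<open>Colimits of presheaves and large presheaves\<close>

context
  fixes C :: "('u, 'u) cat" and J :: "('u, 'u) cat" and K :: "('u, 'u, 'u presheaf, 'u presheaf_arr) ftor"
    and P :: "'u presheaf" and \<iota> :: "'u \<Rightarrow> 'u presheaf_arr"
  assumes U: "universe TYPE('u)" and sC: "small_category C" and sJ: "small_category J"
    and K: "is_functor J (PSh C) K" and P: "is_colimit J (PSh C) K P \<iota>"
begin

lemma colimit_PSh_inj: "j \<in> Obj J \<Longrightarrow> \<iota> j \<in> hom (PSh C) (fobj K j) P"
  using P by (auto simp: is_colimit_def is_cocone_def)

lemma colimit_PSh_comm: "e \<in> hom J i j \<Longrightarrow> \<iota> j \<odot>\<^bsub>PSh C\<^esub> farr K e = \<iota> i"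
  using P by (auto simp: is_colimit_def is_cocone_def hom_def)

text \<open>
  The elements that come from the diagram form a subpresheaf \<open>P0\<close> of \<open>P\<close>.  The colimit cocone
  factors through it, so the identity of \<open>P\<close> factors through the inclusion of \<open>P0\<close>.
\<close>

lemma colimit_PSh_surj:
  assumes x: "x \<in> Obj C" and p: "p \<in> fobj P x"
  obtains j q where "j \<in> Obj J" "q \<in> fobj (fobj K j) x" "p = nap (\<iota> j) x q"
proof -
  have C: "is_category C" and Jc: "is_category J" using sC sJ by (auto simp: small_category_def)
  have Po: "P \<in> Obj (PSh C)" using P by (simp add: is_colimit_def is_cocone_def)
  note PC = PSh_category[OF C]
  define S where "S x = {nap (\<iota> j) x q |j q. j \<in> Obj J \<and> q \<in> fobj (fobj K j) x}" for x
  have SP: "S x \<subseteq> fobj P x" if "x \<in> Obj C" for x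
    using nap_in[OF colimit_PSh_inj that] by (auto simp: S_def)
  define P0 where "P0 = mkpsh C S (act P)"
  have Sa: "act P a p \<in> S x" if a: "a \<in> hom C x y" and p: "p \<in> S y" for a x y p
  proof -
    obtain j q where "j \<in> Obj J" "q \<in> fobj (fobj K j) y" "p = nap (\<iota> j) y q" using p by (auto simp: S_def)
    then have "act P a p = nap (\<iota> j) x (act (fobj K j) a q)" "act (fobj K j) a q \<in> fobj (fobj K j) x"
      using nap_comm[OF C colimit_PSh_inj a] psh_act[OF ftor_obj[OF K] a] by auto
    then show ?thesis using \<open>j \<in> Obj J\<close> by (auto simp: S_def)
  qed
  have P0: "P0 \<in> Obj (PSh C)"
    unfolding P0_def
  proof (rule mkpsh_psh[OF C])
    show "small_set (S x)" if "x \<in> Obj C" for x by (rule small_subset[OF psh_small[OF Po that] SP[OF that]])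
    show "act P (Idt C x) p = p" if "x \<in> Obj C" "p \<in> S x" for x p
      using psh_id[OF Po] SP that by auto
    show "act P (b \<odot>\<^bsub>C\<^esub> a) p = act P a (act P b p)"
      if "a \<in> hom C x y" "b \<in> hom C y z" "p \<in> S z" for a b x y z p
      using psh_cmp[OF Po that(1,2)] SP[OF hom_objs(2)[OF C that(2)]] that(3) by auto
  qed (rule Sa)
  define \<kappa> where "\<kappa> j = mknt C (fobj K j) P0 (\<lambda>x q. nap (\<iota> j) x q)" for j
  define inc where "inc = mknt C P0 P (\<lambda>x p. p)"
  have inc: "inc \<in> hom (PSh C) P0 P"
    unfolding inc_def
    by (rule mknt_hom[OF C P0 Po]) (use SP hom_objs[OF C] in \<open>auto simp: P0_def act_mkpsh\<close>)
  have k: "\<kappa> j \<in> hom (PSh C) (fobj K j) P0" if j: "j \<in> Obj J" for j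
    unfolding \<kappa>_def
  proof (rule mknt_hom[OF C ftor_obj[OF K j] P0])
    fix a x y q assume a: "a \<in> hom C x y" and q: "q \<in> fobj (fobj K j) y"
    have "nap (\<iota> j) y q \<in> S y" using q j by (auto simp: S_def)
    then show "nap (\<iota> j) x (act (fobj K j) a q) = act P0 a (nap (\<iota> j) y q)"
      using nap_comm[OF C colimit_PSh_inj[OF j] a q] a by (simp add: P0_def)
  qed (use j in \<open>auto simp: P0_def S_def\<close>)
  have ik: "inc \<odot>\<^bsub>PSh C\<^esub> \<kappa> j = \<iota> j" if j: "j \<in> Obj J" for j
  proof (rule nap_eqI[OF cmp_hom[OF PC k[OF j] inc] colimit_PSh_inj[OF j]])
    fix x q assume x: "x \<in> Obj C" and q: "q \<in> fobj (fobj K j) x"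
    show "nap (inc \<odot>\<^bsub>PSh C\<^esub> \<kappa> j) x q = nap (\<iota> j) x q"
      unfolding nap_cmp[OF k[OF j] inc x q] using nap_in[OF k[OF j] x q] x q by (simp add: inc_def \<kappa>_def)
  qed
  have "is_cocone J (PSh C) K P0 \<kappa>"
    unfolding is_cocone_def
  proof (intro conjI ballI)
    fix e assume e: "e \<in> Arr J"
    then have eh: "e \<in> hom J (Dom J e) (Cod J e)" by (simp add: hom_def)
    note o = hom_objs[OF Jc eh] and Ke = ftor_hom[OF K eh]
    show "\<kappa> (Cod J e) \<odot>\<^bsub>PSh C\<^esub> farr K e = \<kappa> (Dom J e)"
    proof (rule nap_eqI[OF cmp_hom[OF PC Ke k[OF o(2)]] k[OF o(1)]])
      fix x q assume x: "x \<in> Obj C" and q: "q \<in> fobj (fobj K (Dom J e)) x"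
      show "nap (\<kappa> (Cod J e) \<odot>\<^bsub>PSh C\<^esub> farr K e) x q = nap (\<kappa> (Dom J e)) x q"
        using nap_cmp[OF Ke k[OF o(2)] x q] nap_in[OF Ke x q] x q
          nap_cmp[OF Ke colimit_PSh_inj[OF o(2)] x q] colimit_PSh_comm[OF eh] by (simp add: \<kappa>_def)
    qed
  qed (use P0 k in auto)
  then obtain r where r: "r \<in> hom (PSh C) P P0" and rk: "\<And>j. j \<in> Obj J \<Longrightarrow> r \<odot>\<^bsub>PSh C\<^esub> \<iota> j = \<kappa> j"
    using P unfolding is_colimit_def by metis
  have uniq: "\<exists>!h. h \<in> hom (PSh C) P P \<and> (\<forall>j\<in>Obj J. h \<odot>\<^bsub>PSh C\<^esub> \<iota> j = \<iota> j)"
    using P unfolding is_colimit_def by blast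
  have "(inc \<odot>\<^bsub>PSh C\<^esub> r) \<odot>\<^bsub>PSh C\<^esub> \<iota> j = \<iota> j" if j: "j \<in> Obj J" for j
    using cmp_assoc[OF PC colimit_PSh_inj[OF j] r inc] rk[OF j] ik[OF j] by simp
  moreover have "Idt (PSh C) P \<odot>\<^bsub>PSh C\<^esub> \<iota> j = \<iota> j" if j: "j \<in> Obj J" for j
    using cmp_idl[OF PC colimit_PSh_inj[OF j]] .
  ultimately have "inc \<odot>\<^bsub>PSh C\<^esub> r = Idt (PSh C) P"
    using uniq cmp_hom[OF PC r inc] Idt_hom[OF PC Po] by blast
  then have "nap r x p = p"
    using nap_cmp[OF r inc x p] nap_Idt[of x C p P] x p nap_in[OF r x p] by (simp add: inc_def)
  then have "p \<in> S x" using nap_in[OF r x p] x by (simp add: P0_def)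
  then show ?thesis using that by (auto simp: S_def)
qed

text \<open>
  A colimit of small presheaves is also universal for natural families of maps into a presheaf \<open>M\<close>
  whose stages are large sets, with restriction operation \<open>r\<close>.  The reason is that the values of a
  small cocone \<open>c\<close> form a subpresheaf \<open>T\<close> of \<open>M\<close> with small stages, being images of small sets.
  It is isomorphic to an honest presheaf \<open>Q\<close> on the universe type: an element is coded by one of the
  pairs \<open>(j, q)\<close> from which it arises, and the universal property applies to \<open>Q\<close>.  This replaces the
  use of hom-sets as small sets, so the target of a cocontinuous extension may fail to be locally
  small.
\<close>

lemma colimit_PSh_large:
  fixes M :: "'u \<Rightarrow> 'a set" and r :: "'u \<Rightarrow> 'a \<Rightarrow> 'a" and c :: "'u \<Rightarrow> 'u \<Rightarrow> 'u \<Rightarrow> 'a"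
  assumes rI: "\<And>x s. x \<in> Obj C \<Longrightarrow> s \<in> M x \<Longrightarrow> r (Idt C x) s = s"
    and rM: "\<And>a b x y z s. a \<in> hom C x y \<Longrightarrow> b \<in> hom C y z \<Longrightarrow> s \<in> M z \<Longrightarrow> r (b \<odot>\<^bsub>C\<^esub> a) s = r a (r b s)"
    and cM: "\<And>j x q. j \<in> Obj J \<Longrightarrow> x \<in> Obj C \<Longrightarrow> q \<in> fobj (fobj K j) x \<Longrightarrow> c j x q \<in> M x"
    and cn: "\<And>j a x y q. j \<in> Obj J \<Longrightarrow> a \<in> hom C x y \<Longrightarrow> q \<in> fobj (fobj K j) y \<Longrightarrow>
               c j x (act (fobj K j) a q) = r a (c j y q)"
    and cc: "\<And>e i j x q. e \<in> hom J i j \<Longrightarrow> x \<in> Obj C \<Longrightarrow> q \<in> fobj (fobj K i) x \<Longrightarrow>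
               c j x (nap (farr K e) x q) = c i x q"
  obtains t where "\<And>x p. x \<in> Obj C \<Longrightarrow> p \<in> fobj P x \<Longrightarrow> t x p \<in> M x"
    and "\<And>a x y p. a \<in> hom C x y \<Longrightarrow> p \<in> fobj P y \<Longrightarrow> t x (act P a p) = r a (t y p)"
    and "\<And>j x q. j \<in> Obj J \<Longrightarrow> x \<in> Obj C \<Longrightarrow> q \<in> fobj (fobj K j) x \<Longrightarrow> t x (nap (\<iota> j) x q) = c j x q"
proof -
  have C: "is_category C" and Jc: "is_category J" and sJo: "small_set (Obj J)"
    using sC sJ by (auto simp: small_category_def)
  note PC = PSh_category[OF C]
  define T where "T x = {c j x q |j q. j \<in> Obj J \<and> q \<in> fobj (fobj K j) x}" for x
  define dec where "dec x w = c (dec1 w) x (dec2 w)" for x w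
  define V where "V x = {enc (j, q) |j q. j \<in> Obj J \<and> q \<in> fobj (fobj K j) x}" for x
  define code where "code x s = inv_into (V x) (dec x) s" for x s
  have decV: "dec x (enc (j, q)) = c j x q" for x j q by (simp add: dec_def dec_enc[OF U])
  have img: "T x = dec x ` V x" for x
  proof (intro equalityI subsetI)
    fix s assume "s \<in> T x"
    then obtain j q where "s = dec x (enc (j, q))" "enc (j, q) \<in> V x" by (auto simp: T_def V_def decV)
    then show "s \<in> dec x ` V x" by blast
  next
    fix s assume "s \<in> dec x ` V x"
    then obtain j q where "j \<in> Obj J" "q \<in> fobj (fobj K j) x" "s = c j x q" by (auto simp: V_def decV)
    then show "s \<in> T x" unfolding T_def by blast
  qed
  have dc: "dec x (code x s) = s" and cV: "code x s \<in> V x" if "s \<in> T x" for x s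
    using that unfolding img code_def by (auto intro: f_inv_into_f inv_into_into)
  have TM: "T x \<subseteq> M x" if "x \<in> Obj C" for x using cM that by (auto simp: T_def)
  have Tr: "r a s \<in> T x" if a: "a \<in> hom C x y" and s: "s \<in> T y" for a x y s
  proof -
    obtain j q where j: "j \<in> Obj J" and q: "q \<in> fobj (fobj K j) y" and s': "s = c j y q" using s
        by (auto simp: T_def)
    then show ?thesis unfolding T_def using cn[OF j a q, symmetric] psh_act[OF ftor_obj[OF K j] a q]
        by blast
  qed
  define S where "S x = code x ` T x" for x
  define Q where "Q = mkpsh C S (\<lambda>a w. code (Dom C a) (r a (dec (Cod C a) w)))"
  have Q: "Q \<in> Obj (PSh C)"
    unfolding Q_def
  proof (rule mkpsh_psh[OF C])
    fix x assume x: "x \<in> Obj C"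
    have "small_set (V x)" unfolding V_def by (rule small_Sigma[OF U sJo psh_small[OF ftor_obj[OF K] x]])
    then show "small_set (S x)" by (rule small_subset) (use cV in \<open>auto simp: S_def\<close>)
    fix w assume "w \<in> S x"
    then show "code (Dom C (Idt C x)) (r (Idt C x) (dec (Cod C (Idt C x)) w)) = w"
      using homD[OF Idt_hom[OF C x]] rI[OF x] TM[OF x] dc by (auto simp: S_def)
  next
    fix a x y w assume a: "a \<in> hom C x y" and w: "w \<in> S y"
    then show "code (Dom C a) (r a (dec (Cod C a) w)) \<in> S x"
      using Tr[OF a] dc homD[OF a] by (auto simp: S_def)
  next
    fix a b x y z w assume a: "a \<in> hom C x y" and b: "b \<in> hom C y z" and w: "w \<in> S z"
    then obtain s where s: "s \<in> T z" "w = code z s" by (auto simp: S_def)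
    note ba = cmp_hom[OF C a b]
    show "code (Dom C (b \<odot>\<^bsub>C\<^esub> a)) (r (b \<odot>\<^bsub>C\<^esub> a) (dec (Cod C (b \<odot>\<^bsub>C\<^esub> a)) w)) =
         code (Dom C a) (r a (dec (Cod C a) (code (Dom C b) (r b (dec (Cod C b) w)))))"
      using homD[OF a] homD[OF b] homD[OF ba] s dc[OF s(1)] dc[OF Tr[OF b s(1)]]
        rM[OF a b] TM[OF hom_objs(2)[OF C b]] by auto
  qed
  define \<kappa> where "\<kappa> j = mknt C (fobj K j) Q (\<lambda>x q. code x (c j x q))" for j
  have cT: "c j x q \<in> T x" if "j \<in> Obj J" "q \<in> fobj (fobj K j) x" for j x q using that by (auto simp: T_def)
  have k: "\<kappa> j \<in> hom (PSh C) (fobj K j) Q" if j: "j \<in> Obj J" for j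
    unfolding \<kappa>_def
  proof (rule mknt_hom[OF C ftor_obj[OF K j] Q])
    fix a x y q assume a: "a \<in> hom C x y" and q: "q \<in> fobj (fobj K j) y"
    then show "code x (c j x (act (fobj K j) a q)) = act Q a (code y (c j y q))"
      using cn[OF j a q] cT[OF j q] homD[OF a] dc[OF cT[OF j q]] by (auto simp: Q_def S_def act_mkpsh[OF a])
  qed (use cT[OF j] in \<open>auto simp: Q_def S_def\<close>)
  have "is_cocone J (PSh C) K Q \<kappa>"
    unfolding is_cocone_def
  proof (intro conjI ballI)
    fix e assume e: "e \<in> Arr J"
    then have eh: "e \<in> hom J (Dom J e) (Cod J e)" by (simp add: hom_def)
    note o = hom_objs[OF Jc eh] and Ke = ftor_hom[OF K eh]
    show "\<kappa> (Cod J e) \<odot>\<^bsub>PSh C\<^esub> farr K e = \<kappa> (Dom J e)"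
    proof (rule nap_eqI[OF cmp_hom[OF PC Ke k[OF o(2)]] k[OF o(1)]])
      fix x q assume x: "x \<in> Obj C" and q: "q \<in> fobj (fobj K (Dom J e)) x"
      show "nap (\<kappa> (Cod J e) \<odot>\<^bsub>PSh C\<^esub> farr K e) x q = nap (\<kappa> (Dom J e)) x q"
        using nap_cmp[OF Ke k[OF o(2)] x q] nap_in[OF Ke x q] x q cc[OF eh x q] by (simp add: \<kappa>_def)
    qed
  qed (use Q k in auto)
  then obtain m where m: "m \<in> hom (PSh C) P Q" and mk: "\<And>j. j \<in> Obj J \<Longrightarrow> m \<odot>\<^bsub>PSh C\<^esub> \<iota> j = \<kappa> j"
    using P unfolding is_colimit_def by metis
  have mS: "nap m x p \<in> S x" if "x \<in> Obj C" "p \<in> fobj P x" for x p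
    using nap_in[OF m that] that by (simp add: Q_def)
  show ?thesis
  proof (rule that[of "\<lambda>x p. dec x (nap m x p)"])
    fix x p assume x: "x \<in> Obj C" and p: "p \<in> fobj P x"
    show "dec x (nap m x p) \<in> M x" using mS[OF x p] dc TM[OF x] by (auto simp: S_def)
  next
    fix a x y p assume a: "a \<in> hom C x y" and p: "p \<in> fobj P y"
    obtain s where s: "s \<in> T y" "nap m y p = code y s" using mS[OF hom_objs(2)[OF C a] p]
        by (auto simp: S_def)
    show "dec x (nap m x (act P a p)) = r a (dec y (nap m y p))"
      using nap_comm[OF C m a p] act_mkpsh[where S=S, OF a mS[OF hom_objs(2)[OF C a] p]] s dc[OF s(1)]
          dc[OF Tr[OF a s(1)]]
        homD[OF a] by (simp add: Q_def)
  next
    fix j x q assume j: "j \<in> Obj J" and x: "x \<in> Obj C" and q: "q \<in> fobj (fobj K j) x"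
    have "nap m x (nap (\<iota> j) x q) = code x (c j x q)"
      using nap_cmp[OF colimit_PSh_inj[OF j] m x q] mk[OF j] x q by (simp add: \<kappa>_def)
    then show "dec x (nap m x (nap (\<iota> j) x q)) = c j x q" using dc[OF cT[OF j q]] by simp
  qed
qed

end

section \<open>Cocontinuous extension along the Yoneda embedding\<close>

lemma ftor_cocone:
  assumes J: "is_category J" and K: "is_functor J C K" and H: "is_functor C D H"
      and c: "is_cocone J C K x \<iota>"
  shows "is_cocone J D (comp_ftor J H K) (fobj H x) (\<lambda>j. farr H (\<iota> j))"
  unfolding is_cocone_def
proof (intro conjI ballI)
  have i: "\<iota> j \<in> hom C (fobj K j) x" if "j \<in> Obj J" for j using c that by (auto simp: is_cocone_def)
  show "fobj H x \<in> Obj D" using ftor_obj[OF H] c by (auto simp: is_cocone_def)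
  fix j assume "j \<in> Obj J"
  then show "farr H (\<iota> j) \<in> hom D (fobj (comp_ftor J H K) j) (fobj H x)" using ftor_hom[OF H i] by simp
next
  fix e assume e: "e \<in> Arr J"
  then have eh: "e \<in> hom J (Dom J e) (Cod J e)" by (simp add: hom_def)
  have i: "\<iota> (Cod J e) \<in> hom C (fobj K (Cod J e)) x" using c Cod_obj[OF J e] by (auto simp: is_cocone_def)
  show "farr H (\<iota> (Cod J e)) \<odot>\<^bsub>D\<^esub> farr (comp_ftor J H K) e = farr H (\<iota> (Dom J e))"
    using ftor_cmp[OF H ftor_hom[OF K eh] i] c e by (auto simp: is_cocone_def)
qed

text \<open>
  The extension sends \<open>P\<close> to the colimit \<open>L P\<close> of \<open>f\<close> weighted by \<open>P\<close>.  Maps \<open>L P \<rightarrow> d\<close> are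
  natural families \<open>P x \<rightarrow> D(f x, d)\<close>, that is, maps from \<open>P\<close> to a possibly large presheaf, so
  cocontinuity of \<open>L\<close> is the universal property of colimits of presheaves with respect to large
  presheaves.  On a representable the weighted colimit is the value of \<open>f\<close>: the cocone
  \<open>g \<mapsto> farr f g\<close> is universal by the Yoneda lemma.
\<close>

lemma cocontinuous_extension:
  fixes C :: "('u, 'u) cat" and D :: "('o, 'm) cat"
  assumes U: "universe TYPE('u)" and sC: "small_category C" and D: "is_category D"
    and coc: "cocomplete TYPE('u) D" and f: "is_functor C D f"
  obtains H \<theta> where "cocontinuous TYPE('u) (PSh C) D H"
    "is_natiso C D (comp_ftor C H (yoneda C)) f \<theta>"
proof -
  have C: "is_category C" using sC by (auto simp: small_category_def)
  note PC = PSh_category[OF C]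
  obtain L k where wc: "\<And>P. P \<in> Obj (PSh C) \<Longrightarrow> weighted_colimit C D f P (L P) (k P)"
    using cocomplete_weighted_colimit[OF U sC _ coc f] by metis
  note wcc = weighted_colimit_cocone[OF wc]
  have LO: "L P \<in> Obj D" if "P \<in> Obj (PSh C)" for P using wcc[OF that] by (simp add: weighted_cocone_def)
  note kh = weighted_cocone_hom[OF wcc] and kc = weighted_cocone_comm[OF wcc]
  note eqI = weighted_colimit_eqI[OF D f C _ wc]
  have wex: "\<exists>g. g \<in> hom D (L P) d \<and> (\<forall>x\<in>Obj C. \<forall>p\<in>fobj P x. g \<odot>\<^bsub>D\<^esub> k P x p = l x p)"
    if "P \<in> Obj (PSh C)" "weighted_cocone C D f P d l" for P d l
    using weighted_colimit_ex[OF wc[OF that(1)] that(2)] by metis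
  have "\<exists>g. g \<in> hom D (L P) (L Q) \<and> (\<forall>x\<in>Obj C. \<forall>p\<in>fobj P x. g \<odot>\<^bsub>D\<^esub> k P x p = k Q x (nap m x p))"
    if m: "m \<in> hom (PSh C) P Q" for m P Q
  proof (rule wex[OF hom_PSh_obj(1)[OF C m]], unfold weighted_cocone_def, intro conjI ballI allI)
    note PQ = hom_PSh_obj[OF C m]
    show "L Q \<in> Obj D" by (rule LO[OF PQ(2)])
    fix x p assume x: "x \<in> Obj C" and p: "p \<in> fobj P x"
    show "k Q x (nap m x p) \<in> hom D (fobj f x) (L Q)" by (rule kh[OF PQ(2) x nap_in[OF m x p]])
  next
    fix x y a p assume a: "a \<in> hom C x y" and p: "p \<in> fobj P y"
    show "k Q y (nap m y p) \<odot>\<^bsub>D\<^esub> farr f a = k Q x (nap m x (act P a p))"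
      using kc[OF hom_PSh_obj(2)[OF C m] a nap_in[OF m hom_objs(2)[OF C a] p]] nap_comm[OF C m a p] by simp
  qed
  then have "\<forall>m\<in>Arr (PSh C). \<exists>g. g \<in> hom D (L (Dom (PSh C) m)) (L (Cod (PSh C) m)) \<and>
      (\<forall>x\<in>Obj C. \<forall>p\<in>fobj (Dom (PSh C) m) x. g \<odot>\<^bsub>D\<^esub> k (Dom (PSh C) m) x p = k (Cod (PSh C) m) x (nap m x p))"
    by (simp add: hom_def)
  from bchoice[OF this] obtain h where h0: "\<forall>m\<in>Arr (PSh C). h m
      \<in> hom D (L (Dom (PSh C) m)) (L (Cod (PSh C) m)) \<and>
      (\<forall>x\<in>Obj C. \<forall>p\<in>fobj (Dom (PSh C) m) x. h m \<odot>\<^bsub>D\<^esub> k (Dom (PSh C) m) x p = k (Cod (PSh C) m) x (nap m x p))"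
    by blast
  have h: "h m \<in> hom D (L P) (L Q)" if "m \<in> hom (PSh C) P Q" for m P Q
    using h0 that by (auto simp: hom_def)
  have hk: "h m \<odot>\<^bsub>D\<^esub> k P x p = k Q x (nap m x p)"
    if "m \<in> hom (PSh C) P Q" "x \<in> Obj C" "p \<in> fobj P x" for m P Q x p
    using h0 that by (auto simp: hom_def)
  define H where "H = \<lparr>fobj = (\<lambda>P\<in>Obj (PSh C). L P), farr = (\<lambda>m\<in>Arr (PSh C). h m)\<rparr>"
  have Ho [simp]: "fobj H P = L P" if "P \<in> Obj (PSh C)" for P using that by (simp add: H_def)
  have Ha [simp]: "farr H m = h m" if "m \<in> hom (PSh C) P Q" for m P Q using homD(1)[OF that]
      by (simp add: H_def)
  have H: "is_functor (PSh C) D H"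
  proof (rule is_functorI[OF PC])
    fix P assume P: "P \<in> Obj (PSh C)"
    note i = Idt_hom[OF PC P]
    have "h (Idt (PSh C) P) = Idt D (L P)"
      by (rule eqI[OF P P h[OF i] Idt_hom[OF D LO[OF P]]])
         (simp add: hk[OF i] nap_Idt cmp_idl[OF D kh[OF P]])
    then show "farr H (Idt (PSh C) P) = Idt D (fobj H P)" using i P by simp
  next
    fix m P Q assume m: "m \<in> hom (PSh C) P Q"
    note PQ = hom_PSh_obj[OF C m]
    show "farr H m \<in> hom D (fobj H P) (fobj H Q)" using h[OF m] m PQ by simp
    fix n R assume n: "n \<in> hom (PSh C) Q R"
    note nm = cmp_hom[OF PC m n]
    have "h (n \<odot>\<^bsub>PSh C\<^esub> m) = h n \<odot>\<^bsub>D\<^esub> h m"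
    proof (rule eqI[OF PQ(1) PQ(1) h[OF nm] cmp_hom[OF D h[OF m] h[OF n]]])
      fix x p assume x: "x \<in> Obj C" and p: "p \<in> fobj P x"
      show "h (n \<odot>\<^bsub>PSh C\<^esub> m) \<odot>\<^bsub>D\<^esub> k P x p = h n \<odot>\<^bsub>D\<^esub> h m \<odot>\<^bsub>D\<^esub> k P x p"
        using cmp_assoc[OF D kh[OF PQ(1) x p] h[OF m] h[OF n]] hk[OF m x p] hk[OF n x nap_in[OF m x p]]
          hk[OF nm x p] nap_cmp[OF m n x p] by simp
    qed
    then show "farr H (n \<odot>\<^bsub>PSh C\<^esub> m) = farr H n \<odot>\<^bsub>D\<^esub> farr H m" using m n nm by simp
  qed (use LO in \<open>auto simp: H_def\<close>)
  have "cocontinuous TYPE('u) (PSh C) D H"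
    unfolding cocontinuous_def
  proof (intro conjI allI impI H)
    fix J :: "('u, 'u) cat" and K P \<iota>
    assume sJ: "small_category J" and K: "is_functor J (PSh C) K" and col: "is_colimit J (PSh C) K P \<iota>"
    have J: "is_category J" using sJ by (simp add: small_category_def)
    have P: "P \<in> Obj (PSh C)" and cone: "is_cocone J (PSh C) K P \<iota>" using col
        by (auto simp: is_colimit_def is_cocone_def)
    note i = colimit_PSh_inj[OF U sC sJ K col]
    note Ko = ftor_obj[OF K]
    show "is_colimit J D (comp_ftor J H K) (fobj H P) (\<lambda>j. farr H (\<iota> j))"
      unfolding is_colimit_def
    proof (intro conjI allI impI ftor_cocone[OF J K H cone])
      fix d \<kappa> assume dk: "is_cocone J D (comp_ftor J H K) d \<kappa>"
      have kap: "\<kappa> j \<in> hom D (L (fobj K j)) d" if j: "j \<in> Obj J" for j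
        using dk j Ko[OF j] by (auto simp: is_cocone_def)
      have d: "d \<in> Obj D" using dk by (simp add: is_cocone_def)
      have kapc: "\<kappa> j \<odot>\<^bsub>D\<^esub> h (farr K e) = \<kappa> i" if e: "e \<in> hom J i j" for e i j
        using dk homD[OF e] ftor_hom[OF K e] by (auto simp: is_cocone_def)
      \<comment> \<open>the family of maps from the presheaves of the diagram to the large presheaf of arrows into d\<close>
      define c where "c j x q = \<kappa> j \<odot>\<^bsub>D\<^esub> k (fobj K j) x q" for j x q
      obtain t where tM: "\<And>x p. x \<in> Obj C \<Longrightarrow> p \<in> fobj P x \<Longrightarrow> t x p \<in> hom D (fobj f x) d"
        and tn: "\<And>a x y p. a \<in> hom C x y \<Longrightarrow> p \<in> fobj P y \<Longrightarrow> t x (act P a p) = t y p \<odot>\<^bsub>D\<^esub> farr f a"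
        and tc: "\<And>j x q. j \<in> Obj J \<Longrightarrow> x \<in> Obj C \<Longrightarrow> q \<in> fobj (fobj K j) x \<Longrightarrow> t x (nap (\<iota> j) x q) = c j x q"
      proof (rule colimit_PSh_large[OF U sC sJ K col,
            of "\<lambda>x. hom D (fobj f x) d" "\<lambda>a s. s \<odot>\<^bsub>D\<^esub> farr f a" c])
        fix x s assume x: "x \<in> Obj C" and s: "s \<in> hom D (fobj f x) d"
        then show "s \<odot>\<^bsub>D\<^esub> farr f (Idt C x) = s" using ftor_id[OF f x] cmp_idr[OF D s] by simp
      next
        fix a b x y z s assume a: "a \<in> hom C x y" and b: "b \<in> hom C y z" and s: "s \<in> hom D (fobj f z) d"
        show "s \<odot>\<^bsub>D\<^esub> farr f (b \<odot>\<^bsub>C\<^esub> a) = s \<odot>\<^bsub>D\<^esub> farr f b \<odot>\<^bsub>D\<^esub> farr f a"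
          using ftor_cmp[OF f a b] cmp_assoc[OF D ftor_hom[OF f a] ftor_hom[OF f b] s] by simp
      next
        fix j x q assume j: "j \<in> Obj J" and x: "x \<in> Obj C" and q: "q \<in> fobj (fobj K j) x"
        show "c j x q \<in> hom D (fobj f x) d" unfolding c_def
            by (rule cmp_hom[OF D kh[OF Ko[OF j] x q] kap[OF j]])
      next
        fix j a x y q assume j: "j \<in> Obj J" and a: "a \<in> hom C x y" and q: "q \<in> fobj (fobj K j) y"
        show "c j x (act (fobj K j) a q) = c j y q \<odot>\<^bsub>D\<^esub> farr f a"
          using kc[OF Ko[OF j] a q]
            cmp_assoc[OF D ftor_hom[OF f a] kh[OF Ko[OF j] hom_objs(2)[OF C a] q] kap[OF j]]
                by (simp add: c_def)
      next
        fix e i j x q assume e: "e \<in> hom J i j" and x: "x \<in> Obj C" and q: "q \<in> fobj (fobj K i) x"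
        note o = hom_objs[OF J e] and Ke = ftor_hom[OF K e]
        show "c j x (nap (farr K e) x q) = c i x q"
          unfolding c_def using hk[OF Ke x q] cmp_assoc[OF D kh[OF Ko[OF o(1)] x q] h[OF Ke] kap[OF o(2)]]
              kapc[OF e]
          by simp
      qed auto
      have "weighted_cocone C D f P d t"
        unfolding weighted_cocone_def using d tM tn by auto
      then obtain g where g: "g \<in> hom D (L P) d"
        and gk: "\<And>x p. x \<in> Obj C \<Longrightarrow> p \<in> fobj P x \<Longrightarrow> g \<odot>\<^bsub>D\<^esub> k P x p = t x p"
        using wex[OF P] by metis
      have ki: "g' \<odot>\<^bsub>D\<^esub> k P x (nap (\<iota> j) x q) = g' \<odot>\<^bsub>D\<^esub> h (\<iota> j) \<odot>\<^bsub>D\<^esub> k (fobj K j) x q"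
        if j: "j \<in> Obj J" and x: "x \<in> Obj C" and q: "q \<in> fobj (fobj K j) x" and g': "g' \<in> hom D (L P) d"
        for g' j x q
        using hk[OF i[OF j] x q] cmp_assoc[OF D kh[OF Ko[OF j] x q] h[OF i[OF j]] g'] by simp
      show "\<exists>!g. g \<in> hom D (fobj H P) d \<and> (\<forall>j\<in>Obj J. g \<odot>\<^bsub>D\<^esub> farr H (\<iota> j) = \<kappa> j)"
      proof (rule ex1I[of _ g])
        have "g \<odot>\<^bsub>D\<^esub> h (\<iota> j) = \<kappa> j" if j: "j \<in> Obj J" for j
        proof (rule eqI[OF Ko[OF j] Ko[OF j] cmp_hom[OF D h[OF i[OF j]] g] kap[OF j]])
          fix x q assume x: "x \<in> Obj C" and q: "q \<in> fobj (fobj K j) x"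
          show "g \<odot>\<^bsub>D\<^esub> h (\<iota> j) \<odot>\<^bsub>D\<^esub> k (fobj K j) x q = \<kappa> j \<odot>\<^bsub>D\<^esub> k (fobj K j) x q"
            using ki[OF j x q g] gk[OF x nap_in[OF i[OF j] x q]] tc[OF j x q] by (simp add: c_def)
        qed
        then show "g \<in> hom D (fobj H P) d \<and> (\<forall>j\<in>Obj J. g \<odot>\<^bsub>D\<^esub> farr H (\<iota> j) = \<kappa> j)"
          using g P Ha[OF i] by simp
        fix g' assume "g' \<in> hom D (fobj H P) d \<and> (\<forall>j\<in>Obj J. g' \<odot>\<^bsub>D\<^esub> farr H (\<iota> j) = \<kappa> j)"
        then have g': "g' \<in> hom D (L P) d" and gi: "\<And>j. j \<in> Obj J \<Longrightarrow> g' \<odot>\<^bsub>D\<^esub> h (\<iota> j) = \<kappa> j"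
          using P Ha[OF i] by auto
        show "g' = g"
        proof (rule eqI[OF P P g' g])
          fix x p assume x: "x \<in> Obj C" and p: "p \<in> fobj P x"
          obtain j q where j: "j \<in> Obj J" and q: "q \<in> fobj (fobj K j) x" and p': "p = nap (\<iota> j) x q"
            using colimit_PSh_surj[OF U sC sJ K col x p] by metis
          show "g' \<odot>\<^bsub>D\<^esub> k P x p = g \<odot>\<^bsub>D\<^esub> k P x p"
            using ki[OF j x q g'] gi[OF j] gk[OF x p] tc[OF j x q] p' by (simp add: c_def)
        qed
      qed
    qed
  qed
  moreover
  note rep = hom_psh_psh[OF sC]
  have fc: "weighted_cocone C D f (hom_psh C e) (fobj f e) (\<lambda>x g. farr f g)" if e: "e \<in> Obj C" for e
    unfolding weighted_cocone_def
  proof (intro conjI ballI allI)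
    fix x y a p assume a: "a \<in> hom C x y" and "p \<in> fobj (hom_psh C e) y"
    then have p: "p \<in> hom C y e" using hom_objs[OF C a] by simp
    show "farr f p \<odot>\<^bsub>D\<^esub> farr f a = farr f (act (hom_psh C e) a p)"
      using ftor_cmp[OF f a p] a p by simp
  qed (use ftor_obj[OF f e] ftor_hom[OF f] in auto)
  have "\<exists>\<theta>. \<forall>e\<in>Obj C. \<theta> e \<in> hom D (L (hom_psh C e)) (fobj f e) \<and>
      (\<forall>x\<in>Obj C. \<forall>g\<in>hom C x e. \<theta> e \<odot>\<^bsub>D\<^esub> k (hom_psh C e) x g = farr f g)"
    by (rule bchoice) (use wex[OF rep fc] in auto)
  then obtain \<theta> where th: "\<And>e. e \<in> Obj C \<Longrightarrow> \<theta> e \<in> hom D (L (hom_psh C e)) (fobj f e)"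
    and thk: "\<And>e x g. e \<in> Obj C \<Longrightarrow> g \<in> hom C x e \<Longrightarrow> \<theta> e \<odot>\<^bsub>D\<^esub> k (hom_psh C e) x g = farr f g"
    using hom_objs(1)[OF C] by metis
  have "is_natiso C D (comp_ftor C H (yoneda C)) f (\<lambda>e\<in>Obj C. \<theta> e)"
    unfolding is_natiso_def
  proof (intro conjI is_natI[OF C comp_ftor_functor[OF C yoneda_functor[OF sC] H] f] ballI)
    fix e assume e: "e \<in> Obj C"
    show "(\<lambda>e\<in>Obj C. \<theta> e) e \<in> hom D (fobj (comp_ftor C H (yoneda C)) e) (fobj f e)"
      using th e rep by simp
    note i = Idt_hom[OF C e]
    have kI: "k (hom_psh C e) e (Idt C e) \<in> hom D (fobj f e) (L (hom_psh C e))"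
      using kh[OF rep e] i e by simp
    have "is_iso D (\<theta> e)"
    proof (rule isoI[OF th[OF e] kI])
      show "\<theta> e \<odot>\<^bsub>D\<^esub> k (hom_psh C e) e (Idt C e) = Idt D (fobj f e)"
        using thk[OF e i] ftor_id[OF f e] by simp
      show "k (hom_psh C e) e (Idt C e) \<odot>\<^bsub>D\<^esub> \<theta> e = Idt D (L (hom_psh C e))"
      proof (rule eqI[OF rep rep cmp_hom[OF D th[OF e] kI] Idt_hom[OF D LO[OF rep]]])
        fix x g assume x: "x \<in> Obj C" and g': "g \<in> fobj (hom_psh C e) x"
        then have g: "g \<in> hom C x e" by simp
        note kx = kh[OF rep x g']
        show "k (hom_psh C e) e (Idt C e) \<odot>\<^bsub>D\<^esub> \<theta> e \<odot>\<^bsub>D\<^esub> k (hom_psh C e) x g =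
          Idt D (L (hom_psh C e)) \<odot>\<^bsub>D\<^esub> k (hom_psh C e) x g"
          using cmp_assoc[OF D kx th[OF e] kI] thk[OF e g] kc[OF rep g, of "Idt C e"] i e g cmp_idl[OF C g]
            cmp_idl[OF D kx] by simp
      qed
    qed
    then show "is_iso D ((\<lambda>e\<in>Obj C. \<theta> e) e)" using e by simp
  next
    fix a e e' assume e: "e \<in> Obj C" and e': "e' \<in> Obj C" and a: "a \<in> hom C e e'"
    have ya: "farr (yoneda C) a \<in> hom (PSh C) (hom_psh C e) (hom_psh C e')"
      using ftor_hom[OF yoneda_functor[OF sC] a] e e' by simp
    note fa = ftor_hom[OF f a]
    have "\<theta> e' \<odot>\<^bsub>D\<^esub> h (farr (yoneda C) a) = farr f a \<odot>\<^bsub>D\<^esub> \<theta> e"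
    proof (rule eqI[OF rep rep cmp_hom[OF D h[OF ya] th[OF e']] cmp_hom[OF D th[OF e] fa]])
      fix x g assume x: "x \<in> Obj C" and g': "g \<in> fobj (hom_psh C e) x"
      then have g: "g \<in> hom C x e" by simp
      note kx = kh[OF rep x g']
      show "\<theta> e' \<odot>\<^bsub>D\<^esub> h (farr (yoneda C) a) \<odot>\<^bsub>D\<^esub> k (hom_psh C e) x g =
            farr f a \<odot>\<^bsub>D\<^esub> \<theta> e \<odot>\<^bsub>D\<^esub> k (hom_psh C e) x g"
        using cmp_assoc[OF D kx h[OF ya] th[OF e']] hk[OF ya x g'] nap_yoneda[OF C a g]
          thk[OF e' cmp_hom[OF C g a]] cmp_assoc[OF D kx th[OF e] fa] thk[OF e g] ftor_cmp[OF f g a] by simp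
    qed
    then show "(\<lambda>e\<in>Obj C. \<theta> e) e' \<odot>\<^bsub>D\<^esub> farr (comp_ftor C H (yoneda C)) a = farr f a \<odot>\<^bsub>D\<^esub> (\<lambda>e\<in>Obj C. \<theta> e) e"
      using e e' a Ha[OF ya] by simp
  qed simp
  ultimately show ?thesis by (rule that)
qed

section \<open>Left Kan extension of presheaves\<close>

abbreviation restr :: "('u, 'u) cat \<Rightarrow> ('u, 'u, 'u, 'u) ftor \<Rightarrow> 'u presheaf \<Rightarrow> 'u presheaf" where
  "restr C K Q \<equiv> comp_ftor (opp C) Q K"

lemma act_restr [simp]: "a \<in> hom C x y \<Longrightarrow> act (restr C K Q) a p = act Q (farr K a) p"
  by (simp add: act_def homD)

lemma set_cmp_eq_iff:
  assumes "s \<in> hom set_cat A A'" "t \<in> hom set_cat A' A''" "r \<in> hom set_cat A A''"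
  shows "t \<odot>\<^bsub>set_cat\<^esub> s = r \<longleftrightarrow> (\<forall>p\<in>A. snd (snd t) (snd (snd s) p) = snd (snd r) p)"
proof -
  obtain f g h where fgh: "s = (A, A', f)" "t = (A', A'', g)" "r = (A, A'', h)" and h: "h \<in> A \<rightarrow>\<^sub>E A''"
    using assms by (auto simp: hom_set_cat)
  have "compose A g f = h \<longleftrightarrow> (\<forall>p\<in>A. g (f p) = h p)"
  proof
    assume "\<forall>p\<in>A. g (f p) = h p"
    then show "compose A g f = h"
      using h by (intro extensionalityI[of _ A]) (auto simp: compose_def PiE_def)
  qed (auto simp: compose_def)
  then show ?thesis by (simp add: fgh)
qed

context
  fixes C C' :: "('u, 'u) cat" and K :: "('u, 'u, 'u, 'u) ftor"
  assumes U: "universe TYPE('u)" and sC: "small_category C" and sC': "small_category C'"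
    and K: "is_functor C C' K"
begin

lemma restr_psh: "Q \<in> Obj (PSh C') \<Longrightarrow> restr C K Q \<in> Obj (PSh C)"
  using comp_ftor_functor[OF opp_category functor_opp[OF K]] sC by (auto simp: Obj_PSh small_category_def)

text \<open>
  The value of the Kan extension at \<open>c\<close> is the set of triples of \<open>x\<close>, \<open>g : c \<rightarrow> K x\<close> and \<open>p\<close> in
  \<open>P x\<close>, modulo the relation generated by sliding an arrow of \<open>C\<close> from \<open>g\<close> to \<open>p\<close>.  Instead of
  generating it, \<open>rel\<close> identifies two triples as soon as every map \<open>m\<close> from \<open>P\<close> to the restriction
  of a presheaf gives them the same value \<open>v\<close>.  With this description the factorization of every
  \<open>m\<close> is well defined by construction.  A class is represented by one of its members, which keeps
  the stages small, and it is the restriction along \<open>g\<close> of a value of the unit, which gives the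
  uniqueness of factorizations.
\<close>

lemma lan_presheaf_exists:
  assumes P: "P \<in> Obj (PSh C)"
  obtains L n where "L \<in> Obj (PSh C')" "n \<in> hom (PSh C) P (restr C K L)"
    "\<And>c t. c \<in> Obj C' \<Longrightarrow> t \<in> fobj L c \<Longrightarrow>
       \<exists>x g p. x \<in> Obj C \<and> g \<in> hom C' c (fobj K x) \<and> p \<in> fobj P x \<and> t = act L g (nap n x p)"
    "\<And>Q m. Q \<in> Obj (PSh C') \<Longrightarrow> m \<in> hom (PSh C) P (restr C K Q) \<Longrightarrow>
       \<exists>s. s \<in> hom (PSh C') L Q \<and> (\<forall>x\<in>Obj C. \<forall>p\<in>fobj P x. nap s (fobj K x) (nap n x p) = nap m x p)"
proof -
  have C: "is_category C" and C': "is_category C'" and sO: "small_set (Obj C)" and sA: "small_set (Arr C')"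
    using sC sC' by (auto simp: small_category_def)
  note dec = dec_enc[OF U]
  define T where "T c = {enc (x, enc (g, p)) |x g p. x \<in> Obj C \<and> g \<in> hom C' c (fobj K x) \<and> p \<in> fobj P x}"
      for c
  define v where "v Q m w = act Q (dec1 (dec2 w)) (nap m (dec1 w) (dec2 (dec2 w)))"
    for Q :: "'u presheaf" and m :: "'u presheaf_arr" and w :: 'u
  have v: "v Q m (enc (x, enc (g, p))) = act Q g (nap m x p)" for Q m x g p by (simp add: v_def dec)
  define rel where "rel w w' \<longleftrightarrow> (\<forall>Q m. Q \<in> Obj (PSh C') \<longrightarrow> m \<in> hom (PSh C) P (restr C K Q) \<longrightarrow>
      v Q m w = v Q m w')" for w w'
  \<comment> \<open>a representative is chosen among the triples over c, since rel also relates codes of other stages\<close>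
  define q where "q c w = (SOME w'. w' \<in> T c \<and> rel w' w)" for c w
  define shift where "shift a w = enc (dec1 w, enc (dec1 (dec2 w) \<odot>\<^bsub>C'\<^esub> a, dec2 (dec2 w)))" for a w :: 'u
  have sh: "shift a (enc (x, enc (g, p))) = enc (x, enc (g \<odot>\<^bsub>C'\<^esub> a, p))" for a x g p
    by (simp add: shift_def dec)
  have TI: "enc (x, enc (g, p)) \<in> T c" if "x \<in> Obj C" "g \<in> hom C' c (fobj K x)" "p \<in> fobj P x" for x g p c
    using that by (auto simp: T_def)
  have qT: "q c w \<in> T c" and qr: "rel (q c w) w" if "w \<in> T c" for c w
    using someI[of "\<lambda>w'. w' \<in> T c \<and> rel w' w" w] that by (auto simp: q_def rel_def)
  have q_cong: "q c w = q c w'" if "rel w w'" for c w w'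
  proof -
    have "rel w'' w \<longleftrightarrow> rel w'' w'" for w'' using that unfolding rel_def by simp
    then show ?thesis by (simp add: q_def)
  qed
  have qv: "v Q m (q c w) = v Q m w"
    if "w \<in> T c" "Q \<in> Obj (PSh C')" "m \<in> hom (PSh C) P (restr C K Q)" for Q m c w
    using qr[OF that(1)] that(2,3) unfolding rel_def by blast
  have vin: "v Q m w \<in> fobj Q c" if w: "w \<in> T c" and Q: "Q \<in> Obj (PSh C')"
      and m: "m \<in> hom (PSh C) P (restr C K Q)" for Q m w c
  proof -
    obtain x g p where w': "w = enc (x, enc (g, p))" and x: "x \<in> Obj C" and g: "g \<in> hom C' c (fobj K x)"
        and p: "p \<in> fobj P x"
      using w by (auto simp: T_def)
    show ?thesis unfolding w' v using psh_act[OF Q g] nap_in[OF m x p] x by simp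
  qed
  have shT: "shift a w \<in> T c" if a: "a \<in> hom C' c c'" and w: "w \<in> T c'" for a w c c'
  proof -
    obtain x g p where "w = enc (x, enc (g, p))" "x \<in> Obj C" "g \<in> hom C' c' (fobj K x)" "p \<in> fobj P x"
      using w by (auto simp: T_def)
    then show ?thesis using TI cmp_hom[OF C' a] by (simp add: sh)
  qed
  have shv: "v Q m (shift a w) = act Q a (v Q m w)"
    if a: "a \<in> hom C' c c'" and w: "w \<in> T c'" and Q: "Q \<in> Obj (PSh C')"
        and m: "m \<in> hom (PSh C) P (restr C K Q)" for Q m a w c c'
  proof -
    obtain x g p where w': "w = enc (x, enc (g, p))" and x: "x \<in> Obj C" and g: "g \<in> hom C' c' (fobj K x)"
        and p: "p \<in> fobj P x"
      using w by (auto simp: T_def)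
    show ?thesis unfolding w' sh v using psh_cmp[OF Q a g] nap_in[OF m x p] x by simp
  qed
  have sh_cong: "rel (shift a w) (shift a w')" if "a \<in> hom C' c c'" "w \<in> T c'" "w' \<in> T c'" "rel w w'"
      for a w w' c c'
    using that shv[OF that(1)] unfolding rel_def by simp
  define L where "L = mkpsh C' (\<lambda>c. q c ` T c) (\<lambda>a t. q (Dom C' a) (shift a t))"
  have Lo: "fobj L c = q c ` T c" if "c \<in> Obj C'" for c using that by (simp add: L_def)
  have La: "act L a (q c' w) = q c (shift a w)" if a: "a \<in> hom C' c c'" and w: "w \<in> T c'" for a c c' w
  proof -
    have "act L a (q c' w) = q c (shift a (q c' w))"
      unfolding L_def using act_mkpsh[OF a, of "q c' w" "\<lambda>c. q c ` T c"] w homD[OF a] by simp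
    then show ?thesis using q_cong[OF sh_cong[OF a qT[OF w] w qr[OF w]]] by simp
  qed
  have L: "L \<in> Obj (PSh C')"
    unfolding L_def
  proof (rule mkpsh_psh[OF C'])
    fix c assume c: "c \<in> Obj C'"
    have "small_set (T c)"
    proof (rule small_subset)
      show "small_set {enc (x, b) |x b. x \<in> Obj C \<and> b \<in> {enc (g, p) |g p. g \<in> hom C' c (fobj K x) \<and>
          p \<in> fobj P x}}"
        by (intro small_Sigma[OF U sO] small_Sigma[OF U] psh_small[OF P] small_subset[OF sA])
            (auto simp: hom_def)
    qed (auto simp: T_def)
    then show "small_set (q c ` T c)" by (rule small_image)
    fix t assume "t \<in> q c ` T c"
    then obtain w where w: "w \<in> T c" and t: "t = q c w" by auto
    have "shift (Idt C' c) w = w" using w cmp_idr[OF C'] by (auto simp: T_def sh)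
    then show "q (Dom C' (Idt C' c)) (shift (Idt C' c) t) = t"
      using La[OF Idt_hom[OF C' c] w] homD[OF Idt_hom[OF C' c]] t
        q_cong[OF sh_cong[OF Idt_hom[OF C' c] qT[OF w] w qr[OF w]]] by simp
  next
    fix a c c' t assume a: "a \<in> hom C' c c'" and "t \<in> q c' ` T c'"
    then show "q (Dom C' a) (shift a t) \<in> q c ` T c"
      using shT[OF a] qT homD[OF a] by auto
  next
    fix a b c c' c'' t assume a: "a \<in> hom C' c c'" and b: "b \<in> hom C' c' c''" and "t \<in> q c'' ` T c''"
    then obtain w where w: "w \<in> T c''" and t: "t = q c'' w" by auto
    note wq = qT[OF w]
    obtain x g p where w': "t = enc (x, enc (g, p))" and x: "x \<in> Obj C" and g: "g \<in> hom C' c'' (fobj K x)"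
        and p: "p \<in> fobj P x"
      using wq t by (auto simp: T_def)
    have "shift (b \<odot>\<^bsub>C'\<^esub> a) t = shift a (shift b t)"
      unfolding w' sh using cmp_assoc[OF C' a b g] by simp
    moreover have "q c (shift a (q c' (shift b t))) = q c (shift a (shift b t))"
      using q_cong[OF sh_cong[OF a qT[OF shT[OF b]] shT[OF b] qr[OF shT[OF b]]]] wq t by simp
    ultimately show "q (Dom C' (b \<odot>\<^bsub>C'\<^esub> a)) (shift (b \<odot>\<^bsub>C'\<^esub> a) t)
        = q (Dom C' a) (shift a (q (Dom C' b) (shift b t)))"
      using homD[OF a] homD[OF b] homD[OF cmp_hom[OF C' a b]] by simp
  qed
  define n where "n = mknt C P (restr C K L) (\<lambda>x p. q (fobj K x) (enc (x, enc (Idt C' (fobj K x), p))))"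
  note KI = Idt_hom[OF C' ftor_obj[OF K]]
  have nn: "nap n x p = q (fobj K x) (enc (x, enc (Idt C' (fobj K x), p)))" if "x \<in> Obj C" "p \<in> fobj P x"
      for x p
    unfolding n_def using that by simp
  have n: "n \<in> hom (PSh C) P (restr C K L)"
    unfolding n_def
  proof (rule mknt_hom[OF C P restr_psh[OF L]])
    fix x p assume x: "x \<in> Obj C" and p: "p \<in> fobj P x"
    show "q (fobj K x) (enc (x, enc (Idt C' (fobj K x), p))) \<in> fobj (restr C K L) x"
      using TI[OF x KI[OF x] p] x Lo[OF ftor_obj[OF K x]] by simp
  next
    fix a x y p assume a: "a \<in> hom C x y" and p: "p \<in> fobj P y"
    note o = hom_objs[OF C a] and Ka = ftor_hom[OF K a]
    have "rel (enc (x, enc (Idt C' (fobj K x), act P a p))) (enc (y, enc (farr K a, p)))"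
      unfolding rel_def v
    proof (intro allI impI)
      fix Q m assume Q: "Q \<in> Obj (PSh C')" and m: "m \<in> hom (PSh C) P (restr C K Q)"
      have "nap m x (act P a p) \<in> fobj Q (fobj K x)" using nap_in[OF m o(1) psh_act[OF P a p]] o by simp
      then show "act Q (Idt C' (fobj K x)) (nap m x (act P a p)) = act Q (farr K a) (nap m y p)"
        using psh_id[OF Q ftor_obj[OF K o(1)]] nap_comm[OF C m a p] a by simp
    qed
    then show "q (fobj K x) (enc (x, enc (Idt C' (fobj K x), act P a p))) =
        act (restr C K L) a (q (fobj K y) (enc (y, enc (Idt C' (fobj K y), p))))"
      using q_cong La[OF Ka TI[OF o(2) KI[OF o(2)] p]] a cmp_idl[OF C' Ka] by (simp add: sh)
  qed
  show ?thesis
  proof (rule that[OF L n])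
    fix c t assume c: "c \<in> Obj C'" and "t \<in> fobj L c"
    then obtain w where w: "w \<in> T c" and t: "t = q c w" using Lo by auto
    then obtain x g p where w': "w = enc (x, enc (g, p))" and x: "x \<in> Obj C"
        and g: "g \<in> hom C' c (fobj K x)" and p: "p \<in> fobj P x"
      by (auto simp: T_def)
    have "t = act L g (nap n x p)"
      unfolding t w' nn[OF x p] La[OF g TI[OF x KI[OF x] p]] sh cmp_idl[OF C' g] ..
    then show "\<exists>x g p. x \<in> Obj C \<and> g \<in> hom C' c (fobj K x) \<and> p \<in> fobj P x \<and> t = act L g (nap n x p)"
      using x g p by blast
  next
    fix Q m assume Q: "Q \<in> Obj (PSh C')" and m: "m \<in> hom (PSh C) P (restr C K Q)"
    define s where "s = mknt C' L Q (\<lambda>c t. v Q m t)"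
    have s: "s \<in> hom (PSh C') L Q"
      unfolding s_def
    proof (rule mknt_hom[OF C' L Q])
      fix c t assume c: "c \<in> Obj C'" and "t \<in> fobj L c"
      then show "v Q m t \<in> fobj Q c" using Lo vin[OF qT Q m] by auto
    next
      fix a c c' t assume a: "a \<in> hom C' c c'" and "t \<in> fobj L c'"
      then obtain w where w: "w \<in> T c'" and t: "t = q c' w" using Lo hom_objs[OF C' a] by auto
      show "v Q m (act L a t) = act Q a (v Q m t)"
        unfolding t La[OF a w] qv[OF shT[OF a w] Q m] qv[OF w Q m] shv[OF a w Q m] ..
    qed
    have "nap s (fobj K x) (nap n x p) = nap m x p" if x: "x \<in> Obj C" and p: "p \<in> fobj P x" for x p
    proof -
      have "nap n x p \<in> fobj L (fobj K x)" using nap_in[OF n x p] x by simp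
      moreover have "nap m x p \<in> fobj Q (fobj K x)" using nap_in[OF m x p] x by simp
      ultimately show ?thesis
        using qv[OF TI[OF x KI[OF x] p] Q m] nn[OF x p] ftor_obj[OF K x] psh_id[OF Q ftor_obj[OF K x]]
        by (simp add: s_def v)
    qed
    then show "\<exists>s. s \<in> hom (PSh C') L Q \<and> (\<forall>x\<in>Obj C. \<forall>p\<in>fobj P x. nap s (fobj K x) (nap n x p) = nap m x p)"
      using s by blast
  qed
qed

lemma lan_factor_iff:
  assumes s: "(L, Q, \<sigma>) \<in> hom (PSh C') L Q" and n: "(P, restr C K L, \<eta>) \<in> hom (PSh C) P (restr C K L)"
    and m: "(P, restr C K Q, \<theta>) \<in> hom (PSh C) P (restr C K Q)"
  shows "(\<forall>x\<in>Obj (opp C). \<sigma> (fobj K x) \<odot>\<^bsub>set_cat\<^esub> \<eta> x = \<theta> x) \<longleftrightarrow>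
    (\<forall>x\<in>Obj C. \<forall>p\<in>fobj P x. nap (L, Q, \<sigma>) (fobj K x) (nap (P, restr C K L, \<eta>) x p)
        = nap (P, restr C K Q, \<theta>) x p)"
proof -
  have "\<sigma> (fobj K x) \<odot>\<^bsub>set_cat\<^esub> \<eta> x = \<theta> x \<longleftrightarrow>
    (\<forall>p\<in>fobj P x. nap (L, Q, \<sigma>) (fobj K x) (nap (P, restr C K L, \<eta>) x p) = nap (P, restr C K Q, \<theta>) x p)"
    if x: "x \<in> Obj C" for x
  proof -
    have "is_nat (opp C) set_cat P (restr C K L) \<eta>" "is_nat (opp C) set_cat P (restr C K Q) \<theta>"
      "is_nat (opp C') set_cat L Q \<sigma>"
      using s n m by (auto simp: hom_PSh)
    then have "\<eta> x \<in> hom set_cat (fobj P x) (fobj L (fobj K x))" "\<theta> x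
        \<in> hom set_cat (fobj P x) (fobj Q (fobj K x))"
      "\<sigma> (fobj K x) \<in> hom set_cat (fobj L (fobj K x)) (fobj Q (fobj K x))"
      using nat_hom[of "opp C" _ _ _ _ x] nat_hom[of "opp C'" _ _ _ _ "fobj K x"] ftor_obj[OF K x] x by
          fastforce+
    then show ?thesis using set_cmp_eq_iff by (simp add: nap_def)
  qed
  then show ?thesis by auto
qed

text \<open>
  The universal property of a Kan extension with all functors and transformations read as objects
  and arrows of presheaf categories.
\<close>

lemma is_lan_psh_iff:
  "is_lan (opp C) (opp C') set_cat K P L \<eta> \<longleftrightarrow>
   L \<in> Obj (PSh C') \<and> (P, restr C K L, \<eta>) \<in> hom (PSh C) P (restr C K L) \<and>
   (\<forall>Q \<theta>. Q \<in> Obj (PSh C') \<longrightarrow> (P, restr C K Q, \<theta>) \<in> hom (PSh C) P (restr C K Q) \<longrightarrow>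
      (\<exists>!\<sigma>. (L, Q, \<sigma>) \<in> hom (PSh C') L Q \<and>
        (\<forall>x\<in>Obj (opp C). \<sigma> (fobj K x) \<odot>\<^bsub>set_cat\<^esub> \<eta> x = \<theta> x)))"
  unfolding is_lan_def by (simp add: hom_PSh Obj_PSh)

lemma lan_presheaf_is_lan:
  assumes P: "P \<in> Obj (PSh C)"
  shows "\<exists>L \<eta>. is_lan (opp C) (opp C') set_cat K P L \<eta>"
proof -
  obtain L n where L: "L \<in> Obj (PSh C')" and n: "n \<in> hom (PSh C) P (restr C K L)"
    and gen: "\<And>c t. c \<in> Obj C' \<Longrightarrow> t \<in> fobj L c \<Longrightarrow>
       \<exists>x g p. x \<in> Obj C \<and> g \<in> hom C' c (fobj K x) \<and> p \<in> fobj P x \<and> t = act L g (nap n x p)"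
    and ex: "\<And>Q m. Q \<in> Obj (PSh C') \<Longrightarrow> m \<in> hom (PSh C) P (restr C K Q) \<Longrightarrow>
       \<exists>s. s \<in> hom (PSh C') L Q \<and> (\<forall>x\<in>Obj C. \<forall>p\<in>fobj P x. nap s (fobj K x) (nap n x p) = nap m x p)"
    by (rule lan_presheaf_exists[OF P], rule that, assumption+)
  have C': "is_category C'" using sC' by (simp add: small_category_def)
  define \<eta> where "\<eta> = snd (snd n)"
  have ne: "n = (P, restr C K L, \<eta>)" unfolding \<eta>_def by (rule hom_PSh_triple[OF n])
  note nh = n[unfolded ne]
  have "is_lan (opp C) (opp C') set_cat K P L \<eta>"
    unfolding is_lan_psh_iff
  proof (intro conjI allI impI L nh)
    fix Q \<theta> assume Q: "Q \<in> Obj (PSh C')" and m: "(P, restr C K Q, \<theta>) \<in> hom (PSh C) P (restr C K Q)"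
    obtain s where s: "s \<in> hom (PSh C') L Q"
      and sn: "\<forall>x\<in>Obj C. \<forall>p\<in>fobj P x. nap s (fobj K x) (nap n x p) = nap (P, restr C K Q, \<theta>) x p"
      using ex[OF Q m] by blast
    define \<sigma> where "\<sigma> = snd (snd s)"
    have se: "s = (L, Q, \<sigma>)" unfolding \<sigma>_def by (rule hom_PSh_triple[OF s])
    show "\<exists>!\<sigma>. (L, Q, \<sigma>) \<in> hom (PSh C') L Q \<and> (\<forall>x\<in>Obj (opp C). \<sigma> (fobj K x) \<odot>\<^bsub>set_cat\<^esub> \<eta> x = \<theta> x)"
    proof (rule ex1I[of _ \<sigma>])
      show "(L, Q, \<sigma>) \<in> hom (PSh C') L Q \<and> (\<forall>x\<in>Obj (opp C). \<sigma> (fobj K x) \<odot>\<^bsub>set_cat\<^esub> \<eta> x = \<theta> x)"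
        using lan_factor_iff[OF s[unfolded se] nh m] s sn unfolding se ne by simp
      fix \<rho> assume r: "(L, Q, \<rho>) \<in> hom (PSh C') L Q \<and> (\<forall>x\<in>Obj (opp C). \<rho> (fobj K x) \<odot>\<^bsub>set_cat\<^esub> \<eta> x = \<theta> x)"
      then have rh: "(L, Q, \<rho>) \<in> hom (PSh C') L Q" by simp
      then have rn: "\<forall>x\<in>Obj C. \<forall>p\<in>fobj P x. nap (L, Q, \<rho>) (fobj K x) (nap n x p)
          = nap (P, restr C K Q, \<theta>) x p"
        using lan_factor_iff[OF rh nh m] r unfolding ne by simp
      have "(L, Q, \<rho>) = s"
      proof (rule nap_eqI[OF rh s])
        fix c t assume c: "c \<in> Obj C'" and "t \<in> fobj L c"
        then obtain x g p where x: "x \<in> Obj C" and g: "g \<in> hom C' c (fobj K x)" and p: "p \<in> fobj P x"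
            and t: "t = act L g (nap n x p)"
          using gen by blast
        have np: "nap n x p \<in> fobj L (fobj K x)" using nap_in[OF n x p] x by simp
        show "nap (L, Q, \<rho>) c t = nap s c t"
          unfolding t nap_comm[OF C' rh g np] nap_comm[OF C' s g np] using rn sn x p by simp
      qed
      then show "\<rho> = \<sigma>" using se by simp
    qed
  qed
  then show ?thesis by blast
qed

private abbreviation (input) Lan :: "'u presheaf \<Rightarrow> 'u presheaf" where
  "Lan P \<equiv> lan (opp C) (opp C') set_cat K P"

definition unit_elt :: "'u presheaf \<Rightarrow> 'u \<Rightarrow> 'u \<Rightarrow> 'u" where
  "unit_elt P x p = snd (snd (lan_unit (opp C) (opp C') set_cat K P x)) p"

lemma Lan_is_lan:
  assumes "P \<in> Obj (PSh C)"
  shows "is_lan (opp C) (opp C') set_cat K P (Lan P) (lan_unit (opp C) (opp C') set_cat K P)"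
proof -
  have "\<exists>z. is_lan (opp C) (opp C') set_cat K P (fst z) (snd z)" using lan_presheaf_is_lan[OF assms] by auto
  from someI_ex[OF this] show ?thesis unfolding lan_def lan_unit_def lan_choice_def .
qed

lemma Lan_psh: "P \<in> Obj (PSh C) \<Longrightarrow> Lan P \<in> Obj (PSh C')"
  using Lan_is_lan is_lan_psh_iff by blast

lemma lan_unit_hom:
  assumes P: "P \<in> Obj (PSh C)"
  shows "(P, restr C K (Lan P), lan_unit (opp C) (opp C') set_cat K P) \<in> hom (PSh C) P (restr C K (Lan P))"
  using Lan_is_lan[OF P] is_lan_psh_iff by blast

lemma unit_in:
  assumes P: "P \<in> Obj (PSh C)" and x: "x \<in> Obj C" and p: "p \<in> fobj P x"
  shows "unit_elt P x p \<in> fobj (Lan P) (fobj K x)"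
  using nap_in[OF lan_unit_hom[OF P] x p] x by (simp add: nap_def unit_elt_def)

lemma unit_comm:
  assumes P: "P \<in> Obj (PSh C)" and a: "a \<in> hom C x y" and p: "p \<in> fobj P y"
  shows "unit_elt P x (act P a p) = act (Lan P) (farr K a) (unit_elt P y p)"
  using nap_comm[OF _ lan_unit_hom[OF P] a p] a sC by (simp add: nap_def unit_elt_def small_category_def)

lemma lan_unit_eq:
  assumes P: "P \<in> Obj (PSh C)" and x: "x \<in> Obj C"
  shows "lan_unit (opp C) (opp C') set_cat K P x =
    (fobj P x, fobj (Lan P) (fobj K x), \<lambda>p\<in>fobj P x. unit_elt P x p)"
proof -
  have "is_nat (opp C) set_cat P (restr C K (Lan P)) (lan_unit (opp C) (opp C') set_cat K P)"
    using lan_unit_hom[OF P] by (simp add: hom_PSh)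
  then have "lan_unit (opp C) (opp C') set_cat K P x \<in> hom set_cat (fobj P x) (fobj (Lan P) (fobj K x))"
    using nat_hom[of "opp C" set_cat P "restr C K (Lan P)" _ x] x by simp
  then obtain f where f: "lan_unit (opp C) (opp C') set_cat K P x = (fobj P x, fobj (Lan P) (fobj K x), f)"
    and "f \<in> fobj P x \<rightarrow>\<^sub>E fobj (Lan P) (fobj K x)" by (auto simp: hom_set_cat)
  then have "f = (\<lambda>p\<in>fobj P x. unit_elt P x p)"
    by (intro extensionalityI[of _ "fobj P x"]) (auto simp: unit_elt_def PiE_def)
  then show ?thesis using f by simp
qed

private lemma C: "is_category C" and C': "is_category C'"
  using sC sC' by (auto simp: small_category_def)

text \<open>
  Transposition along the adjunction between Kan extension and restriction.
\<close>

lemma lan_transpose_hom: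
  assumes P: "P \<in> Obj (PSh C)" and m: "m \<in> hom (PSh C') (Lan P) Q"
  shows "mknt C P (restr C K Q) (\<lambda>x p. nap m (fobj K x) (unit_elt P x p)) \<in> hom (PSh C) P (restr C K Q)"
proof (rule mknt_hom[OF C P restr_psh])
  show "Q \<in> Obj (PSh C')" by (rule hom_PSh_obj(2)[OF C' m])
  fix x p assume x: "x \<in> Obj C" and p: "p \<in> fobj P x"
  show "nap m (fobj K x) (unit_elt P x p) \<in> fobj (restr C K Q) x"
    using nap_in[OF m ftor_obj[OF K x] unit_in[OF P x p]] x by simp
next
  fix a x y p assume a: "a \<in> hom C x y" and p: "p \<in> fobj P y"
  show "nap m (fobj K x) (unit_elt P x (act P a p))
      = act (restr C K Q) a (nap m (fobj K y) (unit_elt P y p))"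
    using nap_comm[OF C' m ftor_hom[OF K a] unit_in[OF P hom_objs(2)[OF C a] p]] unit_comm[OF P a p] a by
        simp
qed

text \<open>
  The elements \<open>unit_elt P x p\<close> generate the Kan extension; all equations between maps out of a
  Kan extension are checked on them.
\<close>

lemma Lan_eqI:
  assumes P: "P \<in> Obj (PSh C)" and m: "m \<in> hom (PSh C') (Lan P) Q" and n: "n \<in> hom (PSh C') (Lan P) Q"
    and eq: "\<And>x p. x \<in> Obj C \<Longrightarrow> p \<in> fobj P x \<Longrightarrow> nap m (fobj K x) (unit_elt P x p)
        = nap n (fobj K x) (unit_elt P x p)"
  shows "m = n"
proof -
  have Q: "Q \<in> Obj (PSh C')" by (rule hom_PSh_obj(2)[OF C' m])
  let ?h = "lan_unit (opp C) (opp C') set_cat K P"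
  note h = lan_unit_hom[OF P]
  have nh: "nap (P, restr C K (Lan P), ?h) x p = unit_elt P x p" for x p by (simp add: nap_def unit_elt_def)
  define \<theta> where "\<theta> = (\<lambda>x\<in>Obj C. (fobj P x, fobj (restr C K Q) x, \<lambda>p\<in>fobj P x. nap m (fobj K x)
      (unit_elt P x p)))"
  have mk: "(P, restr C K Q, \<theta>) = mknt C P (restr C K Q) (\<lambda>x p. nap m (fobj K x) (unit_elt P x p))"
    by (simp add: mknt_def \<theta>_def)
  have t: "(P, restr C K Q, \<theta>) \<in> hom (PSh C) P (restr C K Q)"
    unfolding mk by (rule lan_transpose_hom[OF P m])
  have tn: "nap (P, restr C K Q, \<theta>) x p = nap m (fobj K x) (unit_elt P x p)"
    if "x \<in> Obj C" "p \<in> fobj P x" for x p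
    unfolding mk using that by simp
  define A where "A \<sigma> \<longleftrightarrow> (Lan P, Q, \<sigma>) \<in> hom (PSh C') (Lan P) Q \<and>
     (\<forall>x\<in>Obj (opp C). \<sigma> (fobj K x) \<odot>\<^bsub>set_cat\<^esub> ?h x = \<theta> x)" for \<sigma>
  have "\<exists>!\<sigma>. A \<sigma>"
    using Lan_is_lan[OF P] Q t unfolding is_lan_psh_iff A_def by blast
  then obtain \<sigma> where uniq: "\<And>\<rho>. A \<rho> \<Longrightarrow> \<rho> = \<sigma>" by (elim ex1E) blast
  have A: "A (snd (snd k))"
    if k: "k \<in> hom (PSh C') (Lan P) Q"
      and kt: "\<And>x p. x \<in> Obj C \<Longrightarrow> p \<in> fobj P x \<Longrightarrow>
          nap k (fobj K x) (unit_elt P x p) = nap m (fobj K x) (unit_elt P x p)" for k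
  proof -
    have k': "(Lan P, Q, snd (snd k)) = k" by (rule hom_PSh_triple[OF k, symmetric])
    have kh: "(Lan P, Q, snd (snd k)) \<in> hom (PSh C') (Lan P) Q" using k k' by (rule ssubst[rotated])
    have "nap (Lan P, Q, snd (snd k)) (fobj K x) (nap (P, restr C K (Lan P), ?h) x p)
        = nap (P, restr C K Q, \<theta>) x p"
      if "x \<in> Obj C" "p \<in> fobj P x" for x p
      using kt[OF that] tn[OF that] nh k' by metis
    then show ?thesis unfolding A_def using lan_factor_iff[OF kh h t] kh by blast
  qed
  have "A (snd (snd m))" by (rule A[OF m]) (rule refl)
  moreover have "A (snd (snd n))" by (rule A[OF n]) (rule eq[symmetric])
  ultimately have mn: "snd (snd m) = snd (snd n)" using uniq by metis
  show ?thesis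
    by (rule trans[OF hom_PSh_triple[OF m] trans[OF _ hom_PSh_triple[OF n, symmetric]]]) (simp only: mn)
qed

lemma lan_desc_hom:
  assumes P: "P \<in> Obj (PSh C)" and Q: "Q \<in> Obj (PSh C')"
    and t: "(P, restr C K Q, \<theta>) \<in> hom (PSh C) P (restr C K Q)"
  shows "(Lan P, Q, lan_desc (opp C) (opp C') set_cat K P Q \<theta>) \<in> hom (PSh C') (Lan P) Q"
    and "x \<in> Obj C \<Longrightarrow> p \<in> fobj P x \<Longrightarrow>
      nap (Lan P, Q, lan_desc (opp C) (opp C') set_cat K P Q \<theta>) (fobj K x) (unit_elt P x p)
          = snd (snd (\<theta> x)) p"
proof -
  let ?h = "lan_unit (opp C) (opp C') set_cat K P"
  have "\<exists>!\<sigma>. (Lan P, Q, \<sigma>) \<in> hom (PSh C') (Lan P) Q \<and> (\<forall>x\<in>Obj (opp C). \<sigma> (fobj K x) \<odot>\<^bsub>set_cat\<^esub> ?h x = \<theta> x)"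
    using Lan_is_lan[OF P] Q t unfolding is_lan_psh_iff by blast
  from theI'[OF this] have d: "(Lan P, Q, lan_desc (opp C) (opp C') set_cat K P Q \<theta>)
      \<in> hom (PSh C') (Lan P) Q"
    and f: "\<forall>x\<in>Obj (opp C). lan_desc (opp C) (opp C') set_cat K P Q \<theta> (fobj K x) \<odot>\<^bsub>set_cat\<^esub> ?h x = \<theta> x"
    by (auto simp: lan_desc_def hom_PSh)
  show "(Lan P, Q, lan_desc (opp C) (opp C') set_cat K P Q \<theta>) \<in> hom (PSh C') (Lan P) Q" by (rule d)
  show "nap (Lan P, Q, lan_desc (opp C) (opp C') set_cat K P Q \<theta>) (fobj K x) (unit_elt P x p)
      = snd (snd (\<theta> x)) p"
    if "x \<in> Obj C" "p \<in> fobj P x"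
    using lan_factor_iff[OF d lan_unit_hom[OF P] t] f that by (simp add: nap_def unit_elt_def)
qed

lemma lan_transpose_ex:
  assumes P: "P \<in> Obj (PSh C)" and Q: "Q \<in> Obj (PSh C')" and m: "m \<in> hom (PSh C) P (restr C K Q)"
  obtains s where "s \<in> hom (PSh C') (Lan P) Q"
    "\<And>x p. x \<in> Obj C \<Longrightarrow> p \<in> fobj P x \<Longrightarrow> nap s (fobj K x) (unit_elt P x p) = nap m x p"
proof -
  have m': "(P, restr C K Q, snd (snd m)) \<in> hom (PSh C) P (restr C K Q)"
    using hom_PSh_triple[OF m] m by (rule subst)
  show ?thesis
  proof (rule that[OF lan_desc_hom(1)[OF P Q m']])
    show "nap (Lan P, Q, lan_desc (opp C) (opp C') set_cat K P Q (snd (snd m))) (fobj K x) (unit_elt P x p)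
        = nap m x p"
      if "x \<in> Obj C" "p \<in> fobj P x" for x p
      unfolding lan_desc_hom(2)[OF P Q m' that] by (simp add: nap_def)
  qed
qed

text \<open>
  The form in which maps out of a Kan extension are constructed: a natural assignment \<open>t\<close> on
  elements induces a map with prescribed values on the generators.
\<close>

lemma lan_desc_elt:
  assumes P: "P \<in> Obj (PSh C)" and Q: "Q \<in> Obj (PSh C')"
    and \<theta>: "\<theta> \<in> extensional (Obj C)" "\<And>x. x \<in> Obj C \<Longrightarrow>
        \<theta> x = (fobj P x, fobj Q (fobj K x), \<lambda>p\<in>fobj P x. t x p)"
    and t: "\<And>x p. x \<in> Obj C \<Longrightarrow> p \<in> fobj P x \<Longrightarrow> t x p \<in> fobj Q (fobj K x)"
    and n: "\<And>a x y p. a \<in> hom C x y \<Longrightarrow> p \<in> fobj P y \<Longrightarrow> t x (act P a p) = act Q (farr K a) (t y p)"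
  shows "(Lan P, Q, lan_desc (opp C) (opp C') set_cat K P Q \<theta>) \<in> hom (PSh C') (Lan P) Q"
    and "x \<in> Obj C \<Longrightarrow> p \<in> fobj P x \<Longrightarrow>
      nap (Lan P, Q, lan_desc (opp C) (opp C') set_cat K P Q \<theta>) (fobj K x) (unit_elt P x p) = t x p"
proof -
  have "\<theta> = (\<lambda>x\<in>Obj C. (fobj P x, fobj (restr C K Q) x, \<lambda>p\<in>fobj P x. t x p))"
    by (rule extensionalityI[OF \<theta>(1)]) (use \<theta>(2) in auto)
  then have eq: "(P, restr C K Q, \<theta>) = mknt C P (restr C K Q) t" by (simp add: mknt_def)
  have m: "(P, restr C K Q, \<theta>) \<in> hom (PSh C) P (restr C K Q)"
    unfolding eq by (rule mknt_hom[OF C P restr_psh[OF Q]]) (use t n in auto)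
  show "(Lan P, Q, lan_desc (opp C) (opp C') set_cat K P Q \<theta>) \<in> hom (PSh C') (Lan P) Q"
    by (rule lan_desc_hom(1)[OF P Q m])
  show "nap (Lan P, Q, lan_desc (opp C) (opp C') set_cat K P Q \<theta>) (fobj K x) (unit_elt P x p) = t x p"
    if "x \<in> Obj C" "p \<in> fobj P x"
    using lan_desc_hom(2)[OF P Q m that] \<theta>(2)[OF that(1)] that by simp
qed

subsection \<open>The functor on presheaf categories\<close>

private abbreviation (input) "L \<equiv> lan_ftor (opp C) (opp C') set_cat K"

lemma fobj_lan_ftor: "P \<in> Obj (PSh C) \<Longrightarrow> fobj L P = Lan P"
  by (simp add: lan_ftor_def PSh_def)

lemma lan_ftor_arr:
  assumes m: "m \<in> hom (PSh C) P Q"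
  shows "farr L m \<in> hom (PSh C') (Lan P) (Lan Q)"
    and "x \<in> Obj C \<Longrightarrow> p \<in> fobj P x \<Longrightarrow> nap (farr L m) (fobj K x) (unit_elt P x p) = unit_elt Q x (nap m x p)"
proof -
  note PQ = hom_PSh_obj[OF C m]
  obtain \<tau> where m': "m = (P, Q, \<tau>)" and t: "is_nat (opp C) set_cat P Q \<tau>" using m by (auto simp: hom_PSh)
  let ?\<theta> = "\<lambda>x\<in>Obj (opp C). lan_unit (opp C) (opp C') set_cat K Q x \<odot>\<^bsub>set_cat\<^esub> \<tau> x"
  have eq: "farr L m = (Lan P, Lan Q, lan_desc (opp C) (opp C') set_cat K P (Lan Q) ?\<theta>)"
    using homD(1)[OF m] by (simp add: lan_ftor_def PSh_def m')
  have th: "?\<theta> x = (fobj P x, fobj (Lan Q) (fobj K x), \<lambda>p\<in>fobj P x. unit_elt Q x (nap m x p))"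
    if x: "x \<in> Obj C" for x
  proof -
    obtain f where f: "\<tau> x = (fobj P x, fobj Q x, f)" "f \<in> fobj P x \<rightarrow>\<^sub>E fobj Q x"
      using nat_hom[OF t, of x] x by (auto simp: hom_set_cat)
    then show ?thesis
      using lan_unit_eq[OF PQ(2) x] x by (auto simp: compose_def nap_def m' intro!: restrict_ext)
  qed
  have tin: "unit_elt Q x (nap m x p) \<in> fobj (Lan Q) (fobj K x)" if "x \<in> Obj C" "p \<in> fobj P x" for x p
    by (rule unit_in[OF PQ(2) that(1) nap_in[OF m that]])
  have tn: "unit_elt Q x (nap m x (act P a p)) = act (Lan Q) (farr K a) (unit_elt Q y (nap m y p))"
    if "a \<in> hom C x y" "p \<in> fobj P y" for a x y p
    using nap_comm[OF C m that] unit_comm[OF PQ(2) that(1) nap_in[OF m hom_objs(2)[OF C that(1)] that(2)]]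
        by simp
  have ext: "?\<theta> \<in> extensional (Obj C)" by simp
  show "farr L m \<in> hom (PSh C') (Lan P) (Lan Q)"
    unfolding eq by (rule lan_desc_elt(1)[OF PQ(1) Lan_psh[OF PQ(2)] ext th tin tn])
  show "nap (farr L m) (fobj K x) (unit_elt P x p) = unit_elt Q x (nap m x p)" if "x \<in> Obj C" "p \<in> fobj P x"
    unfolding eq by (rule lan_desc_elt(2)[OF PQ(1) Lan_psh[OF PQ(2)] ext th tin tn that])
qed

lemma lan_ftor_functor: "is_functor (PSh C) (PSh C') L"
proof -
  note PC = PSh_category[OF C] and PC' = PSh_category[OF C']
  show ?thesis
  proof (rule is_functorI[OF PC])
    show "fobj L \<in> extensional (Obj (PSh C))" "farr L \<in> extensional (Arr (PSh C))"
      by (simp_all add: lan_ftor_def PSh_def)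
    fix P assume P: "P \<in> Obj (PSh C)"
    show "fobj L P \<in> Obj (PSh C')" using fobj_lan_ftor[OF P] Lan_psh[OF P] by simp
    note i = Idt_hom[OF PC P]
    have "farr L (Idt (PSh C) P) = Idt (PSh C') (Lan P)"
    proof (rule Lan_eqI[OF P lan_ftor_arr(1)[OF i] Idt_hom[OF PC' Lan_psh[OF P]]])
      fix x p assume x: "x \<in> Obj C" and p: "p \<in> fobj P x"
      show "nap (farr L (Idt (PSh C) P)) (fobj K x) (unit_elt P x p)
          = nap (Idt (PSh C') (Lan P)) (fobj K x) (unit_elt P x p)"
        unfolding lan_ftor_arr(2)[OF i x p] nap_Idt[OF x p] nap_Idt[OF ftor_obj[OF K x] unit_in[OF P x p]]
            ..
    qed
    then show "farr L (Idt (PSh C) P) = Idt (PSh C') (fobj L P)" using fobj_lan_ftor[OF P] by simp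
  next
    fix m P Q assume m: "m \<in> hom (PSh C) P Q"
    note PQ = hom_PSh_obj[OF C m] and Lm = lan_ftor_arr(1)[OF m]
    show "farr L m \<in> hom (PSh C') (fobj L P) (fobj L Q)"
      using Lm fobj_lan_ftor PQ by simp
    fix n R assume n: "n \<in> hom (PSh C) Q R"
    note nm = cmp_hom[OF PC m n] and Ln = lan_ftor_arr(1)[OF n]
    show "farr L (n \<odot>\<^bsub>PSh C\<^esub> m) = farr L n \<odot>\<^bsub>PSh C'\<^esub> farr L m"
    proof (rule Lan_eqI[OF PQ(1) lan_ftor_arr(1)[OF nm] cmp_hom[OF PC' Lm Ln]])
      fix x p assume x: "x \<in> Obj C" and p: "p \<in> fobj P x"
      show "nap (farr L (n \<odot>\<^bsub>PSh C\<^esub> m)) (fobj K x) (unit_elt P x p) =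
        nap (farr L n \<odot>\<^bsub>PSh C'\<^esub> farr L m) (fobj K x) (unit_elt P x p)"
        unfolding lan_ftor_arr(2)[OF nm x p] nap_cmp[OF m n x p]
          nap_cmp[OF Lm Ln ftor_obj[OF K x] unit_in[OF PQ(1) x p]] lan_ftor_arr(2)[OF m x p]
          lan_ftor_arr(2)[OF n x nap_in[OF m x p]] ..
    qed
  qed
qed

text \<open>
  Left Kan extension is left adjoint to restriction.  A cocone under the image of a diagram
  transposes to a cocone with vertex \<open>restr C K Q\<close>, and the induced map transposes back.
\<close>

lemma lan_ftor_cocontinuous: "cocontinuous TYPE('u) (PSh C) (PSh C') L"
  unfolding cocontinuous_def
proof (intro conjI allI impI lan_ftor_functor)
  fix J :: "('u, 'u) cat" and D P \<iota>
  assume sJ: "small_category J" and D: "is_functor J (PSh C) D" and col: "is_colimit J (PSh C) D P \<iota>"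
  note PC = PSh_category[OF C] and PC' = PSh_category[OF C']
  have J: "is_category J" using sJ by (simp add: small_category_def)
  have P: "P \<in> Obj (PSh C)" and cone: "is_cocone J (PSh C) D P \<iota>" using col
      by (auto simp: is_colimit_def is_cocone_def)
  note i = colimit_PSh_inj[OF U sC sJ D col] and Do = ftor_obj[OF D]
  show "is_colimit J (PSh C') (comp_ftor J L D) (fobj L P) (\<lambda>j. farr L (\<iota> j))"
    unfolding is_colimit_def
  proof (intro conjI allI impI ftor_cocone[OF J D lan_ftor_functor cone])
    fix Q \<kappa> assume dk: "is_cocone J (PSh C') (comp_ftor J L D) Q \<kappa>"
    have Q: "Q \<in> Obj (PSh C')" using dk by (simp add: is_cocone_def)
    have kap: "\<kappa> j \<in> hom (PSh C') (Lan (fobj D j)) Q" if j: "j \<in> Obj J" for j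
      using dk j fobj_lan_ftor[OF Do[OF j]] by (auto simp: is_cocone_def)
    have kapc: "\<kappa> j \<odot>\<^bsub>PSh C'\<^esub> farr L (farr D e) = \<kappa> i" if e: "e \<in> hom J i j" for e i j
      using dk homD[OF e] by (auto simp: is_cocone_def)
    define \<mu> where "\<mu> j = mknt C (fobj D j) (restr C K Q)
        (\<lambda>x p. nap (\<kappa> j) (fobj K x) (unit_elt (fobj D j) x p))" for j
    have mu: "\<mu> j \<in> hom (PSh C) (fobj D j) (restr C K Q)" if j: "j \<in> Obj J" for j
      unfolding \<mu>_def by (rule lan_transpose_hom[OF Do[OF j] kap[OF j]])
    have mun: "nap (\<mu> j) x q = nap (\<kappa> j) (fobj K x) (unit_elt (fobj D j) x q)"
      if "x \<in> Obj C" "q \<in> fobj (fobj D j) x" for j x q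
      unfolding \<mu>_def using that by simp
    have "is_cocone J (PSh C) D (restr C K Q) \<mu>"
      unfolding is_cocone_def
    proof (intro conjI ballI mu restr_psh[OF Q])
      fix e assume e: "e \<in> Arr J"
      then have eh: "e \<in> hom J (Dom J e) (Cod J e)" by (simp add: hom_def)
      note o = hom_objs[OF J eh] and De = ftor_hom[OF D eh]
      show "\<mu> (Cod J e) \<odot>\<^bsub>PSh C\<^esub> farr D e = \<mu> (Dom J e)"
      proof (rule nap_eqI[OF cmp_hom[OF PC De mu[OF o(2)]] mu[OF o(1)]])
        fix x q assume x: "x \<in> Obj C" and q: "q \<in> fobj (fobj D (Dom J e)) x"
        show "nap (\<mu> (Cod J e) \<odot>\<^bsub>PSh C\<^esub> farr D e) x q = nap (\<mu> (Dom J e)) x q"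
          unfolding nap_cmp[OF De mu[OF o(2)] x q] mun[OF x q] mun[OF x nap_in[OF De x q]]
            lan_ftor_arr(2)[OF De x q, symmetric] kapc[OF eh, symmetric]
            nap_cmp[OF lan_ftor_arr(1)[OF De] kap[OF o(2)] ftor_obj[OF K x] unit_in[OF Do[OF o(1)] x q]] ..
      qed
    qed
    then obtain m where m: "m \<in> hom (PSh C) P (restr C K Q)" and mi: "\<And>j. j \<in> Obj J \<Longrightarrow> m \<odot>\<^bsub>PSh C\<^esub> \<iota> j = \<mu> j"
      using col unfolding is_colimit_def by metis
    obtain s where s: "s \<in> hom (PSh C') (Lan P) Q"
      and sn: "\<And>x p. x \<in> Obj C \<Longrightarrow> p \<in> fobj P x \<Longrightarrow> nap s (fobj K x) (unit_elt P x p) = nap m x p"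
      using lan_transpose_ex[OF P Q m] by metis
    have Li: "nap (r \<odot>\<^bsub>PSh C'\<^esub> farr L (\<iota> j)) (fobj K x) (unit_elt (fobj D j) x q)
        = nap r (fobj K x) (unit_elt P x (nap (\<iota> j) x q))"
      if r: "r \<in> hom (PSh C') (Lan P) Q" and j: "j \<in> Obj J" and x: "x \<in> Obj C"
          and q: "q \<in> fobj (fobj D j) x" for r j x q
      unfolding nap_cmp[OF lan_ftor_arr(1)[OF i[OF j]] r ftor_obj[OF K x] unit_in[OF Do[OF j] x q]]
        lan_ftor_arr(2)[OF i[OF j] x q] ..
    have sk: "s \<odot>\<^bsub>PSh C'\<^esub> farr L (\<iota> j) = \<kappa> j" if j: "j \<in> Obj J" for j
    proof (rule Lan_eqI[OF Do[OF j] cmp_hom[OF PC' lan_ftor_arr(1)[OF i[OF j]] s] kap[OF j]])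
      fix x q assume x: "x \<in> Obj C" and q: "q \<in> fobj (fobj D j) x"
      show "nap (s \<odot>\<^bsub>PSh C'\<^esub> farr L (\<iota> j)) (fobj K x) (unit_elt (fobj D j) x q)
          = nap (\<kappa> j) (fobj K x) (unit_elt (fobj D j) x q)"
        unfolding Li[OF s j x q] sn[OF x nap_in[OF i[OF j] x q]] nap_cmp[OF i[OF j] m x q, symmetric]
            mi[OF j]
        by (rule mun[OF x q])
    qed
    show "\<exists>!h. h \<in> hom (PSh C') (fobj L P) Q \<and> (\<forall>j\<in>Obj J. h \<odot>\<^bsub>PSh C'\<^esub> farr L (\<iota> j) = \<kappa> j)"
      unfolding fobj_lan_ftor[OF P]
    proof (rule ex1I[of _ s])
      show "s \<in> hom (PSh C') (Lan P) Q \<and> (\<forall>j\<in>Obj J. s \<odot>\<^bsub>PSh C'\<^esub> farr L (\<iota> j) = \<kappa> j)" using s sk by blast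
      fix r assume "r \<in> hom (PSh C') (Lan P) Q \<and> (\<forall>j\<in>Obj J. r \<odot>\<^bsub>PSh C'\<^esub> farr L (\<iota> j) = \<kappa> j)"
      then have r: "r \<in> hom (PSh C') (Lan P) Q"
          and rk: "\<And>j. j \<in> Obj J \<Longrightarrow> r \<odot>\<^bsub>PSh C'\<^esub> farr L (\<iota> j) = \<kappa> j" by auto
      show "r = s"
      proof (rule Lan_eqI[OF P r s])
        fix x p assume x: "x \<in> Obj C" and p: "p \<in> fobj P x"
        obtain j q where j: "j \<in> Obj J" and q: "q \<in> fobj (fobj D j) x" and p': "p = nap (\<iota> j) x q"
          using colimit_PSh_surj[OF U sC sJ D col x p] by metis
        show "nap r (fobj K x) (unit_elt P x p) = nap s (fobj K x) (unit_elt P x p)"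
          unfolding p' Li[OF r j x q, symmetric] Li[OF s j x q, symmetric] rk[OF j] sk[OF j] ..
      qed
    qed
  qed
qed

text \<open>
  The map \<open>g \<mapsto> K g\<close> from the Kan extension of the presheaf represented by \<open>e\<close> to the one
  represented by \<open>K e\<close>.
\<close>

definition coyoneda_arr :: "'u \<Rightarrow> 'u presheaf_arr" where
  "coyoneda_arr e = (Lan (hom_psh C e), hom_psh C' (fobj K e),
     lan_desc (opp C) (opp C') set_cat K (hom_psh C e) (hom_psh C' (fobj K e))
       (\<lambda>x\<in>Obj C. (hom C x e, hom C' (fobj K x) (fobj K e), \<lambda>g\<in>hom C x e. farr K g)))"

lemma coyoneda_arr:
  shows "coyoneda_arr e \<in> hom (PSh C') (Lan (hom_psh C e)) (hom_psh C' (fobj K e))"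
    and "g \<in> hom C x e \<Longrightarrow> nap (coyoneda_arr e) (fobj K x) (unit_elt (hom_psh C e) x g) = farr K g"
proof -
  note P = hom_psh_psh[OF sC] and Q = hom_psh_psh[OF sC']
  let ?\<theta> = "\<lambda>x\<in>Obj C. (hom C x e, hom C' (fobj K x) (fobj K e), \<lambda>g\<in>hom C x e. farr K g)"
  have ext: "?\<theta> \<in> extensional (Obj C)" by simp
  have th: "?\<theta> x = (fobj (hom_psh C e) x, fobj (hom_psh C' (fobj K e)) (fobj K x), \<lambda>g\<in>fobj (hom_psh C e) x.
      farr K g)"
    if "x \<in> Obj C" for x using that ftor_obj[OF K that] by simp
  have tin: "farr K g \<in> fobj (hom_psh C' (fobj K e)) (fobj K x)" if "x \<in> Obj C" "g \<in> fobj (hom_psh C e) x"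
      for x g
    using that ftor_obj[OF K that(1)] ftor_hom[OF K] by simp
  have tn: "farr K (act (hom_psh C e) a g) = act (hom_psh C' (fobj K e)) (farr K a) (farr K g)"
    if a: "a \<in> hom C x y" and "g \<in> fobj (hom_psh C e) y" for a x y g
  proof -
    have g: "g \<in> hom C y e" using that hom_objs[OF C a] by simp
    show ?thesis
      unfolding act_hom_psh[OF a g] act_hom_psh[OF ftor_hom[OF K a] ftor_hom[OF K g]]
          by (rule ftor_cmp[OF K a g])
  qed
  show "coyoneda_arr e \<in> hom (PSh C') (Lan (hom_psh C e)) (hom_psh C' (fobj K e))"
    unfolding coyoneda_arr_def by (rule lan_desc_elt(1)[OF P Q ext th tin tn])
  show "nap (coyoneda_arr e) (fobj K x) (unit_elt (hom_psh C e) x g) = farr K g" if "g \<in> hom C x e"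
    unfolding coyoneda_arr_def
    by (rule lan_desc_elt(2)[OF P Q ext th tin tn]) (use that hom_objs[OF C that] in auto)
qed

text \<open>
  The inverse classifies the element \<open>unit_elt (hom_psh C e) e (Idt C e)\<close> under the Yoneda
  lemma.  One composite is checked on generators of the Kan extension, the other at an identity.
\<close>

lemma coyoneda_iso:
  assumes e: "e \<in> Obj C"
  shows "is_iso (PSh C') (coyoneda_arr e)"
proof (rule isoI[OF coyoneda_arr(1)])
  note P = hom_psh_psh[OF sC] and Q = hom_psh_psh[OF sC'] and PC' = PSh_category[OF C']
  note Ke = ftor_obj[OF K e]
  have i: "Idt C e \<in> fobj (hom_psh C e) e" using e Idt_hom[OF C e] by simp
  let ?p = "unit_elt (hom_psh C e) e (Idt C e)"
  have p: "?p \<in> fobj (Lan (hom_psh C e)) (fobj K e)" by (rule unit_in[OF P e i])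
  let ?s = "yelt C' (Lan (hom_psh C e)) (fobj K e) ?p"
  show s: "?s \<in> hom (PSh C') (hom_psh C' (fobj K e)) (Lan (hom_psh C e))"
    by (rule yelt_hom[OF sC' Lan_psh[OF P] Ke p])
  show "?s \<odot>\<^bsub>PSh C'\<^esub> coyoneda_arr e = Idt (PSh C') (Lan (hom_psh C e))"
  proof (rule Lan_eqI[OF P cmp_hom[OF PC' coyoneda_arr(1) s] Idt_hom[OF PC' Lan_psh[OF P]]])
    fix x g assume x: "x \<in> Obj C" and g': "g \<in> fobj (hom_psh C e) x"
    then have g: "g \<in> hom C x e" by simp
    note Kx = ftor_obj[OF K x] and ug = unit_in[OF P x g']
    have "act (hom_psh C e) g (Idt C e) = g" using act_hom_psh[OF g Idt_hom[OF C e]] cmp_idl[OF C g] by simp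
    then show "nap (?s \<odot>\<^bsub>PSh C'\<^esub> coyoneda_arr e) (fobj K x) (unit_elt (hom_psh C e) x g) =
       nap (Idt (PSh C') (Lan (hom_psh C e))) (fobj K x) (unit_elt (hom_psh C e) x g)"
      unfolding nap_cmp[OF coyoneda_arr(1) s Kx ug] nap_Idt[OF Kx ug] coyoneda_arr(2)[OF g]
        nap_yelt[OF C' ftor_hom[OF K g]] using unit_comm[OF P g i] by simp
  qed
  show "coyoneda_arr e \<odot>\<^bsub>PSh C'\<^esub> ?s = Idt (PSh C') (hom_psh C' (fobj K e))"
  proof (rule hom_psh_eqI[OF sC' Ke cmp_hom[OF PC' s coyoneda_arr(1)] Idt_hom[OF PC' Q]])
    note I = Idt_hom[OF C' Ke]
    have I': "Idt C' (fobj K e) \<in> fobj (hom_psh C' (fobj K e)) (fobj K e)" using I Ke by simp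
    show "nap (coyoneda_arr e \<odot>\<^bsub>PSh C'\<^esub> ?s) (fobj K e) (Idt C' (fobj K e)) =
      nap (Idt (PSh C') (hom_psh C' (fobj K e))) (fobj K e) (Idt C' (fobj K e))"
      unfolding nap_cmp[OF s coyoneda_arr(1) Ke I'] nap_Idt[OF Ke I'] nap_yelt[OF C' I]
          psh_id[OF Lan_psh[OF P] Ke p]
        coyoneda_arr(2)[OF Idt_hom[OF C e]] by (rule ftor_id[OF K e])
  qed
qed

lemma coyoneda_natural:
  assumes h: "h \<in> hom C e e'"
  shows "coyoneda_arr e' \<odot>\<^bsub>PSh C'\<^esub> farr L (farr (yoneda C) h) =
         farr (yoneda C') (farr K h) \<odot>\<^bsub>PSh C'\<^esub> coyoneda_arr e"
proof -
  note P = hom_psh_psh[OF sC] and PC' = PSh_category[OF C'] and o = hom_objs[OF C h]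
      and Kh = ftor_hom[OF K h]
  have yh: "farr (yoneda C) h \<in> hom (PSh C) (hom_psh C e) (hom_psh C e')"
    using ftor_hom[OF yoneda_functor[OF sC] h] o by simp
  have yKh: "farr (yoneda C') (farr K h) \<in> hom (PSh C') (hom_psh C' (fobj K e)) (hom_psh C' (fobj K e'))"
    using ftor_hom[OF yoneda_functor[OF sC'] Kh] o ftor_obj[OF K] by simp
  note Lh = lan_ftor_arr(1)[OF yh]
  show ?thesis
  proof (rule Lan_eqI[OF P cmp_hom[OF PC' Lh coyoneda_arr(1)] cmp_hom[OF PC' coyoneda_arr(1) yKh]])
    fix x g assume x: "x \<in> Obj C" and g': "g \<in> fobj (hom_psh C e) x"
    then have g: "g \<in> hom C x e" by simp
    note Kx = ftor_obj[OF K x] and ug = unit_in[OF P x g']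
    show "nap (coyoneda_arr e' \<odot>\<^bsub>PSh C'\<^esub> farr L (farr (yoneda C) h)) (fobj K x) (unit_elt (hom_psh C e) x g) =
      nap (farr (yoneda C') (farr K h) \<odot>\<^bsub>PSh C'\<^esub> coyoneda_arr e) (fobj K x) (unit_elt (hom_psh C e) x g)"
      unfolding nap_cmp[OF Lh coyoneda_arr(1) Kx ug] lan_ftor_arr(2)[OF yh x g'] nap_yoneda[OF C h g]
        nap_cmp[OF coyoneda_arr(1) yKh Kx ug] coyoneda_arr(2)[OF g] coyoneda_arr(2)[OF cmp_hom[OF C g h]]
        nap_yoneda[OF C' Kh ftor_hom[OF K g]]
      by (rule ftor_cmp[OF K g h])
  qed
qed

end

section \<open>The fibrewise presheaf completion\<close>

lemma cmp_arr:
  assumes "is_category B" "u \<in> Arr B" "v \<in> Arr B" "Dom B u = Cod B v"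
  shows "u \<odot>\<^bsub>B\<^esub> v \<in> Arr B" "Dom B (u \<odot>\<^bsub>B\<^esub> v) = Dom B v" "Cod B (u \<odot>\<^bsub>B\<^esub> v) = Cod B u"
  using homD[OF cmp_hom[OF assms(1) homI[OF assms(3) refl assms(4)[symmetric]] homI[OF assms(2) refl refl]]]
      by auto

lemma Idt_arr:
  assumes "is_category B" "b \<in> Obj B"
  shows "Idt B b \<in> Arr B" "Dom B (Idt B b) = b" "Cod B (Idt B b) = b"
  using homD[OF Idt_hom[OF assms]] by auto

text \<open>
  Fibres, reindexing functors and natural comparison cells.  Precomposition and whiskering are
  formulated on this level, where the naturality of the cells enters.
\<close>

definition lax_data :: "('b, 'v) cat \<Rightarrow> ('b, 'v, 'o, 'm) psf \<Rightarrow> bool" where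
  "lax_data B P \<longleftrightarrow> fibre_data B P \<and>
     (\<forall>u\<in>Arr B. \<forall>v\<in>Arr B. Dom B u = Cod B v \<longrightarrow>
        is_nat (PC P (Cod B u)) (PC P (Dom B v))
          (comp_ftor (PC P (Cod B u)) (PF P v) (PF P u)) (PF P (u \<odot>\<^bsub>B\<^esub> v)) (PM P u v)) \<and>
     (\<forall>b\<in>Obj B. is_nat (PC P b) (PC P b) (id_ftor (PC P b)) (PF P (Idt B b)) (PI P b))"

lemma pseudofunctor_lax_data: "pseudofunctor B P \<Longrightarrow> lax_data B P"
  unfolding lax_data_def using pseudofunctor_fibre_data unfolding pseudofunctor_def is_natiso_def by blast

lemma lax_data_fibre_data: "lax_data B P \<Longrightarrow> fibre_data B P"
  by (simp add: lax_data_def)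

lemma psf_M_nat:
  assumes "lax_data B P" "u \<in> Arr B" "v \<in> Arr B" "Dom B u = Cod B v"
  shows "is_nat (PC P (Cod B u)) (PC P (Dom B v)) (comp_ftor (PC P (Cod B u)) (PF P v) (PF P u))
      (PF P (u \<odot>\<^bsub>B\<^esub> v)) (PM P u v)"
  using assms unfolding lax_data_def by blast

lemma psf_M_hom:
  assumes "lax_data B P" "u \<in> Arr B" "v \<in> Arr B" "Dom B u = Cod B v" "x \<in> Obj (PC P (Cod B u))"
  shows "PM P u v x \<in> hom (PC P (Dom B v)) (fobj (PF P v) (fobj (PF P u) x)) (fobj (PF P (u \<odot>\<^bsub>B\<^esub> v)) x)"
  using nat_hom[OF psf_M_nat[OF assms(1-4)] assms(5)] assms(5) by simp

lemma psf_M_comm: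
  assumes "lax_data B P" "u \<in> Arr B" "v \<in> Arr B" "Dom B u = Cod B v" "f \<in> hom (PC P (Cod B u)) x y"
  shows "PM P u v y \<odot>\<^bsub>PC P (Dom B v)\<^esub> farr (PF P v) (farr (PF P u) f) =
         farr (PF P (u \<odot>\<^bsub>B\<^esub> v)) f \<odot>\<^bsub>PC P (Dom B v)\<^esub> PM P u v x"
  using nat_comm[OF psf_M_nat[OF assms(1-4)] assms(5)] assms(5) by simp

lemma psf_I_nat:
  assumes "lax_data B P" "b \<in> Obj B"
  shows "is_nat (PC P b) (PC P b) (id_ftor (PC P b)) (PF P (Idt B b)) (PI P b)"
  using assms unfolding lax_data_def by blast

lemma psf_I_hom:
  assumes "lax_data B P" "b \<in> Obj B" "x \<in> Obj (PC P b)"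
  shows "PI P b x \<in> hom (PC P b) x (fobj (PF P (Idt B b)) x)"
  using nat_hom[OF psf_I_nat[OF assms(1,2)] assms(3)] assms(3) by simp

lemma psf_I_comm:
  assumes "lax_data B P" "b \<in> Obj B" "f \<in> hom (PC P b) x y"
  shows "PI P b y \<odot>\<^bsub>PC P b\<^esub> f = farr (PF P (Idt B b)) f \<odot>\<^bsub>PC P b\<^esub> PI P b x"
  using nat_comm[OF psf_I_nat[OF assms(1,2)] assms(3)] homD(1)[OF assms(3)] by simp

lemma psh_completion_sel [simp]:
  "PC (psh_completion B F) b = PSh (PC F b)"
  "PF (psh_completion B F) u = lan_ftor (opp (PC F (Cod B u))) (opp (PC F (Dom B u))) set_cat (PF F u)"
  by (simp_all add: psh_completion_def)

context
  fixes B :: "('b, 'v) cat" and F :: "('b, 'v, 'u, 'u) psf"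
  assumes U: "universe TYPE('u)" and B: "is_category B" and F: "pseudofunctor B F"
    and small: "\<And>b. b \<in> Obj B \<Longrightarrow> small_category (PC F b)"
begin

private abbreviation (input) "Fh \<equiv> psh_completion B F"
private abbreviation (input) "ext u P \<equiv> psh_ext B F u P"
private abbreviation (input) "un u P x p \<equiv> unit_elt (PC F (Cod B u)) (PC F (Dom B u)) (PF F u) P x p"

private lemma sCod: "u \<in> Arr B \<Longrightarrow> small_category (PC F (Cod B u))"
  and sDom: "u \<in> Arr B \<Longrightarrow> small_category (PC F (Dom B u))"
  using small Cod_obj[OF B] Dom_obj[OF B] by auto

private lemmas F_lax = pseudofunctor_lax_data[OF F]

private lemma Fu: "u \<in> Arr B \<Longrightarrow> is_functor (PC F (Cod B u)) (PC F (Dom B u)) (PF F u)"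
  by (rule fibre_ftor[OF pseudofunctor_fibre_data[OF F]])

private lemma Fb: "b \<in> Obj B \<Longrightarrow> is_category (PC F b)"
  by (rule fibre_cat[OF pseudofunctor_fibre_data[OF F]])

lemma psh_completion_cocontinuous:
  "u \<in> Arr B \<Longrightarrow> cocontinuous TYPE('u) (PC Fh (Cod B u)) (PC Fh (Dom B u)) (PF Fh u)"
  using lan_ftor_cocontinuous[OF U sCod sDom Fu] by simp

lemma psh_completion_fibre_data: "fibre_data B Fh"
  unfolding fibre_data_def using PSh_category[OF Fb] lan_ftor_functor[OF U sCod sDom Fu] by simp

lemma ext_psh: "u \<in> Arr B \<Longrightarrow> P \<in> Obj (PSh (PC F (Cod B u))) \<Longrightarrow> ext u P \<in> Obj (PSh (PC F (Dom B u)))"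
  unfolding psh_ext_def by (rule Lan_psh[OF U sCod sDom Fu])

lemma fobj_ext: "u \<in> Arr B \<Longrightarrow> P \<in> Obj (PSh (PC F (Cod B u))) \<Longrightarrow> fobj (PF Fh u) P = ext u P"
  unfolding psh_ext_def using fobj_lan_ftor[OF U sCod sDom Fu] by simp

lemma un_in: "u \<in> Arr B \<Longrightarrow> P \<in> Obj (PSh (PC F (Cod B u))) \<Longrightarrow> x \<in> Obj (PC F (Cod B u)) \<Longrightarrow> p \<in> fobj P x \<Longrightarrow>
    un u P x p \<in> fobj (ext u P) (fobj (PF F u) x)"
  unfolding psh_ext_def by (rule unit_in[OF U sCod sDom Fu])

lemma un_comm: "u \<in> Arr B \<Longrightarrow> P \<in> Obj (PSh (PC F (Cod B u))) \<Longrightarrow> a \<in> hom (PC F (Cod B u)) x y \<Longrightarrow> p \<in> fobj P y \<Longrightarrow>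
    un u P x (act P a p) = act (ext u P) (farr (PF F u) a) (un u P y p)"
  unfolding psh_ext_def by (rule unit_comm[OF U sCod sDom Fu])

lemma ext_eqI:
  assumes "u \<in> Arr B" "P \<in> Obj (PSh (PC F (Cod B u)))"
    "m \<in> hom (PSh (PC F (Dom B u))) (ext u P) Q" "n \<in> hom (PSh (PC F (Dom B u))) (ext u P) Q"
    "\<And>x p. x \<in> Obj (PC F (Cod B u)) \<Longrightarrow> p \<in> fobj P x \<Longrightarrow>
       nap m (fobj (PF F u) x) (un u P x p) = nap n (fobj (PF F u) x) (un u P x p)"
  shows "m = n"
  using Lan_eqI[OF U sCod sDom Fu] assms unfolding psh_ext_def by blast

text \<open>
  The iterated extension is generated by the elements obtained from those of \<open>P\<close> by applying
  both units: transposing once reduces the claim to maps out of the inner extension.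
\<close>

lemma ext_ext_eqI:
  assumes u: "u \<in> Arr B" and v: "v \<in> Arr B" and uv: "Dom B u = Cod B v"
      and P: "P \<in> Obj (PSh (PC F (Cod B u)))"
    and m: "m \<in> hom (PSh (PC F (Dom B v))) (ext v (ext u P)) Q"
    and n: "n \<in> hom (PSh (PC F (Dom B v))) (ext v (ext u P)) Q"
    and eq: "\<And>x p. x \<in> Obj (PC F (Cod B u)) \<Longrightarrow> p \<in> fobj P x \<Longrightarrow>
       nap m (fobj (PF F v) (fobj (PF F u) x)) (un v (ext u P) (fobj (PF F u) x) (un u P x p)) =
       nap n (fobj (PF F v) (fobj (PF F u) x)) (un v (ext u P) (fobj (PF F u) x) (un u P x p))"
  shows "m = n"
proof -
  have E: "ext u P \<in> Obj (PSh (PC F (Cod B v)))" using ext_psh[OF u P] uv by simp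
  let ?t = "\<lambda>m. mknt (PC F (Cod B v)) (ext u P) (restr (PC F (Cod B v)) (PF F v) Q)
                  (\<lambda>x p. nap m (fobj (PF F v) x) (un v (ext u P) x p))"
  have t: "?t k \<in> hom (PSh (PC F (Dom B u))) (ext u P) (restr (PC F (Cod B v)) (PF F v) Q)"
    if "k \<in> hom (PSh (PC F (Dom B v))) (ext v (ext u P)) Q" for k
    using lan_transpose_hom[OF U sCod[OF v] sDom[OF v] Fu[OF v] E] that uv
        by (simp add: psh_ext_def[of B F v])
  have "?t m = ?t n"
  proof (rule ext_eqI[OF u P t[OF m] t[OF n]])
    fix x p assume x: "x \<in> Obj (PC F (Cod B u))" and p: "p \<in> fobj P x"
    have "fobj (PF F u) x \<in> Obj (PC F (Cod B v))" using ftor_obj[OF Fu[OF u] x] uv by simp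
    then show "nap (?t m) (fobj (PF F u) x) (un u P x p) = nap (?t n) (fobj (PF F u) x) (un u P x p)"
      using un_in[OF u P x p] eq[OF x p] by simp
  qed
  then have tt: "nap (?t m) y q = nap (?t n) y q" for y q by simp
  show ?thesis
  proof (rule ext_eqI[OF v E m n])
    fix y q assume "y \<in> Obj (PC F (Cod B v))" and "q \<in> fobj (ext u P) y"
    then show "nap m (fobj (PF F v) y) (un v (ext u P) y q) = nap n (fobj (PF F v) y) (un v (ext u P) y q)"
      using tt[of y q] by simp
  qed
qed

lemma ext_arr:
  assumes "u \<in> Arr B" "m \<in> hom (PSh (PC F (Cod B u))) P Q"
  shows "farr (PF Fh u) m \<in> hom (PSh (PC F (Dom B u))) (ext u P) (ext u Q)"
    and "x \<in> Obj (PC F (Cod B u)) \<Longrightarrow> p \<in> fobj P x \<Longrightarrow>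
      nap (farr (PF Fh u) m) (fobj (PF F u) x) (un u P x p) = un u Q x (nap m x p)"
  using lan_ftor_arr[OF U sCod[OF assms(1)] sDom[OF assms(1)] Fu[OF assms(1)] assms(2)]
      by (auto simp: psh_ext_def)

lemma set_cmp_restrict:
  assumes "t \<in> A \<rightarrow> A'"
  shows "(A', A'', \<lambda>p\<in>A'. s p) \<odot>\<^bsub>set_cat\<^esub> (A, A', \<lambda>p\<in>A. t p) = (A, A'', \<lambda>p\<in>A. s (t p))"
  using assms by (auto simp: compose_def intro!: restrict_ext)

lemma psh_unit_eq: "u \<in> Arr B \<Longrightarrow> P \<in> Obj (PSh (PC F (Cod B u))) \<Longrightarrow> x \<in> Obj (PC F (Cod B u)) \<Longrightarrow>
    psh_unit B F u P x = (fobj P x, fobj (ext u P) (fobj (PF F u) x), \<lambda>p\<in>fobj P x. un u P x p)"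
  unfolding psh_unit_def psh_ext_def by (rule lan_unit_eq[OF U sCod sDom Fu])

text \<open>
  The comparison cell sends the generator of the iterated extension that belongs to \<open>p\<close> to the
  corresponding generator of the extension along \<open>u \<odot> v\<close>, moved to the stage \<open>F v (F u x)\<close> by
  restriction along the comparison cell of \<open>F\<close>.
\<close>

lemma completion_M:
  assumes u: "u \<in> Arr B" and v: "v \<in> Arr B" and uv: "Dom B u = Cod B v"
      and P: "P \<in> Obj (PSh (PC F (Cod B u)))"
  shows "PM Fh u v P \<in> hom (PSh (PC F (Dom B v))) (ext v (ext u P)) (ext (u \<odot>\<^bsub>B\<^esub> v) P)"
    and "x \<in> Obj (PC F (Cod B u)) \<Longrightarrow> p \<in> fobj P x \<Longrightarrow>
       nap (PM Fh u v P) (fobj (PF F v) (fobj (PF F u) x)) (un v (ext u P) (fobj (PF F u) x) (un u P x p)) =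
       act (ext (u \<odot>\<^bsub>B\<^esub> v) P) (PM F u v x) (un (u \<odot>\<^bsub>B\<^esub> v) P x p)"
proof -
  note w = cmp_arr[OF B u v uv]
  let ?w = "u \<odot>\<^bsub>B\<^esub> v"
  have Pw: "P \<in> Obj (PSh (PC F (Cod B ?w)))" using P w by simp
  have E: "ext u P \<in> Obj (PSh (PC F (Cod B v)))" using ext_psh[OF u P] uv by simp
  have Ew: "ext ?w P \<in> Obj (PSh (PC F (Dom B v)))" using ext_psh[OF w(1) Pw] w by simp
  define R where "R = restr (PC F (Dom B u)) (PF F v) (ext ?w P)"
  have R': "R = restr (PC F (Cod B v)) (PF F v) (ext ?w P)" by (simp add: R_def uv)
  have R: "R \<in> Obj (PSh (PC F (Dom B u)))"
    using restr_psh[OF U sCod[OF v] sDom[OF v] Fu[OF v] Ew] uv by (simp add: R_def)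
  have Ro: "fobj R z = fobj (ext ?w P) (fobj (PF F v) z)" if "z \<in> Obj (PC F (Dom B u))" for z
    using that by (simp add: R_def)
  define t where "t x p = act (ext ?w P) (PM F u v x) (un ?w P x p)" for x p
  define \<theta> where "\<theta> = (\<lambda>x\<in>Obj (PC F (Cod B u)). farr (ext ?w P) (PM F u v x) \<odot>\<^bsub>set_cat\<^esub> psh_unit B F ?w P x)"
  note Mh = psf_M_hom[OF F_lax u v uv]
  have unw: "un ?w P x p \<in> fobj (ext ?w P) (fobj (PF F ?w) x)" if "x \<in> Obj (PC F (Cod B u))" "p \<in> fobj P x"
      for x p
    using un_in[OF w(1) Pw] that w by simp
  have th: "\<theta> x = (fobj P x, fobj R (fobj (PF F u) x), \<lambda>p\<in>fobj P x. t x p)" if x: "x \<in> Obj (PC F (Cod B u))"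
      for x
  proof -
    have "psh_unit B F ?w P x = (fobj P x, fobj (ext ?w P) (fobj (PF F ?w) x), \<lambda>p\<in>fobj P x. un ?w P x p)"
      using psh_unit_eq[OF w(1) Pw, of x] x w by simp
    moreover have "farr (ext ?w P) (PM F u v x) = (fobj (ext ?w P) (fobj (PF F ?w) x),
        fobj (ext ?w P) (fobj (PF F v) (fobj (PF F u) x)),
        \<lambda>p\<in>fobj (ext ?w P) (fobj (PF F ?w) x). act (ext ?w P) (PM F u v x) p)"
      by (rule psh_farr[OF Ew Mh[OF x]])
    ultimately show ?thesis
      using set_cmp_restrict[of "\<lambda>p. un ?w P x p" "fobj P x" "fobj (ext ?w P) (fobj (PF F ?w) x)"] unw[OF x]
          x
        Ro[OF ftor_obj[OF Fu[OF u] x]] by (simp add: \<theta>_def t_def)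
  qed
  have tin: "t x p \<in> fobj R (fobj (PF F u) x)" if x: "x \<in> Obj (PC F (Cod B u))" and p: "p \<in> fobj P x"
      for x p
    unfolding t_def Ro[OF ftor_obj[OF Fu[OF u] x]] by (rule psh_act[OF Ew Mh[OF x] unw[OF x p]])
  have tn: "t x (act P a p) = act R (farr (PF F u) a) (t y p)"
    if a: "a \<in> hom (PC F (Cod B u)) x y" and p: "p \<in> fobj P y" for a x y p
  proof -
    note o = hom_objs[OF Fb[OF Cod_obj[OF B u]] a]
    have aw: "a \<in> hom (PC F (Cod B ?w)) x y" using a w by simp
    note Fa = ftor_hom[OF Fu[OF u] a]
    have Fa': "farr (PF F u) a \<in> hom (PC F (Cod B v)) (fobj (PF F u) x) (fobj (PF F u) y)"
        using Fa uv by simp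
    have Fwa: "farr (PF F ?w) a \<in> hom (PC F (Dom B v)) (fobj (PF F ?w) x) (fobj (PF F ?w) y)"
      using ftor_hom[OF Fu[OF w(1)] aw] w by simp
    have "t x (act P a p) = act (ext ?w P) (PM F u v x) (act (ext ?w P) (farr (PF F ?w) a) (un ?w P y p))"
      unfolding t_def using un_comm[OF w(1) Pw aw p] by simp
    also have "\<dots> = act (ext ?w P) (PM F u v y \<odot>\<^bsub>PC F (Dom B v)\<^esub> farr (PF F v) (farr (PF F u) a))
        (un ?w P y p)"
      unfolding psf_M_comm[OF F_lax u v uv a] psh_cmp[OF Ew Mh[OF o(1)] Fwa unw[OF o(2) p]] ..
    also have "\<dots> = act (ext ?w P) (farr (PF F v) (farr (PF F u) a)) (t y p)"
      unfolding t_def by (rule psh_cmp[OF Ew ftor_hom[OF Fu[OF v] Fa'] Mh[OF o(2)] unw[OF o(2) p]])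
    finally show ?thesis using act_restr[OF Fa] by (simp add: R_def)
  qed
  have xt: "\<theta> \<in> extensional (Obj (PC F (Cod B u)))" by (simp add: \<theta>_def)
  note D1 = lan_desc_elt[OF U sCod[OF u] sDom[OF u] Fu[OF u] P R xt th tin tn]
  define \<psi> where "\<psi> = psh_desc B F u P R \<theta>"
  have i1: "(ext u P, R, \<psi>) \<in> hom (PSh (PC F (Dom B u))) (ext u P) R"
    unfolding \<psi>_def psh_desc_def psh_ext_def by (rule D1(1))
  have i2: "nap (ext u P, R, \<psi>) (fobj (PF F u) x) (un u P x p) = t x p"
    if "x \<in> Obj (PC F (Cod B u))" "p \<in> fobj P x" for x p
    unfolding \<psi>_def psh_desc_def psh_ext_def by (rule D1(2)) (use that in auto)
  have i1': "(ext u P, restr (PC F (Cod B v)) (PF F v) (ext ?w P), \<psi>)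
      \<in> hom (PSh (PC F (Cod B v))) (ext u P) (restr (PC F (Cod B v)) (PF F v) (ext ?w P))"
    using i1 uv R' by simp
  have eq: "PM Fh u v P = (ext v (ext u P), ext ?w P, psh_desc B F v (ext u P) (ext ?w P) \<psi>)"
    using P by (simp add: psh_completion_def \<psi>_def R_def \<theta>_def)
  note D2 = lan_desc_hom[OF U sCod[OF v] sDom[OF v] Fu[OF v] E Ew i1']
  show "PM Fh u v P \<in> hom (PSh (PC F (Dom B v))) (ext v (ext u P)) (ext ?w P)"
    unfolding eq psh_desc_def psh_ext_def[of B F v] by (rule D2(1))
  fix x p assume x: "x \<in> Obj (PC F (Cod B u))" and p: "p \<in> fobj P x"
  have y: "fobj (PF F u) x \<in> Obj (PC F (Cod B v))" using ftor_obj[OF Fu[OF u] x] uv by simp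
  have "nap (PM Fh u v P) (fobj (PF F v) (fobj (PF F u) x)) (un v (ext u P) (fobj (PF F u) x) (un u P x p))
      =
      snd (snd (\<psi> (fobj (PF F u) x))) (un u P x p)"
    unfolding eq psh_desc_def psh_ext_def[of B F v] by (rule D2(2)[OF y un_in[OF u P x p]])
  also have "\<dots> = t x p" using i2[OF x p] by (simp add: nap_def)
  finally show "nap (PM Fh u v P) (fobj (PF F v) (fobj (PF F u) x))
      (un v (ext u P) (fobj (PF F u) x) (un u P x p)) =
       act (ext ?w P) (PM F u v x) (un ?w P x p)" by (simp add: t_def)
qed

lemma completion_I:
  assumes b: "b \<in> Obj B" and P: "P \<in> Obj (PSh (PC F b))"
  shows "PI Fh b P \<in> hom (PSh (PC F b)) P (ext (Idt B b) P)"
    and "x \<in> Obj (PC F b) \<Longrightarrow> p \<in> fobj P x \<Longrightarrow>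
       nap (PI Fh b P) x p = act (ext (Idt B b) P) (PI F b x) (un (Idt B b) P x p)"
proof -
  note i = Idt_arr[OF B b]
  let ?i = "Idt B b"
  have Pi: "P \<in> Obj (PSh (PC F (Cod B ?i)))" using P i by simp
  have E: "ext ?i P \<in> Obj (PSh (PC F b))" using ext_psh[OF i(1) Pi] i by simp
  note Ih = psf_I_hom[OF F_lax b]
  have uni: "un ?i P x p \<in> fobj (ext ?i P) (fobj (PF F ?i) x)" if "x \<in> Obj (PC F b)" "p \<in> fobj P x" for x p
    using un_in[OF i(1) Pi] that i by simp
  define t where "t x p = act (ext ?i P) (PI F b x) (un ?i P x p)" for x p
  have th: "farr (ext ?i P) (PI F b x) \<odot>\<^bsub>set_cat\<^esub> psh_unit B F ?i P x
      = (fobj P x, fobj (ext ?i P) x, \<lambda>p\<in>fobj P x. t x p)"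
    if x: "x \<in> Obj (PC F b)" for x
  proof -
    have "psh_unit B F ?i P x = (fobj P x, fobj (ext ?i P) (fobj (PF F ?i) x), \<lambda>p\<in>fobj P x. un ?i P x p)"
      using psh_unit_eq[OF i(1) Pi, of x] x i by simp
    moreover have "farr (ext ?i P) (PI F b x) = (fobj (ext ?i P) (fobj (PF F ?i) x), fobj (ext ?i P) x,
        \<lambda>p\<in>fobj (ext ?i P) (fobj (PF F ?i) x). act (ext ?i P) (PI F b x) p)"
      by (rule psh_farr[OF E Ih[OF x]])
    ultimately show ?thesis
      using set_cmp_restrict[of "\<lambda>p. un ?i P x p" "fobj P x" "fobj (ext ?i P) (fobj (PF F ?i) x)"] uni[OF x]
      by (simp add: t_def)
  qed
  have eq: "PI Fh b P = mknt (PC F b) P (ext ?i P) t"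
    using P th by (simp add: psh_completion_def mknt_def cong: restrict_cong)
  show "PI Fh b P \<in> hom (PSh (PC F b)) P (ext ?i P)"
    unfolding eq
  proof (rule mknt_hom[OF Fb[OF b] P E])
    fix x p assume x: "x \<in> Obj (PC F b)" and p: "p \<in> fobj P x"
    show "t x p \<in> fobj (ext ?i P) x" unfolding t_def by (rule psh_act[OF E Ih[OF x] uni[OF x p]])
  next
    fix a x y p assume a: "a \<in> hom (PC F b) x y" and p: "p \<in> fobj P y"
    note o = hom_objs[OF Fb[OF b] a]
    have ai: "a \<in> hom (PC F (Cod B ?i)) x y" using a i by simp
    have Fia: "farr (PF F ?i) a \<in> hom (PC F b) (fobj (PF F ?i) x) (fobj (PF F ?i) y)"
      using ftor_hom[OF Fu[OF i(1)] ai] i by simp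
    show "t x (act P a p) = act (ext ?i P) a (t y p)"
      unfolding t_def un_comm[OF i(1) Pi ai p] psh_cmp[OF E Ih[OF o(1)] Fia uni[OF o(2) p], symmetric]
        psf_I_comm[OF F_lax b a, symmetric] by (rule psh_cmp[OF E a Ih[OF o(2)] uni[OF o(2) p]])
  qed
  show "nap (PI Fh b P) x p = act (ext ?i P) (PI F b x) (un ?i P x p)" if "x \<in> Obj (PC F b)" "p \<in> fobj P x"
    unfolding eq using that by (simp add: t_def)
qed

text \<open>
  On generators both sides equal the generator that belongs to the image of \<open>p\<close> under \<open>m\<close>,
  restricted along the comparison cell of \<open>F\<close>.
\<close>

lemma completion_M_comm:
  assumes u: "u \<in> Arr B" and v: "v \<in> Arr B" and uv: "Dom B u = Cod B v"
    and m: "m \<in> hom (PSh (PC F (Cod B u))) P Q"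
  shows "PM Fh u v Q \<odot>\<^bsub>PSh (PC F (Dom B v))\<^esub> farr (PF Fh v) (farr (PF Fh u) m) =
         farr (PF Fh (u \<odot>\<^bsub>B\<^esub> v)) m \<odot>\<^bsub>PSh (PC F (Dom B v))\<^esub> PM Fh u v P"
proof -
  note w = cmp_arr[OF B u v uv]
  let ?w = "u \<odot>\<^bsub>B\<^esub> v"
  note PC = PSh_category[OF Fb[OF Dom_obj[OF B v]]] and Cv = Fb[OF Dom_obj[OF B v]]
  note PQ = hom_PSh_obj[OF Fb[OF Cod_obj[OF B u]] m]
  have mw: "m \<in> hom (PSh (PC F (Cod B ?w))) P Q" using m w by simp
  note um = ext_arr[OF u m]
  have um1: "farr (PF Fh u) m \<in> hom (PSh (PC F (Cod B v))) (ext u P) (ext u Q)" using um(1) uv by simp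
  note vm = ext_arr[OF v um1]
  have wm1: "farr (PF Fh ?w) m \<in> hom (PSh (PC F (Dom B v))) (ext ?w P) (ext ?w Q)"
      using ext_arr(1)[OF w(1) mw] w by simp
  note MP = completion_M[OF u v uv PQ(1)] and MQ = completion_M[OF u v uv PQ(2)]
  show ?thesis
  proof (rule ext_ext_eqI[OF u v uv PQ(1) cmp_hom[OF PC vm(1) MQ(1)] cmp_hom[OF PC MP(1) wm1]])
    fix x p assume x: "x \<in> Obj (PC F (Cod B u))" and p: "p \<in> fobj P x"
    have y: "fobj (PF F u) x \<in> Obj (PC F (Cod B v))" using ftor_obj[OF Fu[OF u] x] uv by simp
    note z = ftor_obj[OF Fu[OF v] y]
    note q = un_in[OF u PQ(1) x p]
    have r: "un v (ext u P) (fobj (PF F u) x) (un u P x p)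
        \<in> fobj (ext v (ext u P)) (fobj (PF F v) (fobj (PF F u) x))"
      using un_in[OF v _ y q] ext_psh[OF u PQ(1)] uv by simp
    have xw: "x \<in> Obj (PC F (Cod B ?w))" using x w by simp
    have s: "un ?w P x p \<in> fobj (ext ?w P) (fobj (PF F ?w) x)"
      using un_in[OF w(1) _ xw p] PQ(1) w by simp
    have "nap (PM Fh u v Q \<odot>\<^bsub>PSh (PC F (Dom B v))\<^esub> farr (PF Fh v) (farr (PF Fh u) m))
            (fobj (PF F v) (fobj (PF F u) x)) (un v (ext u P) (fobj (PF F u) x) (un u P x p)) =
          act (ext ?w Q) (PM F u v x) (un ?w Q x (nap m x p))"
      unfolding nap_cmp[OF vm(1) MQ(1) z r] vm(2)[OF y q] um(2)[OF x p] MQ(2)[OF x nap_in[OF m x p]] ..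
    also have "\<dots> = act (ext ?w Q) (PM F u v x) (nap (farr (PF Fh ?w) m) (fobj (PF F ?w) x) (un ?w P x p))"
      using ext_arr(2)[OF w(1) mw xw p] by simp
    also have "\<dots> = nap (farr (PF Fh ?w) m) (fobj (PF F v) (fobj (PF F u) x))
        (act (ext ?w P) (PM F u v x) (un ?w P x p))"
      by (rule nap_comm[OF Cv wm1 psf_M_hom[OF F_lax u v uv x] s, symmetric])
    also have "\<dots> = nap (farr (PF Fh ?w) m \<odot>\<^bsub>PSh (PC F (Dom B v))\<^esub> PM Fh u v P)
            (fobj (PF F v) (fobj (PF F u) x)) (un v (ext u P) (fobj (PF F u) x) (un u P x p))"
      unfolding nap_cmp[OF MP(1) wm1 z r] MP(2)[OF x p] ..
    finally show "nap (PM Fh u v Q \<odot>\<^bsub>PSh (PC F (Dom B v))\<^esub> farr (PF Fh v) (farr (PF Fh u) m))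
            (fobj (PF F v) (fobj (PF F u) x)) (un v (ext u P) (fobj (PF F u) x) (un u P x p)) =
        nap (farr (PF Fh ?w) m \<odot>\<^bsub>PSh (PC F (Dom B v))\<^esub> PM Fh u v P)
            (fobj (PF F v) (fobj (PF F u) x)) (un v (ext u P) (fobj (PF F u) x) (un u P x p))" .
  qed
qed

lemma completion_I_comm:
  assumes b: "b \<in> Obj B" and m: "m \<in> hom (PSh (PC F b)) P Q"
  shows "PI Fh b Q \<odot>\<^bsub>PSh (PC F b)\<^esub> m = farr (PF Fh (Idt B b)) m \<odot>\<^bsub>PSh (PC F b)\<^esub> PI Fh b P"
proof -
  note i = Idt_arr[OF B b]
  note PC = PSh_category[OF Fb[OF b]] and PQ = hom_PSh_obj[OF Fb[OF b] m]
  have mi: "m \<in> hom (PSh (PC F (Cod B (Idt B b)))) P Q" using m i by simp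
  have im: "farr (PF Fh (Idt B b)) m \<in> hom (PSh (PC F b)) (ext (Idt B b) P) (ext (Idt B b) Q)"
    using ext_arr(1)[OF i(1) mi] i by simp
  note IP = completion_I[OF b PQ(1)] and IQ = completion_I[OF b PQ(2)]
  show ?thesis
  proof (rule nap_eqI[OF cmp_hom[OF PC m IQ(1)] cmp_hom[OF PC IP(1) im]])
    fix x p assume x: "x \<in> Obj (PC F b)" and p: "p \<in> fobj P x"
    have xi: "x \<in> Obj (PC F (Cod B (Idt B b)))" using x i by simp
    have s: "un (Idt B b) P x p \<in> fobj (ext (Idt B b) P) (fobj (PF F (Idt B b)) x)"
      using un_in[OF i(1) _ xi p] PQ(1) i by simp
    show "nap (PI Fh b Q \<odot>\<^bsub>PSh (PC F b)\<^esub> m) x p = nap (farr (PF Fh (Idt B b)) m \<odot>\<^bsub>PSh (PC F b)\<^esub> PI Fh b P) x p"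
      unfolding nap_cmp[OF m IQ(1) x p] nap_cmp[OF IP(1) im x p] IQ(2)[OF x nap_in[OF m x p]] IP(2)[OF x p]
        nap_comm[OF Fb[OF b] im psf_I_hom[OF F_lax b x] s] ext_arr(2)[OF i(1) mi xi p] ..
  qed
qed

lemma psh_completion_lax_data: "lax_data B Fh"
  unfolding lax_data_def
proof (intro conjI ballI impI psh_completion_fibre_data)
  fix u v assume u: "u \<in> Arr B" and v: "v \<in> Arr B" and uv: "Dom B u = Cod B v"
  note w = cmp_arr[OF B u v uv]
  note PC = PSh_category[OF Fb[OF Cod_obj[OF B u]]]
  have Lu: "is_functor (PSh (PC F (Cod B u))) (PSh (PC F (Cod B v))) (PF Fh u)"
    using fibre_ftor[OF psh_completion_fibre_data u] uv by simp
  have Lv: "is_functor (PSh (PC F (Cod B v))) (PSh (PC F (Dom B v))) (PF Fh v)"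
    using fibre_ftor[OF psh_completion_fibre_data v] by simp
  have Lw: "is_functor (PSh (PC F (Cod B u))) (PSh (PC F (Dom B v))) (PF Fh (u \<odot>\<^bsub>B\<^esub> v))"
    using fibre_ftor[OF psh_completion_fibre_data w(1)] w by simp
  show "is_nat (PC Fh (Cod B u)) (PC Fh (Dom B v)) (comp_ftor (PC Fh (Cod B u)) (PF Fh v) (PF Fh u))
      (PF Fh (u \<odot>\<^bsub>B\<^esub> v)) (PM Fh u v)"
    unfolding psh_completion_sel(1)
  proof (rule is_natI[OF PC comp_ftor_functor[OF PC Lu Lv] Lw])
    show "PM Fh u v \<in> extensional (Obj (PSh (PC F (Cod B u))))" by (simp add: psh_completion_def)
    fix P assume P: "P \<in> Obj (PSh (PC F (Cod B u)))"
    have Pw: "P \<in> Obj (PSh (PC F (Cod B (u \<odot>\<^bsub>B\<^esub> v))))" using P w by simp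
    have E: "ext u P \<in> Obj (PSh (PC F (Cod B v)))" using ext_psh[OF u P] uv by simp
    show "PM Fh u v P \<in> hom (PSh (PC F (Dom B v)))
        (fobj (comp_ftor (PSh (PC F (Cod B u))) (PF Fh v) (PF Fh u)) P)
        (fobj (PF Fh (u \<odot>\<^bsub>B\<^esub> v)) P)"
      using completion_M(1)[OF u v uv P] unfolding fobj_comp[OF P] fobj_ext[OF u P] fobj_ext[OF v E]
          fobj_ext[OF w(1) Pw] .
  next
    fix m P Q assume m: "m \<in> hom (PSh (PC F (Cod B u))) P Q"
    show "PM Fh u v Q \<odot>\<^bsub>PSh (PC F (Dom B v))\<^esub> farr (comp_ftor (PSh (PC F (Cod B u))) (PF Fh v) (PF Fh u)) m =
        farr (PF Fh (u \<odot>\<^bsub>B\<^esub> v)) m \<odot>\<^bsub>PSh (PC F (Dom B v))\<^esub> PM Fh u v P"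
      unfolding farr_comp_hom[OF m] by (rule completion_M_comm[OF u v uv m])
  qed
next
  fix b assume b: "b \<in> Obj B"
  note i = Idt_arr[OF B b]
  note PC = PSh_category[OF Fb[OF b]]
  have Li: "is_functor (PSh (PC F b)) (PSh (PC F b)) (PF Fh (Idt B b))"
    using fibre_ftor[OF psh_completion_fibre_data i(1)] i by simp
  show "is_nat (PC Fh b) (PC Fh b) (id_ftor (PC Fh b)) (PF Fh (Idt B b)) (PI Fh b)"
    unfolding psh_completion_sel(1)
  proof (rule is_natI[OF PC id_ftor_functor[OF PC] Li])
    show "PI Fh b \<in> extensional (Obj (PSh (PC F b)))" by (simp add: psh_completion_def)
    fix P assume P: "P \<in> Obj (PSh (PC F b))"
    have Pi: "P \<in> Obj (PSh (PC F (Cod B (Idt B b))))" using P i by simp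
    show "PI Fh b P \<in> hom (PSh (PC F b)) (fobj (id_ftor (PSh (PC F b))) P) (fobj (PF Fh (Idt B b)) P)"
      using completion_I(1)[OF b P] unfolding fobj_id[OF P] fobj_ext[OF i(1) Pi] .
  next
    fix m P Q assume m: "m \<in> hom (PSh (PC F b)) P Q"
    show "PI Fh b Q \<odot>\<^bsub>PSh (PC F b)\<^esub> farr (id_ftor (PSh (PC F b))) m =
        farr (PF Fh (Idt B b)) m \<odot>\<^bsub>PSh (PC F b)\<^esub> PI Fh b P"
      unfolding farr_id[OF homD(1)[OF m]] by (rule completion_I_comm[OF b m])
  qed
qed

lemma yoneda_pnt_sel:
  "b \<in> Obj B \<Longrightarrow> NC (yoneda_pnt B F) b = yoneda (PC F b)"
  "u \<in> Arr B \<Longrightarrow> e \<in> Obj (PC F (Cod B u)) \<Longrightarrow>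
     N2 (yoneda_pnt B F) u e = coyoneda_arr (PC F (Cod B u)) (PC F (Dom B u)) (PF F u) e"
  by (simp_all add: yoneda_pnt_def coyoneda_arr_def[OF U sCod sDom Fu] psh_ext_def psh_desc_def)

text \<open>
  On the generator that belongs to an arrow \<open>g\<close>, the coherence conditions become the naturality of
  the comparison cells of \<open>F\<close> at \<open>g\<close>.
\<close>

lemma yoneda_pnt_pseudonat: "pseudonat B F Fh (yoneda_pnt B F)"
  unfolding pseudonat_def
proof (intro conjI ballI impI)
  show "NC (yoneda_pnt B F) \<in> extensional (Obj B)" "N2 (yoneda_pnt B F) \<in> extensional (Arr B)"
    by (simp_all add: yoneda_pnt_def)
  show "is_functor (PC F b) (PC Fh b) (NC (yoneda_pnt B F) b)" if b: "b \<in> Obj B" for b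
    using yoneda_functor[OF small[OF b]] yoneda_pnt_sel(1)[OF b] by simp
next
  fix u assume u: "u \<in> Arr B"
  note c = Cod_obj[OF B u] and d = Dom_obj[OF B u]
  note ctx = U sCod[OF u] sDom[OF u] Fu[OF u]
  note N = yoneda_pnt_sel(2)[OF u]
  let ?C = "PC F (Cod B u)" and ?C' = "PC F (Dom B u)"
  have y: "is_functor ?C (PSh ?C) (yoneda ?C)" "is_functor ?C' (PSh ?C') (yoneda ?C')"
    using yoneda_functor small c d by blast+
  have L: "is_functor (PSh ?C) (PSh ?C') (PF Fh u)" using fibre_ftor[OF psh_completion_fibre_data u] by simp
  show "is_natiso ?C (PC Fh (Dom B u)) (comp_ftor ?C (PF Fh u) (NC (yoneda_pnt B F) (Cod B u)))
      (comp_ftor ?C (NC (yoneda_pnt B F) (Dom B u)) (PF F u)) (N2 (yoneda_pnt B F) u)"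
    unfolding is_natiso_def yoneda_pnt_sel(1)[OF c] yoneda_pnt_sel(1)[OF d] psh_completion_sel(1)
  proof (intro conjI ballI is_natI[OF Fb[OF c] comp_ftor_functor[OF Fb[OF c] y(1) L]
        comp_ftor_functor[OF Fb[OF c] Fu[OF u] y(2)]])
    show "N2 (yoneda_pnt B F) u \<in> extensional (Obj ?C)" using u by (simp add: yoneda_pnt_def)
    fix e assume e: "e \<in> Obj ?C"
    show "is_iso (PSh ?C') (N2 (yoneda_pnt B F) u e)" unfolding N[OF e] by (rule coyoneda_iso[OF ctx e])
    show "N2 (yoneda_pnt B F) u e \<in> hom (PSh ?C') (fobj (comp_ftor ?C (PF Fh u) (yoneda ?C)) e)
        (fobj (comp_ftor ?C (yoneda ?C') (PF F u)) e)"
      unfolding N[OF e] using coyoneda_arr(1)[OF ctx, of e] e ftor_obj[OF Fu[OF u] e]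
        fobj_ext[OF u hom_psh_psh[OF sCod[OF u]]] by (simp add: psh_ext_def)
  next
    fix h e e' assume e: "e \<in> Obj ?C" and e': "e' \<in> Obj ?C" and h: "h \<in> hom ?C e e'"
    show "N2 (yoneda_pnt B F) u e' \<odot>\<^bsub>PSh ?C'\<^esub> farr (comp_ftor ?C (PF Fh u) (yoneda ?C)) h =
       farr (comp_ftor ?C (yoneda ?C') (PF F u)) h \<odot>\<^bsub>PSh ?C'\<^esub> N2 (yoneda_pnt B F) u e"
      unfolding N[OF e] N[OF e'] farr_comp_hom[OF h] psh_completion_sel(2)
          by (rule coyoneda_natural[OF ctx h])
  qed
next
  fix u v e assume u: "u \<in> Arr B" and v: "v \<in> Arr B" and uv: "Dom B u = Cod B v"
      and e: "e \<in> Obj (PC F (Cod B u))"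
  note w = cmp_arr[OF B u v uv]
  let ?w = "u \<odot>\<^bsub>B\<^esub> v"
  let ?C = "PC F (Cod B u)" and ?Cv = "PC F (Cod B v)" and ?C'' = "PC F (Dom B v)"
  note cu = Cod_obj[OF B u] and dv = Dom_obj[OF B v]
  note C'' = Fb[OF dv] and PC = PSh_category[OF Fb[OF dv]]
  note ctu = U sCod[OF u] sDom[OF u] Fu[OF u] and ctv = U sCod[OF v] sDom[OF v] Fu[OF v]
    and ctw = U sCod[OF w(1)] sDom[OF w(1)] Fu[OF w(1)]
  let ?Fe = "fobj (PF F u) e"
  have Fe: "?Fe \<in> Obj ?Cv" using ftor_obj[OF Fu[OF u] e] uv by simp
  have P: "hom_psh ?C e \<in> Obj (PSh ?C)" by (rule hom_psh_psh[OF sCod[OF u]])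
  have ew: "e \<in> Obj (PC F (Cod B ?w))" using e w by simp
  let ?yu = "coyoneda_arr ?C (PC F (Dom B u)) (PF F u) e"
  let ?yv = "coyoneda_arr ?Cv ?C'' (PF F v) ?Fe"
  let ?yw = "coyoneda_arr (PC F (Cod B ?w)) (PC F (Dom B ?w)) (PF F ?w) e"
  have yu: "?yu \<in> hom (PSh ?Cv) (ext u (hom_psh ?C e)) (hom_psh ?Cv ?Fe)"
    using coyoneda_arr(1)[OF ctu, of e] uv by (simp add: psh_ext_def)
  have yv: "?yv \<in> hom (PSh ?C'') (ext v (hom_psh ?Cv ?Fe)) (hom_psh ?C'' (fobj (PF F v) ?Fe))"
    using coyoneda_arr(1)[OF ctv, of ?Fe] by (simp add: psh_ext_def)
  have yw: "?yw \<in> hom (PSh ?C'') (ext ?w (hom_psh ?C e)) (hom_psh ?C'' (fobj (PF F ?w) e))"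
    using coyoneda_arr(1)[OF ctw, of e] w by (simp add: psh_ext_def)
  note vyu = ext_arr[OF v yu]
  note M = completion_M[OF u v uv P]
  note Mh = psf_M_hom[OF F_lax u v uv]
  have FM: "farr (yoneda ?C'') (PM F u v e) \<in> hom (PSh ?C'') (hom_psh ?C'' (fobj (PF F v) ?Fe))
      (hom_psh ?C'' (fobj (PF F ?w) e))"
    using ftor_hom[OF yoneda_functor[OF sDom[OF v]] Mh[OF e]] hom_objs[OF C'' Mh[OF e]] by simp
  have "?yw \<odot>\<^bsub>PSh ?C''\<^esub> PM Fh u v (hom_psh ?C e) =
    farr (yoneda ?C'') (PM F u v e) \<odot>\<^bsub>PSh ?C''\<^esub> (?yv \<odot>\<^bsub>PSh ?C''\<^esub> farr (PF Fh v) ?yu)"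
  proof (rule ext_ext_eqI[OF u v uv P cmp_hom[OF PC M(1) yw] cmp_hom[OF PC cmp_hom[OF PC vyu(1) yv] FM]])
    fix x g assume x: "x \<in> Obj ?C" and g': "g \<in> fobj (hom_psh ?C e) x"
    then have g: "g \<in> hom ?C x e" by simp
    let ?Fx = "fobj (PF F u) x"
    have y: "?Fx \<in> Obj ?Cv" using ftor_obj[OF Fu[OF u] x] uv by simp
    note z = ftor_obj[OF Fu[OF v] y]
    note q = un_in[OF u P x g']
    have r: "un v (ext u (hom_psh ?C e)) ?Fx (un u (hom_psh ?C e) x g)
        \<in> fobj (ext v (ext u (hom_psh ?C e))) (fobj (PF F v) ?Fx)"
      using un_in[OF v _ y q] ext_psh[OF u P] uv by simp
    have gw: "g \<in> hom (PC F (Cod B ?w)) x e" using g w by simp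
    have s: "un ?w (hom_psh ?C e) x g \<in> fobj (ext ?w (hom_psh ?C e)) (fobj (PF F ?w) x)"
      using un_in[OF w(1) _ _ , of "hom_psh ?C e" x g] P x g' w by simp
    have Fg: "farr (PF F u) g \<in> hom ?Cv ?Fx ?Fe" using ftor_hom[OF Fu[OF u] g] uv by simp
    have Fwg: "farr (PF F ?w) g \<in> hom ?C'' (fobj (PF F ?w) x) (fobj (PF F ?w) e)"
      using ftor_hom[OF Fu[OF w(1)] gw] w by simp
    have yug: "nap ?yu ?Fx (un u (hom_psh ?C e) x g) = farr (PF F u) g" by (rule coyoneda_arr(2)[OF ctu g])
    have ywg: "nap ?yw (fobj (PF F ?w) x) (un ?w (hom_psh ?C e) x g) = farr (PF F ?w) g"
      using coyoneda_arr(2)[OF ctw gw] w by simp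
    have "nap (?yw \<odot>\<^bsub>PSh ?C''\<^esub> PM Fh u v (hom_psh ?C e)) (fobj (PF F v) ?Fx)
        (un v (ext u (hom_psh ?C e)) ?Fx (un u (hom_psh ?C e) x g)) = farr (PF F ?w) g \<odot>\<^bsub>?C''\<^esub> PM F u v x"
      unfolding nap_cmp[OF M(1) yw z r] M(2)[OF x g'] nap_comm[OF C'' yw Mh[OF x] s] ywg
      by (rule act_hom_psh[OF Mh[OF x] Fwg])
    also have "\<dots> = nap (farr (yoneda ?C'') (PM F u v e) \<odot>\<^bsub>PSh ?C''\<^esub> (?yv \<odot>\<^bsub>PSh ?C''\<^esub> farr (PF Fh v) ?yu))
        (fobj (PF F v) ?Fx) (un v (ext u (hom_psh ?C e)) ?Fx (un u (hom_psh ?C e) x g))"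
      unfolding nap_cmp[OF cmp_hom[OF PC vyu(1) yv] FM z r] nap_cmp[OF vyu(1) yv z r] vyu(2)[OF y q] yug
        coyoneda_arr(2)[OF ctv Fg] nap_yoneda[OF C'' Mh[OF e] ftor_hom[OF Fu[OF v] Fg]]
      by (rule psf_M_comm[OF F_lax u v uv g, symmetric])
    finally show "nap (?yw \<odot>\<^bsub>PSh ?C''\<^esub> PM Fh u v (hom_psh ?C e)) (fobj (PF F v) ?Fx)
        (un v (ext u (hom_psh ?C e)) ?Fx (un u (hom_psh ?C e) x g)) =
      nap (farr (yoneda ?C'') (PM F u v e) \<odot>\<^bsub>PSh ?C''\<^esub> (?yv \<odot>\<^bsub>PSh ?C''\<^esub> farr (PF Fh v) ?yu))
        (fobj (PF F v) ?Fx) (un v (ext u (hom_psh ?C e)) ?Fx (un u (hom_psh ?C e) x g))" .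
  qed
  then show "N2 (yoneda_pnt B F) ?w e \<odot>\<^bsub>PC Fh (Dom B v)\<^esub> PM Fh u v (fobj (NC (yoneda_pnt B F) (Cod B u)) e) =
     farr (NC (yoneda_pnt B F) (Dom B v)) (PM F u v e) \<odot>\<^bsub>PC Fh (Dom B v)\<^esub>
       (N2 (yoneda_pnt B F) v (fobj (PF F u) e) \<odot>\<^bsub>PC Fh (Dom B v)\<^esub> farr (PF Fh v) (N2 (yoneda_pnt B F) u e))"
    unfolding yoneda_pnt_sel(1)[OF dv] yoneda_pnt_sel(1)[OF cu] yoneda_pnt_sel(2)[OF u e]
        yoneda_pnt_sel(2)[OF v Fe]
      yoneda_pnt_sel(2)[OF w(1) ew] fobj_yoneda[OF e] psh_completion_sel(1) .
next
  fix b e assume b: "b \<in> Obj B" and e: "e \<in> Obj (PC F b)"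
  note i = Idt_arr[OF B b]
  let ?i = "Idt B b" and ?C = "PC F b"
  note C = Fb[OF b] and PC = PSh_category[OF Fb[OF b]]
  note cti = U sCod[OF i(1)] sDom[OF i(1)] Fu[OF i(1)]
  have P: "hom_psh ?C e \<in> Obj (PSh ?C)" by (rule hom_psh_psh[OF small[OF b]])
  have ei: "e \<in> Obj (PC F (Cod B ?i))" using e i by simp
  let ?yi = "coyoneda_arr (PC F (Cod B ?i)) (PC F (Dom B ?i)) (PF F ?i) e"
  have yi: "?yi \<in> hom (PSh ?C) (ext ?i (hom_psh ?C e)) (hom_psh ?C (fobj (PF F ?i) e))"
    using coyoneda_arr(1)[OF cti, of e] i by (simp add: psh_ext_def)
  note I = completion_I[OF b P] and Ih = psf_I_hom[OF F_lax b]
  have FI: "farr (yoneda ?C) (PI F b e) \<in> hom (PSh ?C) (hom_psh ?C e) (hom_psh ?C (fobj (PF F ?i) e))"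
    using ftor_hom[OF yoneda_functor[OF small[OF b]] Ih[OF e]] hom_objs[OF C Ih[OF e]] by simp
  have "?yi \<odot>\<^bsub>PSh ?C\<^esub> PI Fh b (hom_psh ?C e) = farr (yoneda ?C) (PI F b e)"
  proof (rule nap_eqI[OF cmp_hom[OF PC I(1) yi] FI])
    fix x g assume x: "x \<in> Obj ?C" and g': "g \<in> fobj (hom_psh ?C e) x"
    then have g: "g \<in> hom ?C x e" by simp
    have gi: "g \<in> hom (PC F (Cod B ?i)) x e" using g i by simp
    have Fg: "farr (PF F ?i) g \<in> hom ?C (fobj (PF F ?i) x) (fobj (PF F ?i) e)"
      using ftor_hom[OF Fu[OF i(1)] gi] i by simp
    have s: "un ?i (hom_psh ?C e) x g \<in> fobj (ext ?i (hom_psh ?C e)) (fobj (PF F ?i) x)"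
      using un_in[OF i(1) _ _ , of "hom_psh ?C e" x g] P x g' i by simp
    have yig: "nap ?yi (fobj (PF F ?i) x) (un ?i (hom_psh ?C e) x g) = farr (PF F ?i) g"
      using coyoneda_arr(2)[OF cti gi] i by simp
    show "nap (?yi \<odot>\<^bsub>PSh ?C\<^esub> PI Fh b (hom_psh ?C e)) x g = nap (farr (yoneda ?C) (PI F b e)) x g"
      unfolding nap_cmp[OF I(1) yi x g'] I(2)[OF x g'] nap_comm[OF C yi Ih[OF x] s] yig
          act_hom_psh[OF Ih[OF x] Fg]
        nap_yoneda[OF C Ih[OF e] g] by (rule psf_I_comm[OF F_lax b g, symmetric])
  qed
  then show "N2 (yoneda_pnt B F) ?i e \<odot>\<^bsub>PC Fh b\<^esub> PI Fh b (fobj (NC (yoneda_pnt B F) b) e) =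
      farr (NC (yoneda_pnt B F) b) (PI F b e)"
    unfolding yoneda_pnt_sel(1)[OF b] yoneda_pnt_sel(2)[OF i(1) ei] fobj_yoneda[OF e] psh_completion_sel(1)
        .
qed

end

section \<open>Restriction along a pseudonatural transformation\<close>

lemma arr_cmp:
  assumes "is_category D"
  shows "f \<in> Arr D \<Longrightarrow> g \<in> Arr D \<Longrightarrow> Dom D g = Cod D f \<Longrightarrow> g \<odot>\<^bsub>D\<^esub> f \<in> Arr D"
    and "f \<in> Arr D \<Longrightarrow> g \<in> Arr D \<Longrightarrow> Dom D g = Cod D f \<Longrightarrow> Dom D (g \<odot>\<^bsub>D\<^esub> f) = Dom D f"
    and "f \<in> Arr D \<Longrightarrow> g \<in> Arr D \<Longrightarrow> Dom D g = Cod D f \<Longrightarrow> Cod D (g \<odot>\<^bsub>D\<^esub> f) = Cod D g"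
    and "f \<in> Arr D \<Longrightarrow> g \<in> Arr D \<Longrightarrow> h \<in> Arr D \<Longrightarrow> Dom D g = Cod D f \<Longrightarrow> Dom D h = Cod D g \<Longrightarrow>
           (h \<odot>\<^bsub>D\<^esub> g) \<odot>\<^bsub>D\<^esub> f = h \<odot>\<^bsub>D\<^esub> (g \<odot>\<^bsub>D\<^esub> f)"
  using assms unfolding is_category_def hom_def by auto

text \<open>
  Composites are normalized to nest to the right; this form of an equation between composites
  applies in front of a further arrow \<open>z\<close>.
\<close>

lemma cmp_rewrite:
  assumes "is_category D" "g \<odot>\<^bsub>D\<^esub> f = k" "f \<in> Arr D" "g \<in> Arr D" "Dom D g = Cod D f"
  shows "z \<in> Arr D \<Longrightarrow> Dom D f = Cod D z \<Longrightarrow> g \<odot>\<^bsub>D\<^esub> (f \<odot>\<^bsub>D\<^esub> z) = k \<odot>\<^bsub>D\<^esub> z"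
  using assms arr_cmp(4)[OF assms(1)] by metis

lemma comp_pnt_sel:
  "b \<in> Obj B \<Longrightarrow> NC (comp_pnt B P Q R \<beta> \<alpha>) b = comp_ftor (PC P b) (NC \<beta> b) (NC \<alpha> b)"
  "u \<in> Arr B \<Longrightarrow> x \<in> Obj (PC P (Cod B u)) \<Longrightarrow> N2 (comp_pnt B P Q R \<beta> \<alpha>) u x =
     farr (NC \<beta> (Dom B u)) (N2 \<alpha> u x) \<odot>\<^bsub>PC R (Dom B u)\<^esub> N2 \<beta> u (fobj (NC \<alpha> (Cod B u)) x)"
  by (simp_all add: comp_pnt_def)

context
  fixes B :: "('b, 'v) cat" and P :: "('b, 'v, 'o1, 'm1) psf" and Q :: "('b, 'v, 'o2, 'm2) psf"
    and R :: "('b, 'v, 'o3, 'm3) psf"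
  assumes B: "is_category B" and P: "lax_data B P" and Q: "lax_data B Q" and R: "lax_data B R"
begin

private lemmas Pf = lax_data_fibre_data[OF P] and Qf = lax_data_fibre_data[OF Q]
    and Rf = lax_data_fibre_data[OF R]

text \<open>
  The 2-cell of the composite is a pasting of the 2-cells of \<open>\<alpha>\<close> and \<open>\<beta>\<close>.  Coherence for a
  composable pair follows from that of \<open>\<alpha>\<close> and \<open>\<beta>\<close> after exchanging the 2-cell of \<open>\<beta>\<close> at the second
  arrow with the 2-cell of \<open>\<alpha>\<close> at the first, by naturality.
\<close>

lemma comp_pnt_pseudonat:
  assumes a: "pseudonat B P Q \<alpha>" and b: "pseudonat B Q R \<beta>"
  shows "pseudonat B P R (comp_pnt B P Q R \<beta> \<alpha>)"
  unfolding pseudonat_def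
proof (intro conjI ballI impI)
  show "NC (comp_pnt B P Q R \<beta> \<alpha>) \<in> extensional (Obj B)" "N2 (comp_pnt B P Q R \<beta> \<alpha>) \<in> extensional (Arr B)"
    by (simp_all add: comp_pnt_def)
  show "is_functor (PC P c) (PC R c) (NC (comp_pnt B P Q R \<beta> \<alpha>) c)" if c: "c \<in> Obj B" for c
    unfolding comp_pnt_sel(1)[OF c] by (rule comp_ftor_functor[OF fibre_cat[OF Pf c] pnt_ftor[OF a c]
        pnt_ftor[OF b c]])
next
  fix u assume u: "u \<in> Arr B"
  note c = Cod_obj[OF B u] and d = Dom_obj[OF B u]
  note Pc = fibre_cat[OF Pf c] and Rd = fibre_cat[OF Rf d]
  note ac = pnt_ftor[OF a c] and ad = pnt_ftor[OF a d] and bc = pnt_ftor[OF b c] and bd = pnt_ftor[OF b d]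
  show "is_natiso (PC P (Cod B u)) (PC R (Dom B u))
      (comp_ftor (PC P (Cod B u)) (PF R u) (NC (comp_pnt B P Q R \<beta> \<alpha>) (Cod B u)))
      (comp_ftor (PC P (Cod B u)) (NC (comp_pnt B P Q R \<beta> \<alpha>) (Dom B u)) (PF P u))
          (N2 (comp_pnt B P Q R \<beta> \<alpha>) u)"
    unfolding is_natiso_def comp_pnt_sel(1)[OF c] comp_pnt_sel(1)[OF d]
  proof (intro conjI ballI is_natI[OF Pc comp_ftor_functor[OF Pc comp_ftor_functor[OF Pc ac bc]
      fibre_ftor[OF Rf u]]
        comp_ftor_functor[OF Pc fibre_ftor[OF Pf u] comp_ftor_functor[OF fibre_cat[OF Pf d] ad bd]]])
    show "N2 (comp_pnt B P Q R \<beta> \<alpha>) u \<in> extensional (Obj (PC P (Cod B u)))" using u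
        by (simp add: comp_pnt_def)
    fix x assume x: "x \<in> Obj (PC P (Cod B u))"
    note ax = pnt_hom[OF a u x] and bx = pnt_hom[OF b u ftor_obj[OF ac x]]
    show "N2 (comp_pnt B P Q R \<beta> \<alpha>) u x \<in> hom (PC R (Dom B u))
        (fobj (comp_ftor (PC P (Cod B u)) (PF R u)
            (comp_ftor (PC P (Cod B u)) (NC \<beta> (Cod B u)) (NC \<alpha> (Cod B u)))) x)
        (fobj (comp_ftor (PC P (Cod B u)) (comp_ftor (PC P (Dom B u)) (NC \<beta> (Dom B u)) (NC \<alpha> (Dom B u)))
            (PF P u)) x)"
      using cmp_hom[OF Rd bx ftor_hom[OF bd ax]] x ftor_obj[OF fibre_ftor[OF Pf u] x]
      by (simp add: comp_pnt_sel(2)[OF u x])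
    show "is_iso (PC R (Dom B u)) (N2 (comp_pnt B P Q R \<beta> \<alpha>) u x)"
      unfolding comp_pnt_sel(2)[OF u x]
      by (rule iso_cmp[OF Rd pnt_iso[OF b u ftor_obj[OF ac x]] bx
            ftor_iso[OF fibre_cat[OF Qf d] bd pnt_iso[OF a u x] ax] ftor_hom[OF bd ax]])
  next
    fix f x y assume x: "x \<in> Obj (PC P (Cod B u))" and y: "y \<in> Obj (PC P (Cod B u))"
        and f: "f \<in> hom (PC P (Cod B u)) x y"
    note af = ftor_hom[OF ac f] and Pu = fibre_ftor[OF Pf u] and Qu = fibre_ftor[OF Qf u]
        and Ru = fibre_ftor[OF Rf u]
    note ax = pnt_hom[OF a u x] and ay = pnt_hom[OF a u y]
    note bx = pnt_hom[OF b u ftor_obj[OF ac x]] and b_y = pnt_hom[OF b u ftor_obj[OF ac y]]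
    note baf = pnt_comm[OF b u af]
    have sq: "farr (NC \<beta> (Dom B u)) (N2 \<alpha> u y) \<odot>\<^bsub>PC R (Dom B u)\<^esub> farr (NC \<beta> (Dom B u))
        (farr (PF Q u) (farr (NC \<alpha> (Cod B u)) f)) =
        farr (NC \<beta> (Dom B u)) (farr (NC \<alpha> (Dom B u)) (farr (PF P u) f)) \<odot>\<^bsub>PC R (Dom B u)\<^esub> farr
            (NC \<beta> (Dom B u)) (N2 \<alpha> u x)"
      unfolding ftor_cmp[OF bd ftor_hom[OF Qu af] ay, symmetric]
          ftor_cmp[OF bd ax ftor_hom[OF ad ftor_hom[OF Pu f]], symmetric]
        pnt_comm[OF a u f] ..
    note at = homD[OF ftor_hom[OF Ru ftor_hom[OF bc af]]] homD[OF bx] homD[OF b_y]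
        homD[OF ftor_hom[OF bd ay]]
      homD[OF ftor_hom[OF bd ax]] homD[OF ftor_hom[OF bd ftor_hom[OF Qu af]]]
      homD[OF ftor_hom[OF bd ftor_hom[OF ad ftor_hom[OF Pu f]]]]
    have "farr (comp_ftor (PC P (Cod B u)) (PF R u)
        (comp_ftor (PC P (Cod B u)) (NC \<beta> (Cod B u)) (NC \<alpha> (Cod B u)))) f =
        farr (PF R u) (farr (NC \<beta> (Cod B u)) (farr (NC \<alpha> (Cod B u)) f))"
      "farr (comp_ftor (PC P (Cod B u)) (comp_ftor (PC P (Dom B u)) (NC \<beta> (Dom B u)) (NC \<alpha> (Dom B u)))
          (PF P u)) f =
        farr (NC \<beta> (Dom B u)) (farr (NC \<alpha> (Dom B u)) (farr (PF P u) f))"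
      by (simp_all add: farr_comp_hom[OF f] farr_comp_hom[OF ftor_hom[OF Pu f]])
    then show "N2 (comp_pnt B P Q R \<beta> \<alpha>) u y \<odot>\<^bsub>PC R (Dom B u)\<^esub>
        farr (comp_ftor (PC P (Cod B u)) (PF R u)
            (comp_ftor (PC P (Cod B u)) (NC \<beta> (Cod B u)) (NC \<alpha> (Cod B u)))) f =
        farr (comp_ftor (PC P (Cod B u)) (comp_ftor (PC P (Dom B u)) (NC \<beta> (Dom B u)) (NC \<alpha> (Dom B u)))
            (PF P u)) f
          \<odot>\<^bsub>PC R (Dom B u)\<^esub> N2 (comp_pnt B P Q R \<beta> \<alpha>) u x"
      unfolding comp_pnt_sel(2)[OF u x] comp_pnt_sel(2)[OF u y]
      by (simp add: at arr_cmp[OF Rd] baf cmp_rewrite[OF Rd sq])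
  qed
next
  fix u v x assume u: "u \<in> Arr B" and v: "v \<in> Arr B" and uv: "Dom B u = Cod B v"
      and x: "x \<in> Obj (PC P (Cod B u))"
  note w = cmp_arr[OF B u v uv]
  let ?w = "u \<odot>\<^bsub>B\<^esub> v" and ?D = "PC R (Dom B v)"
  note c = Cod_obj[OF B u] and d = Dom_obj[OF B u] and d' = Dom_obj[OF B v] and cv = Cod_obj[OF B v]
  note D = fibre_cat[OF Rf d'] 
  note ac = pnt_ftor[OF a c] and acv = pnt_ftor[OF a cv] and bcv = pnt_ftor[OF b cv]
      and bc = pnt_ftor[OF b c] and b' = pnt_ftor[OF b d'] and a' = pnt_ftor[OF a d']
  have xw: "x \<in> Obj (PC P (Cod B ?w))" using x w by simp
  note Rv = fibre_ftor[OF Rf v] and Qv = fibre_ftor[OF Qf v]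
  let ?ax = "fobj (NC \<alpha> (Cod B u)) x" and ?Px = "fobj (PF P u) x"
  have ax: "?ax \<in> Obj (PC Q (Cod B u))" by (rule ftor_obj[OF ac x])
  have Px: "?Px \<in> Obj (PC P (Cod B v))" using ftor_obj[OF fibre_ftor[OF Pf u] x] uv by simp
  have axw: "?ax \<in> Obj (PC Q (Cod B ?w))" using ax w by simp
  have auh: "N2 \<alpha> u x \<in> hom (PC Q (Cod B v)) (fobj (PF Q u) ?ax) (fobj (NC \<alpha> (Cod B v)) ?Px)"
    using pnt_hom[OF a u x] uv by simp
  have buh: "N2 \<beta> u ?ax \<in> hom (PC R (Cod B v)) (fobj (PF R u) (fobj (NC \<beta> (Cod B u)) ?ax))
      (fobj (NC \<beta> (Cod B v)) (fobj (PF Q u) ?ax))"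
    using pnt_hom[OF b u ax] uv by simp
  have awh: "N2 \<alpha> ?w x \<in> hom (PC Q (Dom B v)) (fobj (PF Q ?w) ?ax)
      (fobj (NC \<alpha> (Dom B v)) (fobj (PF P ?w) x))"
    using pnt_hom[OF a w(1) xw] w by simp
  have bwh: "N2 \<beta> ?w ?ax \<in> hom ?D (fobj (PF R ?w) (fobj (NC \<beta> (Cod B u)) ?ax))
      (fobj (NC \<beta> (Dom B v)) (fobj (PF Q ?w) ?ax))"
    using pnt_hom[OF b w(1) axw] w by simp
  note avh = pnt_hom[OF a v Px]
  note bvh = pnt_hom[OF b v ftor_obj[OF acv Px]]
      and bvQ = pnt_hom[OF b v hom_objs(1)[OF fibre_cat[OF Qf cv] auh]]
  note PMx = psf_M_hom[OF P u v uv x] and QMx = psf_M_hom[OF Q u v uv ax]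
      and RMx = psf_M_hom[OF R u v uv ftor_obj[OF bc ax]]
  note eb = pnt_comp[OF b u v uv ax]
  have ea: "farr (NC \<beta> (Dom B v)) (N2 \<alpha> ?w x) \<odot>\<^bsub>?D\<^esub> farr (NC \<beta> (Dom B v)) (PM Q u v ?ax) =
      farr (NC \<beta> (Dom B v)) (farr (NC \<alpha> (Dom B v)) (PM P u v x)) \<odot>\<^bsub>?D\<^esub>
        (farr (NC \<beta> (Dom B v)) (N2 \<alpha> v ?Px) \<odot>\<^bsub>?D\<^esub> farr (NC \<beta> (Dom B v)) (farr (PF Q v) (N2 \<alpha> u x)))"
    unfolding ftor_cmp[OF b' QMx awh, symmetric] ftor_cmp[OF b' ftor_hom[OF Qv auh] avh, symmetric]
      ftor_cmp[OF b' cmp_hom[OF fibre_cat[OF Qf d'] ftor_hom[OF Qv auh] avh] ftor_hom[OF a' PMx], symmetric]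
      pnt_comp[OF a u v uv x] ..
  note en = pnt_comm[OF b v auh]
  note ec = ftor_cmp[OF Rv buh ftor_hom[OF bcv auh]]
  note at = homD[OF bwh] homD[OF RMx] homD[OF ftor_hom[OF b' awh]] homD[OF ftor_hom[OF b' QMx]]
     homD[OF ftor_hom[OF b' ftor_hom[OF a' PMx]]] homD[OF ftor_hom[OF b' avh]]
         homD[OF ftor_hom[OF b' ftor_hom[OF Qv auh]]]
     homD[OF bvh] homD[OF bvQ] homD[OF ftor_hom[OF Rv buh]] homD[OF ftor_hom[OF Rv ftor_hom[OF bcv auh]]]
  show "N2 (comp_pnt B P Q R \<beta> \<alpha>) ?w x \<odot>\<^bsub>?D\<^esub> PM R u v (fobj (NC (comp_pnt B P Q R \<beta> \<alpha>) (Cod B u)) x) =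
      farr (NC (comp_pnt B P Q R \<beta> \<alpha>) (Dom B v)) (PM P u v x) \<odot>\<^bsub>?D\<^esub>
        (N2 (comp_pnt B P Q R \<beta> \<alpha>) v (fobj (PF P u) x) \<odot>\<^bsub>?D\<^esub> farr (PF R v) (N2 (comp_pnt B P Q R \<beta> \<alpha>) u x))"
    unfolding comp_pnt_sel(2)[OF u x] comp_pnt_sel(2)[OF v Px] comp_pnt_sel(2)[OF w(1) xw]
        comp_pnt_sel(1)[OF c]
      comp_pnt_sel(1)[OF d'] fobj_comp[OF x] farr_comp_hom[OF PMx] w(2,3) uv ec
    by (simp add: at arr_cmp[OF D] eb cmp_rewrite[OF D ea] cmp_rewrite[OF D en])
next
  fix c x assume c: "c \<in> Obj B" and x: "x \<in> Obj (PC P c)"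
  note i = Idt_arr[OF B c]
  let ?i = "Idt B c" and ?D = "PC R c"
  note D = fibre_cat[OF Rf c]
  have xi: "x \<in> Obj (PC P (Cod B ?i))" using x i by simp
  note ac = pnt_ftor[OF a c] and bc = pnt_ftor[OF b c]
  let ?ax = "fobj (NC \<alpha> c) x"
  have ax: "?ax \<in> Obj (PC Q c)" by (rule ftor_obj[OF ac x])
  have axi: "?ax \<in> Obj (PC Q (Cod B ?i))" using ax i by simp
  have aih: "N2 \<alpha> ?i x \<in> hom (PC Q c) (fobj (PF Q ?i) ?ax) (fobj (NC \<alpha> c) (fobj (PF P ?i) x))"
    using pnt_hom[OF a i(1) xi] i by simp
  have bih: "N2 \<beta> ?i ?ax \<in> hom ?D (fobj (PF R ?i) (fobj (NC \<beta> c) ?ax)) (fobj (NC \<beta> c) (fobj (PF Q ?i) ?ax))"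
    using pnt_hom[OF b i(1) axi] i by simp
  note PIx = psf_I_hom[OF P c x] and QIx = psf_I_hom[OF Q c ax]
      and RIx = psf_I_hom[OF R c ftor_obj[OF bc ax]]
  have ea: "farr (NC \<beta> c) (N2 \<alpha> ?i x) \<odot>\<^bsub>?D\<^esub> farr (NC \<beta> c) (PI Q c ?ax)
      = farr (NC \<beta> c) (farr (NC \<alpha> c) (PI P c x))"
    unfolding ftor_cmp[OF bc QIx aih, symmetric] pnt_unit[OF a c x] ..
  note eb = pnt_unit[OF b c ax]
  note at = homD[OF bih] homD[OF RIx] homD[OF ftor_hom[OF bc aih]] homD[OF ftor_hom[OF bc QIx]]
  show "N2 (comp_pnt B P Q R \<beta> \<alpha>) ?i x \<odot>\<^bsub>?D\<^esub> PI R c (fobj (NC (comp_pnt B P Q R \<beta> \<alpha>) c) x) =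
      farr (NC (comp_pnt B P Q R \<beta> \<alpha>) c) (PI P c x)"
    unfolding comp_pnt_sel(2)[OF i(1) xi] comp_pnt_sel(1)[OF c] fobj_comp[OF x] farr_comp_hom[OF PIx] i(2,3)
    by (simp add: at arr_cmp[OF D] eb ea)
qed

text \<open>
  The condition at \<open>u\<close> combines the condition on \<open>\<Gamma>\<close> at \<open>u\<close> with the naturality of its component at
  the 2-cell of \<open>\<alpha>\<close>.
\<close>

lemma modification_whisker:
  assumes a: "pseudonat B P Q \<alpha>" and G: "modification B Q R \<beta> \<gamma> \<Gamma>"
  shows "modification B P R (comp_pnt B P Q R \<beta> \<alpha>) (comp_pnt B P Q R \<gamma> \<alpha>)
           (\<lambda>b\<in>Obj B. \<lambda>x\<in>Obj (PC P b). \<Gamma> b (fobj (NC \<alpha> b) x))"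
  unfolding modification_def
proof (intro conjI ballI comp_pnt_pseudonat[OF a mod_pnt(1)[OF G]]
    comp_pnt_pseudonat[OF a mod_pnt(2)[OF G]])
  fix b assume b: "b \<in> Obj B"
  show "is_nat (PC P b) (PC R b) (NC (comp_pnt B P Q R \<beta> \<alpha>) b) (NC (comp_pnt B P Q R \<gamma> \<alpha>) b)
      ((\<lambda>b\<in>Obj B. \<lambda>x\<in>Obj (PC P b). \<Gamma> b (fobj (NC \<alpha> b) x)) b)"
    using nat_whisker_right[OF fibre_cat[OF Pf b] pnt_ftor[OF a b] mod_nat[OF G b]] b
    by (simp add: comp_pnt_sel(1)[OF b])
next
  fix u x assume u: "u \<in> Arr B" and x: "x \<in> Obj (PC P (Cod B u))"
  note c = Cod_obj[OF B u] and d = Dom_obj[OF B u]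
  note D = fibre_cat[OF Rf d]
  note ac = pnt_ftor[OF a c] and gd = pnt_ftor[OF mod_pnt(2)[OF G] d]
      and bd = pnt_ftor[OF mod_pnt(1)[OF G] d]
  note Px = ftor_obj[OF fibre_ftor[OF Pf u] x] and ax = ftor_obj[OF ac x]
  note auh = pnt_hom[OF a u x] and Qax = ftor_obj[OF fibre_ftor[OF Qf u] ax]
  note e1 = mod_comm[OF G u ax]
  note e2 = nat_comm[OF mod_nat[OF G d] auh]
  note at = homD[OF ftor_hom[OF fibre_ftor[OF Rf u] mod_hom[OF G c ax]]]
      homD[OF pnt_hom[OF mod_pnt(2)[OF G] u ax]]
    homD[OF pnt_hom[OF mod_pnt(1)[OF G] u ax]] homD[OF ftor_hom[OF gd auh]] homD[OF ftor_hom[OF bd auh]]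
    homD[OF mod_hom[OF G d Qax]] homD[OF mod_hom[OF G d ftor_obj[OF pnt_ftor[OF a d] Px]]]
  show "N2 (comp_pnt B P Q R \<gamma> \<alpha>) u x \<odot>\<^bsub>PC R (Dom B u)\<^esub>
        farr (PF R u) ((\<lambda>b\<in>Obj B. \<lambda>x\<in>Obj (PC P b). \<Gamma> b (fobj (NC \<alpha> b) x)) (Cod B u) x) =
      (\<lambda>b\<in>Obj B. \<lambda>x\<in>Obj (PC P b). \<Gamma> b (fobj (NC \<alpha> b) x)) (Dom B u) (fobj (PF P u) x) \<odot>\<^bsub>PC R (Dom B u)\<^esub>
        N2 (comp_pnt B P Q R \<beta> \<alpha>) u x"
    unfolding comp_pnt_sel(2)[OF u x] restrict_apply'[OF c] restrict_apply'[OF d] restrict_apply'[OF x]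
        restrict_apply'[OF Px]
    by (simp add: at arr_cmp[OF D] e1 cmp_rewrite[OF D e2[symmetric]])
qed simp

lemma restrict_along_functor:
  assumes a: "pseudonat B P Q \<alpha>"
  shows "is_functor (PsNat_cocont U B Q R) (PsNat B P R) (restrict_along U B P Q R \<alpha>)"
proof -
  let ?C = "PsNat_cocont U B Q R" and ?D = "PsNat B P R" and ?F = "restrict_along U B P Q R \<alpha>"
  have C: "is_category ?C" unfolding PsNat_cocont_def
      by (rule full_subcat_category[OF PsNat_category[OF B Qf Rf]])
  have fo: "fobj ?F \<beta> = comp_pnt B P Q R \<beta> \<alpha>" if "\<beta> \<in> Obj ?C" for \<beta> using that
      by (simp add: restrict_along_def)
  have oc: "pseudonat B Q R \<beta>" if "\<beta> \<in> Obj ?C" for \<beta> using that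
      by (simp add: PsNat_cocont_def full_subcat_def)
  have hc: "\<exists>\<Gamma>. t = (\<beta>, \<gamma>, \<Gamma>) \<and> modification B Q R \<beta> \<gamma> \<Gamma>" if "t \<in> hom ?C \<beta> \<gamma>" for t \<beta> \<gamma>
    using that by (auto simp: PsNat_cocont_def hom_full_subcat hom_PsNat split: if_splits)
  have fa: "farr ?F (\<beta>, \<gamma>, \<Gamma>) = (comp_pnt B P Q R \<beta> \<alpha>, comp_pnt B P Q R \<gamma> \<alpha>, \<lambda>b\<in>Obj B. \<lambda>x\<in>Obj (PC P b). \<Gamma> b
      (fobj (NC \<alpha> b) x))"
    if "(\<beta>, \<gamma>, \<Gamma>) \<in> hom ?C \<beta> \<gamma>" for \<beta> \<gamma> \<Gamma> using homD(1)[OF that] by (simp add: restrict_along_def)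
  note ao = ftor_obj[OF pnt_ftor[OF a]]
  show ?thesis
  proof (rule is_functorI[OF C])
    fix \<beta> assume b: "\<beta> \<in> Obj ?C"
    show "fobj ?F \<beta> \<in> Obj ?D" using fo[OF b] comp_pnt_pseudonat[OF a oc[OF b]] by simp
    have I: "Idt ?C \<beta> = (\<beta>, \<beta>, \<lambda>b\<in>Obj B. \<lambda>x\<in>Obj (PC Q b). Idt (PC R b) (fobj (NC \<beta> b) x))"
      by (simp add: PsNat_cocont_def full_subcat_def)
    show "farr ?F (Idt ?C \<beta>) = Idt ?D (fobj ?F \<beta>)"
      unfolding I fa[OF Idt_hom[OF C b, unfolded I]] fo[OF b] PsNat_sel
      by (auto simp: fun_eq_iff restrict_def ao comp_pnt_sel)
  next
    fix t \<beta> \<gamma> assume t: "t \<in> hom ?C \<beta> \<gamma>"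
    note o = hom_objs[OF C t]
    obtain \<Gamma> where t': "t = (\<beta>, \<gamma>, \<Gamma>)" and G: "modification B Q R \<beta> \<gamma> \<Gamma>" using hc[OF t] by blast
    show "farr ?F t \<in> hom ?D (fobj ?F \<beta>) (fobj ?F \<gamma>)"
      unfolding t' fa[OF t[unfolded t']] fo[OF o(1)] fo[OF o(2)] hom_PsNat
          using modification_whisker[OF a G] by simp
    fix s \<delta> assume s: "s \<in> hom ?C \<gamma> \<delta>"
    obtain \<Delta> where s': "s = (\<gamma>, \<delta>, \<Delta>)" using hc[OF s] by blast
    have st: "s \<odot>\<^bsub>?C\<^esub> t = (\<beta>, \<delta>, \<lambda>b\<in>Obj B. \<lambda>x\<in>Obj (PC Q b). \<Delta> b x \<odot>\<^bsub>PC R b\<^esub> \<Gamma> b x)"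
      unfolding s' t' by (simp add: PsNat_cocont_def full_subcat_def)
    show "farr ?F (s \<odot>\<^bsub>?C\<^esub> t) = farr ?F s \<odot>\<^bsub>?D\<^esub> farr ?F t"
      unfolding st fa[OF cmp_hom[OF C t s, unfolded st]] 
      unfolding t' s' fa[OF t[unfolded t']] fa[OF s[unfolded s']] PsNat_sel
      by (auto simp: fun_eq_iff restrict_def ao)
  qed (simp_all add: restrict_along_def)
qed

end

section \<open>The universal property of the completion\<close>

lemma colimit_cong:
  assumes J: "is_category J" and eq: "\<And>j. j \<in> Obj J \<Longrightarrow> \<iota> j = \<iota>' j" and c: "is_colimit J D K x \<iota>"
  shows "is_colimit J D K x \<iota>'"
proof -
  have "is_cocone J D K x \<iota>'"
    using c eq Dom_obj[OF J] Cod_obj[OF J] by (simp add: is_colimit_def is_cocone_def)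
  then show ?thesis using c eq unfolding is_colimit_def by simp
qed

lemma cocontinuous_comp:
  fixes U :: "'w itself"
  assumes C: "is_category C" and F: "cocontinuous U C D F" and G: "cocontinuous U D E G"
  shows "cocontinuous U C E (comp_ftor C G F)"
  unfolding cocontinuous_def
proof (intro conjI allI impI)
  have Ff: "is_functor C D F" and Gf: "is_functor D E G" using F G by (auto simp: cocontinuous_def)
  show "is_functor C E (comp_ftor C G F)" by (rule comp_ftor_functor[OF C Ff Gf])
  fix J :: "('w, 'w) cat" and K x \<iota>
  assume sJ: "small_category J" and K: "is_functor J C K" and col: "is_colimit J C K x \<iota>"
  have J: "is_category J" using sJ by (simp add: small_category_def)
  have x: "x \<in> Obj C" and i: "\<And>j. j \<in> Obj J \<Longrightarrow> \<iota> j \<in> hom C (fobj K j) x"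
    using col by (auto simp: is_colimit_def is_cocone_def)
  have "is_colimit J D (comp_ftor J F K) (fobj F x) (\<lambda>j. farr F (\<iota> j))"
    using F sJ K col unfolding cocontinuous_def by blast
  then have "is_colimit J E (comp_ftor J G (comp_ftor J F K)) (fobj G (fobj F x))
      (\<lambda>j. farr G (farr F (\<iota> j)))"
    using G sJ comp_ftor_functor[OF J K Ff] unfolding cocontinuous_def by blast
  then have "is_colimit J E (comp_ftor J (comp_ftor C G F) K) (fobj (comp_ftor C G F) x)
      (\<lambda>j. farr G (farr F (\<iota> j)))"
    unfolding comp_ftor_assoc[OF K] using x by simp
  then show "is_colimit J E (comp_ftor J (comp_ftor C G F) K) (fobj (comp_ftor C G F) x)
      (\<lambda>j. farr (comp_ftor C G F) (\<iota> j))"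
    by (rule colimit_cong[OF J, rotated]) (use homD(1)[OF i] in simp)
qed

text \<open>
  The diagram chase for the coherence of the extended transformation at a composite \<open>u \<odot> v\<close>, at a
  representable.  Its arrows are the following: \<open>n\<close>, \<open>n1\<close>, \<open>n2\<close> are extended 2-cells and \<open>gn\<close> is the
  image of one under \<open>G v\<close>; \<open>k\<close>, \<open>k1\<close>, \<open>hk\<close>, \<open>gk\<close> come from the 2-cells of the Yoneda
  transformation; \<open>t\<close>, \<open>t1\<close>, \<open>gt\<close>, \<open>wt\<close>, \<open>ggt\<close> from the isomorphisms between the restricted extension
  and the given transformation; \<open>p\<close>, \<open>p1\<close>, \<open>gp\<close> from the 2-cells of the latter; \<open>m\<close>, \<open>m'\<close>, \<open>hm\<close>, \<open>ym\<close>,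
  \<open>pm\<close> from comparison cells.  The equations \<open>sq\<close> define the extended 2-cells, and \<open>coh\<close> contains the
  coherence of the given transformation and of the Yoneda transformation.
\<close>

lemma coherence_from_representables:
  fixes D (structure)
  assumes D: "is_category D"
    and t: "is_iso D t" "t \<in> hom D d e" and k: "is_iso D k" "k \<in> hom D c d"
    and homs: "n \<in> hom D b c" "m \<in> hom D a b" "gn \<in> hom D a a1" "n1 \<in> hom D a1 c1" "hm \<in> hom D c1 c"
      "gk \<in> hom D a1 a2" "n2 \<in> hom D a2 c2" "hk \<in> hom D c1 c2" "k1 \<in> hom D c2 d1" "ym \<in> hom D d1 d"
      "t1 \<in> hom D d1 e1" "pm \<in> hom D e1 e" "gt \<in> hom D a2 a3" "p1 \<in> hom D a3 e1"
      "ggt \<in> hom D a a4" "gp \<in> hom D a4 a3" "wt \<in> hom D b b4" "m' \<in> hom D a4 b4" "p \<in> hom D b4 e"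
    and sq: "t \<odot> (k \<odot> n) = p \<odot> wt" "t1 \<odot> (k1 \<odot> n2) = p1 \<odot> gt" "gt \<odot> (gk \<odot> gn) = gp \<odot> ggt"
    and nat: "wt \<odot> m = m' \<odot> ggt" "t \<odot> ym = pm \<odot> t1" "hk \<odot> n1 = n2 \<odot> gk"
    and coh: "p \<odot> m' = pm \<odot> (p1 \<odot> gp)" "k \<odot> hm = ym \<odot> (k1 \<odot> hk)"
  shows "n \<odot> m = hm \<odot> (n1 \<odot> gn)"
proof (rule iso_cancel_left[OF D iso_cmp[OF D k t] cmp_hom[OF D k(2) t(2)]])
  note at = arr_cmp[OF D] homD[OF t(2)] homD[OF k(2)] homs[THEN homD(1)] homs[THEN homD(2)]
      homs[THEN homD(3)]
  show "n \<odot> m \<in> hom D a c" by (rule cmp_hom[OF D homs(2,1)])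
  show "hm \<odot> (n1 \<odot> gn) \<in> hom D a c" by (rule cmp_hom[OF D cmp_hom[OF D homs(3,4)] homs(5)])
  have "t \<odot> k \<odot> (n \<odot> m) = (t \<odot> (k \<odot> n)) \<odot> m" by (simp add: at)
  also have "\<dots> = p \<odot> (wt \<odot> m)" unfolding sq(1) by (simp add: at)
  also have "\<dots> = (p \<odot> m') \<odot> ggt" unfolding nat(1) by (simp add: at)
  also have "\<dots> = pm \<odot> (p1 \<odot> (gp \<odot> ggt))" unfolding coh(1) by (simp add: at)
  also have "\<dots> = pm \<odot> ((p1 \<odot> gt) \<odot> (gk \<odot> gn))" unfolding sq(3)[symmetric] by (simp add: at)
  also have "\<dots> = (pm \<odot> t1) \<odot> (k1 \<odot> ((n2 \<odot> gk) \<odot> gn))" unfolding sq(2)[symmetric] by (simp add: at)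
  also have "\<dots> = t \<odot> ((ym \<odot> (k1 \<odot> hk)) \<odot> (n1 \<odot> gn))" unfolding nat(2,3)[symmetric] by (simp add: at)
  also have "\<dots> = t \<odot> k \<odot> (hm \<odot> (n1 \<odot> gn))" unfolding coh(2)[symmetric] by (simp add: at)
  finally show "t \<odot> k \<odot> (n \<odot> m) = t \<odot> k \<odot> (hm \<odot> (n1 \<odot> gn))" .
qed

text \<open>
  The analogous chase at an identity arrow, with the unit cells in place of the comparison cells.
\<close>

lemma unit_coherence_from_representables:
  fixes D (structure)
  assumes D: "is_category D"
    and t: "is_iso D t" "t \<in> hom D d e" and k: "is_iso D k" "k \<in> hom D c d"
    and homs: "n \<in> hom D b c" "i \<in> hom D a b" "hi \<in> hom D a c"
      "gt \<in> hom D b b4" "i' \<in> hom D a4 b4" "p \<in> hom D b4 e" "t0 \<in> hom D a a4"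
    and eqs: "t \<odot> (k \<odot> n) = p \<odot> gt" "gt \<odot> i = i' \<odot> t0" "p \<odot> i' = pi" "k \<odot> hi = yi" "t \<odot> yi = pi \<odot> t0"
  shows "n \<odot> i = hi"
proof (rule iso_cancel_left[OF D iso_cmp[OF D k t] cmp_hom[OF D k(2) t(2)] cmp_hom[OF D homs(2,1)] homs(3)])
  note at = arr_cmp[OF D] homD[OF t(2)] homD[OF k(2)] homs[THEN homD(1)] homs[THEN homD(2)]
      homs[THEN homD(3)]
  have "t \<odot> k \<odot> (n \<odot> i) = (t \<odot> (k \<odot> n)) \<odot> i" by (simp add: at)
  also have "\<dots> = p \<odot> (gt \<odot> i)" unfolding eqs(1) by (simp add: at)
  also have "\<dots> = (p \<odot> i') \<odot> t0" unfolding eqs(2) by (simp add: at)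
  also have "\<dots> = t \<odot> (k \<odot> hi)" unfolding eqs(3,4,5) ..
  also have "\<dots> = t \<odot> k \<odot> hi" by (simp add: at)
  finally show "t \<odot> k \<odot> (n \<odot> i) = t \<odot> k \<odot> hi" .
qed

context
  fixes B :: "('b, 'v) cat" and F :: "('b, 'v, 'u, 'u) psf" and G :: "('b, 'v, 'o, 'm) psf"
  assumes U: "universe TYPE('u)" and B: "is_category B" and F: "pseudofunctor B F"
    and small: "\<And>b. b \<in> Obj B \<Longrightarrow> small_category (PC F b)" and G: "pseudofunctor_cocont TYPE('u) B G"
begin

private abbreviation (input) "Fhat \<equiv> psh_completion B F"
private abbreviation (input) "y \<equiv> yoneda_pnt B F"

private lemma Gp: "pseudofunctor B G" using G by (simp add: pseudofunctor_cocont_def)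
private lemmas Gl = pseudofunctor_lax_data[OF Gp] and Fl = pseudofunctor_lax_data[OF F]
  and Fhl = psh_completion_lax_data[OF U B F small]
private lemmas Gf = lax_data_fibre_data[OF Gl] and Ff = lax_data_fibre_data[OF Fl]
    and Fhf = lax_data_fibre_data[OF Fhl]
private lemmas yp = yoneda_pnt_pseudonat[OF U B F small]

private lemma Gcoc: "u \<in> Arr B \<Longrightarrow> cocontinuous TYPE('u) (PC G (Cod B u)) (PC G (Dom B u)) (PF G u)"
  using G by (simp add: pseudofunctor_cocont_def)

private lemma NCy: "b \<in> Obj B \<Longrightarrow> NC y b = yoneda (PC F b)"
  by (rule yoneda_pnt_sel(1)[OF U B F small])

private lemma yh:
  assumes "u \<in> Arr B" "e \<in> Obj (PC F (Cod B u))"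
  shows "N2 y u e \<in> hom (PSh (PC F (Dom B u))) (fobj (PF Fhat u) (hom_psh (PC F (Cod B u)) e))
           (hom_psh (PC F (Dom B u)) (fobj (PF F u) e))"
  using pnt_hom[OF yp assms] assms(2) NCy Cod_obj[OF B assms(1)] Dom_obj[OF B assms(1)]
    ftor_obj[OF fibre_ftor[OF Ff assms(1)] assms(2)] by simp

private lemma yiso: "u \<in> Arr B \<Longrightarrow> e \<in> Obj (PC F (Cod B u)) \<Longrightarrow> is_iso (PSh (PC F (Dom B u))) (N2 y u e)"
  using pnt_iso[OF yp] by simp

private lemma rep: "b \<in> Obj B \<Longrightarrow> hom_psh (PC F b) e \<in> Obj (PSh (PC F b))"
  by (rule hom_psh_psh[OF small])

text \<open>
  In every fibre the component \<open>\<Gamma>0 c\<close> has a unique extension \<open>\<sigma> c\<close> along the Yoneda embedding.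
  Both sides of the condition for a modification are natural in \<open>P\<close> and start from the cocontinuous
  functor \<open>G u \<circ> \<alpha> c\<close>, so it suffices to compare them at representables.  There they agree after
  composition with the image under \<open>\<beta>\<close> of the co-Yoneda isomorphism, because \<open>\<Gamma>0\<close> is a modification.
\<close>

lemma restrict_fully_faithful:
  assumes a: "pseudonat B Fhat G \<alpha>" and ac: "\<And>b. b \<in> Obj B \<Longrightarrow>
      cocontinuous TYPE('u) (PSh (PC F b)) (PC G b) (NC \<alpha> b)"
    and b: "pseudonat B Fhat G \<beta>"
    and G0: "modification B F G (comp_pnt B F Fhat G \<alpha> y) (comp_pnt B F Fhat G \<beta> y) \<Gamma>0"
  shows "\<exists>!\<Gamma>. modification B Fhat G \<alpha> \<beta> \<Gamma> \<and> (\<forall>b\<in>Obj B. \<forall>e\<in>Obj (PC F b). \<Gamma> b (hom_psh (PC F b) e) = \<Gamma>0 b e)"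
proof -
  have "\<exists>\<sigma>. is_nat (PSh (PC F c)) (PC G c) (NC \<alpha> c) (NC \<beta> c) \<sigma> \<and>
      (\<forall>e\<in>Obj (PC F c). \<sigma> (hom_psh (PC F c) e) = \<Gamma>0 c e)"
    if c: "c \<in> Obj B" for c
  proof -
    have n: "is_nat (PC F c) (PC G c) (comp_ftor (PC F c) (NC \<alpha> c) (yoneda (PC F c)))
        (comp_ftor (PC F c) (NC \<beta> c) (yoneda (PC F c))) (\<Gamma>0 c)"
      using mod_nat[OF G0 c] unfolding comp_pnt_sel(1)[OF c] NCy[OF c] .
    have K: "is_functor (PSh (PC F c)) (PC G c) (NC \<beta> c)" using pnt_ftor[OF b c] by simp
    show ?thesis
      by (rule nat_extension[OF U small[OF c] fibre_cat[OF Gf c] ac[OF c] K n]) blast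
  qed
  then have "\<forall>c\<in>Obj B. \<exists>\<sigma>. is_nat (PSh (PC F c)) (PC G c) (NC \<alpha> c) (NC \<beta> c) \<sigma> \<and>
      (\<forall>e\<in>Obj (PC F c). \<sigma> (hom_psh (PC F c) e) = \<Gamma>0 c e)"
    by blast
  from bchoice[OF this] obtain \<sigma> where s0: "\<forall>c\<in>Obj B. is_nat (PSh (PC F c)) (PC G c) (NC \<alpha> c) (NC \<beta> c) (\<sigma> c)
      \<and>
      (\<forall>e\<in>Obj (PC F c). \<sigma> c (hom_psh (PC F c) e) = \<Gamma>0 c e)" by blast
  have s: "is_nat (PSh (PC F c)) (PC G c) (NC \<alpha> c) (NC \<beta> c) (\<sigma> c)" if "c \<in> Obj B" for c using s0 that
      by blast
  have sr: "\<sigma> c (hom_psh (PC F c) e) = \<Gamma>0 c e" if "c \<in> Obj B" "e \<in> Obj (PC F c)" for c e using s0 that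
      by blast
  define \<Gamma> where "\<Gamma> = (\<lambda>c\<in>Obj B. \<sigma> c)"
  have Gs: "\<Gamma> c = \<sigma> c" if "c \<in> Obj B" for c using that by (simp add: \<Gamma>_def)
  have M: "modification B Fhat G \<alpha> \<beta> \<Gamma>"
    unfolding modification_def
  proof (intro conjI ballI a b)
    show "\<Gamma> \<in> extensional (Obj B)" by (simp add: \<Gamma>_def)
    show "is_nat (PC Fhat c) (PC G c) (NC \<alpha> c) (NC \<beta> c) (\<Gamma> c)" if c: "c \<in> Obj B" for c
      using s[OF c] Gs[OF c] by simp
  next
    fix u P assume u: "u \<in> Arr B" and P: "P \<in> Obj (PC Fhat (Cod B u))"
    note c = Cod_obj[OF B u] and d = Dom_obj[OF B u]
    let ?C = "PC F (Cod B u)" and ?C' = "PC F (Dom B u)" and ?D = "PC G (Dom B u)"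
    note D = fibre_cat[OF Gf d] and PC = PSh_category[OF fibre_cat[OF Ff c]]
    note Gu = fibre_ftor[OF Gf u] and Fu = fibre_ftor[OF Ff u]
    have L: "is_functor (PSh ?C) (PSh ?C') (PF Fhat u)" using fibre_ftor[OF Fhf u] by simp
    have na: "is_nat (PSh ?C) ?D (comp_ftor (PSh ?C) (PF G u) (NC \<alpha> (Cod B u)))
        (comp_ftor (PSh ?C) (NC \<alpha> (Dom B u)) (PF Fhat u)) (N2 \<alpha> u)"
      using natiso_nat[OF pnt_natiso[OF a u]] by simp
    have nb: "is_nat (PSh ?C) ?D (comp_ftor (PSh ?C) (PF G u) (NC \<beta> (Cod B u)))
        (comp_ftor (PSh ?C) (NC \<beta> (Dom B u)) (PF Fhat u)) (N2 \<beta> u)"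
      using natiso_nat[OF pnt_natiso[OF b u]] by simp
    \<comment> \<open>the two sides of the modification condition as transformations from G u alpha to beta F(u)_!\<close>
    note n1 = nat_vcomp[OF PC D nat_whisker_left[OF PC s[OF c] Gu] nb]
    note n2 = nat_vcomp[OF PC D na nat_whisker_right[OF PC L s[OF d]]]
    have eq: "N2 \<beta> u (hom_psh ?C e) \<odot>\<^bsub>?D\<^esub> farr (PF G u) (\<sigma> (Cod B u) (hom_psh ?C e)) =
        \<sigma> (Dom B u) (fobj (PF Fhat u) (hom_psh ?C e)) \<odot>\<^bsub>?D\<^esub> N2 \<alpha> u (hom_psh ?C e)" if e: "e \<in> Obj ?C" for e
    proof (rule iso_cancel_left[OF D])
      note Fe = ftor_obj[OF Fu e] and r = rep[OF c, of e]
      have r': "hom_psh ?C e \<in> Obj (PC Fhat (Cod B u))" using r by simp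
      have bd: "is_functor (PSh ?C') ?D (NC \<beta> (Dom B u))" using pnt_ftor[OF b d] by simp
      have ad: "is_functor (PSh ?C') ?D (NC \<alpha> (Dom B u))" using pnt_ftor[OF a d] by simp
      note yue = yh[OF u e]
      have PC': "is_category (PSh ?C')" using fibre_cat[OF Fhf d] by simp
      note S = ftor_hom[OF bd yue]
      note A = ftor_hom[OF ad yue]
      note bh = pnt_hom[OF b u r'] and ah = pnt_hom[OF a u r']
      note sc = nat_hom[OF s[OF c] r]
      note Gsc = ftor_hom[OF Gu sc]
      note sd = nat_hom[OF s[OF d] ftor_obj[OF L r]]
      note sd' = nat_hom[OF s[OF d] rep[OF d, of "fobj (PF F u) e"]]
      show "is_iso ?D (farr (NC \<beta> (Dom B u)) (N2 y u e))" by (rule ftor_iso[OF PC' bd yiso[OF u e] yue])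
      show "farr (NC \<beta> (Dom B u)) (N2 y u e) \<in> hom ?D
          (fobj (NC \<beta> (Dom B u)) (fobj (PF Fhat u) (hom_psh ?C e)))
          (fobj (NC \<beta> (Dom B u)) (hom_psh ?C' (fobj (PF F u) e)))" by (rule S)
      show "N2 \<beta> u (hom_psh ?C e) \<odot>\<^bsub>?D\<^esub> farr (PF G u) (\<sigma> (Cod B u) (hom_psh ?C e)) \<in>
          hom ?D (fobj (PF G u) (fobj (NC \<alpha> (Cod B u)) (hom_psh ?C e)))
              (fobj (NC \<beta> (Dom B u)) (fobj (PF Fhat u) (hom_psh ?C e)))"
        by (rule cmp_hom[OF D Gsc bh])
      show "\<sigma> (Dom B u) (fobj (PF Fhat u) (hom_psh ?C e)) \<odot>\<^bsub>?D\<^esub> N2 \<alpha> u (hom_psh ?C e) \<in>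
          hom ?D (fobj (PF G u) (fobj (NC \<alpha> (Cod B u)) (hom_psh ?C e)))
              (fobj (NC \<beta> (Dom B u)) (fobj (PF Fhat u) (hom_psh ?C e)))"
        by (rule cmp_hom[OF D ah sd])
      have law: "farr (NC \<beta> (Dom B u)) (N2 y u e) \<odot>\<^bsub>?D\<^esub> N2 \<beta> u (hom_psh ?C e) \<odot>\<^bsub>?D\<^esub> farr (PF G u)
          (\<sigma> (Cod B u) (hom_psh ?C e)) =
          \<sigma> (Dom B u) (hom_psh ?C' (fobj (PF F u) e)) \<odot>\<^bsub>?D\<^esub>
            (farr (NC \<alpha> (Dom B u)) (N2 y u e) \<odot>\<^bsub>?D\<^esub> N2 \<alpha> u (hom_psh ?C e))"
        using mod_comm[OF G0 u e] unfolding comp_pnt_sel(2)[OF u e] NCy[OF c] fobj_yoneda[OF e] sr[OF c e]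
            sr[OF d Fe] .
      note nat = nat_comm[OF s[OF d] yue]
      show "farr (NC \<beta> (Dom B u)) (N2 y u e) \<odot>\<^bsub>?D\<^esub>
          (N2 \<beta> u (hom_psh ?C e) \<odot>\<^bsub>?D\<^esub> farr (PF G u) (\<sigma> (Cod B u) (hom_psh ?C e))) =
        farr (NC \<beta> (Dom B u)) (N2 y u e) \<odot>\<^bsub>?D\<^esub> (\<sigma> (Dom B u) (fobj (PF Fhat u) (hom_psh ?C e)) \<odot>\<^bsub>?D\<^esub> N2 \<alpha> u
            (hom_psh ?C e))"
        unfolding cmp_assoc[OF D Gsc bh S] law cmp_assoc[OF D ah sd S] nat[symmetric]
            cmp_assoc[OF D ah A sd'] ..
    qed
    have H: "cocontinuous TYPE('u) (PSh ?C) ?D (comp_ftor (PSh ?C) (PF G u) (NC \<alpha> (Cod B u)))"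
      by (rule cocontinuous_comp[OF PC ac[OF c] Gcoc[OF u]])
    have "(\<lambda>P\<in>Obj (PSh ?C). N2 \<beta> u P \<odot>\<^bsub>?D\<^esub> (\<lambda>P\<in>Obj (PSh ?C). farr (PF G u) (\<sigma> (Cod B u) P)) P) =
       (\<lambda>P\<in>Obj (PSh ?C). (\<lambda>P\<in>Obj (PSh ?C). \<sigma> (Dom B u) (fobj (PF Fhat u) P)) P \<odot>\<^bsub>?D\<^esub> N2 \<alpha> u P)"
      by (rule nat_eq_on_representables[OF U small[OF c] D H n1 n2]) (use rep[OF c] eq in simp)
    from fun_cong[OF this, of P] show "N2 \<beta> u P \<odot>\<^bsub>?D\<^esub> farr (PF G u) (\<Gamma> (Cod B u) P)
        = \<Gamma> (Dom B u) (fobj (PF Fhat u) P) \<odot>\<^bsub>?D\<^esub> N2 \<alpha> u P"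
      using P Gs[OF c] Gs[OF d] by simp
  qed
  show ?thesis
  proof (rule ex1I[of _ \<Gamma>])
    show "modification B Fhat G \<alpha> \<beta> \<Gamma> \<and> (\<forall>b\<in>Obj B. \<forall>e\<in>Obj (PC F b). \<Gamma> b (hom_psh (PC F b) e) = \<Gamma>0 b e)"
      using M Gs sr by simp
    fix \<Delta> assume D: "modification B Fhat G \<alpha> \<beta> \<Delta> \<and>
        (\<forall>b\<in>Obj B. \<forall>e\<in>Obj (PC F b). \<Delta> b (hom_psh (PC F b) e) = \<Gamma>0 b e)"
    show "\<Delta> = \<Gamma>"
    proof (rule mod_eqI[OF conjunct1[OF D] M])
      fix c P assume c: "c \<in> Obj B"
      have "\<Delta> c = \<sigma> c"
        by (rule nat_eq_on_representables[OF U small[OF c] fibre_cat[OF Gf c] ac[OF c] _ s[OF c]])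
          (use mod_nat[OF conjunct1[OF D] c] D sr[OF c] c in simp_all)
      then show "\<Delta> c P = \<Gamma> c P" using Gs[OF c] by simp
    qed
  qed
qed

text \<open>
  Each component \<open>NC \<phi> c\<close> has a cocontinuous extension \<open>H c\<close>, with \<open>\<theta> c\<close> identifying its
  restriction with \<open>NC \<phi> c\<close>.  For \<open>u\<close> from \<open>d\<close> to \<open>c\<close>, the functors \<open>G u \<circ> H c\<close> and \<open>H d \<circ> F(u)\<^sub>!\<close> are
  cocontinuous and their restrictions to representables are isomorphic to \<open>G u \<circ> NC \<phi> c\<close> and
  \<open>NC \<phi> d \<circ> F u\<close>; the 2-cell of \<open>\<phi>\<close> therefore extends to an isomorphism \<open>n u\<close>.  The equation that
  determines \<open>n u\<close> at representables says that \<open>\<theta>\<close> is a modification, and the coherence conditions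
  follow from those of \<open>\<phi>\<close> and of the Yoneda transformation at representables.
\<close>

lemma restrict_essentially_surjective:
  assumes p: "pseudonat B F G \<phi>"
  obtains \<alpha> \<theta> where "pseudonat B Fhat G \<alpha>"
    "\<And>b. b \<in> Obj B \<Longrightarrow> cocontinuous TYPE('u) (PSh (PC F b)) (PC G b) (NC \<alpha> b)"
    "modification B F G (comp_pnt B F Fhat G \<alpha> y) \<phi> \<theta>"
    "\<And>b e. b \<in> Obj B \<Longrightarrow> e \<in> Obj (PC F b) \<Longrightarrow> is_iso (PC G b) (\<theta> b e)"
proof -
  have "\<exists>z. cocontinuous TYPE('u) (PSh (PC F c)) (PC G c) (fst z) \<and>
      is_natiso (PC F c) (PC G c) (comp_ftor (PC F c) (fst z) (yoneda (PC F c))) (NC \<phi> c) (snd z)"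
          if c: "c \<in> Obj B" for c
  proof -
    have "cocomplete TYPE('u) (PC G c)" using G c by (simp add: pseudofunctor_cocont_def)
    from cocontinuous_extension[OF U small[OF c] fibre_cat[OF Gf c] this pnt_ftor[OF p c]] show ?thesis
      by (metis fst_conv snd_conv)
  qed
  then have "\<forall>c\<in>Obj B. \<exists>z. cocontinuous TYPE('u) (PSh (PC F c)) (PC G c) (fst z) \<and>
      is_natiso (PC F c) (PC G c) (comp_ftor (PC F c) (fst z) (yoneda (PC F c))) (NC \<phi> c) (snd z)" by blast
  from bchoice[OF this] obtain z where z: "\<forall>c\<in>Obj B. cocontinuous TYPE('u) (PSh (PC F c)) (PC G c)
      (fst (z c)) \<and>
      is_natiso (PC F c) (PC G c) (comp_ftor (PC F c) (fst (z c)) (yoneda (PC F c))) (NC \<phi> c) (snd (z c))"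
          by blast
  define H where "H c = fst (z c)" for c
  define \<theta> where "\<theta> c = snd (z c)" for c
  have Hc: "cocontinuous TYPE('u) (PSh (PC F c)) (PC G c) (H c)" if "c \<in> Obj B" for c using z that
      by (simp add: H_def)
  have ti: "is_natiso (PC F c) (PC G c) (comp_ftor (PC F c) (H c) (yoneda (PC F c))) (NC \<phi> c) (\<theta> c)"
      if "c \<in> Obj B" for c
    using z that by (simp add: H_def \<theta>_def)
  have H: "is_functor (PSh (PC F c)) (PC G c) (H c)" if "c \<in> Obj B" for c using Hc[OF that]
      by (simp add: cocontinuous_def)
  have th: "\<theta> c e \<in> hom (PC G c) (fobj (H c) (hom_psh (PC F c) e)) (fobj (NC \<phi> c) e)"
      if "c \<in> Obj B" "e \<in> Obj (PC F c)" for c e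
    using nat_hom[OF natiso_nat[OF ti[OF that(1)]] that(2)] that by simp
  have tiso: "is_iso (PC G c) (\<theta> c e)" if "c \<in> Obj B" "e \<in> Obj (PC F c)" for c e
    using natiso_iso[OF ti[OF that(1)] that(2)] .
  have tcomm: "\<theta> c e' \<odot>\<^bsub>PC G c\<^esub> farr (H c) (farr (yoneda (PC F c)) f) = farr (NC \<phi> c) f \<odot>\<^bsub>PC G c\<^esub> \<theta> c e"
    if "c \<in> Obj B" "f \<in> hom (PC F c) e e'" for c f e e'
    using nat_comm[OF natiso_nat[OF ti[OF that(1)]] that(2)] that(2) by simp
  have Fhu: "is_functor (PSh (PC F (Cod B u))) (PSh (PC F (Dom B u))) (PF Fhat u)" if "u \<in> Arr B" for u
    using fibre_ftor[OF Fhf that] by simp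
  have PCc: "is_category (PSh (PC F c))" if "c \<in> Obj B" for c using fibre_cat[OF Fhf that] by simp
  have "\<exists>n. is_natiso (PSh (PC F (Cod B u))) (PC G (Dom B u))
      (comp_ftor (PSh (PC F (Cod B u))) (PF G u) (H (Cod B u)))
        (comp_ftor (PSh (PC F (Cod B u))) (H (Dom B u)) (PF Fhat u)) n \<and>
      (\<forall>e\<in>Obj (PC F (Cod B u)). \<theta> (Dom B u) (fobj (PF F u) e) \<odot>\<^bsub>PC G (Dom B u)\<^esub>
         (farr (H (Dom B u)) (N2 y u e) \<odot>\<^bsub>PC G (Dom B u)\<^esub> n (hom_psh (PC F (Cod B u)) e)) =
         N2 \<phi> u e \<odot>\<^bsub>PC G (Dom B u)\<^esub> farr (PF G u) (\<theta> (Cod B u) e))"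
    if u: "u \<in> Arr B" for u
  proof -
    note c = Cod_obj[OF B u] and d = Dom_obj[OF B u]
    let ?C = "PC F (Cod B u)" and ?C' = "PC F (Dom B u)" and ?D = "PC G (Dom B u)"
    note C = fibre_cat[OF Ff c] and C' = fibre_cat[OF Ff d] and D = fibre_cat[OF Gf d]
    note Gu = fibre_ftor[OF Gf u] and Fu = fibre_ftor[OF Ff u]
    note yc = yoneda_functor[OF small[OF c]]
    have yn: "is_natiso ?C (PSh ?C') (comp_ftor ?C (PF Fhat u) (yoneda ?C))
        (comp_ftor ?C (yoneda ?C') (PF F u)) (N2 y u)"
      using pnt_natiso[OF yp u] NCy[OF c] NCy[OF d] by simp
    note t1 = nat_whisker_left[OF C natiso_nat[OF ti[OF c]] Gu]
    note t2 = natiso_nat[OF pnt_natiso[OF p u]]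
    note t3 = nat_whisker_right[OF C Fu nat_cinv[OF C' D ti[OF d]]]
    note t4 = nat_whisker_left[OF C nat_cinv[OF C PCc[OF d] yn] H[OF d]]
    (* G u H y, by theta to G u phi, by the 2-cell of phi to phi F u, by the inverse of theta to
       H y F u, and by the inverse of the co-Yoneda isomorphism to H F(u)_! y *)
    note t = nat_vcomp[OF C D nat_vcomp[OF C D nat_vcomp[OF C D t1 t2] t3]
        t4[folded comp_ftor_assoc[OF Fu]],
        folded comp_ftor_assoc[OF yc]]
    have Kc: "cocontinuous TYPE('u) (PSh ?C) ?D (comp_ftor (PSh ?C) (PF G u) (H (Cod B u)))"
      by (rule cocontinuous_comp[OF PCc[OF c] Hc[OF c] Gcoc[OF u]])
    have Lc: "cocontinuous TYPE('u) (PSh ?C) ?D (comp_ftor (PSh ?C) (H (Dom B u)) (PF Fhat u))"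
      using psh_completion_cocontinuous[OF U B F small u] cocontinuous_comp[OF PCc[OF c] _ Hc[OF d]] by simp
    have Lf: "is_functor (PSh ?C) ?D (comp_ftor (PSh ?C) (H (Dom B u)) (PF Fhat u))" using Lc
        by (simp add: cocontinuous_def)
    obtain n where n: "is_nat (PSh ?C) ?D (comp_ftor (PSh ?C) (PF G u) (H (Cod B u)))
        (comp_ftor (PSh ?C) (H (Dom B u)) (PF Fhat u)) n"
      and nr0: "\<And>e. e \<in> Obj ?C \<Longrightarrow> n (hom_psh ?C e) = farr (H (Dom B u)) (cinv (PSh ?C') (N2 y u e)) \<odot>\<^bsub>?D\<^esub>
          (cinv ?D (\<theta> (Dom B u) (fobj (PF F u) e)) \<odot>\<^bsub>?D\<^esub> (N2 \<phi> u e \<odot>\<^bsub>?D\<^esub> farr (PF G u) (\<theta> (Cod B u) e)))"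
      by (rule nat_extension[OF U small[OF c] D Kc Lf t]) (use that ftor_obj[OF Fu] in simp)
    have nr: "is_iso ?D (n (hom_psh ?C e)) \<and> \<theta> (Dom B u) (fobj (PF F u) e) \<odot>\<^bsub>?D\<^esub>
         (farr (H (Dom B u)) (N2 y u e) \<odot>\<^bsub>?D\<^esub> n (hom_psh ?C e)) = N2 \<phi> u e \<odot>\<^bsub>?D\<^esub> farr (PF G u) (\<theta> (Cod B u) e)"
      if e: "e \<in> Obj ?C" for e
    proof -
      note Fe = ftor_obj[OF Fu e]
      note ci = cinv[OF yiso[OF u e] yh[OF u e]]
      note Hci = ftor_hom[OF H[OF d] ci(1)] and Hy = ftor_hom[OF H[OF d] yh[OF u e]]
      note Hiso = ftor_iso[OF PCc[OF d] H[OF d] iso_cinv[OF yiso[OF u e] yh[OF u e]] ci(1)]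
      note ct = cinv(1)[OF tiso[OF d Fe] th[OF d Fe]]
      note Gt = ftor_hom[OF Gu th[OF c e]] and ph = pnt_hom[OF p u e]
      note X = cmp_hom[OF D Gt ph] and Y = cmp_hom[OF D cmp_hom[OF D Gt ph] ct]
      have "is_iso ?D (n (hom_psh ?C e))"
        unfolding nr0[OF e]
        by (rule iso_cmp[OF D iso_cmp[OF D iso_cmp[OF D
            ftor_iso[OF fibre_cat[OF Gf c] Gu tiso[OF c e] th[OF c e]] Gt
                pnt_iso[OF p u e] ph] X iso_cinv[OF tiso[OF d Fe] th[OF d Fe]] ct] Y Hiso Hci])
      moreover have "farr (H (Dom B u)) (N2 y u e) \<odot>\<^bsub>?D\<^esub> farr (H (Dom B u)) (cinv (PSh ?C') (N2 y u e)) =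
          Idt ?D (fobj (H (Dom B u)) (hom_psh ?C' (fobj (PF F u) e)))"
        unfolding ftor_cmp[OF H[OF d] ci(1) yh[OF u e], symmetric] ci(3)
            by (rule ftor_id[OF H[OF d] rep[OF d]])
      then have "farr (H (Dom B u)) (N2 y u e) \<odot>\<^bsub>?D\<^esub> n (hom_psh ?C e) =
          cinv ?D (\<theta> (Dom B u) (fobj (PF F u) e)) \<odot>\<^bsub>?D\<^esub> (N2 \<phi> u e \<odot>\<^bsub>?D\<^esub> farr (PF G u) (\<theta> (Cod B u) e))"
        unfolding nr0[OF e] cmp_assoc[OF D Y Hci Hy] using cmp_idl[OF D Y] by simp
      then have "\<theta> (Dom B u) (fobj (PF F u) e) \<odot>\<^bsub>?D\<^esub> (farr (H (Dom B u)) (N2 y u e) \<odot>\<^bsub>?D\<^esub> n (hom_psh ?C e)) =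
          N2 \<phi> u e \<odot>\<^bsub>?D\<^esub> farr (PF G u) (\<theta> (Cod B u) e)"
        using cmp_cinv_cancel[OF D tiso[OF d Fe] th[OF d Fe] X] by simp
      ultimately show ?thesis by blast
    qed
    have "is_natiso (PSh ?C) ?D (comp_ftor (PSh ?C) (PF G u) (H (Cod B u)))
        (comp_ftor (PSh ?C) (H (Dom B u)) (PF Fhat u)) n"
      by (rule natiso_extension[OF U small[OF c] D Kc Lc n]) (use nr in blast)
    then show ?thesis using nr by blast
  qed
  then have "\<forall>u\<in>Arr B. \<exists>n. is_natiso (PSh (PC F (Cod B u))) (PC G (Dom B u))
      (comp_ftor (PSh (PC F (Cod B u))) (PF G u) (H (Cod B u)))
        (comp_ftor (PSh (PC F (Cod B u))) (H (Dom B u)) (PF Fhat u)) n \<and>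
      (\<forall>e\<in>Obj (PC F (Cod B u)). \<theta> (Dom B u) (fobj (PF F u) e) \<odot>\<^bsub>PC G (Dom B u)\<^esub>
         (farr (H (Dom B u)) (N2 y u e) \<odot>\<^bsub>PC G (Dom B u)\<^esub> n (hom_psh (PC F (Cod B u)) e)) =
         N2 \<phi> u e \<odot>\<^bsub>PC G (Dom B u)\<^esub> farr (PF G u) (\<theta> (Cod B u) e))" by blast
  from bchoice[OF this] obtain n where n0: "\<forall>u\<in>Arr B. is_natiso (PSh (PC F (Cod B u))) (PC G (Dom B u))
      (comp_ftor (PSh (PC F (Cod B u))) (PF G u) (H (Cod B u)))
        (comp_ftor (PSh (PC F (Cod B u))) (H (Dom B u)) (PF Fhat u)) (n u) \<and>
      (\<forall>e\<in>Obj (PC F (Cod B u)). \<theta> (Dom B u) (fobj (PF F u) e) \<odot>\<^bsub>PC G (Dom B u)\<^esub>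
         (farr (H (Dom B u)) (N2 y u e) \<odot>\<^bsub>PC G (Dom B u)\<^esub> n u (hom_psh (PC F (Cod B u)) e)) =
         N2 \<phi> u e \<odot>\<^bsub>PC G (Dom B u)\<^esub> farr (PF G u) (\<theta> (Cod B u) e))" by blast
  have ni: "is_natiso (PSh (PC F (Cod B u))) (PC G (Dom B u))
      (comp_ftor (PSh (PC F (Cod B u))) (PF G u) (H (Cod B u)))
        (comp_ftor (PSh (PC F (Cod B u))) (H (Dom B u)) (PF Fhat u)) (n u)" if "u \<in> Arr B" for u
            using n0 that by blast
  have nr: "\<theta> (Dom B u) (fobj (PF F u) e) \<odot>\<^bsub>PC G (Dom B u)\<^esub>
         (farr (H (Dom B u)) (N2 y u e) \<odot>\<^bsub>PC G (Dom B u)\<^esub> n u (hom_psh (PC F (Cod B u)) e)) =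
         N2 \<phi> u e \<odot>\<^bsub>PC G (Dom B u)\<^esub> farr (PF G u) (\<theta> (Cod B u) e)"
    if "u \<in> Arr B" "e \<in> Obj (PC F (Cod B u))" for u e using n0 that by blast
  have nh: "n u P \<in> hom (PC G (Dom B u)) (fobj (PF G u) (fobj (H (Cod B u)) P))
      (fobj (H (Dom B u)) (fobj (PF Fhat u) P))"
    if "u \<in> Arr B" "P \<in> Obj (PSh (PC F (Cod B u)))" for u P
    using nat_hom[OF natiso_nat[OF ni[OF that(1)]] that(2)] that(2) by simp
  have nc: "n u Q \<odot>\<^bsub>PC G (Dom B u)\<^esub> farr (PF G u) (farr (H (Cod B u)) m) =
      farr (H (Dom B u)) (farr (PF Fhat u) m) \<odot>\<^bsub>PC G (Dom B u)\<^esub> n u P"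
    if "u \<in> Arr B" "m \<in> hom (PSh (PC F (Cod B u))) P Q" for u m P Q
    using nat_comm[OF natiso_nat[OF ni[OF that(1)]] that(2)] unfolding farr_comp_hom[OF that(2)] .
  define \<alpha> where "\<alpha> = \<lparr>NC = (\<lambda>c\<in>Obj B. H c), N2 = (\<lambda>u\<in>Arr B. n u)\<rparr>"
  have aC: "NC \<alpha> c = H c" if "c \<in> Obj B" for c using that by (simp add: \<alpha>_def)
  have a2: "N2 \<alpha> u = n u" if "u \<in> Arr B" for u using that by (simp add: \<alpha>_def)
  have a: "pseudonat B Fhat G \<alpha>"
    unfolding pseudonat_def
  proof (intro conjI ballI impI)
    show "NC \<alpha> \<in> extensional (Obj B)" "N2 \<alpha> \<in> extensional (Arr B)" by (simp_all add: \<alpha>_def)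
    show "is_functor (PC Fhat c) (PC G c) (NC \<alpha> c)" if c: "c \<in> Obj B" for c using H[OF c] aC[OF c] by simp
    show "is_natiso (PC Fhat (Cod B u)) (PC G (Dom B u))
        (comp_ftor (PC Fhat (Cod B u)) (PF G u) (NC \<alpha> (Cod B u)))
        (comp_ftor (PC Fhat (Cod B u)) (NC \<alpha> (Dom B u)) (PF Fhat u)) (N2 \<alpha> u)" if u: "u \<in> Arr B" for u
      using ni[OF u] aC[OF Cod_obj[OF B u]] aC[OF Dom_obj[OF B u]] a2[OF u] by simp
  next
    fix u v P assume u: "u \<in> Arr B" and v: "v \<in> Arr B" and uv: "Dom B u = Cod B v"
        and P: "P \<in> Obj (PC Fhat (Cod B u))"
    note w = cmp_arr[OF B u v uv]
    let ?w = "u \<odot>\<^bsub>B\<^esub> v" and ?C = "PC F (Cod B u)" and ?C1 = "PC F (Cod B v)" and ?C2 = "PC F (Dom B v)"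
        and ?D = "PC G (Dom B v)"
    note c = Cod_obj[OF B u] and c1 = Cod_obj[OF B v] and d = Dom_obj[OF B v]
    note D = fibre_cat[OF Gf d] and PC = PCc[OF c]
    let ?H = "H (Cod B u)" and ?H1 = "H (Cod B v)" and ?H2 = "H (Dom B v)"
    have Lu: "is_functor (PSh ?C) (PSh ?C1) (PF Fhat u)" using Fhu[OF u] uv by simp
    note Lv = Fhu[OF v]
    have Gu: "is_functor (PC G (Cod B u)) (PC G (Cod B v)) (PF G u)" using fibre_ftor[OF Gf u] uv by simp
    note Gv = fibre_ftor[OF Gf v]
    have niu: "is_nat (PSh ?C) (PC G (Cod B v)) (comp_ftor (PSh ?C) (PF G u) ?H)
        (comp_ftor (PSh ?C) ?H1 (PF Fhat u)) (n u)"
      using natiso_nat[OF ni[OF u]] uv by simp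
    have niw: "is_nat (PSh ?C) ?D (comp_ftor (PSh ?C) (PF G ?w) ?H) (comp_ftor (PSh ?C) ?H2 (PF Fhat ?w))
        (n ?w)"
      using natiso_nat[OF ni[OF w(1)]] w by simp
    note niv = natiso_nat[OF ni[OF v]]
    have MF: "is_nat (PSh ?C) (PSh ?C2) (comp_ftor (PSh ?C) (PF Fhat v) (PF Fhat u)) (PF Fhat ?w)
        (PM Fhat u v)"
      using psf_M_nat[OF Fhl u v uv] by simp
    note MG = psf_M_nat[OF Gl u v uv]
    have l1: "is_nat (PSh ?C) ?D (comp_ftor (PSh ?C) (PF G v) (comp_ftor (PSh ?C) (PF G u) ?H))
        (comp_ftor (PSh ?C) (PF G ?w) ?H)
        (\<lambda>P\<in>Obj (PSh ?C). PM G u v (fobj ?H P))"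
      using nat_whisker_right[OF PC H[OF c] MG] unfolding comp_ftor_assoc[OF H[OF c]] .
    note n1 = nat_vcomp[OF PC D l1 niw]
    note r1 = nat_whisker_left[OF PC niu Gv]
    have r2: "is_nat (PSh ?C) ?D (comp_ftor (PSh ?C) (PF G v) (comp_ftor (PSh ?C) ?H1 (PF Fhat u)))
        (comp_ftor (PSh ?C) ?H2 (comp_ftor (PSh ?C) (PF Fhat v) (PF Fhat u)))
            (\<lambda>P\<in>Obj (PSh ?C). n v (fobj (PF Fhat u) P))"
      using nat_whisker_right[OF PC Lu niv] unfolding comp_ftor_assoc[OF Lu] .
    note n2 = nat_vcomp[OF PC D nat_vcomp[OF PC D r1 r2] nat_whisker_left[OF PC MF H[OF d]]]
    \<comment> \<open>the common source of both sides is cocontinuous, so they are compared at representables only\<close>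
    have uvH: "cocontinuous TYPE('u) (PSh ?C) ?D
        (comp_ftor (PSh ?C) (PF G v) (comp_ftor (PSh ?C) (PF G u) ?H))"
      using cocontinuous_comp[OF PC cocontinuous_comp[OF PC Hc[OF c] Gcoc[OF u]]] Gcoc[OF v] uv by simp
    have eq: "n ?w (hom_psh ?C e) \<odot>\<^bsub>?D\<^esub> PM G u v (fobj ?H (hom_psh ?C e)) =
        farr ?H2 (PM Fhat u v (hom_psh ?C e)) \<odot>\<^bsub>?D\<^esub>
          (n v (fobj (PF Fhat u) (hom_psh ?C e)) \<odot>\<^bsub>?D\<^esub> farr (PF G v) (n u (hom_psh ?C e)))" if e: "e \<in> Obj ?C"
              for e
    proof -
      let ?P = "hom_psh ?C e" and ?Fe = "fobj (PF F u) e"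
      note r = rep[OF c, of e]
      have ew: "e \<in> Obj (PC F (Cod B ?w))" using e w by simp
      have Fe: "?Fe \<in> Obj ?C1" using ftor_obj[OF fibre_ftor[OF Ff u] e] uv by simp
      note FFe = ftor_obj[OF fibre_ftor[OF Ff v] Fe]
      have Fwe: "fobj (PF F ?w) e \<in> Obj ?C2" using ftor_obj[OF fibre_ftor[OF Ff w(1)] ew] w by simp
      have rw: "?P \<in> Obj (PSh (PC F (Cod B ?w)))" using r w by simp
      have r': "fobj (PF Fhat u) ?P \<in> Obj (PSh ?C1)" by (rule ftor_obj[OF Lu r])
      have nuh: "n u ?P \<in> hom (PC G (Cod B v)) (fobj (PF G u) (fobj ?H ?P))
          (fobj ?H1 (fobj (PF Fhat u) ?P))"
        using nh[OF u r] uv by simp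
      have nwh: "n ?w ?P \<in> hom ?D (fobj (PF G ?w) (fobj ?H ?P)) (fobj ?H2 (fobj (PF Fhat ?w) ?P))"
        using nh[OF w(1) rw] w by simp
      note nvh = nh[OF v r'] and nvF = nh[OF v rep[OF c1, of ?Fe]]
      note MGh = psf_M_hom[OF Gl u v uv ftor_obj[OF H[OF c] r]]
          and MGp = psf_M_hom[OF Gl u v uv ftor_obj[OF pnt_ftor[OF p c] e]]
      have MFh: "PM Fhat u v ?P \<in> hom (PSh ?C2) (fobj (PF Fhat v) (fobj (PF Fhat u) ?P))
          (fobj (PF Fhat ?w) ?P)"
        using psf_M_hom[OF Fhl u v uv] r by simp
      note Mh = psf_M_hom[OF Fl u v uv e]
      have yu: "N2 y u e \<in> hom (PSh ?C1) (fobj (PF Fhat u) ?P) (hom_psh ?C1 ?Fe)"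
          using yh[OF u e] uv by simp
      note yv = yh[OF v Fe]
      have yw: "N2 y ?w e \<in> hom (PSh ?C2) (fobj (PF Fhat ?w) ?P) (hom_psh ?C2 (fobj (PF F ?w) e))"
          using yh[OF w(1) ew] w by simp
      have ywi: "is_iso (PSh ?C2) (N2 y ?w e)" using yiso[OF w(1) ew] w by simp
      have yM: "farr (yoneda ?C2) (PM F u v e)
          \<in> hom (PSh ?C2) (hom_psh ?C2 (fobj (PF F v) ?Fe)) (hom_psh ?C2 (fobj (PF F ?w) e))"
        using ftor_hom[OF yoneda_functor[OF small[OF d]] Mh] FFe Fwe by simp
      note H2 = H[OF d] and P2 = PCc[OF d]
      note tw = th[OF d Fwe] and tFF = th[OF d FFe]
      note Lyu = ftor_hom[OF Lv yu]
      have pu: "N2 \<phi> u e \<in> hom (PC G (Cod B v)) (fobj (PF G u) (fobj (NC \<phi> (Cod B u)) e))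
          (fobj (NC \<phi> (Cod B v)) ?Fe)"
        using pnt_hom[OF p u e] uv by simp
      note pv = pnt_hom[OF p v Fe]
      have pw: "N2 \<phi> ?w e \<in> hom ?D (fobj (PF G ?w) (fobj (NC \<phi> (Cod B u)) e))
          (fobj (NC \<phi> (Dom B v)) (fobj (PF F ?w) e))"
        using pnt_hom[OF p w(1) ew] w by simp
      have Gute: "farr (PF G u) (\<theta> (Cod B u) e)
          \<in> hom (PC G (Cod B v)) (fobj (PF G u) (fobj ?H ?P)) (fobj (PF G u) (fobj (NC \<phi> (Cod B u)) e))"
        by (rule ftor_hom[OF Gu th[OF c e]])
      have Gwte: "farr (PF G ?w) (\<theta> (Cod B u) e)
          \<in> hom ?D (fobj (PF G ?w) (fobj ?H ?P)) (fobj (PF G ?w) (fobj (NC \<phi> (Cod B u)) e))"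
        using ftor_hom[OF fibre_ftor[OF Gf w(1)], of "\<theta> (Cod B u) e"] th[OF c e] w by simp
      have H1yu: "farr ?H1 (N2 y u e) \<in> hom (PC G (Cod B v)) (fobj ?H1 (fobj (PF Fhat u) ?P))
          (fobj ?H1 (hom_psh ?C1 ?Fe))"
        by (rule ftor_hom[OF H[OF c1] yu])
      note tF = th[OF c1 Fe]
      note H2yw = ftor_hom[OF H2 yw] and H2MF = ftor_hom[OF H2 MFh] and H2yM = ftor_hom[OF H2 yM]
          and H2yv = ftor_hom[OF H2 yv]
        and H2Lyu = ftor_hom[OF H2 Lyu] and pM = ftor_hom[OF pnt_ftor[OF p d] Mh]
      note Gvnu = ftor_hom[OF Gv nuh] and GvH1 = ftor_hom[OF Gv H1yu] and GvtF = ftor_hom[OF Gv tF]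
        and Gvpu = ftor_hom[OF Gv pu] and GvGu = ftor_hom[OF Gv Gute]
      have e1: "\<theta> (Dom B v) (fobj (PF F ?w) e) \<odot>\<^bsub>?D\<^esub> (farr ?H2 (N2 y ?w e) \<odot>\<^bsub>?D\<^esub> n ?w ?P) =
          N2 \<phi> ?w e \<odot>\<^bsub>?D\<^esub> farr (PF G ?w) (\<theta> (Cod B u) e)" using nr[OF w(1) ew] w by simp
      have e2: "farr (PF G ?w) (\<theta> (Cod B u) e) \<odot>\<^bsub>?D\<^esub> PM G u v (fobj ?H ?P) =
          PM G u v (fobj (NC \<phi> (Cod B u)) e) \<odot>\<^bsub>?D\<^esub> farr (PF G v) (farr (PF G u) (\<theta> (Cod B u) e))"
        using psf_M_comm[OF Gl u v uv th[OF c e]] by simp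
      have e3: "N2 \<phi> ?w e \<odot>\<^bsub>?D\<^esub> PM G u v (fobj (NC \<phi> (Cod B u)) e) = farr (NC \<phi> (Dom B v)) (PM F u v e) \<odot>\<^bsub>?D\<^esub>
          (N2 \<phi> v ?Fe \<odot>\<^bsub>?D\<^esub> farr (PF G v) (N2 \<phi> u e))" by (rule pnt_comp[OF p u v uv e])
      have ey: "N2 y ?w e \<odot>\<^bsub>PSh ?C2\<^esub> PM Fhat u v ?P = farr (yoneda ?C2) (PM F u v e) \<odot>\<^bsub>PSh ?C2\<^esub>
          (N2 y v ?Fe \<odot>\<^bsub>PSh ?C2\<^esub> farr (PF Fhat v) (N2 y u e))"
        using pnt_comp[OF yp u v uv e] unfolding NCy[OF c] NCy[OF d] fobj_yoneda[OF e] psh_completion_sel(1)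
            .
      have e4: "farr ?H2 (N2 y ?w e) \<odot>\<^bsub>?D\<^esub> farr ?H2 (PM Fhat u v ?P)
          = farr ?H2 (farr (yoneda ?C2) (PM F u v e)) \<odot>\<^bsub>?D\<^esub>
          (farr ?H2 (N2 y v ?Fe) \<odot>\<^bsub>?D\<^esub> farr ?H2 (farr (PF Fhat v) (N2 y u e)))"
        unfolding ftor_cmp[OF H2 MFh yw, symmetric] ey ftor_cmp[OF H2 cmp_hom[OF P2 Lyu yv] yM]
            ftor_cmp[OF H2 Lyu yv] ..
      have e5: "\<theta> (Dom B v) (fobj (PF F ?w) e) \<odot>\<^bsub>?D\<^esub> farr ?H2 (farr (yoneda ?C2) (PM F u v e)) =
          farr (NC \<phi> (Dom B v)) (PM F u v e) \<odot>\<^bsub>?D\<^esub> \<theta> (Dom B v) (fobj (PF F v) ?Fe)" by (rule tcomm[OF d Mh])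
      have e6: "farr ?H2 (farr (PF Fhat v) (N2 y u e)) \<odot>\<^bsub>?D\<^esub> n v (fobj (PF Fhat u) ?P) =
          n v (hom_psh ?C1 ?Fe) \<odot>\<^bsub>?D\<^esub> farr (PF G v) (farr ?H1 (N2 y u e))" by (rule nc[OF v yu, symmetric])
      have e7: "\<theta> (Dom B v) (fobj (PF F v) ?Fe) \<odot>\<^bsub>?D\<^esub> (farr ?H2 (N2 y v ?Fe) \<odot>\<^bsub>?D\<^esub> n v (hom_psh ?C1 ?Fe)) =
          N2 \<phi> v ?Fe \<odot>\<^bsub>?D\<^esub> farr (PF G v) (\<theta> (Cod B v) ?Fe)" by (rule nr[OF v Fe])
      have e8: "farr (PF G v) (\<theta> (Cod B v) ?Fe) \<odot>\<^bsub>?D\<^esub>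
          (farr (PF G v) (farr ?H1 (N2 y u e)) \<odot>\<^bsub>?D\<^esub> farr (PF G v) (n u ?P)) =
          farr (PF G v) (N2 \<phi> u e) \<odot>\<^bsub>?D\<^esub> farr (PF G v) (farr (PF G u) (\<theta> (Cod B u) e))"
        unfolding ftor_cmp[OF Gv nuh H1yu, symmetric]
            ftor_cmp[OF Gv cmp_hom[OF fibre_cat[OF Gf c1] nuh H1yu] tF, symmetric]
          ftor_cmp[OF Gv Gute pu, symmetric] using nr[OF u e] uv by simp
      show ?thesis
        by (rule coherence_from_representables[OF D tiso[OF d Fwe] tw ftor_iso[OF P2 H2 ywi yw] H2yw nwh MGh
            Gvnu nvh H2MF
              GvH1 nvF H2Lyu H2yv H2yM tFF pM GvtF pv GvGu Gvpu Gwte MGp pw e1 e7 e8 e2 e5 e6 e3 e4])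
    qed
    have P': "P \<in> Obj (PSh ?C)" using P by simp
    note all = nat_eq_on_representables[OF U small[OF c] D uvH n1 n2]
    have "n ?w P \<odot>\<^bsub>?D\<^esub> PM G u v (fobj ?H P) =
        farr ?H2 (PM Fhat u v P) \<odot>\<^bsub>?D\<^esub> (n v (fobj (PF Fhat u) P) \<odot>\<^bsub>?D\<^esub> farr (PF G v) (n u P))"
      using fun_cong[OF all, of P] eq rep[OF c] P' by simp
    then show "N2 \<alpha> ?w P \<odot>\<^bsub>?D\<^esub> PM G u v (fobj (NC \<alpha> (Cod B u)) P) = farr (NC \<alpha> (Dom B v)) (PM Fhat u v P) \<odot>\<^bsub>?D\<^esub>
        (N2 \<alpha> v (fobj (PF Fhat u) P) \<odot>\<^bsub>?D\<^esub> farr (PF G v) (N2 \<alpha> u P))"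
      unfolding a2[OF u] a2[OF v] a2[OF w(1)] aC[OF c] aC[OF d] .
  next
    fix c P assume c: "c \<in> Obj B" and P: "P \<in> Obj (PC Fhat c)"
    note i = Idt_arr[OF B c]
    let ?i = "Idt B c" and ?C = "PC F c" and ?D = "PC G c"
    note D = fibre_cat[OF Gf c] and PC = PCc[OF c]
    \<comment> \<open>whiskering the unit cells produces composites with identity functors\<close>
    have Hid: "comp_ftor (PSh ?C) (id_ftor ?D) (H c) = H c"
      by (rule ftor_eqI[OF comp_ftor_functor[OF PC H[OF c] id_ftor_functor[OF D]] H[OF c]])
        (use ftor_obj[OF H[OF c]] H[OF c] in \<open>auto simp: is_functor_def hom_def\<close>)
    have Hid': "comp_ftor (PSh ?C) (H c) (id_ftor (PSh ?C)) = H c"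
      by (rule ftor_eqI[OF comp_ftor_functor[OF PC id_ftor_functor[OF PC] H[OF c]] H[OF c]]) auto
    have nii: "is_nat (PSh ?C) ?D (comp_ftor (PSh ?C) (PF G ?i) (H c))
        (comp_ftor (PSh ?C) (H c) (PF Fhat ?i)) (n ?i)"
      using natiso_nat[OF ni[OF i(1)]] i by simp
    have l1: "is_nat (PSh ?C) ?D (H c) (comp_ftor (PSh ?C) (PF G ?i) (H c))
        (\<lambda>P\<in>Obj (PSh ?C). PI G c (fobj (H c) P))"
      using nat_whisker_right[OF PC H[OF c] psf_I_nat[OF Gl c]] unfolding Hid .
    have IF: "is_nat (PSh ?C) (PSh ?C) (id_ftor (PSh ?C)) (PF Fhat ?i) (PI Fhat c)"
        using psf_I_nat[OF Fhl c] by simp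
    have n2: "is_nat (PSh ?C) ?D (H c) (comp_ftor (PSh ?C) (H c) (PF Fhat ?i))
        (\<lambda>P\<in>Obj (PSh ?C). farr (H c) (PI Fhat c P))"
      using nat_whisker_left[OF PC IF H[OF c]] unfolding Hid' .
    note n1 = nat_vcomp[OF PC D l1 nii]
    have eq: "n ?i (hom_psh ?C e) \<odot>\<^bsub>?D\<^esub> PI G c (fobj (H c) (hom_psh ?C e))
        = farr (H c) (PI Fhat c (hom_psh ?C e))"
      if e: "e \<in> Obj ?C" for e
    proof -
      let ?P = "hom_psh ?C e"
      note r = rep[OF c, of e] and Hcc = H[OF c]
      have ei: "e \<in> Obj (PC F (Cod B ?i))" using e i by simp
      have Fie: "fobj (PF F ?i) e \<in> Obj ?C" using ftor_obj[OF fibre_ftor[OF Ff i(1)] ei] i by simp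
      have nih: "n ?i ?P \<in> hom ?D (fobj (PF G ?i) (fobj (H c) ?P)) (fobj (H c) (fobj (PF Fhat ?i) ?P))"
        using nh[OF i(1), of ?P] r i by simp
      note IGh = psf_I_hom[OF Gl c ftor_obj[OF Hcc r]]
          and IGp = psf_I_hom[OF Gl c ftor_obj[OF pnt_ftor[OF p c] e]]
      have IFh: "PI Fhat c ?P \<in> hom (PSh ?C) ?P (fobj (PF Fhat ?i) ?P)" using psf_I_hom[OF Fhl c] r by simp
      note Ih = psf_I_hom[OF Fl c e]
      have yi: "N2 y ?i e \<in> hom (PSh ?C) (fobj (PF Fhat ?i) ?P) (hom_psh ?C (fobj (PF F ?i) e))"
          using yh[OF i(1) ei] i by simp
      have yii: "is_iso (PSh ?C) (N2 y ?i e)" using yiso[OF i(1) ei] i by simp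
      note ti' = th[OF c Fie]
      have pi: "N2 \<phi> ?i e \<in> hom ?D (fobj (PF G ?i) (fobj (NC \<phi> c) e)) (fobj (NC \<phi> c) (fobj (PF F ?i) e))"
        using pnt_hom[OF p i(1) ei] i by simp
      have Git: "farr (PF G ?i) (\<theta> c e) \<in> hom ?D (fobj (PF G ?i) (fobj (H c) ?P))
          (fobj (PF G ?i) (fobj (NC \<phi> c) e))"
        using ftor_hom[OF fibre_ftor[OF Gf i(1)], of "\<theta> c e"] th[OF c e] i by simp
      note Hyi = ftor_hom[OF Hcc yi] and HIF = ftor_hom[OF Hcc IFh]
      have e1: "\<theta> c (fobj (PF F ?i) e) \<odot>\<^bsub>?D\<^esub> (farr (H c) (N2 y ?i e) \<odot>\<^bsub>?D\<^esub> n ?i ?P)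
          = N2 \<phi> ?i e \<odot>\<^bsub>?D\<^esub> farr (PF G ?i) (\<theta> c e)"
        using nr[OF i(1) ei] i by simp
      have e2: "farr (PF G ?i) (\<theta> c e) \<odot>\<^bsub>?D\<^esub> PI G c (fobj (H c) ?P) = PI G c (fobj (NC \<phi> c) e) \<odot>\<^bsub>?D\<^esub> \<theta> c e"
        by (rule psf_I_comm[OF Gl c th[OF c e], symmetric])
      note e3 = pnt_unit[OF p c e]
      have e4: "farr (H c) (N2 y ?i e) \<odot>\<^bsub>?D\<^esub> farr (H c) (PI Fhat c ?P)
          = farr (H c) (farr (yoneda ?C) (PI F c e))"
        unfolding ftor_cmp[OF Hcc IFh yi, symmetric]
        using pnt_unit[OF yp c e] unfolding NCy[OF c] fobj_yoneda[OF e] psh_completion_sel(1)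
            by (rule arg_cong)
      note e5 = tcomm[OF c Ih]
      show ?thesis
        by (rule unit_coherence_from_representables[OF D tiso[OF c Fie] ti' ftor_iso[OF PC Hcc yii yi] Hyi
            nih IGh HIF Git IGp pi
              th[OF c e] e1 e2 e3 e4 e5])
    qed
    have P': "P \<in> Obj (PSh ?C)" using P by simp
    note all = nat_eq_on_representables[OF U small[OF c] D Hc[OF c] n1 n2]
    have "n ?i P \<odot>\<^bsub>?D\<^esub> PI G c (fobj (H c) P) = farr (H c) (PI Fhat c P)"
      using fun_cong[OF all, of P] eq rep[OF c] P' by simp
    then show "N2 \<alpha> ?i P \<odot>\<^bsub>?D\<^esub> PI G c (fobj (NC \<alpha> c) P) = farr (NC \<alpha> c) (PI Fhat c P)"
      unfolding a2[OF i(1)] aC[OF c] .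
  qed
  define \<Theta> where "\<Theta> = (\<lambda>c\<in>Obj B. \<theta> c)"
  have T: "\<Theta> c = \<theta> c" if "c \<in> Obj B" for c using that by (simp add: \<Theta>_def)
  have "modification B F G (comp_pnt B F Fhat G \<alpha> y) \<phi> \<Theta>"
    unfolding modification_def
  proof (intro conjI ballI comp_pnt_pseudonat[OF B Fl Fhl Gl yp a] p)
    show "\<Theta> \<in> extensional (Obj B)" by (simp add: \<Theta>_def)
    show "is_nat (PC F c) (PC G c) (NC (comp_pnt B F Fhat G \<alpha> y) c) (NC \<phi> c) (\<Theta> c)" if c: "c \<in> Obj B" for c
      unfolding comp_pnt_sel(1)[OF c] NCy[OF c] aC[OF c] T[OF c] by (rule natiso_nat[OF ti[OF c]])
  next
    fix u e assume u: "u \<in> Arr B" and e: "e \<in> Obj (PC F (Cod B u))"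
    note c = Cod_obj[OF B u] and d = Dom_obj[OF B u]
    show "N2 \<phi> u e \<odot>\<^bsub>PC G (Dom B u)\<^esub> farr (PF G u) (\<Theta> (Cod B u) e) =
        \<Theta> (Dom B u) (fobj (PF F u) e) \<odot>\<^bsub>PC G (Dom B u)\<^esub> N2 (comp_pnt B F Fhat G \<alpha> y) u e"
      unfolding comp_pnt_sel(2)[OF u e] NCy[OF c] aC[OF d] a2[OF u] T[OF c] T[OF d] fobj_yoneda[OF e]
      by (rule nr[OF u e, symmetric])
  qed
  then show ?thesis
    by (rule that[OF a, rotated]) (use Hc aC tiso T in simp_all)
qed

end

section \<open>Restriction along the Yoneda embeddings is an equivalence\<close>

theorem theorem17p2:
  fixes B :: "('b, 'v) cat"
    and F :: "('b, 'v, 'u, 'u) psf"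
    and G :: "('b, 'v, 'o, 'm) psf"
  assumes "universe TYPE('u)"
    and "is_category B"
    and "pseudofunctor B F"
    and "\<And>b. b \<in> Obj B \<Longrightarrow> small_category (PC F b)"
    and "pseudofunctor_cocont TYPE('u) B G"
  shows "is_equivalence
           (PsNat_cocont TYPE('u) B (psh_completion B F) G)
           (PsNat B F G)
           (restrict_along TYPE('u) B F (psh_completion B F) G (yoneda_pnt B F))"
proof -
  let ?Fh = "psh_completion B F" and ?y = "yoneda_pnt B F"
  let ?C = "PsNat_cocont TYPE('u) B ?Fh G" and ?D = "PsNat B F G"
  let ?R = "restrict_along TYPE('u) B F ?Fh G ?y"
  have Gp: "pseudofunctor B G" using assms(5) by (simp add: pseudofunctor_cocont_def)
  note Gl = pseudofunctor_lax_data[OF Gp] and Fl = pseudofunctor_lax_data[OF assms(3)]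
    and Fhl = psh_completion_lax_data[OF assms(1-4)] and yp = yoneda_pnt_pseudonat[OF assms(1-4)]
  note Gf = lax_data_fibre_data[OF Gl] and Ff = lax_data_fibre_data[OF Fl]
      and Fhf = lax_data_fibre_data[OF Fhl]
  have C: "is_category ?C"
    unfolding PsNat_cocont_def by (rule full_subcat_category[OF PsNat_category[OF assms(2) Fhf Gf]])
  have O: "\<alpha> \<in> Obj ?C \<longleftrightarrow> pseudonat B ?Fh G \<alpha> \<and> (\<forall>b\<in>Obj B. cocontinuous TYPE('u) (PSh (PC F b)) (PC G b)
      (NC \<alpha> b))" for \<alpha>
    by (simp add: PsNat_cocont_def full_subcat_def)
  have hC: "t \<in> hom ?C \<alpha> \<beta> \<longleftrightarrow> (\<exists>\<Gamma>. t = (\<alpha>, \<beta>, \<Gamma>) \<and> modification B ?Fh G \<alpha> \<beta> \<Gamma>)"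
    if "\<alpha> \<in> Obj ?C" "\<beta> \<in> Obj ?C" for t \<alpha> \<beta>
    using that unfolding O unfolding PsNat_cocont_def hom_full_subcat hom_PsNat by simp
  have Ro: "fobj ?R \<alpha> = comp_pnt B F ?Fh G \<alpha> ?y" if "\<alpha> \<in> Obj ?C" for \<alpha>
    using that by (simp add: restrict_along_def)
  show ?thesis
  proof (rule equivalenceI[OF C PsNat_category[OF assms(2) Ff Gf]
      restrict_along_functor[OF assms(2) Fl Fhl Gl yp]])
    fix \<alpha> \<beta> g assume a: "\<alpha> \<in> Obj ?C" and b: "\<beta> \<in> Obj ?C" and gh: "g \<in> hom ?D (fobj ?R \<alpha>) (fobj ?R \<beta>)"
    obtain \<Gamma>0 where g: "g = (comp_pnt B F ?Fh G \<alpha> ?y, comp_pnt B F ?Fh G \<beta> ?y, \<Gamma>0)"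
      and G0: "modification B F G (comp_pnt B F ?Fh G \<alpha> ?y) (comp_pnt B F ?Fh G \<beta> ?y) \<Gamma>0"
      using gh unfolding hom_PsNat Ro[OF a] Ro[OF b] by blast
    have Ra: "farr ?R (\<alpha>, \<beta>, \<Gamma>) = g \<longleftrightarrow> (\<forall>b\<in>Obj B. \<forall>e\<in>Obj (PC F b). \<Gamma> b (hom_psh (PC F b) e) = \<Gamma>0 b e)"
      if G: "modification B ?Fh G \<alpha> \<beta> \<Gamma>" for \<Gamma>
    proof -
      have h: "(\<alpha>, \<beta>, \<Gamma>) \<in> hom ?C \<alpha> \<beta>" using hC[OF a b] G by blast
      have fa: "farr ?R (\<alpha>, \<beta>, \<Gamma>) = (comp_pnt B F ?Fh G \<alpha> ?y, comp_pnt B F ?Fh G \<beta> ?y,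
          \<lambda>b\<in>Obj B. \<lambda>x\<in>Obj (PC F b). \<Gamma> b (fobj (NC ?y b) x))"
        using homD(1)[OF h] by (simp add: restrict_along_def)
      have W: "modification B F G (comp_pnt B F ?Fh G \<alpha> ?y) (comp_pnt B F ?Fh G \<beta> ?y)
          (\<lambda>b\<in>Obj B. \<lambda>x\<in>Obj (PC F b). \<Gamma> b (fobj (NC ?y b) x))"
        by (rule modification_whisker[OF assms(2) Fl Fhl Gl yp G])
      have v: "(\<lambda>b\<in>Obj B. \<lambda>x\<in>Obj (PC F b). \<Gamma> b (fobj (NC ?y b) x)) b e = \<Gamma> b (hom_psh (PC F b) e)"
        if "b \<in> Obj B" "e \<in> Obj (PC F b)" for b e
        using that yoneda_pnt_sel(1)[OF assms(1-4) that(1)] by simp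
      show ?thesis
      proof
        assume "farr ?R (\<alpha>, \<beta>, \<Gamma>) = g"
        then have eq: "(\<lambda>b\<in>Obj B. \<lambda>x\<in>Obj (PC F b). \<Gamma> b (fobj (NC ?y b) x)) = \<Gamma>0" unfolding fa g by simp
        show "\<forall>b\<in>Obj B. \<forall>e\<in>Obj (PC F b). \<Gamma> b (hom_psh (PC F b) e) = \<Gamma>0 b e"
          unfolding eq[symmetric] using v by simp
      next
        assume eq: "\<forall>b\<in>Obj B. \<forall>e\<in>Obj (PC F b). \<Gamma> b (hom_psh (PC F b) e) = \<Gamma>0 b e"
        have "(\<lambda>b\<in>Obj B. \<lambda>x\<in>Obj (PC F b). \<Gamma> b (fobj (NC ?y b) x)) = \<Gamma>0"
          by (rule mod_eqI[OF W G0], rule trans[OF v]) (use eq in auto)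
        then show "farr ?R (\<alpha>, \<beta>, \<Gamma>) = g" unfolding fa g by simp
      qed
    qed
    have "\<exists>!\<Gamma>. modification B ?Fh G \<alpha> \<beta> \<Gamma> \<and> (\<forall>b\<in>Obj B. \<forall>e\<in>Obj (PC F b). \<Gamma> b (hom_psh (PC F b) e) = \<Gamma>0 b e)"
    proof (rule restrict_fully_faithful[OF assms _ _ _ G0])
      show "pseudonat B ?Fh G \<alpha>" "pseudonat B ?Fh G \<beta>" using a b unfolding O by (auto simp only:)
      show "cocontinuous TYPE('u) (PSh (PC F b)) (PC G b) (NC \<alpha> b)" if "b \<in> Obj B" for b
        using a that unfolding O by blast
    qed
    then obtain \<Gamma> where \<Gamma>: "modification B ?Fh G \<alpha> \<beta> \<Gamma> \<and>
        (\<forall>b\<in>Obj B. \<forall>e\<in>Obj (PC F b). \<Gamma> b (hom_psh (PC F b) e) = \<Gamma>0 b e)"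
      and uniq: "\<And>\<Delta>. modification B ?Fh G \<alpha> \<beta> \<Delta> \<and>
          (\<forall>b\<in>Obj B. \<forall>e\<in>Obj (PC F b). \<Delta> b (hom_psh (PC F b) e) = \<Gamma>0 b e) \<Longrightarrow> \<Delta> = \<Gamma>"
      by (elim ex1E) blast
    have G: "modification B ?Fh G \<alpha> \<beta> \<Gamma>" and Gr: "farr ?R (\<alpha>, \<beta>, \<Gamma>) = g"
      using \<Gamma> Ra[OF conjunct1[OF \<Gamma>]] by auto
    show "\<exists>!f. f \<in> hom ?C \<alpha> \<beta> \<and> farr ?R f = g"
    proof (rule ex1I[of _ "(\<alpha>, \<beta>, \<Gamma>)"])
      show "(\<alpha>, \<beta>, \<Gamma>) \<in> hom ?C \<alpha> \<beta> \<and> farr ?R (\<alpha>, \<beta>, \<Gamma>) = g" using hC[OF a b] G Gr by blast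
      fix f assume f: "f \<in> hom ?C \<alpha> \<beta> \<and> farr ?R f = g"
      then obtain \<Delta> where f': "f = (\<alpha>, \<beta>, \<Delta>)" and D: "modification B ?Fh G \<alpha> \<beta> \<Delta>" using hC[OF a b] by blast
      have "farr ?R (\<alpha>, \<beta>, \<Delta>) = g" using f unfolding f' by (rule conjunct2)
      then have "\<Delta> = \<Gamma>" unfolding Ra[OF D] by (intro uniq conjI D)
      then show "f = (\<alpha>, \<beta>, \<Gamma>)" using f' by simp
    qed
  next
    fix \<phi> assume "\<phi> \<in> Obj ?D"
    then have p: "pseudonat B F G \<phi>" by simp
    show "\<exists>\<alpha> e. \<alpha> \<in> Obj ?C \<and> e \<in> hom ?D (fobj ?R \<alpha>) \<phi> \<and> is_iso ?D e"
    proof (rule restrict_essentially_surjective[OF assms p])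
      fix \<alpha> \<theta> assume a: "pseudonat B ?Fh G \<alpha>"
        and ac: "\<And>b. b \<in> Obj B \<Longrightarrow> cocontinuous TYPE('u) (PSh (PC F b)) (PC G b) (NC \<alpha> b)"
        and t: "modification B F G (comp_pnt B F ?Fh G \<alpha> ?y) \<phi> \<theta>"
        and ti: "\<And>b e. b \<in> Obj B \<Longrightarrow> e \<in> Obj (PC F b) \<Longrightarrow> is_iso (PC G b) (\<theta> b e)"
      have aO: "\<alpha> \<in> Obj ?C" using O a ac by blast
      show ?thesis
      proof (intro exI conjI)
        show "\<alpha> \<in> Obj ?C" by (rule aO)
        show "(comp_pnt B F ?Fh G \<alpha> ?y, \<phi>, \<theta>) \<in> hom ?D (fobj ?R \<alpha>) \<phi>" using t Ro[OF aO]
            by (simp add: hom_PsNat)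
        show "is_iso ?D (comp_pnt B F ?Fh G \<alpha> ?y, \<phi>, \<theta>)" by (rule mod_iso[OF assms(2) Ff Gf t ti])
      qed
    qed
  qed
qed

end
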